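(* Let $\beta\ge\beta_*:=\frac{\ln4-\ln3}{\ln3-\ln2}$ (equivalently $2^{1/(\beta+1)}\le\frac32$). Then there are sequences $(R^N_{j,p})_{j=0,\dots,N-1}$, $N\in\mathbb{N}$, $p=1,2$, of positive numbers, decreasing in $j$, and a sequence $(\varepsilon^N)_{N\in\mathbb{N}}$ with the following properties, where $\bar x^N$ and $x^N$ denote the solutions of $\dot x_j=\Delta_\sigma x_j^{-\beta}$ with initial data $\bar x^N(0)=\alpha^N$ and $x^N(0)=\alpha^N+\varepsilon^N e_{3N}$ defined in the context: (1) For any $j=0,1,\dots$ and $p=1,2$ the sequence $(R^N_{j,p})_N$ converges to some $R_{j,p}>0$ as $N\to\infty$. (2) There are a time $T>0$, functions $\bar x\colon[0,T]\to\ell^\infty_+$ and $x\colon[0,T]\to\ell^\infty_+$, and a subsequence of $N\to\infty$ (not relabeled) such that for all $j\in\mathbb{Z}$ we have $\bar x^N_j\to\bar x_j$ and $x^N_j\to x_j$ in $C([0,T])$ as $N\to\infty$. (3) Both $\bar x$ and $x$ solve $\dot x_j=\Delta_\sigma x_j^{-\beta}$ in $[0,T)$ with initial data $\bar x(0)=x(0)=\alpha$, where $\alpha_j=1$ for $j<0$ and $\alpha_{3j}=1$, $\alpha_{3j+1}=R_{j,1}$, $\alpha_{3j+2}=R_{j,2}$ for $j\ge0$, but $\bar x\ne x$.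
   Context: Let $\ell^\infty_+$ be the set of sequences $x=(x_j)_{j\in\mathbb{Z}}$ with $0\le x_j\le C$ for all $j$ and some constant $C$ depending on $x$. Convention: $0^{-\beta}=0$. For $x\in\ell^\infty_+$ and $j\in\mathbb{Z}$ put $\sigma_-(j,x)=\sup\{k<j:x_k>0\}$, $\sigma_+(j,x)=\inf\{k>j:x_k>0\}$, with $\sup\emptyset=-\infty$, $\inf\emptyset=+\infty$, $x_{\pm\infty}=0$, and $$\Delta_\sigma x_j^{-\beta}=\big(x_{\sigma_-(j,x)}^{-\beta}-2x_j^{-\beta}+x_{\sigma_+(j,x)}^{-\beta}\big)\,\chi_{\{x_j>0\}}.$$ For $T\in(0,\infty]$, a solution on $[0,T)$ of $\dot x_j=\Delta_\sigma x_j^{-\beta}$ ($j\in\mathbb{Z}$) with initial data $x(0)$ is a map $x=(x_j)\colon[0,T)\to\ell^\infty_+$ such that each $x_j$ is continuous on $[0,T)$; each $x_j^{-\beta}\chi_{\{x_j>0\}}$ is locally integrable in $[0,T)$; and $x_j(t_2)-x_j(t_1)=\int_{t_1}^{t_2}\Delta_\sigma x_j(s)^{-\beta}\,ds$ for all $j$ and $0\le t_1<t_2<T$. Given $N\in\mathbb{N}$ and positive numbers $R^N_{j,p}$ ($j=0,\dots,N-1$, $p=1,2$), define $\alpha^N\in\ell^\infty_+$ by $\alpha^N_j=0$ for $|j|>3N$; $\alpha^N_j=1$ for $-3N\le j<0$; $\alpha^N_{3N}=1$; and $\alpha^N_{3j}=1$, $\alpha^N_{3j+1}=R^N_{j,1}$,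 $\alpha^N_{3j+2}=R^N_{j,2}$ for $j=0,\dots,N-1$. Let $e_{3N}$ be the sequence equal to $1$ at index $3N$ and $0$ elsewhere. For these data, which have finitely many nonzero particles, solutions exist on $[0,\infty)$. *)

theory Defs
  imports "HOL-Analysis.Analysis"
begin

definition linf_plus :: "(int \<Rightarrow> real) set" where
  "linf_plus = {x. \<exists>C. \<forall>j. 0 \<le> x j \<and> x j \<le> C}"

text \<open>The nearest nonzero particles, with \<open>None\<close> standing for minus and plus infinity
  (empty supremum or infimum).\<close>

definition sigma_minus :: "int \<Rightarrow> (int \<Rightarrow> real) \<Rightarrow> int option" where
  "sigma_minus j x =
     (if {k. k < j \<and> x k > 0} = {} then None else Some (Sup {k. k < j \<and> x k > 0}))"

definition sigma_plus :: "int \<Rightarrow> (int \<Rightarrow> real) \<Rightarrow> int option" where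
  "sigma_plus j x =
     (if {k. k > j \<and> x k > 0} = {} then None else Some (Inf {k. k > j \<and> x k > 0}))"

definition at_ext :: "(int \<Rightarrow> real) \<Rightarrow> int option \<Rightarrow> real" where
  "at_ext x k = (case k of None \<Rightarrow> 0 | Some i \<Rightarrow> x i)"

text \<open>The convention that \<open>0\<close> to the power \<open>- \<beta>\<close> is \<open>0\<close> is built into \<open>powr\<close>.\<close>

definition lap_sigma :: "real \<Rightarrow> (int \<Rightarrow> real) \<Rightarrow> int \<Rightarrow> real" where
  "lap_sigma \<beta> x j =
     (at_ext x (sigma_minus j x) powr (- \<beta>) - 2 * x j powr (- \<beta>)
       + at_ext x (sigma_plus j x) powr (- \<beta>)) * of_bool (x j > 0)"

text \<open>A solution on \<open>[0,T)\<close>; only the values \<open>x t\<close> with \<open>0 \<le> t < T\<close> matter.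
  Local integrability in \<open>[0,T)\<close> is integrability on all \<open>[0,S]\<close> with \<open>S < T\<close>.
  Integrability of the right-hand side has to be required explicitly because the library
  integral of a non-integrable function is \<open>0\<close>.\<close>

definition is_solution :: "real \<Rightarrow> ereal \<Rightarrow> (real \<Rightarrow> int \<Rightarrow> real) \<Rightarrow> bool" where
  "is_solution \<beta> T x \<longleftrightarrow>
     (\<forall>t. 0 \<le> t \<and> ereal t < T \<longrightarrow> x t \<in> linf_plus) \<and>
     (\<forall>j. continuous_on {t. 0 \<le> t \<and> ereal t < T} (\<lambda>t. x t j)) \<and>
     (\<forall>j S. 0 \<le> S \<and> ereal S < T \<longrightarrow>
        set_integrable lborel {0..S} (\<lambda>s. x s j powr (- \<beta>) * of_bool (x s j > 0))) \<and>
     (\<forall>j t1 t2. 0 \<le> t1 \<and> t1 < t2 \<and> ereal t2 < T \<longrightarrow>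
        set_integrable lborel {t1..t2} (\<lambda>s. lap_sigma \<beta> (x s) j) \<and>
        x t2 j - x t1 j = (LBINT s:{t1..t2}. lap_sigma \<beta> (x s) j))"

text \<open>The solution of a system with finitely many nonzero particles, defined for all times:
  sites that are empty initially stay empty. This selects the solution, which is unique in this
  class. The integral equation alone does not determine it: infinitely many particles can emerge
  at once from an infinite row of empty sites. For instance, \<open>x\<^sub>j(t) = c\<^sub>j t powr (1/(\<beta>+1))\<close>
  solves the equation with zero initial data whenever all \<open>c\<^sub>j > 0\<close> are such that
  \<open>u\<^sub>j = c\<^sub>j powr (-\<beta>)\<close> satisfies
  \<open>u\<^sub>j\<^sub>-\<^sub>1 - 2 u\<^sub>j + u\<^sub>j\<^sub>+\<^sub>1 = u\<^sub>j powr (-1/\<beta>) / (\<beta>+1)\<close>.\<close>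

definition finite_particle_solution ::
    "real \<Rightarrow> (int \<Rightarrow> real) \<Rightarrow> (real \<Rightarrow> int \<Rightarrow> real) \<Rightarrow> bool" where
  "finite_particle_solution \<beta> a x \<longleftrightarrow>
     finite {j. a j \<noteq> 0} \<and> is_solution \<beta> \<infinity> x \<and> x 0 = a \<and>
     (\<forall>j. a j = 0 \<longrightarrow> (\<forall>t\<ge>0. x t j = 0))"

definition alpha :: "(nat \<Rightarrow> nat \<Rightarrow> real) \<Rightarrow> int \<Rightarrow> real" where
  "alpha R i =
     (if i < 0 \<or> i mod 3 = 0 then 1 else R (nat (i div 3)) (nat (i mod 3)))"

definition alpha_N :: "nat \<Rightarrow> (nat \<Rightarrow> nat \<Rightarrow> real) \<Rightarrow> int \<Rightarrow> real" where
  "alpha_N N R i = (if \<bar>i\<bar> > 3 * int N then 0 else alpha R i)"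

definition unit_seq :: "int \<Rightarrow> int \<Rightarrow> real" where
  "unit_seq k i = of_bool (i = k)"

end

(*
A row of particles of sizes 1, R_{j,1}, R_{j,2}, 1, ... with R_{j,p} tiny loses its small pairs one
after the other, the rightmost first. The sizes of the two particles of a pair can be tuned so that
both die at the same time: which of the two dies first is a labelling of the parameter cube to which
Kuhn's lemma applies, and a limit of cells of finer and finer grids yields simultaneous deaths.

For the tuned flow v and a flow x with a perturbed rightmost particle put Y_i = (-1)^i (x_i - v_i),
up to a global sign. Linearising the equation shows that the system for Y is cooperative, so
(approximate) nonnegativity is preserved until the first death in the pair at hand, which destroys
the tie. Up to that moment the difference q of the pair grows at least like X^(-2 beta), where X is
the size of the dying particles. Hence x keeps a survivor whose size Q satisfies
Q^(1 + 2 beta) >= c g r^(1 + 3 beta), g being the perturbation of the big particle on the right and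
r the initial size of the pair; the survivor hands a mass of order Q over to its big neighbours with
opposite signs. If r_{j+1} = r_j^A with a suitable exponent A < 1 + 2 beta, then the perturbation
gains enough at each pair to be bounded below at site 0 uniformly in the number N of pairs. The limits of
the two flows as N tends to infinity therefore differ, although the limits of their initial data agree.
*)
theory Submission
  imports Defs "HOL-Complex_Analysis.Great_Picard" "HOL-Library.Diagonal_Subsequence" "HOL-Real_Asymp.Real_Asymp"
begin

section \<open>Calculus with finitely many exceptional times\<close>

text \<open>The exponents come from two demands on a stage with
  \<open>Q powr (1 + 2 * \<beta>) >= c * g * r powr (1 + 3 * \<beta>)\<close>. If \<open>g\<close>
  is at most of order \<open>r powr A\<close>, then \<open>Q\<close> dominates \<open>g\<close> as
  soon as \<open>2 * \<beta> * A > 1 + 3 * \<beta>\<close>. A bound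
  \<open>g >= (r powr A) powr P\<close> turns into \<open>Q >= r powr P\<close> as soon as
  \<open>A * P + 1 + 3 * \<beta> < P * (1 + 2 * \<beta>)\<close>, which a large \<open>P\<close>
  achieves if \<open>A < 1 + 2 * \<beta>\<close>. Both are possible when
  \<open>1 + 3 * \<beta> < 2 * \<beta> * (1 + 2 * \<beta>)\<close>, hence for
  \<open>\<beta> >= 2 / 3\<close>; this is how the threshold enters. Ties matter because of parity:
  the sign \<open>(- 1)^i\<close> alternates along the living sites only while an even number of
  dead sites lies between neighbours. While a pair is broken the linearisation fails at its two
  large neighbours, and linear combinations in which the singular terms cancel bridge that time.
  Velocities are unbounded at deaths, so the equation is used pointwise off finitely many times,
  limits are taken through increments over short intervals, and integrability of the singular powers
  is recovered from one-sided bounds.\<close>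

lemma fe_ge:
  fixes f :: "real => real"
  assumes "finite F" "a <= b" "continuous_on {a..b} f"
    and D: "!!t. t \<in> {a<..<b} - F ==> \<exists>D. (f has_real_derivative D) (at t) \<and> c <= D"
  shows "c * (b - a) <= f b - f a"
proof -
  obtain g where g: "!!t. t \<in> {a<..<b} - F ==> (f has_real_derivative g t) (at t) \<and> c <= g t"
    using D by metis
  define h where "h t = (if t \<in> {a<..<b} - F then g t else c)" for t
  have "(h has_integral (f b - f a)) {a..b}"
  proof (rule fundamental_theorem_of_calculus_interior_strong[OF assms(1,2) _ assms(3)])
    fix t assume "t \<in> {a<..<b} - F"
    then show "(f has_vector_derivative h t) (at t)"
      using g[of t] by (simp add: h_def has_real_derivative_iff_has_vector_derivative)
  qed
  moreover have "((%_. c) has_integral (b - a) *\<^sub>R c) {a..b}"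
    using has_integral_const_real[of c a b] \<open>a <= b\<close> by simp
  moreover have "c <= h t" for t using g[of t] by (auto simp: h_def)
  ultimately have "(b - a) *\<^sub>R c <= f b - f a"
    by (auto intro: has_integral_le[of "%_. c" _ "{a..b}" h])
  then show ?thesis by (simp add: mult.commute)
qed

lemma fe_le:
  fixes f :: "real => real"
  assumes "finite F" "a <= b" "continuous_on {a..b} f"
    and D: "!!t. t \<in> {a<..<b} - F ==> \<exists>D. (f has_real_derivative D) (at t) \<and> D <= c"
  shows "f b - f a <= c * (b - a)"
proof -
  have "(-c) * (b - a) <= (- f b) - (- f a)"
  proof (rule fe_ge[OF assms(1,2)])
    show "continuous_on {a..b} (%t. - f t)" using assms(3) by (intro continuous_intros)
    fix t assume "t \<in> {a<..<b} - F"
    from D[OF this] obtain D where "(f has_real_derivative D) (at t)" "D <= c" by blast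
    then show "\<exists>D. ((%t. - f t) has_real_derivative D) (at t) \<and> - c <= D"
      by (intro exI[of _ "-D"]) (auto intro!: derivative_eq_intros)
  qed
  then show ?thesis by simp
qed

lemma fe_abs:
  fixes f :: "real => real"
  assumes "finite F" "a <= b" "continuous_on {a..b} f"
    and D: "!!t. t \<in> {a<..<b} - F ==> \<exists>D. (f has_real_derivative D) (at t) \<and> \<bar>D\<bar> <= c"
  shows "\<bar>f b - f a\<bar> <= c * (b - a)"
proof -
  have "f b - f a <= c * (b - a)"
    using D by (intro fe_le[OF assms(1-3)]) (meson abs_le_D1)
  moreover have "(-c) * (b - a) <= f b - f a"
    using D by (intro fe_ge[OF assms(1-3)]) (meson abs_le_D2 minus_le_iff)
  ultimately show ?thesis by (simp add: abs_le_iff)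
qed

text \<open>Bootstrap: the times at which some \<open>\<phi> k\<close> is not positive form a closed
  set. At its infimum everything was positive strictly before, so \<open>step\<close> excludes
  it.\<close>

lemma continuation:
  fixes \<phi> :: "'i => real => real"
  assumes "finite I" and cont: "!!i. i \<in> I ==> continuous_on {a..b} (\<phi> i)"
    and init: "!!i. i \<in> I ==> 0 < \<phi> i a"
    and step: "!!t i. a < t ==> t <= b ==> (!!s k. a <= s ==> s < t ==> k \<in> I ==> 0 < \<phi> k s)
       ==> i \<in> I ==> 0 < \<phi> i t"
    and "i \<in> I" "a <= t" "t <= b"
  shows "0 < \<phi> i t"
proof (rule ccontr)
  assume neg: "\<not> 0 < \<phi> i t"
  define B where "B = (\<Union>k\<in>I. {s \<in> {a..b}. \<phi> k s <= 0})"
  have "closed {s \<in> {a..b}. \<phi> k s <= 0}" if "k \<in> I" for k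
    using continuous_closed_preimage[OF cont[OF that], of "{..0}"]
    by (auto simp: vimage_def Int_def)
  then have "closed B" unfolding B_def using \<open>finite I\<close> by blast
  have "t \<in> B" using neg assms by (force simp: B_def)
  have bb: "bdd_below B" by (rule bdd_belowI[of _ a]) (auto simp: B_def)
  have "Inf B \<in> B" using \<open>closed B\<close> \<open>t \<in> B\<close> bb closed_contains_Inf by blast
  then obtain k where k: "k \<in> I" "Inf B \<in> {a..b}" "\<phi> k (Inf B) <= 0" by (auto simp: B_def)
  have "Inf B \<noteq> a" using init[OF k(1)] k(3) by auto
  then have "a < Inf B" using k by auto
  have "0 < \<phi> k (Inf B)"
  proof (rule step[OF \<open>a < Inf B\<close> _ _ k(1)])
    fix s l assume "a <= s" "s < Inf B" "l \<in> I"
    then show "0 < \<phi> l s"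
      using cInf_lower[OF _ bb, of s] k(2) by (force simp: B_def)
  qed (use k in auto)
  with k(3) show False by simp
qed

text \<open>Bootstrap with a factor 2 of room: while all bounds hold doubled, the derivative can
  move \<open>f i\<close> by at most \<open>B i / 2\<close> over the whole interval, so the value
  stays below \<open>3 / 2 * B i\<close> and the doubled bound is never attained.\<close>

lemma sup_bound:
  fixes f :: "'i => real => real"
  assumes "finite I" "finite F" and cont: "!!i. i \<in> I ==> continuous_on {a..c} (f i)"
    and init: "!!i. i \<in> I ==> \<bar>f i a\<bar> <= B i" and pos: "!!i. i \<in> I ==> 0 < B i"
    and D: "!!t i. t \<in> {a<..<c} - F ==> (!!k. k \<in> I ==> \<bar>f k t\<bar> <= 2 * B k) ==> i \<in> I ==>
       \<exists>D. (f i has_real_derivative D) (at t) \<and> \<bar>D\<bar> * (c - a) <= B i / 2"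
    and "i \<in> I" "a <= t" "t <= c"
  shows "\<bar>f i t\<bar> <= 2 * B i"
proof -
  have "0 < 2 * B i - \<bar>f i t\<bar>"
  proof (rule continuation[of I a c "%i t. 2 * B i - \<bar>f i t\<bar>", OF \<open>finite I\<close> _ _ _ \<open>i \<in> I\<close> \<open>a <= t\<close> \<open>t <= c\<close>])
    fix i assume i: "i \<in> I"
    show "continuous_on {a..c} (%t. 2 * B i - \<bar>f i t\<bar>)"
      using cont[OF i] by (intro continuous_intros)
    show "0 < 2 * B i - \<bar>f i a\<bar>" using init[OF i] pos[OF i] by auto
  next
    fix t i assume t: "a < t" "t <= c" and i: "i \<in> I"
      and IH: "!!s k. a <= s ==> s < t ==> k \<in> I ==> 0 < 2 * B k - \<bar>f k s\<bar>"
    have "\<bar>f i t - f i a\<bar> <= (B i / 2 / (c - a)) * (t - a)"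
    proof (rule fe_abs[OF \<open>finite F\<close>])
      show "continuous_on {a..t} (f i)" using cont[OF i] t by (auto intro: continuous_on_subset)
      fix s assume s: "s \<in> {a<..<t} - F"
      have "\<exists>D. (f i has_real_derivative D) (at s) \<and> \<bar>D\<bar> * (c - a) <= B i / 2"
        using s t i IH[of s] by (intro D) (auto intro: less_imp_le)
      moreover have "0 < c - a" using s t by simp
      ultimately show "\<exists>D. (f i has_real_derivative D) (at s) \<and> \<bar>D\<bar> <= B i / 2 / (c - a)"
        by (metis pos_le_divide_eq)
    qed (use t in auto)
    also have "\<dots> <= (B i / 2 / (c - a)) * (c - a)"
      using t pos[OF i] by (intro mult_left_mono) auto
    also have "\<dots> = B i / 2" using t by (simp add: field_simps)
    finally show "0 < 2 * B i - \<bar>f i t\<bar>" using init[OF i] pos[OF i] by linarith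
  qed
  then show ?thesis by simp
qed

text \<open>A derivative is a pointwise limit of difference quotients, hence measurable; the
  finitely many times at which nothing is known about \<open>g\<close> contribute a finite sum of
  functions supported at one point.\<close>

lemma derivative_borel_measurable:
  fixes f g :: "real => real"
  assumes "finite F" "continuous_on {a..b} f"
    and D: "!!t. t \<in> {a<..<b} - F ==> (f has_real_derivative g t) (at t)"
  shows "(%t. indicator {a..b} t *\<^sub>R g t) \<in> borel_measurable borel"
proof (cases "a <= b")
  case False
  then have "(%t. indicator {a..b} t *\<^sub>R g t) = (%_. 0)" by auto
  then show ?thesis by simp
next
  case True
  \<comment> \<open>Clamping the argument extends \<open>f\<close> to a continuous function on the
    line, so that the difference quotients are measurable everywhere.\<close>
  define h where "h t = f (max a (min b t))" for t
  have conth: "continuous_on UNIV h"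
    unfolding h_def using True
    by (intro continuous_on_compose2[OF assms(2)] continuous_intros) auto
  define G where "G = {a<..<b} - F"
  have oG: "open G" unfolding G_def using finite_imp_closed[OF \<open>finite F\<close>]
    by (intro open_Diff) auto
  have lim: "(%n. (h (t + 1 / real (Suc n)) - h t) / (1 / real (Suc n))) \<longlonglongrightarrow> g t" if "t \<in> G" for t
  proof -
    have "(h has_real_derivative g t) (at t)"
    proof (rule has_field_derivative_transform_within_open[OF D oG that])
      show "t \<in> {a<..<b} - F" using that by (simp add: G_def)
      show "!!x. x \<in> G ==> f x = h x" by (auto simp: G_def h_def)
    qed
    then have "((%e. (h (t + e) - h t) / e) \<longlongrightarrow> g t) (at 0)" by (simp add: DERIV_def)
    moreover have "filterlim (%n. 1 / real (Suc n)) (at 0) sequentially"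
      using lim_inverse_n' by (intro filterlim_atI) (auto intro: LIMSEQ_Suc[OF lim_1_over_n, simplified])
    ultimately show ?thesis by (rule filterlim_compose)
  qed
  have "(%t. indicator G t *\<^sub>R g t) \<in> borel_measurable borel"
  proof (rule borel_measurable_LIMSEQ_real)
    fix t
    show "(%n. indicator G t *\<^sub>R ((h (t + 1 / real (Suc n)) - h t) / (1 / real (Suc n)))) \<longlonglongrightarrow> indicator G t *\<^sub>R g t"
    proof (cases "t \<in> G")
      case True
      then show ?thesis using lim[OF True] by simp
    qed simp
  next
    fix n
    have [measurable]: "h \<in> borel_measurable borel" using conth by (rule borel_measurable_continuous_onI)
    have [measurable]: "G \<in> sets borel" using oG by auto
    show "(%t. indicator G t *\<^sub>R ((h (t + 1 / real (Suc n)) - h t) / (1 / real (Suc n)))) \<in> borel_measurable borel"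
      by measurable
  qed
  moreover have "(%t. indicator {a..b} t *\<^sub>R g t) =
      (%t. indicator G t *\<^sub>R g t + (\<Sum>s\<in>(F \<union> {a,b}) \<inter> {a..b}. indicator {s} t *\<^sub>R g s))"
  proof
    fix t
    have fin: "finite ((F \<union> {a,b}) \<inter> {a..b})" using \<open>finite F\<close> by auto
    have "(\<Sum>s\<in>(F \<union> {a,b}) \<inter> {a..b}. indicator {s} t *\<^sub>R g s) =
        (\<Sum>s\<in>(F \<union> {a,b}) \<inter> {a..b}. if s = t then g t else 0)"
      by (intro sum.cong) (auto simp: indicator_def)
    also have "\<dots> = (if t \<in> (F \<union> {a,b}) \<inter> {a..b} then g t else 0)"
      using fin by (simp add: sum.delta)
    finally show "indicator {a..b} t *\<^sub>R g t =
        indicator G t *\<^sub>R g t + (\<Sum>s\<in>(F \<union> {a,b}) \<inter> {a..b}. indicator {s} t *\<^sub>R g s)"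
      by (auto simp: G_def indicator_def)
  qed
  ultimately show ?thesis by simp
qed

text \<open>A nonnegative gauge integrable function is Lebesgue integrable; Borel measurability is
  assumed in order to pass from the completed measure to \<open>lborel\<close>.\<close>

lemma lborel_integrable_of_nonneg:
  fixes f :: "real => real"
  assumes "f integrable_on {a..b}" "!!t. t \<in> {a..b} ==> 0 <= f t"
    and meas: "(%t. indicator {a..b} t *\<^sub>R f t) \<in> borel_measurable borel"
  shows "set_integrable lborel {a..b} f"
proof -
  have "f absolutely_integrable_on {a..b}"
    by (rule nonnegative_absolutely_integrable_1[OF assms(1,2)])
  then show ?thesis unfolding set_integrable_def
    by (subst (asm) integrable_completion) (use meas in auto)
qed

text \<open>Only a one-sided integrable bound on the derivative is needed: Henstock--Kurzweil
  integrability comes for free from the fundamental theorem of calculus.\<close>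

lemma lborel_ftc:
  fixes f g h :: "real => real"
  assumes "finite F" "a <= b" "continuous_on {a..b} f"
    and D: "!!t. t \<in> {a<..<b} - F ==> (f has_real_derivative g t) (at t)"
    and h: "set_integrable lborel {a..b} h" and le: "!!t. t \<in> {a..b} ==> 0 <= g t + h t"
  shows "set_integrable lborel {a..b} g" "f b - f a = (LBINT t:{a..b}. g t)"
proof -
  have hi: "(g has_integral (f b - f a)) {a..b}"
    using D by (intro fundamental_theorem_of_calculus_interior_strong[OF assms(1,2) _ assms(3)])
      (auto simp: has_real_derivative_iff_has_vector_derivative)
  have "set_integrable lborel {a..b} (%t. g t + h t)"
  proof (rule lborel_integrable_of_nonneg[OF _ le])
    show "(%t. g t + h t) integrable_on {a..b}"
      using hi set_borel_integral_eq_integral(1)[OF h] by (intro integrable_add) auto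
    have "(%t. indicator {a..b} t *\<^sub>R h t) \<in> borel_measurable borel"
      using h unfolding set_integrable_def by (auto dest: borel_measurable_integrable)
    then show "(%t. indicator {a..b} t *\<^sub>R (g t + h t)) \<in> borel_measurable borel"
      using derivative_borel_measurable[OF assms(1,3) D] by (simp add: algebra_simps)
  qed
  from set_integral_diff(1)[OF this h] show si: "set_integrable lborel {a..b} g" by simp
  show "f b - f a = (LBINT t:{a..b}. g t)"
    using set_borel_integral_eq_integral(2)[OF si] hi by (simp add: integral_unique)
qed

section \<open>Negative powers and nearest particles\<close>

text \<open>The slope \<open>w\<close> with two-sided bounds yields both the Lipschitz estimates and
  the growth rates of the linearised system. For \<open>x = y\<close> every admissible
  \<open>w\<close> serves.\<close>

lemma powr_neg_mvt:
  fixes x y \<beta> :: real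
  assumes "0 < c" "c <= x" "c <= y" "x <= d" "y <= d" "0 < \<beta>"
  shows "\<exists>w. x powr (- \<beta>) - y powr (- \<beta>) = - w * (x - y) \<and> \<beta> * d powr (-(\<beta> + 1)) <= w \<and> w <= \<beta> * c powr (-(\<beta> + 1))"
proof -
  have *: "\<exists>w. x powr (- \<beta>) - y powr (- \<beta>) = - w * (x - y) \<and> \<beta> * d powr (-(\<beta> + 1)) <= w \<and> w <= \<beta> * c powr (-(\<beta> + 1))"
    if "c <= y" "x <= d" "y < x" for x y
  proof -
    have "\<exists>z. y < z \<and> z < x \<and> x powr (- \<beta>) - y powr (- \<beta>) = (x - y) * (- \<beta> * z powr (- (\<beta> + 1)))"
      using that assms by (intro MVT2) (auto intro!: derivative_eq_intros)
    then obtain z where z: "y < z" "z < x" "x powr (- \<beta>) - y powr (- \<beta>) = (x - y) * (- \<beta> * z powr (- (\<beta> + 1)))" by blast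
    show ?thesis
    proof (intro exI conjI)
      show "x powr (- \<beta>) - y powr (- \<beta>) = - (\<beta> * z powr (- (\<beta> + 1))) * (x - y)"
        using z(3) by (simp add: minus_diff_commute)
      show "\<beta> * d powr (- (\<beta> + 1)) <= \<beta> * z powr (- (\<beta> + 1))"
        using z that assms by (intro mult_left_mono powr_mono2') auto
      show "\<beta> * z powr (- (\<beta> + 1)) <= \<beta> * c powr (- (\<beta> + 1))"
        using z that assms by (intro mult_left_mono powr_mono2') auto
    qed
  qed
  consider "x < y" | "x = y" | "y < x" by linarith
  then show ?thesis
  proof cases
    case 1
    from *[of x y] 1 assms obtain w where "y powr (- \<beta>) - x powr (- \<beta>) = - w * (y - x)"
      "\<beta> * d powr (-(\<beta> + 1)) <= w" "w <= \<beta> * c powr (-(\<beta> + 1))"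
      using *[of x y] *[of y x] by auto
    then show ?thesis by (intro exI[of _ w]) (auto simp: algebra_simps)
  next
    case 2
    then show ?thesis using assms
      by (intro exI[of _ "\<beta> * d powr (-(\<beta> + 1))"]) (auto intro!: mult_left_mono powr_mono2')
  next
    case 3
    then show ?thesis using * assms by blast
  qed
qed

lemma powr_neg_lipschitz:
  fixes x y \<beta> :: real
  assumes "0 < c" "c <= x" "c <= y" "0 < \<beta>"
  shows "\<bar>x powr (- \<beta>) - y powr (- \<beta>)\<bar> <= \<beta> * c powr (-(\<beta> + 1)) * \<bar>x - y\<bar>"
proof -
  obtain w where w: "x powr (- \<beta>) - y powr (- \<beta>) = - w * (x - y)"
    "\<beta> * (max x y) powr (-(\<beta> + 1)) <= w" "w <= \<beta> * c powr (-(\<beta> + 1))"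
    using powr_neg_mvt[OF assms(1-3) _ _ assms(4), of "max x y"] by auto
  have "0 <= w" using w(2) assms by (smt (verit) mult_nonneg_nonneg powr_ge_zero)
  then show ?thesis using w by (simp add: abs_mult mult_right_mono)
qed

lemma sigma_minus_Some:
  assumes "k < j" "0 < x k" "!!i. k < i ==> i < j ==> \<not> 0 < x i"
  shows "sigma_minus j x = Some k"
proof -
  have "Sup {k. k < j \<and> 0 < x k} = k"
    using assms by (intro cSup_eq_maximum) (auto intro: leI)
  then show ?thesis using assms by (auto simp: sigma_minus_def)
qed

lemma sigma_plus_Some:
  assumes "j < k" "0 < x k" "!!i. j < i ==> i < k ==> \<not> 0 < x i"
  shows "sigma_plus j x = Some k"
proof -
  have "Inf {k. j < k \<and> 0 < x k} = k"
    using assms by (intro cInf_eq_minimum) (auto intro: leI)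
  then show ?thesis using assms by (auto simp: sigma_plus_def)
qed

lemma sigma_minus_None: "(!!k. k < j ==> \<not> 0 < x k) ==> sigma_minus j x = None"
  by (auto simp: sigma_minus_def)

lemma sigma_plus_None: "(!!k. j < k ==> \<not> 0 < x k) ==> sigma_plus j x = None"
  by (auto simp: sigma_plus_def)

lemma sigma_cong:
  assumes "!!k. 0 < x k \<longleftrightarrow> 0 < y k"
  shows "sigma_minus j x = sigma_minus j y" "sigma_plus j x = sigma_plus j y"
  using assms by (auto simp: sigma_minus_def sigma_plus_def)

text \<open>A nonempty set of integers that is bounded above contains its supremum: it is the
  maximum of the finite part lying above any chosen element.\<close>

lemma sigma_minus_SomeD:
  assumes "sigma_minus j x = Some k"
  shows "k < j" "0 < x k" "!!i. k < i ==> i < j ==> \<not> 0 < x i"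
proof -
  let ?A = "{k. k < j \<and> 0 < x k}"
  have ne: "?A \<noteq> {}" and k: "k = Sup ?A" using assms by (auto simp: sigma_minus_def split: if_splits)
  have bdd: "bdd_above ?A" by (rule bdd_aboveI[of _ j]) auto
  obtain a where a: "a \<in> ?A" using ne by auto
  define M where "M = Max {k \<in> {a..j}. k < j \<and> 0 < x k}"
  have fin: "finite {k \<in> {a..j}. k < j \<and> 0 < x k}"
    by (rule finite_subset[of _ "{a..j}"]) auto
  have M: "M \<in> {k \<in> {a..j}. k < j \<and> 0 < x k}" unfolding M_def using a by (intro Max_in fin) auto
  have ub: "i <= M" if "i \<in> ?A" for i
  proof (cases "a <= i")
    case True
    then show ?thesis unfolding M_def using that by (intro Max_ge fin) auto
  qed (use M in auto)
  have "Sup ?A = M" using M ub by (intro cSup_eq_maximum) auto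
  then have "Sup ?A \<in> ?A" using M by auto
  then show "k < j" "0 < x k" using k by auto
  show "!!i. k < i ==> i < j ==> \<not> 0 < x i" using cSup_upper[OF _ bdd] k by force
qed

section \<open>Ordinary differential equations with Lipschitz right-hand side\<close>

text \<open>Successive approximation for a possibly infinite family of sites. Boundedness and the
  Lipschitz condition are uniform in the site, so the factorial estimate holds for all sites at once
  and the telescoping series converges uniformly on bounded times.\<close>

lemma picard:
  fixes G :: "('i => real) => 'i => real"
  assumes M: "!!x j. \<bar>G x j\<bar> <= M"
    and L: "!!x y j C. (!!i. \<bar>x i - y i\<bar> <= C) ==> \<bar>G x j - G y j\<bar> <= L * C" and "0 <= L"
  obtains X where "X 0 = a"
    "!!t j. 0 <= t ==> ((%t. X t j) has_real_derivative G (X t) j) (at t within {0..})"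
proof -
  have M0: "0 <= M" using M[of "%_. 0"] abs_ge_zero order_trans by blast
  define P :: "nat => real => 'i => real" where "P = rec_nat (%t j. a j) (%_ p t j. a j + integral {0..t} (%s. G (p s) j))"
  have P0: "P 0 t j = a j" for t j by (simp add: P_def)
  have PS: "P (Suc n) t j = a j + integral {0..t} (%s. G (P n s) j)" for n t j by (simp add: P_def)
  have contG: "continuous_on {0..} (%s. G (p s) j)"
    if "!!s t j. 0 <= s ==> 0 <= t ==> \<bar>p t j - p s j\<bar> <= M * \<bar>t - s\<bar>" for p :: "real => 'i => real" and j
  proof (rule lipschitz_on_continuous_on[of "L * M"], rule lipschitz_onI)
    fix s t :: real assume "s \<in> {0..}" "t \<in> {0..}"
    then show "dist (G (p s) j) (G (p t) j) <= L * M * dist s t"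
      using L[of "p s" "p t" "M * \<bar>s - t\<bar>" j] that[of t s] by (auto simp: dist_real_def mult.assoc)
  qed (use \<open>0 <= L\<close> M0 in auto)
  have intG: "(%s. G (p s) j) integrable_on {u..v}"
    if "!!s t j. 0 <= s ==> 0 <= t ==> \<bar>p t j - p s j\<bar> <= M * \<bar>t - s\<bar>" "0 <= u"
    for p :: "real => 'i => real" and j :: 'i and u v :: real
    using that(2) by (intro integrable_continuous_interval continuous_on_subset[OF contG[OF that(1)]]) auto
  \<comment> \<open>All iterates are Lipschitz in time with constant \<open>M\<close>; this makes
    the integrands of the iteration continuous.\<close>
  have A: "\<bar>P n t j - P n s j\<bar> <= M * \<bar>t - s\<bar>" if "0 <= s" "0 <= t" for n s t j
    using that
  proof (induction n arbitrary: s t j)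
    case 0
    then show ?case using M0 by (simp add: P0)
  next
    case (Suc n)
    have *: "\<bar>P (Suc n) t j - P (Suc n) s j\<bar> <= M * \<bar>t - s\<bar>" if "0 <= s" "s <= t" for s t
    proof -
      have "integral {0..s} (%s. G (P n s) j) + integral {s..t} (%s. G (P n s) j) = integral {0..t} (%s. G (P n s) j)"
        using that by (intro Henstock_Kurzweil_Integration.integral_combine intG Suc.IH) auto
      then have "P (Suc n) t j - P (Suc n) s j = integral {s..t} (%s. G (P n s) j)" by (simp add: PS)
      moreover have "norm (integral {s..t} (%s. G (P n s) j)) <= M * (t - s)"
        using that M by (intro integral_bound continuous_on_subset[OF contG[OF Suc.IH]]) auto
      ultimately show ?thesis using that by simp
    qed
    show ?case
    proof (cases "s <= t")
      case True
      then show ?thesis using *[of s t] Suc.prems by simp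
    next
      case False
      then show ?thesis using *[of t s] Suc.prems by (simp add: abs_minus_commute)
    qed
  qed
  have B: "\<bar>P (Suc n) t j - P n t j\<bar> <= M * L ^ n * t ^ Suc n / fact (Suc n)" if "0 <= t" for n t j
    using that
  proof (induction n arbitrary: t j)
    case 0
    then show ?case using A[of 0 t 1 j] by (simp add: P0 PS)
  next
    case (Suc n)
    have "integral {0..t} (%s. G (P (Suc n) s) j - G (P n s) j) =
        integral {0..t} (%s. G (P (Suc n) s) j) - integral {0..t} (%s. G (P n s) j)"
      by (intro Henstock_Kurzweil_Integration.integral_diff intG A) auto
    then have "P (Suc (Suc n)) t j - P (Suc n) t j = integral {0..t} (%s. G (P (Suc n) s) j - G (P n s) j)"
      by (simp add: PS)
    also have "norm \<dots> <= integral {0..t} (%s. L * (M * L ^ n / fact (Suc n)) * s ^ Suc n)"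
    proof (rule integral_norm_bound_integral)
      show "(%s. G (P (Suc n) s) j - G (P n s) j) integrable_on {0..t}"
        by (intro integrable_diff intG A) auto
      show "(%s. L * (M * L ^ n / fact (Suc n)) * s ^ Suc n) integrable_on {0..t}"
        by (intro integrable_continuous_interval continuous_intros)
      fix s assume "s \<in> {0..t}"
      then show "norm (G (P (Suc n) s) j - G (P n s) j) <= L * (M * L ^ n / fact (Suc n)) * s ^ Suc n"
        using L[of "P (Suc n) s" "P n s" "M * L ^ n * s ^ Suc n / fact (Suc n)" j] Suc.IH[of s] by simp
    qed
    also have "\<dots> = L * (M * L ^ n / fact (Suc n)) * (t ^ Suc (Suc n) / Suc (Suc n))"
    proof (rule integral_unique)
      have "((%s. s ^ Suc n) has_integral (t ^ Suc (Suc n) / Suc (Suc n) - 0 ^ Suc (Suc n) / Suc (Suc n))) {0..t}"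
        using Suc.prems
        by (intro fundamental_theorem_of_calculus)
          (auto intro!: derivative_eq_intros simp: has_real_derivative_iff_has_vector_derivative[symmetric] simp del: power_Suc)
      from has_integral_mult_right[OF this, of "L * (M * L ^ n / fact (Suc n))"]
      show "((%s. L * (M * L ^ n / fact (Suc n)) * s ^ Suc n) has_integral
         L * (M * L ^ n / fact (Suc n)) * (t ^ Suc (Suc n) / Suc (Suc n))) {0..t}" by simp
    qed
    also have "\<dots> = M * L ^ Suc n * t ^ Suc (Suc n) / fact (Suc (Suc n))"
      by (simp add: field_simps)
    finally show ?case by simp
  qed
  define X where "X t j = a j + (\<Sum>n. P (Suc n) t j - P n t j)" for t j
  have ul: "uniform_limit ({0..T} \<times> UNIV) (%n (t,j). P n t j) (%(t,j). X t j) sequentially" if "0 <= T" for T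
  proof -
    have "uniform_limit ({0..T} \<times> UNIV) (%n x. \<Sum>i<n. (case x of (t,j) => P (Suc i) t j - P i t j))
       (%x. suminf (%i. case x of (t,j) => P (Suc i) t j - P i t j)) sequentially"
    proof (rule Weierstrass_m_test)
      fix n and x :: "real \<times> 'i" assume "x \<in> {0..T} \<times> UNIV"
      then obtain t j where x: "x = (t,j)" "0 <= t" "t <= T" by auto
      have "\<bar>P (Suc n) t j - P n t j\<bar> <= M * L ^ n * t ^ Suc n / fact (Suc n)" using B x by blast
      also have "\<dots> <= M * L ^ n * T ^ Suc n / fact (Suc n)"
        using x M0 \<open>0 <= L\<close> by (intro divide_right_mono mult_left_mono power_mono) auto
      also have "\<dots> <= M * L ^ n * T ^ Suc n / fact n"
        using that M0 \<open>0 <= L\<close> by (intro divide_left_mono) (auto simp: fact_mono)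
      finally show "norm (case x of (t,j) => P (Suc n) t j - P n t j) <= M * T * ((L * T) ^ n / fact n)"
        using x by (simp add: power_mult_distrib mult_ac)
    next
      have "summable (%n. (L * T) ^ n /\<^sub>R fact n)" by (rule summable_exp_generic)
      then show "summable (%n. M * T * ((L * T) ^ n / fact n))"
        by (intro summable_mult) (simp add: divide_inverse mult.commute)
    qed
    then have "uniform_limit ({0..T} \<times> UNIV) (%n x. (case x of (t,j) => a j) + (\<Sum>i<n. (case x of (t,j) => P (Suc i) t j - P i t j)))
       (%x. (case x of (t,j) => a j) + suminf (%i. case x of (t,j) => P (Suc i) t j - P i t j)) sequentially"
      by (intro uniform_limit_add uniform_limit_const)
    moreover have "(case x of (t,j) => a j) + (\<Sum>i<n. (case x of (t,j) => P (Suc i) t j - P i t j)) = (case x of (t,j) => P n t j)" for n x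
      by (cases x) (simp add: sum_lessThan_telescope[of "%i. P i _ _"] P0)
    ultimately show ?thesis by (simp add: X_def split_def)
  qed
  have ulG: "uniform_limit {0..T} (%n t. G (P n t) j) (%t. G (X t) j) sequentially" if "0 <= T" for T j
  proof (rule uniform_limitI)
    fix e :: real assume "0 < e"
    then have "0 < e / (L + 1)" using \<open>0 <= L\<close> by simp
    from uniform_limitD[OF ul[OF that] this]
    show "\<forall>\<^sub>F n in sequentially. \<forall>t\<in>{0..T}. dist (G (P n t) j) (G (X t) j) < e"
    proof eventually_elim
      case (elim n)
      show ?case
      proof
        fix t assume "t \<in> {0..T}"
        then have "\<bar>P n t i - X t i\<bar> <= e / (L + 1)" for i
          using bspec[OF elim, of "(t, i)"] by (simp add: dist_real_def less_imp_le)
        then have "\<bar>G (P n t) j - G (X t) j\<bar> <= L * (e / (L + 1))" by (rule L)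
        also have "\<dots> < e" using \<open>0 <= L\<close> \<open>0 < e\<close> by (simp add: field_simps)
        finally show "dist (G (P n t) j) (G (X t) j) < e" by (simp add: dist_real_def)
      qed
    qed
  qed
  have pl: "(%n. P n t j) \<longlonglongrightarrow> X t j" if "0 <= t" for t j
    using tendsto_uniform_limitI[OF ul[OF that], of "(t,j)"] that by simp
  have contX: "continuous_on {0..T} (%s. G (X s) j)" if "0 <= T" for T j
    using ulG[OF that] by (rule uniform_limit_theorem[rotated])
      (auto intro!: always_eventually continuous_on_subset[OF contG[OF A]])
  have intX: "X t j = a j + integral {0..t} (%s. G (X s) j)" if "0 <= t" for t j
  proof -
    note t0 = that
    have c: "continuous_on {0..t} (%s. G (P n s) j)" for n
      by (rule continuous_on_subset[OF contG[OF A]]) auto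
    obtain I J where IJ: "!!n. ((%s. G (P n s) j) has_integral I n) {0..t}"
      "((%s. G (X s) j) has_integral J) {0..t}" "I \<longlonglongrightarrow> J"
      by (rule uniform_limit_integral[OF ulG[OF t0, of j] c]) auto
    have "(%n. P (Suc n) t j) \<longlonglongrightarrow> a j + J"
      unfolding PS using IJ(1)[THEN integral_unique] IJ(3) by (intro tendsto_intros) auto
    then show ?thesis
      using LIMSEQ_unique[OF LIMSEQ_Suc[OF pl[OF that]]] integral_unique[OF IJ(2)] by blast
  qed
  show ?thesis
  proof (rule that)
    show "X 0 = a" using intX[of 0] by auto
    fix t :: real and j assume t: "0 <= t"
    have "((%s. a j + integral {0..s} (%s. G (X s) j)) has_real_derivative (0 + G (X t) j)) (at t within {0..t+1})"
      using t by (intro DERIV_add DERIV_const integral_has_real_derivative contX) auto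
    then have "((%s. a j + integral {0..s} (%s. G (X s) j)) has_real_derivative G (X t) j) (at t within {0..t+1})"
      by simp
    then have "((%s. X s j) has_real_derivative G (X t) j) (at t within {0..t+1})"
      by (rule has_field_derivative_transform_within[where d = 1]) (use t intX in auto)
    moreover have "at t within {0..t+1} = at t within {0..}"
      using t by (intro at_within_nhd[of t "{..<t+1}"]) auto
    ultimately show "((%t. X t j) has_real_derivative G (X t) j) (at t within {0..})" by simp
  qed
qed

text \<open>Gronwall for the sum of squares: multiplied by \<open>exp (- c * t)\<close> it does not
  increase. The factor \<open>card I\<close> in \<open>c\<close> comes from Cauchy-Schwarz.\<close>

lemma ode_unique:
  fixes X Y :: "real => 'i => real"
  assumes "finite I" "finite F" "0 <= L"
    and contX: "!!i. i \<in> I ==> continuous_on {a..b} (%t. X t i)"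
    and contY: "!!i. i \<in> I ==> continuous_on {a..b} (%t. Y t i)"
    and init: "!!i. i \<in> I ==> X a i = Y a i"
    and D: "!!t i. t \<in> {a<..<b} - F ==> i \<in> I ==>
      \<exists>D E. ((%t. X t i) has_real_derivative D) (at t) \<and> ((%t. Y t i) has_real_derivative E) (at t) \<and>
        \<bar>D - E\<bar> <= L * (\<Sum>k\<in>I. \<bar>X t k - Y t k\<bar>)"
    and "i \<in> I" "a <= t" "t <= b"
  shows "X t i = Y t i"
proof -
  define d where "d t = (\<Sum>i\<in>I. (X t i - Y t i)\<^sup>2)" for t
  define c where "c = 2 * L * card I"
  have contd: "continuous_on {a..t} d"
    unfolding d_def using \<open>t <= b\<close>
    by (intro continuous_intros continuous_on_subset[OF contX] continuous_on_subset[OF contY]) auto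
  have "d t * exp (- c * t) - d a * exp (- c * a) <= 0 * (t - a)"
  proof (rule fe_le[OF \<open>finite F\<close> \<open>a <= t\<close>])
    show "continuous_on {a..t} (%t. d t * exp (- c * t))" by (intro continuous_intros contd)
    fix s assume s: "s \<in> {a<..<t} - F"
    then have "s \<in> {a<..<b} - F" using \<open>t <= b\<close> by auto
    from D[OF this] obtain D E where DE: "!!i. i \<in> I ==> ((%t. X t i) has_real_derivative D i) (at s) \<and>
        ((%t. Y t i) has_real_derivative E i) (at s) \<and> \<bar>D i - E i\<bar> <= L * (\<Sum>k\<in>I. \<bar>X s k - Y s k\<bar>)"
      by metis
    let ?S = "\<Sum>k\<in>I. \<bar>X s k - Y s k\<bar>"
    have dd: "(d has_real_derivative (\<Sum>i\<in>I. 2 * (X s i - Y s i) * (D i - E i))) (at s)"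
      unfolding d_def using DE by (auto intro!: derivative_eq_intros sum.cong)
    have "(\<Sum>i\<in>I. 2 * (X s i - Y s i) * (D i - E i)) <= (\<Sum>i\<in>I. 2 * \<bar>X s i - Y s i\<bar> * (L * ?S))"
    proof (rule sum_mono)
      fix i assume "i \<in> I"
      have "2 * (X s i - Y s i) * (D i - E i) <= 2 * (\<bar>X s i - Y s i\<bar> * \<bar>D i - E i\<bar>)"
        using abs_ge_self[of "(X s i - Y s i) * (D i - E i)"] by (simp only: abs_mult mult.assoc)
      also have "\<dots> <= 2 * (\<bar>X s i - Y s i\<bar> * (L * ?S))"
        using DE[OF \<open>i \<in> I\<close>] by (intro mult_left_mono) auto
      finally show "2 * (X s i - Y s i) * (D i - E i) <= 2 * \<bar>X s i - Y s i\<bar> * (L * ?S)" by simp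
    qed
    also have "\<dots> = 2 * L * ?S\<^sup>2"
      by (simp add: sum_distrib_right[symmetric] sum_distrib_left[symmetric] power2_eq_square)
    also have "\<dots> <= 2 * L * (card I * d s)"
    proof (rule mult_left_mono)
      have "?S\<^sup>2 <= card I * (\<Sum>k\<in>I. \<bar>X s k - Y s k\<bar>\<^sup>2)"
        using sum_squared_le_sum_of_squares[of "%k. \<bar>X s k - Y s k\<bar>" I] by (simp add: mult.commute)
      then show "?S\<^sup>2 <= card I * d s" by (simp add: d_def)
    qed (use \<open>0 <= L\<close> in auto)
    finally have le: "(\<Sum>i\<in>I. 2 * (X s i - Y s i) * (D i - E i)) <= c * d s" by (simp add: c_def)
    show "\<exists>D. ((%t. d t * exp (- c * t)) has_real_derivative D) (at s) \<and> D <= 0"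
    proof (intro exI conjI)
      show "((%t. d t * exp (- c * t)) has_real_derivative
         ((\<Sum>i\<in>I. 2 * (X s i - Y s i) * (D i - E i)) - c * d s) * exp (- c * s)) (at s)"
        by (rule derivative_eq_intros dd refl | simp add: algebra_simps)+
      show "((\<Sum>i\<in>I. 2 * (X s i - Y s i) * (D i - E i)) - c * d s) * exp (- c * s) <= 0"
        using le by (intro mult_nonpos_nonneg) auto
    qed
  qed
  then have "d t * exp (- c * t) <= 0" using init by (simp add: d_def)
  then have "d t <= 0" by (simp add: mult_le_0_iff)
  then have "d t = 0" unfolding d_def by (meson antisym sum_nonneg zero_le_power2)
  then have "(X t i - Y t i)\<^sup>2 = 0"
    unfolding d_def using sum_nonneg_eq_0_iff[OF \<open>finite I\<close>] \<open>i \<in> I\<close> by (metis (mono_tags, lifting) zero_le_power2)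
  then show ?thesis by simp
qed

section \<open>The discrete Laplacian on a fixed set of sites\<close>

definition nbr :: "(int => real) => int option => real" where
  "nbr v k = (case k of None => 0 | Some i => v i)"

abbreviation ind :: "int set => int => real" where
  "ind S \<equiv> %k. of_bool (k \<in> S)"

text \<open>The right-hand side for a fixed set \<open>S\<close> of living sites, as a linear
  operator on the powers \<open>v k = x k powr (- \<beta>)\<close>. Linearity makes differences of
  two flows with the same living sites accessible.\<close>

definition clap :: "int set => (int => real) => int => real" where
  "clap S v j = (if j \<in> S then nbr v (sigma_minus j (ind S)) - 2 * v j + nbr v (sigma_plus j (ind S)) else 0)"

lemma sigma_plus_SomeD:
  assumes "sigma_plus j x = Some k"
  shows "j < k" "0 < x k" "!!i. j < i ==> i < k ==> \<not> 0 < x i"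
proof -
  let ?A = "{k. j < k \<and> 0 < x k}"
  have ne: "?A \<noteq> {}" and k: "k = Inf ?A" using assms by (auto simp: sigma_plus_def split: if_splits)
  have bdd: "bdd_below ?A" by (rule bdd_belowI[of _ j]) auto
  obtain a where a: "a \<in> ?A" using ne by auto
  define M where "M = Min {k \<in> {j..a}. j < k \<and> 0 < x k}"
  have fin: "finite {k \<in> {j..a}. j < k \<and> 0 < x k}"
    by (rule finite_subset[of _ "{j..a}"]) auto
  have M: "M \<in> {k \<in> {j..a}. j < k \<and> 0 < x k}" unfolding M_def using a by (intro Min_in fin) auto
  have ub: "M <= i" if "i \<in> ?A" for i
  proof (cases "i <= a")
    case True
    then show ?thesis unfolding M_def using that by (intro Min_le fin) auto
  qed (use M in auto)
  have "Inf ?A = M" using M ub by (intro cInf_eq_minimum) auto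
  then have "Inf ?A \<in> ?A" using M by auto
  then show "j < k" "0 < x k" using k by auto
  show "!!i. j < i ==> i < k ==> \<not> 0 < x i" using cInf_lower[OF _ bdd] k by force
qed

lemma lap_sigma_clap: "lap_sigma \<beta> x j = clap {k. 0 < x k} (%k. x k powr (- \<beta>)) j"
proof -
  have s: "sigma_minus j (ind {k. 0 < x k}) = sigma_minus j x" "sigma_plus j (ind {k. 0 < x k}) = sigma_plus j x"
    by (rule sigma_cong, simp)+
  have "at_ext x k powr (- \<beta>) = nbr (%k. x k powr (- \<beta>)) k" for k
    by (cases k) (auto simp: at_ext_def nbr_def)
  then show ?thesis unfolding lap_sigma_def clap_def s by simp
qed

lemma nbr_cong_ind:
  assumes "!!k. k \<in> S ==> v k = w k"
  shows "nbr v (sigma_minus j (ind S)) = nbr w (sigma_minus j (ind S))"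
    "nbr v (sigma_plus j (ind S)) = nbr w (sigma_plus j (ind S))"
proof -
  show "nbr v (sigma_minus j (ind S)) = nbr w (sigma_minus j (ind S))"
    using assms sigma_minus_SomeD(2)[of j "ind S"] by (cases "sigma_minus j (ind S)") (simp_all add: nbr_def)
  show "nbr v (sigma_plus j (ind S)) = nbr w (sigma_plus j (ind S))"
    using assms sigma_plus_SomeD(2)[of j "ind S"] by (cases "sigma_plus j (ind S)") (simp_all add: nbr_def)
qed

lemma clap_cong: "(!!k. k \<in> S ==> v k = w k) ==> clap S v j = clap S w j"
  using nbr_cong_ind[of S v w j] by (auto simp: clap_def)

lemma clap_diff: "clap S v j - clap S w j = clap S (%k. v k - w k) j"
proof -
  have "nbr (%k. v k - w k) k = nbr v k - nbr w k" for k by (cases k) (auto simp: nbr_def)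
  then show ?thesis by (simp add: clap_def)
qed

lemma clap_bound:
  assumes "!!k. k \<in> S ==> \<bar>v k\<bar> <= C" "0 <= C"
  shows "\<bar>clap S v j\<bar> <= 4 * C"
proof -
  have "\<bar>nbr v (sigma_minus j (ind S))\<bar> <= C"
    using assms sigma_minus_SomeD(2)[of j "ind S"] by (auto simp: nbr_def split: option.splits)
  moreover have "\<bar>nbr v (sigma_plus j (ind S))\<bar> <= C"
    using assms sigma_plus_SomeD(2)[of j "ind S"] by (auto simp: nbr_def split: option.splits)
  moreover have "j \<in> S ==> \<bar>v j\<bar> <= C" using assms by auto
  ultimately show ?thesis using assms(2) by (auto simp: clap_def abs_le_iff)
qed

lemma clap_ge:
  assumes "!!k. k \<in> S ==> 0 <= v k" "j \<in> S"
  shows "- 2 * v j <= clap S v j"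
proof -
  have "0 <= nbr v (sigma_minus j (ind S))"
    using assms sigma_minus_SomeD(2)[of j "ind S"] by (auto simp: nbr_def split: option.splits)
  moreover have "0 <= nbr v (sigma_plus j (ind S))"
    using assms sigma_plus_SomeD(2)[of j "ind S"] by (auto simp: nbr_def split: option.splits)
  ultimately show ?thesis using assms by (auto simp: clap_def)
qed

text \<open>The only negative contribution is the particle's own loss. The speed limit for shrinking
  particles and the integrability of the right-hand side rest on this bound.\<close>

lemma lap_sigma_ge: "(!!k. 0 <= x k) ==> - 2 * x j powr (- \<beta>) <= lap_sigma \<beta> x j"
  using clap_ge[of "{k. 0 < x k}" "%k. x k powr (- \<beta>)" j]
  by (cases "0 < x j") (auto simp: lap_sigma_clap clap_def not_less order.antisym)

lemma lap_sigma_dead: "\<not> 0 < x j ==> lap_sigma \<beta> x j = 0"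
  by (simp add: lap_sigma_def)

lemma sigma_minus_Min:
  assumes "finite S" "j \<in> S" "j \<noteq> Min S"
  obtains k where "k \<in> S" "k < j" "sigma_minus j (ind S) = Some k" "sigma_plus k (ind S) = Some j"
proof -
  have "Min S < j" using assms by (metis Min_le order_le_imp_less_or_eq)
  moreover have "Min S \<in> S" using assms by (intro Min_in) auto
  ultimately obtain k where k: "sigma_minus j (ind S) = Some k"
    by (cases "sigma_minus j (ind S)") (auto simp: sigma_minus_def split: if_splits)
  note kk = sigma_minus_SomeD[OF k]
  have "sigma_plus k (ind S) = Some j"
    using kk assms by (intro sigma_plus_Some) auto
  then show ?thesis using that kk k by auto
qed

lemma sigma_plus_Max:
  assumes "finite S" "j \<in> S" "j \<noteq> Max S"
  obtains k where "k \<in> S" "j < k" "sigma_plus j (ind S) = Some k" "sigma_minus k (ind S) = Some j"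
proof -
  have "j < Max S" using assms by (metis Max_ge order_le_imp_less_or_eq)
  moreover have "Max S \<in> S" using assms by (intro Max_in) auto
  ultimately obtain k where k: "sigma_plus j (ind S) = Some k"
    by (cases "sigma_plus j (ind S)") (auto simp: sigma_plus_def split: if_splits)
  note kk = sigma_plus_SomeD[OF k]
  have "sigma_minus k (ind S) = Some j"
    using kk assms by (intro sigma_minus_Some) auto
  then show ?thesis using that kk k by auto
qed

text \<open>The sum telescopes: passing to the nearest living neighbour is a bijection between
  \<open>S\<close> without one end and \<open>S\<close> without the other, so interior values are
  gained twice and lost twice. Mass leaves only through the two ends.\<close>

lemma sum_clap:
  assumes "finite S" "S \<noteq> {}"
  shows "(\<Sum>j\<in>S. clap S v j) = - v (Min S) - v (Max S)"
proof -
  have mi: "Min S \<in> S" and ma: "Max S \<in> S" using assms by auto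
  have nm: "sigma_minus (Min S) (ind S) = None" "sigma_plus (Max S) (ind S) = None"
    using Min_le[OF assms(1)] Max_ge[OF assms(1)]
    by (auto intro!: sigma_minus_None sigma_plus_None simp: not_less[symmetric])
  have a: "(\<Sum>j\<in>S. nbr v (sigma_minus j (ind S))) = (\<Sum>j\<in>S - {Max S}. v j)"
  proof -
    have "(\<Sum>j\<in>S. nbr v (sigma_minus j (ind S))) = (\<Sum>j\<in>S - {Min S}. nbr v (sigma_minus j (ind S)))"
      using assms mi nm by (subst sum.remove[OF assms(1) mi]) (simp add: nbr_def)
    also have "\<dots> = (\<Sum>j\<in>S - {Max S}. v j)"
    proof (rule sum.reindex_bij_witness[of _ "%j. the (sigma_plus j (ind S))" "%j. the (sigma_minus j (ind S))"])
      fix j assume "j \<in> S - {Min S}"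
      then obtain k where k: "k \<in> S" "k < j" "sigma_minus j (ind S) = Some k" "sigma_plus k (ind S) = Some j"
        using sigma_minus_Min[OF assms(1), of j] by auto
      show "the (sigma_plus (the (sigma_minus j (ind S))) (ind S)) = j" using k by simp
      show "the (sigma_minus j (ind S)) \<in> S - {Max S}" using k nm by auto
      show "v (the (sigma_minus j (ind S))) = nbr v (sigma_minus j (ind S))" using k by (simp add: nbr_def)
    next
      fix j assume "j \<in> S - {Max S}"
      then obtain k where k: "k \<in> S" "j < k" "sigma_plus j (ind S) = Some k" "sigma_minus k (ind S) = Some j"
        using sigma_plus_Max[OF assms(1), of j] by auto
      show "the (sigma_minus (the (sigma_plus j (ind S))) (ind S)) = j" using k by simp
      show "the (sigma_plus j (ind S)) \<in> S - {Min S}" using k nm by auto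
    qed
    finally show ?thesis .
  qed
  have b: "(\<Sum>j\<in>S. nbr v (sigma_plus j (ind S))) = (\<Sum>j\<in>S - {Min S}. v j)"
  proof -
    have "(\<Sum>j\<in>S. nbr v (sigma_plus j (ind S))) = (\<Sum>j\<in>S - {Max S}. nbr v (sigma_plus j (ind S)))"
      using assms ma nm by (subst sum.remove[OF assms(1) ma]) (simp add: nbr_def)
    also have "\<dots> = (\<Sum>j\<in>S - {Min S}. v j)"
    proof (rule sum.reindex_bij_witness[of _ "%j. the (sigma_minus j (ind S))" "%j. the (sigma_plus j (ind S))"])
      fix j assume "j \<in> S - {Max S}"
      then obtain k where k: "k \<in> S" "j < k" "sigma_plus j (ind S) = Some k" "sigma_minus k (ind S) = Some j"
        using sigma_plus_Max[OF assms(1), of j] by auto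
      show "the (sigma_minus (the (sigma_plus j (ind S))) (ind S)) = j" using k by simp
      show "the (sigma_plus j (ind S)) \<in> S - {Min S}" using k nm by auto
      show "v (the (sigma_plus j (ind S))) = nbr v (sigma_plus j (ind S))" using k by (simp add: nbr_def)
    next
      fix j assume "j \<in> S - {Min S}"
      then obtain k where k: "k \<in> S" "k < j" "sigma_minus j (ind S) = Some k" "sigma_plus k (ind S) = Some j"
        using sigma_minus_Min[OF assms(1), of j] by auto
      show "the (sigma_plus (the (sigma_minus j (ind S))) (ind S)) = j" using k by simp
      show "the (sigma_minus j (ind S)) \<in> S - {Max S}" using k nm by auto
    qed
    finally show ?thesis .
  qed
  have "(\<Sum>j\<in>S. clap S v j) = (\<Sum>j\<in>S. nbr v (sigma_minus j (ind S))) - 2 * (\<Sum>j\<in>S. v j) + (\<Sum>j\<in>S. nbr v (sigma_plus j (ind S)))"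
    by (simp add: clap_def sum.distrib sum_subtractf sum_distrib_left)
  then show ?thesis
    unfolding a b using sum.remove[OF assms(1) mi, of v] sum.remove[OF assms(1) ma, of v] by simp
qed

section \<open>Existence of finite particle systems\<close>

lemma cont_local:
  fixes f :: "real => real"
  assumes "!!t. t \<in> A ==> \<exists>e>0. continuous_on (A \<inter> ball t e) f"
  shows "continuous_on A f"
  unfolding continuous_on_eq_continuous_within
proof
  fix t assume t: "t \<in> A"
  then obtain e where e: "e > 0" "continuous_on (A \<inter> ball t e) f" using assms by blast
  then have "continuous (at t within (A \<inter> ball t e)) f"
    using t by (simp add: continuous_on_eq_continuous_within)
  moreover have "at t within (A \<inter> ball t e) = at t within A"
    using e by (intro at_within_nhd[of t "ball t e"]) auto
  ultimately show "continuous (at t within A) f" by simp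
qed

lemma at_within_nonneg: "0 < t ==> at t within {0..} = at (t::real)"
  by (rule at_within_interior) simp

lemma powr_has_derivative_pos:
  fixes f :: "real => real"
  assumes "(f has_real_derivative D) (at t)" "0 < f t"
  shows "((%t. f t powr p) has_real_derivative p * f t powr (p - 1) * D) (at t)"
  using assms by (auto intro!: derivative_eq_intros simp: powr_diff field_simps)

text \<open>The singular power is truncated at small sizes; the truncated systems have global
  solutions, and these agree as long as all particles are above the truncation levels. If the union
  of these time intervals is bounded, the sizes have limits at its end, and one of them vanishes
  since otherwise some truncation level would not have been reached.\<close>

lemma particle_phase:
  fixes a :: "int => real"
  assumes \<beta>: "0 < \<beta>" and S: "finite S" "S \<noteq> {}"
    and a_pos: "!!j. j \<in> S ==> 0 < a j" and a_off: "!!j. j \<notin> S ==> a j = 0"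
  obtains
    (global) X where "X 0 = a" "!!t j. j \<notin> S ==> X t j = 0" "!!t j. 0 <= t ==> j \<in> S ==> 0 < X t j"
      "!!j. continuous_on {0..} (%t. X t j)"
      "!!t j. 0 < t ==> ((%t. X t j) has_real_derivative clap S (%k. X t k powr (- \<beta>)) j) (at t)"
  | (dies) X T where "0 < T" "X 0 = a" "!!t j. j \<notin> S ==> X t j = 0"
      "!!t j. 0 <= t ==> t < T ==> j \<in> S ==> 0 < X t j"
      "!!j. continuous_on {0..T} (%t. X t j)" "!!j. 0 <= X T j" "\<exists>j\<in>S. X T j = 0"
      "!!t j. 0 < t ==> t < T ==> ((%t. X t j) has_real_derivative clap S (%k. X t k powr (- \<beta>)) j) (at t)"
proof -
  define d where "d n = inverse (real (Suc n))" for n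
  have d0: "0 < d n" for n by (simp add: d_def)
  have dmono: "m <= n ==> d n <= d m" for m n by (simp add: d_def)
  have dsmall: "\<exists>n. d n < c" if "0 < c" for c using reals_Archimedean[OF that] by (auto simp: d_def)
  define G where "G n x j = clap S (%k. (max (x k) (d n)) powr (- \<beta>)) j" for n x j
  define L where "L n = \<beta> * d n powr (-(\<beta> + 1))" for n
  have L0: "0 <= L n" for n using \<beta> by (simp add: L_def)
  have glip: "\<bar>(max u (d n)) powr (- \<beta>) - (max v (d n)) powr (- \<beta>)\<bar> <= L n * \<bar>u - v\<bar>" for n u v
  proof -
    have "\<bar>(max u (d n)) powr (- \<beta>) - (max v (d n)) powr (- \<beta>)\<bar> <= L n * \<bar>max u (d n) - max v (d n)\<bar>"
      unfolding L_def using d0 \<beta> by (intro powr_neg_lipschitz) auto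
    also have "\<dots> <= L n * \<bar>u - v\<bar>" by (intro mult_left_mono L0) auto
    finally show ?thesis .
  qed
  have "\<exists>X. X 0 = a \<and> (\<forall>t j. 0 <= t --> ((%t. X t j) has_real_derivative G n (X t) j) (at t within {0..}))" for n
  proof (rule picard[of "G n" "4 * d n powr (- \<beta>)" "4 * L n" a])
    fix x j show "\<bar>G n x j\<bar> <= 4 * d n powr (- \<beta>)"
      unfolding G_def using d0[of n] \<beta> by (intro clap_bound) (auto intro!: powr_mono2')
  next
    fix x y :: "int => real" and j C assume C: "!!i. \<bar>x i - y i\<bar> <= C"
    then have "0 <= C" using abs_ge_zero order_trans by blast
    show "\<bar>G n x j - G n y j\<bar> <= 4 * L n * C"
      unfolding G_def clap_diff mult.assoc
    proof (rule clap_bound)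
      show "\<bar>max (x k) (d n) powr - \<beta> - max (y k) (d n) powr - \<beta>\<bar> <= L n * C" for k
        using order_trans[OF glip mult_left_mono[OF C L0]] .
    qed (use L0 \<open>0 <= C\<close> in auto)
  qed (use L0 in auto)
  then obtain P where P0: "!!n. P n 0 = a"
    and PD: "!!n t j. 0 <= t ==> ((%t. P n t j) has_real_derivative G n (P n t) j) (at t within {0..})"
    by metis
  have contP: "continuous_on {0..} (%t. P n t j)" for n j
    by (rule DERIV_continuous_on) (use PD in auto)
  have contP': "continuous_on {0..u} (%t. P n t j)" for n j u
    by (rule continuous_on_subset[OF contP]) auto
  have PD': "((%t. P n t j) has_real_derivative G n (P n t) j) (at t)" if "0 < t" for n t j
    using PD[of t n j] that by (simp add: at_within_nonneg)
  define good where "good n t \<longleftrightarrow> 0 <= t \<and> (\<forall>s j. 0 <= s --> s <= t --> j \<in> S --> d n < P n s j)" for n t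
  have Gclap: "G n (P n s) j = clap S (%k. P n s k powr (- \<beta>)) j" if "good n t" "0 <= s" "s <= t" for n s t j
    unfolding G_def
  proof (rule clap_cong)
    fix k assume "k \<in> S"
    then have "d n < P n s k" using that by (simp add: good_def)
    then show "max (P n s k) (d n) powr - \<beta> = P n s k powr - \<beta>" by (simp add: max_def)
  qed
  \<comment> \<open>A true solution that stays above the level \<open>d n\<close> also solves the
    truncated system, whose solution is unique.\<close>
  have agree: "P n s j = Y s j"
    if contY: "!!j. continuous_on {0..t} (%t. Y t j)" and Y0: "Y 0 = a"
      and YD: "!!s j. 0 < s ==> s < t ==> ((%t. Y t j) has_real_derivative clap S (%k. Y s k powr (- \<beta>)) j) (at s)"
      and Yd: "!!s k. 0 < s ==> s < t ==> k \<in> S ==> d n <= Y s k"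
      and "0 <= s" "s <= t" "j \<in> S" for n t s j and Y :: "real => int => real"
  proof (rule ode_unique[of S "{}" "4 * L n" 0 t "P n" Y])
    fix \<tau> i assume \<tau>: "\<tau> \<in> {0<..<t} - {}" and i: "i \<in> S"
    have e: "clap S (%k. Y \<tau> k powr (- \<beta>)) i = G n (Y \<tau>) i"
      unfolding G_def
    proof (rule clap_cong)
      fix k assume "k \<in> S"
      then have "d n <= Y \<tau> k" using Yd[of \<tau>] \<tau> by simp
      then show "Y \<tau> k powr - \<beta> = max (Y \<tau> k) (d n) powr - \<beta>" by (simp add: max_absorb1)
    qed
    have "\<bar>G n (P n \<tau>) i - G n (Y \<tau>) i\<bar> <= 4 * (L n * (\<Sum>k\<in>S. \<bar>P n \<tau> k - Y \<tau> k\<bar>))"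
      unfolding G_def clap_diff
    proof (rule clap_bound)
      fix k assume k: "k \<in> S"
      have "\<bar>P n \<tau> k - Y \<tau> k\<bar> <= (\<Sum>k\<in>S. \<bar>P n \<tau> k - Y \<tau> k\<bar>)" using S k by (intro member_le_sum) auto
      then show "\<bar>max (P n \<tau> k) (d n) powr - \<beta> - max (Y \<tau> k) (d n) powr - \<beta>\<bar> <= L n * (\<Sum>k\<in>S. \<bar>P n \<tau> k - Y \<tau> k\<bar>)"
        using glip[of "P n \<tau> k" n "Y \<tau> k"] L0[of n] by (meson mult_left_mono order_trans)
    qed (use L0 in \<open>auto intro!: mult_nonneg_nonneg sum_nonneg\<close>)
    then show "\<exists>D E. ((%t. P n t i) has_real_derivative D) (at \<tau>) \<and> ((%t. Y t i) has_real_derivative E) (at \<tau>) \<and>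
        \<bar>D - E\<bar> <= 4 * L n * (\<Sum>k\<in>S. \<bar>P n \<tau> k - Y \<tau> k\<bar>)"
      using PD'[of \<tau> n i] YD[of \<tau> i] \<tau> by (auto simp: e mult.assoc)
  qed (use that S L0 P0 contP' in auto)
  have agree_good: "P n s j = P m s j" if "good n t" "good m t" "0 <= s" "s <= t" "j \<in> S" for n m s t j
  proof -
    have *: "P n s j = P m s j" if "good n t" "good m t" "m <= n" for n m
    proof (rule agree[of t "P m"])
      fix \<tau> j assume \<tau>: "0 < \<tau>" "\<tau> < t"
      show "((%t. P m t j) has_real_derivative clap S (%k. P m \<tau> k powr - \<beta>) j) (at \<tau>)"
        using PD'[OF \<tau>(1), of m j] Gclap[OF that(2), of \<tau> j] \<tau> by simp
      show "d n <= P m \<tau> j" if "j \<in> S"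
        using \<open>good m t\<close> \<tau> that dmono[OF \<open>m <= n\<close>] unfolding good_def by (meson less_imp_le order_trans)
    qed (use \<open>0 <= s\<close> \<open>s <= t\<close> \<open>j \<in> S\<close> contP' P0 in auto)
    show ?thesis using *[of n m] *[of m n] that(1,2) by (metis nle_le)
  qed
  define D where "D = {t. \<exists>n. good n t}"
  have good_down: "good n s" if "good n t" "0 <= s" "s <= t" for n s t using that by (auto simp: good_def)
  have good_open: "\<exists>t'>t. good n t'" if g: "good n t" for n t
  proof -
    have "\<forall>j\<in>S. eventually (%s. d n < P n s j) (at t within {t..})"
    proof
      fix j assume "j \<in> S"
      have "((%s. P n s j) \<longlongrightarrow> P n t j) (at t within {0..})"
        using contP[of n j] g by (auto simp: continuous_on good_def)
      then have "((%s. P n s j) \<longlongrightarrow> P n t j) (at t within {t..})"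
        by (rule tendsto_within_subset) (use g in \<open>auto simp: good_def\<close>)
      then show "eventually (%s. d n < P n s j) (at t within {t..})"
        using g \<open>j \<in> S\<close> by (intro order_tendstoD(1)) (auto simp: good_def)
    qed
    then have "eventually (%s. \<forall>j\<in>S. d n < P n s j) (at t within {t..})"
      using S by (simp add: eventually_ball_finite_distrib)
    then obtain e where e: "e > 0" "!!s. s \<in> {t..} ==> s \<noteq> t ==> dist s t < e ==> \<forall>j\<in>S. d n < P n s j"
      unfolding eventually_at by blast
    have "good n (t + e / 2)"
      unfolding good_def
    proof (intro conjI allI impI)
      fix s j assume s: "0 <= s" "s <= t + e / 2" "j \<in> S"
      show "d n < P n s j"
      proof (cases "s <= t")
        case True
        then show ?thesis using g s by (auto simp: good_def)
      next
        case False
        then show ?thesis using e(2)[of s] s e(1) by (auto simp: dist_real_def)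
      qed
    qed (use g e in \<open>auto simp: good_def\<close>)
    then show ?thesis using e by (intro exI[of _ "t + e / 2"]) auto
  qed
  have zero_D: "0 \<in> D"
  proof -
    have "0 < Min (a ` S)" using S a_pos by (subst Min_gr_iff) auto
    then obtain n where "d n < Min (a ` S)" using dsmall by blast
    then have "good n 0" using S by (auto simp: good_def P0 Min_gr_iff)
    then show ?thesis by (auto simp: D_def)
  qed
  define x where "x t j = (if j \<in> S then P (SOME n. good n t) t j else 0)" for t j
  have x_eq: "x s j = P n s j" if "good n t" "0 <= s" "s <= t" "j \<in> S" for n s t j
  proof -
    have "good n s" using good_down that by blast
    then have "good (SOME n. good n s) s" by (rule someI)
    then show ?thesis using agree_good[OF _ \<open>good n s\<close>] that by (auto simp: x_def)
  qed
  have x_pos: "0 < x t j" if "t \<in> D" "j \<in> S" for t j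
  proof -
    obtain n where n: "good n t" using \<open>t \<in> D\<close> by (auto simp: D_def)
    then have "0 <= t" "d n < P n t j" using that by (auto simp: good_def)
    then show ?thesis using x_eq[OF n, of t j] that d0[of n] by simp
  qed
  have x_off: "x t j = 0" if "j \<notin> S" for t j using that by (simp add: x_def)
  have x_deriv: "((%t. x t j) has_real_derivative clap S (%k. x t k powr (- \<beta>)) j) (at t)"
    if "t \<in> D" "0 < t" for t j
  proof (cases "j \<in> S")
    case True
    obtain n t' where n: "good n t'" "t < t'" using good_open \<open>t \<in> D\<close> unfolding D_def by blast
    have "((%t. P n t j) has_real_derivative clap S (%k. P n t k powr (- \<beta>)) j) (at t)"
      using PD'[OF \<open>0 < t\<close>, of n j] Gclap[OF n(1), of t j] n that by simp
    also have "clap S (%k. P n t k powr (- \<beta>)) j = clap S (%k. x t k powr (- \<beta>)) j"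
      using x_eq[OF n(1), of t] n that by (intro clap_cong) auto
    finally show ?thesis
      using x_eq[OF n(1) _ _ True] n that
      by (elim has_field_derivative_transform_within_open[of _ _ _ "{0<..<t'}"]) auto
  next
    case False
    then show ?thesis by (simp add: x_def clap_def)
  qed
  have x0: "x 0 = a"
  proof
    fix j
    obtain n where "good n 0" using zero_D by (auto simp: D_def)
    then show "x 0 j = a j" using x_eq[of n 0 0 j] P0 a_off by (cases "j \<in> S") (auto simp: x_off)
  qed
  have x_cont: "continuous_on {0..t} (%t. x t j)" if "t \<in> D" for t j
  proof (cases "j \<in> S")
    case True
    obtain n where n: "good n t" using \<open>t \<in> D\<close> by (auto simp: D_def)
    have "continuous_on {0..t} (%t. P n t j)" by (rule continuous_on_subset[OF contP]) auto
    then show ?thesis using x_eq[OF n _ _ True] by (subst continuous_on_cong[OF refl]) auto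
  qed (simp add: x_def)
  show ?thesis
  proof (cases "bdd_above D")
    case False
    have all: "t \<in> D" if "0 <= t" for t
    proof -
      obtain t' where "t' \<in> D" "t <= t'" using False by (meson bdd_aboveI linear)
      then show ?thesis using good_down that by (auto simp: D_def)
    qed
    show ?thesis
    proof (rule global[of x])
      fix j show "continuous_on {0..} (%t. x t j)"
      proof (rule cont_local)
        fix t :: real assume "t \<in> {0..}"
        then show "\<exists>e>0. continuous_on ({0..} \<inter> ball t e) (%t. x t j)"
          by (intro exI[of _ 1] conjI continuous_on_subset[OF x_cont[OF all, of "t + 1"]]) (auto simp: dist_real_def)
      qed
    qed (use x0 x_off x_pos all x_deriv in auto)
  next
    case True
    define T where "T = Sup D"
    have DT: "t < T" if "t \<in> D" for t
      using that good_open cSup_upper[OF _ True] unfolding T_def D_def by fastforce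
    have TD: "t \<in> D" if "0 <= t" "t < T" for t
    proof -
      obtain t' where "t' \<in> D" "t < t'" using \<open>t < T\<close> zero_D less_cSupD[of D t] unfolding T_def by blast
      then obtain n where "good n t'" by (auto simp: D_def)
      then have "good n t" by (rule good_down) (use \<open>0 <= t\<close> \<open>t < t'\<close> in auto)
      then show ?thesis by (auto simp: D_def)
    qed
    have T0: "0 < T" using DT zero_D by blast
    \<comment> \<open>The total mass does not increase by \<open>sum_clap\<close>, and it bounds
      every single particle.\<close>
    have xb: "x t j <= (\<Sum>k\<in>S. a k)" if "0 <= t" "t < T" "j \<in> S" for t j
    proof -
      have "(\<Sum>k\<in>S. x t k) - (\<Sum>k\<in>S. x 0 k) <= 0 * (t - 0)"
      proof (rule fe_le[of "{}"])
        show "continuous_on {0..t} (%t. \<Sum>k\<in>S. x t k)" using x_cont TD that by (intro continuous_intros) auto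
        fix s assume s: "s \<in> {0<..<t} - {}"
        have "((%t. \<Sum>k\<in>S. x t k) has_real_derivative (\<Sum>k\<in>S. clap S (%k. x s k powr (- \<beta>)) k)) (at s)"
          using s that by (intro DERIV_sum x_deriv TD) auto
        then show "\<exists>D. ((%t. \<Sum>k\<in>S. x t k) has_real_derivative D) (at s) \<and> D <= 0"
          unfolding sum_clap[OF S]
          using powr_ge_zero[of "x s (Min S)" "- \<beta>"] powr_ge_zero[of "x s (Max S)" "- \<beta>"]
          by (intro exI conjI) (assumption, linarith)
      qed (use that in auto)
      moreover have "x t j <= (\<Sum>k\<in>S. x t k)"
        using S that x_pos TD by (intro member_le_sum) (auto intro: less_imp_le)
      ultimately show ?thesis by (simp add: x0)
    qed
    have "\<exists>l\<ge>0. ((%t. x t j) \<longlongrightarrow> l) (at_left T)" if j: "j \<in> S" for j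
    proof -
      \<comment> \<open>By \<open>clap_ge\<close> the power \<open>\<beta> + 1\<close> of a size
        decreases with speed at most \<open>2 * (\<beta> + 1)\<close>, so \<open>h\<close> is
        monotone. Being bounded, it has a limit at \<open>T\<close>, and so has the size.\<close>
      define h where "h t = x t j powr (\<beta> + 1) + 2 * (\<beta> + 1) * t" for t
      have hmono: "h s <= h t" if "0 <= s" "s <= t" "t < T" for s t
      proof -
        have "0 * (t - s) <= h t - h s"
        proof (rule fe_ge[of "{}"])
          show "continuous_on {s..t} h" unfolding h_def using x_pos[OF TD] that j
            by (intro continuous_intros continuous_on_subset[OF x_cont[OF TD]]) (auto simp: less_le)
          fix \<tau> assume \<tau>: "\<tau> \<in> {s<..<t} - {}"
          then have xp: "0 < x \<tau> j" and tD: "\<tau> \<in> D" "0 < \<tau>" using TD that x_pos j by auto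
          have "(h has_real_derivative ((\<beta> + 1) * x \<tau> j powr (\<beta> + 1 - 1) * clap S (%k. x \<tau> k powr (- \<beta>)) j + 2 * (\<beta> + 1))) (at \<tau>)"
            unfolding h_def by (rule derivative_eq_intros powr_has_derivative_pos x_deriv tD xp refl | simp)+
          moreover have "(\<beta> + 1) * x \<tau> j powr \<beta> * (- 2 * x \<tau> j powr (- \<beta>)) <= (\<beta> + 1) * x \<tau> j powr \<beta> * clap S (%k. x \<tau> k powr (- \<beta>)) j"
            using \<beta> j by (intro mult_left_mono clap_ge) auto
          moreover have "x \<tau> j powr \<beta> * x \<tau> j powr (- \<beta>) = 1" using xp by (simp add: powr_minus)
          then have "(\<beta> + 1) * x \<tau> j powr \<beta> * (- 2 * x \<tau> j powr (- \<beta>)) = - 2 * (\<beta> + 1)" by (simp add: mult.assoc mult.left_commute)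
          ultimately show "\<exists>D. (h has_real_derivative D) (at \<tau>) \<and> 0 <= D" by (intro exI conjI) auto
        qed (use that in auto)
        then show ?thesis by simp
      qed
      define N where "N = (\<Sum>k\<in>S. a k) powr (\<beta> + 1) + 2 * (\<beta> + 1) * T"
      have hN: "h t <= N" if "0 <= t" "t < T" for t
        unfolding h_def N_def using that xb[OF that j] x_pos[OF TD[OF that] j] \<beta>
        by (intro add_mono powr_mono2 mult_left_mono) auto
      define l where "l = Sup (h ` {0..<T})"
      have bdd: "bdd_above (h ` {0..<T})" using hN by (auto intro!: bdd_aboveI)
      have "(h \<longlongrightarrow> l) (at_left T)"
      proof (rule increasing_tendsto)
        have ev: "eventually (%t. t \<in> {0<..<T}) (at_left T)"
          using T0 by (auto simp: eventually_at_left_field)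
        show "eventually (%t. h t <= l) (at_left T)"
          using ev by eventually_elim (auto simp: l_def intro!: cSup_upper bdd)
        fix y assume "y < l"
        then obtain s where s: "0 <= s" "s < T" "y < h s"
          using less_cSupD[of "h ` {0..<T}" y] T0 by (auto simp: l_def)
        have "eventually (%t. t \<in> {s<..<T}) (at_left T)" using s by (auto simp: eventually_at_left_field)
        then show "eventually (%t. y < h t) (at_left T)"
        proof eventually_elim
          case (elim t)
          then show ?case using hmono[of s t] s by auto
        qed
      qed
      then have "((%t. h t - 2 * (\<beta> + 1) * t) \<longlongrightarrow> l - 2 * (\<beta> + 1) * T) (at_left T)"
        by (intro tendsto_intros)
      then have "((%t. (h t - 2 * (\<beta> + 1) * t) powr (1 / (\<beta> + 1))) \<longlongrightarrow> (l - 2 * (\<beta> + 1) * T) powr (1 / (\<beta> + 1))) (at_left T)"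
        using \<beta> by (intro tendsto_powr') (auto simp: h_def)
      moreover have "eventually (%t. (h t - 2 * (\<beta> + 1) * t) powr (1 / (\<beta> + 1)) = x t j) (at_left T)"
      proof -
        have "eventually (%t. t \<in> {0<..<T}) (at_left T)"
          using T0 by (auto simp: eventually_at_left_field)
        then show ?thesis
        proof eventually_elim
          case (elim t)
          then have "0 < x t j" by (intro x_pos TD j) auto
          then show ?case using \<beta> by (simp add: h_def powr_powr)
        qed
      qed
      ultimately have "((%t. x t j) \<longlongrightarrow> (l - 2 * (\<beta> + 1) * T) powr (1 / (\<beta> + 1))) (at_left T)"
        using tendsto_cong by force
      then show ?thesis by (intro exI[of _ "(l - 2 * (\<beta> + 1) * T) powr (1 / (\<beta> + 1))"]) auto
    qed
    then obtain l where l: "!!j. j \<in> S ==> 0 <= l j \<and> ((%t. x t j) \<longlongrightarrow> l j) (at_left T)" by metis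
    define X where "X t j = (if t < T \<or> j \<notin> S then x t j else l j)" for t j
    have X_off: "X t j = 0" if "j \<notin> S" for t j using that by (simp add: X_def x_off)
    have X_lt: "t < T ==> X t = x t" for t by (auto simp: X_def)
    have X_pos: "0 < X t j" if "0 <= t" "t < T" "j \<in> S" for t j
      using that x_pos TD by (simp add: X_def)
    have X_deriv: "((%t. X t j) has_real_derivative clap S (%k. X t k powr (- \<beta>)) j) (at t)" if "0 < t" "t < T" for t j
    proof -
      have "((%t. X t j) has_real_derivative clap S (%k. x t k powr (- \<beta>)) j) (at t)"
        by (rule has_field_derivative_transform_within_open[OF x_deriv[OF TD], of _ "{..<T}"])
          (use that in \<open>auto simp: X_def\<close>)
      then show ?thesis using X_lt[OF that(2)] by simp
    qed
    have X_cont: "continuous_on {0..T} (%t. X t j)" for j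
    proof (cases "j \<in> S")
      case True
      show ?thesis
      proof (rule continuous_on_IccI)
        show "((%t. X t j) \<longlongrightarrow> X T j) (at_left T)"
        proof -
          have "eventually (%t. x t j = X t j) (at_left T)"
            by (auto simp: eventually_at_filter X_def)
          then show ?thesis using l[OF True] tendsto_cong True by (force simp: X_def)
        qed
        show "((%t. X t j) \<longlongrightarrow> X 0 j) (at_right 0)"
        proof -
          have "continuous_on {0..T/2} (%t. x t j)" using T0 by (intro x_cont TD) auto
          then have "((%t. x t j) \<longlongrightarrow> x 0 j) (at 0 within {0..T/2})" using T0 by (auto simp: continuous_on)
          moreover have "at 0 within {0..T/2} = at_right (0::real)"
            using T0 by (subst at_within_Icc_at_right) auto
          moreover have "eventually (%t. x t j = X t j) (at_right 0)"
            using T0 unfolding eventually_at_right_field by (intro exI[of _ T]) (auto simp: X_def)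
          ultimately show ?thesis using tendsto_cong T0 by (force simp: X_def)
        qed
        show "((%t. X t j) \<longlongrightarrow> X t j) (at t)" if "0 < t" "t < T" for t
          using DERIV_isCont[OF X_deriv[OF that]] by (simp add: isCont_def)
      qed (rule T0)
    qed (simp add: X_off)
    have X0: "X 0 = a" using X_lt[OF T0] x0 by simp
    show ?thesis
    proof (rule dies[of T X])
      show "\<exists>j\<in>S. X T j = 0"
      proof (rule ccontr)
        \<comment> \<open>Positive limits give a common positive lower bound on
          \<open>{0..T}\<close>, so some truncation level is good up to and including
          \<open>T\<close>. Every good time can be prolonged, which contradicts the choice of
          \<open>T\<close> as a supremum.\<close>
        assume "\<not> (\<exists>j\<in>S. X T j = 0)"
        then have lp: "0 < X T j" if "j \<in> S" for j using l that by (force simp: X_def)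
        have "\<exists>c>0. \<forall>t\<in>{0..T}. c <= X t j" if "j \<in> S" for j
        proof -
          obtain t where t: "t \<in> {0..T}" "\<forall>s\<in>{0..T}. X t j <= X s j"
            using continuous_attains_inf[OF compact_Icc _ X_cont[of j]] T0 by force
          moreover have "0 < X t j" using lp[OF that] X_pos[of t j] that t by (cases "t = T") auto
          ultimately show ?thesis by blast
        qed
        then obtain c where c: "!!j. j \<in> S ==> 0 < c j \<and> (\<forall>t\<in>{0..T}. c j <= X t j)" by metis
        have "0 < Min (c ` S)" using S c by (subst Min_gr_iff) auto
        then obtain n where n: "d n < Min (c ` S)" using dsmall by blast
        have nX: "d n < X t j" if "t \<in> {0..T}" "j \<in> S" for t j
          using n c[OF \<open>j \<in> S\<close>] that S by (force simp: Min_gr_iff)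
        have "P n s j = X s j" if "0 <= s" "s <= T" "j \<in> S" for s j
          by (rule agree[of T X]) (use X_cont X0 X_deriv that nX in \<open>auto intro: less_imp_le\<close>)
        then have "good n T" using nX T0 by (auto simp: good_def)
        then show False using DT by (auto simp: D_def)
      qed
      show "0 <= X T j" for j using l by (auto simp: X_def x_off)
    qed (use T0 X0 X_off X_pos X_cont X_deriv in auto)
  qed
qed

text \<open>The form in which flows are used: death is final, and the equation holds pointwise
  outside one finite set of times common to all sites.\<close>

definition particle_flow :: "real => int set => (real => int => real) => bool" where
  "particle_flow \<beta> S x \<longleftrightarrow> finite S \<and>
     (\<forall>t\<ge>0. \<forall>j. 0 <= x t j) \<and> (\<forall>t\<ge>0. \<forall>j. j \<notin> S --> x t j = 0) \<and>
     (\<forall>j. continuous_on {0..} (%t. x t j)) \<and>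
     (\<forall>j s t. 0 <= s --> s <= t --> x s j = 0 --> x t j = 0) \<and>
     (\<exists>F. finite F \<and> (\<forall>t j. 0 < t --> t \<notin> F -->
        ((%t. x t j) has_real_derivative lap_sigma \<beta> (x t) j) (at t))) \<and>
     (\<forall>j T. 0 <= T --> set_integrable lborel {0..T} (%t. x t j powr (- \<beta>)))"

lemma powr_indicator_measurable:
  fixes f :: "real => real"
  assumes "continuous_on {a..b} f"
  shows "(%t. indicator {a..b} t *\<^sub>R (f t powr p)) \<in> borel_measurable borel"
proof -
  have "(%t. indicator {a..b} t *\<^sub>R f t) \<in> borel_measurable borel"
    by (rule borel_measurable_continuous_on_indicator[OF _ assms]) auto
  then have "(%t. indicator {a..b} t *\<^sub>R ((indicator {a..b} t *\<^sub>R f t) powr p)) \<in> borel_measurable borel"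
    by measurable
  also have "(%t. indicator {a..b} t *\<^sub>R ((indicator {a..b} t *\<^sub>R f t) powr p)) = (%t. indicator {a..b} t *\<^sub>R (f t powr p))"
    by (auto simp: indicator_def)
  finally show ?thesis .
qed

text \<open>By the fundamental theorem every \<open>clap\<close> is gauge integrable, although
  single powers may blow up at \<open>T\<close>. The sum over all sites isolates the two end powers,
  which are nonnegative and therefore Lebesgue integrable. From the left end one walks through the
  chain: each power equals \<open>clap\<close> at its left neighbour plus terms already
  treated.\<close>

lemma chain_integrable:
  fixes X :: "real => int => real"
  assumes S: "finite S" "S \<noteq> {}" and "0 <= T" and cont: "!!j. continuous_on {0..T} (%t. X t j)"
    and D: "!!t j. 0 < t ==> t < T ==> ((%t. X t j) has_real_derivative clap S (%k. X t k powr (- \<beta>)) j) (at t)"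
    and j: "j \<in> S"
  shows "set_integrable lborel {0..T} (%t. X t j powr (- \<beta>))"
proof -
  let ?u = "%k t. X t k powr (- \<beta>)"
  have hk: "(%t. clap S (%k. ?u k t) i) integrable_on {0..T}" for i
  proof -
    have "((%t. clap S (%k. ?u k t) i) has_integral (X T i - X 0 i)) {0..T}"
      using D by (intro fundamental_theorem_of_calculus_interior_strong[of "{}"] cont \<open>0 <= T\<close>)
        (auto simp: has_real_derivative_iff_has_vector_derivative[symmetric])
    then show ?thesis by (rule has_integral_integrable)
  qed
  have meas: "(%t. indicator {0..T} t *\<^sub>R ?u k t) \<in> borel_measurable borel" for k
    by (rule powr_indicator_measurable[OF cont])
  have min: "set_integrable lborel {0..T} (?u (Min S))"
  proof -
    have "(%t. - (\<Sum>i\<in>S. clap S (%k. ?u k t) i)) integrable_on {0..T}"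
      using hk S by (intro integrable_neg integrable_sum) auto
    then have i: "(%t. ?u (Min S) t + ?u (Max S) t) integrable_on {0..T}"
      unfolding sum_clap[OF S] by (simp add: add.commute)
    have "set_integrable lborel {0..T} (%t. ?u (Min S) t + ?u (Max S) t)"
    proof (rule lborel_integrable_of_nonneg[OF i])
      show "(%t. indicator {0..T} t *\<^sub>R (?u (Min S) t + ?u (Max S) t)) \<in> borel_measurable borel"
        using borel_measurable_add[OF meas meas, of "Min S" "Max S"] by (simp add: algebra_simps)
    qed auto
    then show ?thesis
      by (rule set_integrable_bound) (use meas in \<open>auto simp: set_borel_measurable_def\<close>)
  qed
  have "i \<in> S --> set_integrable lborel {0..T} (?u i)" for i
  proof (induction "nat (i - Min S)" arbitrary: i rule: less_induct)
    case less
    show ?case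
    proof (intro impI)
      assume i: "i \<in> S"
      show "set_integrable lborel {0..T} (?u i)"
      proof (cases "i = Min S")
        case True
        then show ?thesis using min by simp
      next
        case False
        obtain k where k: "k \<in> S" "k < i" "sigma_minus i (ind S) = Some k" "sigma_plus k (ind S) = Some i"
          using sigma_minus_Min[OF S(1) i False] by blast
        have mink: "Min S <= k" using S k by auto
        have ik: "?u k integrable_on {0..T}"
          using less[of k] k mink by (intro set_borel_integral_eq_integral(1)) auto
        have ip: "(%t. nbr (%k. ?u k t) (sigma_minus k (ind S))) integrable_on {0..T}"
        proof (cases "sigma_minus k (ind S)")
          case None
          then show ?thesis by (simp add: nbr_def integrable_0)
        next
          case (Some l)
          note sigma_minus_SomeD[OF Some]
          then have "l \<in> S" "l < k" by auto
          moreover have "Min S <= l" using S \<open>l \<in> S\<close> by auto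
          ultimately have "?u l integrable_on {0..T}"
            using less[of l] k by (intro set_borel_integral_eq_integral(1)) auto
          then show ?thesis using Some by (simp add: nbr_def)
        qed
        have "(%t. clap S (%k. ?u k t) k + 2 * ?u k t - nbr (%k. ?u k t) (sigma_minus k (ind S))) integrable_on {0..T}"
          by (intro integrable_add integrable_diff hk ip integrable_on_mult_right ik)
        also have "(%t. clap S (%k. ?u k t) k + 2 * ?u k t - nbr (%k. ?u k t) (sigma_minus k (ind S))) = ?u i"
          using k by (simp add: clap_def nbr_def)
        finally show ?thesis by (intro lborel_integrable_of_nonneg meas) auto
      qed
    qed
  qed
  then show ?thesis using j by blast
qed

lemma set_integrable_shift:
  fixes f :: "real => real"
  assumes "set_integrable lborel {0..b} f"
  shows "set_integrable lborel {T..T + b} (%t. f (t - T))"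
proof -
  have "integrable lborel (%t. indicator {0..b} (- T + 1 * t) *\<^sub>R f (- T + 1 * t))"
    using assms unfolding set_integrable_def by (intro lborel_integrable_real_affine) auto
  also have "(%t. indicator {0..b} (- T + 1 * t) *\<^sub>R f (- T + 1 * t)) = (%t. indicator {T..T + b} t *\<^sub>R f (t - T))"
    by (auto simp: indicator_def fun_eq_iff)
  finally show ?thesis by (simp add: set_integrable_def)
qed

lemma lap_sigma_S:
  assumes "!!k. 0 < x k \<longleftrightarrow> k \<in> S"
  shows "lap_sigma \<beta> x j = clap S (%k. x k powr (- \<beta>)) j"
proof -
  have "{k. 0 < x k} = S" using assms by auto
  then show ?thesis by (simp add: lap_sigma_clap)
qed

text \<open>Induction on the number of particles: the flow up to the first death is continued by the
  flow of the remaining particles.\<close>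

lemma particle_flow_exists:
  assumes \<beta>: "0 < \<beta>" and "finite {j. a j \<noteq> 0}" "!!j. 0 <= a j"
  shows "\<exists>x. particle_flow \<beta> {j. a j \<noteq> 0} x \<and> x 0 = a"
  using assms(2,3)
proof (induction "card {j. a j \<noteq> 0}" arbitrary: a rule: less_induct)
  case less
  define S where "S = {j. a j \<noteq> 0}"
  have fin: "finite S" and a0: "!!j. 0 <= a j" using less.prems by (auto simp: S_def)
  have apos: "0 < a j" if "j \<in> S" for j using a0[of j] that by (auto simp: S_def less_le)
  have aoff: "a j = 0" if "j \<notin> S" for j using that by (simp add: S_def)
  have "\<exists>x. particle_flow \<beta> S x \<and> x 0 = a"
  proof (cases "S = {}")
    case True
    then have "a = (%_. 0)" by (auto simp: S_def)
    have "lap_sigma \<beta> (%_. 0) j = 0" for j by (simp add: lap_sigma_dead)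
    then show ?thesis using True \<open>a = _\<close>
      by (intro exI[of _ "%_ _. 0"]) (auto simp: particle_flow_def set_integrable_def)
  next
    case False
    show ?thesis
    proof (rule particle_phase[OF \<beta> fin False apos aoff])
      fix X assume X0: "X 0 = a" and off: "!!t j. j \<notin> S ==> X t j = (0::real)"
        and pos: "!!t j. 0 <= t ==> j \<in> S ==> 0 < X t j" and cont: "!!j. continuous_on {0..} (%t. X t j)"
        and D: "!!t j. 0 < t ==> ((%t. X t j) has_real_derivative clap S (%k. X t k powr (- \<beta>)) j) (at t)"
      have lap: "lap_sigma \<beta> (X t) j = clap S (%k. X t k powr (- \<beta>)) j" if "0 <= t" for t j
        using pos[OF that] off by (intro lap_sigma_S) (metis less_irrefl)
      have "particle_flow \<beta> S X"
        unfolding particle_flow_def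
      proof (intro conjI allI impI)
        show "\<exists>F. finite F \<and> (\<forall>t j. 0 < t --> t \<notin> F --> ((%t. X t j) has_real_derivative lap_sigma \<beta> (X t) j) (at t))"
          using D lap by (intro exI[of _ "{}"]) auto
        fix j and t :: real
        show "0 <= X t j" if "0 <= t" using pos[of t j] off[of j t] that by (cases "j \<in> S") auto
        show "X t j = 0" if "0 <= s" "s <= t" "X s j = 0" for s
          using pos[of s j] off[of j t] that by (cases "j \<in> S") auto
        show "set_integrable lborel {0..t} (%t. X t j powr - \<beta>)" if "0 <= t"
        proof (cases "j \<in> S")
          case True
          show ?thesis using D
            by (intro chain_integrable[OF fin False that _ _ True]) (auto intro: continuous_on_subset[OF cont])
        qed (simp add: off set_integrable_def)
      qed (use fin off cont in auto)
      then show ?thesis using X0 by blast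
    next
      fix X T assume T: "0 < T" and X0: "X 0 = a" and off: "!!t j. j \<notin> S ==> X t j = (0::real)"
        and pos: "!!t j. 0 <= t ==> t < T ==> j \<in> S ==> 0 < X t j" and cont: "!!j. continuous_on {0..T} (%t. X t j)"
        and XT: "!!j. 0 <= X T j" and dies: "\<exists>j\<in>S. X T j = 0"
        and D: "!!t j. 0 < t ==> t < T ==> ((%t. X t j) has_real_derivative clap S (%k. X t k powr (- \<beta>)) j) (at t)"
      define S' where "S' = {j. X T j \<noteq> 0}"
      have "S' \<subset> S" using off dies by (auto simp: S'_def)
      then have "card S' < card S" "finite S'" using fin psubset_card_mono finite_subset by blast+
      then obtain y where y: "particle_flow \<beta> S' y" and y0: "y 0 = X T"
        using less.hyps[of "X T"] XT by (auto simp: S'_def S_def)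
      obtain F where F: "finite F" and yD: "!!t j. 0 < t ==> t \<notin> F ==> ((%t. y t j) has_real_derivative lap_sigma \<beta> (y t) j) (at t)"
        using y by (auto simp: particle_flow_def)
      define z where "z t = (if t < T then X t else y (t - T))" for t
      have z_le: "z t = X t" if "t <= T" for t using that y0 by (auto simp: z_def)
      have z_ge: "z t = y (t - T)" if "T <= t" for t using that by (auto simp: z_def)
      have lap: "lap_sigma \<beta> (X t) j = clap S (%k. X t k powr (- \<beta>)) j" if "0 <= t" "t < T" for t j
        using pos[OF that] off by (intro lap_sigma_S) (metis less_irrefl)
      have y_nn: "0 <= y t j" if "0 <= t" for t j using y that by (auto simp: particle_flow_def)
      have y_off: "y t j = 0" if "0 <= t" "j \<notin> S'" for t j using y that by (auto simp: particle_flow_def)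
      have y_dead: "y t j = 0" if "0 <= s" "s <= t" "y s j = 0" for s t j
        using y that unfolding particle_flow_def by blast
      have y_cont: "continuous_on {0..} (%t. y t j)" for j using y by (auto simp: particle_flow_def)
      have X_nn: "0 <= X t j" if "0 <= t" "t <= T" for t j
        using pos[of t j] XT off[of j t] that by (cases "j \<in> S"; cases "t = T") auto
      have X_dead: "X t j = 0" if "0 <= s" "s <= t" "t <= T" "X s j = 0" for s t j
        using pos[of s j] off[of j t] that by (cases "j \<in> S"; cases "s = T") auto
      have "particle_flow \<beta> S z"
        unfolding particle_flow_def
      proof (intro conjI)
        show "\<forall>t\<ge>0. \<forall>j. 0 <= z t j" using X_nn y_nn by (auto simp: z_def)
        show "\<forall>t\<ge>0. \<forall>j. j \<notin> S --> z t j = 0" 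
        proof (intro allI impI)
          fix t :: real and j assume "0 <= t" "j \<notin> S"
          then show "z t j = 0" using off[of j t] y_off[of "t - T" j] \<open>S' \<subset> S\<close>
            by (cases "t < T") (auto simp: z_def)
        qed
        show "\<forall>j. continuous_on {0..} (%t. z t j)"
        proof
          fix j
          have "continuous_on ({0..T} \<union> {T..}) (%t. z t j)"
          proof (rule continuous_on_closed_Un)
            show "continuous_on {0..T} (%t. z t j)" using cont[of j] z_le by (simp cong: continuous_on_cong_simp)
            have "continuous_on {T..} (%t. y (t - T) j)"
              by (rule continuous_on_compose2[OF y_cont, of _ "%t. t - T"]) (auto intro!: continuous_intros)
            then show "continuous_on {T..} (%t. z t j)" using z_ge by (simp cong: continuous_on_cong_simp)
          qed auto
          then show "continuous_on {0..} (%t. z t j)" 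
            by (rule continuous_on_subset) (use T in auto)
        qed
        show "\<forall>j s t. 0 <= s --> s <= t --> z s j = 0 --> z t j = 0"
        proof (intro allI impI)
          fix j s t assume s: "0 <= s" "s <= t" "z s j = 0"
          consider "t <= T" | "T <= s" | "s < T" "T < t" by linarith
          then show "z t j = 0"
          proof cases
            case 1
            then show ?thesis using X_dead[of s t j] s by (simp add: z_le)
          next
            case 2
            then show ?thesis using y_dead[of "s - T" "t - T" j] s by (simp add: z_ge)
          next
            case 3
            then have "X T j = 0" using X_dead[of s T j] s by (simp add: z_le)
            then show ?thesis using y_dead[of 0 "t - T" j] 3 by (simp add: z_ge y0)
          qed
        qed
        show "\<exists>F. finite F \<and> (\<forall>t j. 0 < t --> t \<notin> F --> ((%t. z t j) has_real_derivative lap_sigma \<beta> (z t) j) (at t))"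
        proof (intro exI[of _ "insert T ((%t. t + T) ` F)"] conjI allI impI)
          fix t j assume t: "0 < t" "t \<notin> insert T ((%t. t + T) ` F)"
          show "((%t. z t j) has_real_derivative lap_sigma \<beta> (z t) j) (at t)"
          proof (cases "t < T")
            case True
            have "((%t. X t j) has_real_derivative lap_sigma \<beta> (z t) j) (at t)"
              using D[of t j] lap[of t j] t True by (simp add: z_def)
            then show ?thesis
              by (rule has_field_derivative_transform_within_open[of _ _ _ "{..<T}"]) (use True in \<open>auto simp: z_def\<close>)
          next
            case False
            have "((%t. y (t - T) j) has_real_derivative lap_sigma \<beta> (z t) j) (at t)"
            proof -
              have "t - T \<notin> F" using t(2) by (metis diff_add_cancel image_eqI insertCI)
              then have "((%t. y t j) has_real_derivative lap_sigma \<beta> (y (t - T)) j) (at (t - T))"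
                using t False by (intro yD) auto
              from DERIV_shift[THEN iffD1, of "%t. y t j" _ t "- T"] this
              show ?thesis using False by (simp add: z_def)
            qed
            then show ?thesis
              by (rule has_field_derivative_transform_within_open[of _ _ _ "{T<..}"]) (use False t in \<open>auto simp: z_def\<close>)
          qed
        qed (use F in auto)
        show "\<forall>j t. 0 <= t --> set_integrable lborel {0..t} (%t. z t j powr - \<beta>)"
        proof (intro allI impI)
          fix j t assume t: "0 <= (t::real)"
          have i1: "set_integrable lborel {0..T} (%t. X t j powr - \<beta>)"
          proof (cases "j \<in> S")
            case True
            show ?thesis using D T by (intro chain_integrable[OF fin False _ _ _ True] cont) auto
          qed (simp add: off set_integrable_def)
          then have i1: "set_integrable lborel {0..T} (%t. z t j powr - \<beta>)"
            using z_le by (subst set_integrable_cong[OF refl]) auto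
          have "set_integrable lborel {T..T + t} (%s. y (s - T) j powr - \<beta>)"
            using set_integrable_shift[of t "%t. y t j powr - \<beta>" T] y t by (auto simp: particle_flow_def)
          then have i2: "set_integrable lborel {T..T + t} (%s. z s j powr - \<beta>)"
            using z_ge by (subst set_integrable_cong[OF refl]) auto
          have "set_integrable lborel ({0..T} \<union> {T..T + t}) (%s. z s j powr - \<beta>)"
            by (intro set_integrable_Un i1 i2) auto
          then show "set_integrable lborel {0..t} (%t. z t j powr - \<beta>)"
            by (rule set_integrable_subset) (use T in auto)
        qed
      qed (rule fin)
      moreover have "z 0 = a" using T X0 by (simp add: z_def)
      ultimately show ?thesis by blast
    qed auto
  qed
  then show ?case by (simp add: S_def)
qed

text \<open>The right-hand side is bounded below by \<open>- 2 * x t j powr (- \<beta>)\<close>,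
  which is integrable; so \<open>lborel_ftc\<close> yields its integrability together with the
  integral equation.\<close>

lemma is_solutionI:
  assumes nn: "!!t j. 0 <= t ==> ereal t < T ==> 0 <= x t j"
    and linf: "!!t. 0 <= t ==> ereal t < T ==> x t \<in> linf_plus"
    and cont: "!!j. continuous_on {t. 0 <= t \<and> ereal t < T} (%t. x t j)"
    and int: "!!j t. 0 <= t ==> ereal t < T ==> set_integrable lborel {0..t} (%s. x s j powr (- \<beta>))"
    and D: "!!j. \<exists>F. finite F \<and> (\<forall>t. 0 < t --> ereal t < T --> t \<notin> F -->
       ((%t. x t j) has_real_derivative lap_sigma \<beta> (x t) j) (at t))"
  shows "is_solution \<beta> T x"
  unfolding is_solution_def
proof (intro conjI allI impI)
  fix j t assume t: "0 <= t \<and> ereal t < T"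
  have "(%s. x s j powr - \<beta> * of_bool (0 < x s j)) s = x s j powr - \<beta>" if "s \<in> {0..t}" for s
  proof -
    have "ereal s < T" using t that by (metis atLeastAtMost_iff ereal_less_eq(3) order_le_less_trans)
    then show ?thesis using nn[of s j] that by (cases "x s j = 0") (auto simp: less_le)
  qed
  then show "set_integrable lborel {0..t} (%s. x s j powr - \<beta> * of_bool (0 < x s j))"
    using int[of t j] t by (subst set_integrable_cong[OF refl]) auto
next
  fix j t1 t2 assume t: "0 <= t1 \<and> t1 < t2 \<and> ereal t2 < T"
  obtain F where F: "finite F" and D': "!!t. 0 < t ==> ereal t < T ==> t \<notin> F ==>
       ((%t. x t j) has_real_derivative lap_sigma \<beta> (x t) j) (at t)"
    using D[of j] by auto
  have le: "ereal s < T" if "s <= t2" for s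
    using t that by (metis ereal_less_eq(3) order_le_less_trans)
  have h: "set_integrable lborel {t1..t2} (%s. 2 * x s j powr (- \<beta>))"
    using int[of t2 j] t by (intro set_integrable_mult_right) (auto elim!: set_integrable_subset)
  have "continuous_on {t1..t2} (%t. x t j)"
    by (rule continuous_on_subset[OF cont]) (use t le in auto)
  moreover have "((%t. x t j) has_real_derivative lap_sigma \<beta> (x s) j) (at s)" if "s \<in> {t1<..<t2} - F" for s
    using t that le by (intro D') auto
  moreover have "0 <= lap_sigma \<beta> (x s) j + 2 * x s j powr (- \<beta>)" if "s \<in> {t1..t2}" for s
    using lap_sigma_ge[of "x s" j \<beta>] nn[of s] le t that by fastforce
  ultimately show "set_integrable lborel {t1..t2} (%s. lap_sigma \<beta> (x s) j)"
    "x t2 j - x t1 j = (LBINT s:{t1..t2}. lap_sigma \<beta> (x s) j)"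
    using lborel_ftc[OF F _ _ _ h, of "%t. x t j" "%s. lap_sigma \<beta> (x s) j"] t by auto
qed (use linf cont in auto)

lemma finite_support_linf_plus:
  assumes "finite {j. y j \<noteq> 0}" "!!j. 0 <= y j"
  shows "y \<in> linf_plus"
  unfolding linf_plus_def
proof (intro CollectI exI[of _ "\<Sum>j | y j \<noteq> 0. y j"] allI conjI)
  fix j show "y j <= (\<Sum>j | y j \<noteq> 0. y j)"
  proof (cases "y j = 0")
    case True
    then show ?thesis using assms(2) by (simp add: sum_nonneg)
  next
    case False
    then show ?thesis using assms by (intro member_le_sum) auto
  qed
qed (rule assms)

lemma particle_flow_solution:
  assumes "particle_flow \<beta> {j. a j \<noteq> 0} x" "x 0 = a"
  shows "finite_particle_solution \<beta> a x"
proof -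
  have S: "finite {j. a j \<noteq> 0}" and off: "!!t j. 0 <= t ==> a j = 0 ==> x t j = 0"
    and nn: "!!t j. 0 <= t ==> 0 <= x t j"
    using assms(1) by (auto simp: particle_flow_def)
  have "is_solution \<beta> \<infinity> x"
  proof (rule is_solutionI)
    fix t :: real assume t: "0 <= t"
    have "finite {j. x t j \<noteq> 0}" by (rule finite_subset[OF _ S]) (use off t in auto)
    then show "x t \<in> linf_plus" using nn t by (intro finite_support_linf_plus) auto
  next
    fix j show "continuous_on {t. 0 <= t \<and> ereal t < \<infinity>} (%t. x t j)"
      using assms(1) by (simp add: particle_flow_def atLeast_def)
    show "\<exists>F. finite F \<and> (\<forall>t. 0 < t --> ereal t < \<infinity> --> t \<notin> F -->
       ((%t. x t j) has_real_derivative lap_sigma \<beta> (x t) j) (at t))"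
    proof -
      obtain F where "finite F" "!!t j. 0 < t ==> t \<notin> F ==> ((%t. x t j) has_real_derivative lap_sigma \<beta> (x t) j) (at t)"
        using assms(1) by (auto simp: particle_flow_def)
      then show ?thesis by (intro exI[of _ F]) simp
    qed
    show "set_integrable lborel {0..t} (%s. x s j powr (- \<beta>))" if "0 <= t" for t
      using assms(1) that unfolding particle_flow_def by blast
  qed (rule nn)
  then show ?thesis unfolding finite_particle_solution_def
    using S off assms(2) by (intro conjI allI impI) simp_all
qed

text \<open>A flow on a bounded time interval, with no integrability built in. Limits of flows with
  fixed finite support have this form, and uniqueness in this class identifies them.\<close>

definition flow_on :: "real => int set => real => (real => int => real) => bool" where
  "flow_on \<beta> S T x \<longleftrightarrow> finite S \<and>
     (\<forall>t j. 0 <= t --> t <= T --> 0 <= x t j) \<and> (\<forall>t j. 0 <= t --> t <= T --> j \<notin> S --> x t j = 0) \<and>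
     (\<forall>j. continuous_on {0..T} (%t. x t j)) \<and>
     (\<forall>j s t. 0 <= s --> s <= t --> t <= T --> x s j = 0 --> x t j = 0) \<and>
     (\<exists>F. finite F \<and> (\<forall>t j. 0 < t --> t < T --> t \<notin> F -->
        ((%t. x t j) has_real_derivative lap_sigma \<beta> (x t) j) (at t)))"

lemma particle_flow_on:
  assumes "particle_flow \<beta> S x"
  shows "flow_on \<beta> S T x"
proof -
  have c: "continuous_on {0..T} (%t. x t j)" for j
    by (rule continuous_on_subset[of "{0..}"]) (use assms in \<open>auto simp: particle_flow_def\<close>)
  obtain F where "finite F" "!!t j. 0 < t ==> t \<notin> F ==> ((%t. x t j) has_real_derivative lap_sigma \<beta> (x t) j) (at t)"
    using assms by (auto simp: particle_flow_def)
  then have "\<exists>F. finite F \<and> (\<forall>t j. 0 < t --> t < T --> t \<notin> F --> ((%t. x t j) has_real_derivative lap_sigma \<beta> (x t) j) (at t))"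
    by (intro exI[of _ F]) simp
  moreover have "x t j = 0" if "0 <= s" "s <= t" "x s j = 0" for s t j
    using assms that unfolding particle_flow_def by blast
  ultimately show ?thesis unfolding flow_on_def using c assms by (simp add: particle_flow_def)
qed

text \<open>Dead sites stay dead, so just after the last time of agreement both flows live on a common
  set of sites on which they are bounded below, where the equation is Lipschitz.\<close>

lemma flow_on_unique:
  assumes \<beta>: "0 < \<beta>" and x: "flow_on \<beta> S T x" and y: "flow_on \<beta> S T y" and xy: "x 0 = y 0" and "0 <= t" "t <= T"
  shows "x t = y t"
proof (rule ccontr)
  assume neq: "x t \<noteq> y t"
  define E where "E = {t. 0 <= t \<and> t <= T \<and> x t \<noteq> y t}"
  have bdd: "bdd_below E" by (auto simp: E_def intro!: bdd_belowI)
  have ne: "E \<noteq> {}" using neq \<open>0 <= t\<close> \<open>t <= T\<close> by (auto simp: E_def)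
  define t0 where "t0 = Inf E"
  have S: "finite S" using x by (simp add: flow_on_def)
  have t0: "0 <= t0" unfolding t0_def using ne by (rule cInf_greatest) (auto simp: E_def)
  have t0T: "t0 <= T" using ne cInf_lower[OF _ bdd] unfolding t0_def E_def by force
  have cx: "continuous_on {0..T} (%t. x t j)" and cy: "continuous_on {0..T} (%t. y t j)" for j
    using x y by (auto simp: flow_on_def)
  have offx: "x s j = 0" if "0 <= s" "s <= T" "j \<notin> S" for s j
    using x that by (simp add: flow_on_def)
  have before: "x s = y s" if "0 <= s" "s < t0" for s
    using t0T cInf_lower[OF _ bdd, of s] that by (force simp: E_def t0_def)
  have at: "x t0 j = y t0 j" for j
  proof (cases "t0 = 0")
    case False
    have "closed {s \<in> {0..T}. x s j - y s j = 0}"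
      using continuous_closed_preimage[OF continuous_on_diff[OF cx cy], of "{0}" j j] by (auto simp: vimage_def Int_def)
    moreover have "t0 \<in> closure {0..<t0}" using False t0 by simp
    moreover have "{0..<t0} \<subseteq> {s \<in> {0..T}. x s j - y s j = 0}" using before t0T by auto
    ultimately have "t0 \<in> {s \<in> {0..T}. x s j - y s j = 0}" by (meson closure_minimal subsetD)
    then show ?thesis by simp
  qed (use xy in simp)
  have t0T': "t0 < T"
  proof (rule ccontr)
    assume "\<not> t0 < T"
    then have "s = t0" if "s \<in> E" for s using cInf_lower[OF that bdd] that by (auto simp: E_def t0_def)
    then show False using ne at by (force simp: E_def)
  qed
  have "\<exists>h c. 0 < h \<and> 0 < c \<and> t0 + h <= T \<and> (\<forall>s\<in>{t0..t0+h}. \<forall>j. 0 < x t0 j --> c <= x s j \<and> c <= y s j)"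
  proof -
    let ?A = "{j \<in> S. 0 < x t0 j}"
    have "\<exists>e>0. \<forall>s\<in>{t0..<t0+e}. s <= T --> x t0 j / 2 < x s j \<and> x t0 j / 2 < y s j" if "j \<in> ?A" for j
    proof -
      have "((%s. x s j) \<longlongrightarrow> x t0 j) (at t0 within {0..T})" "((%s. y s j) \<longlongrightarrow> x t0 j) (at t0 within {0..T})"
        using cx[of j, unfolded continuous_on, rule_format, of t0] cy[of j, unfolded continuous_on, rule_format, of t0] t0 t0T
        by (simp_all add: at[of j])
      then have "eventually (%s. x t0 j / 2 < x s j \<and> x t0 j / 2 < y s j) (at t0 within {0..T})"
        using \<open>j \<in> ?A\<close> by (intro eventually_conj order_tendstoD(1)) auto
      then obtain e where e: "e > 0" "!!s. 0 <= s ==> s <= T ==> s \<noteq> t0 ==> dist s t0 < e ==> x t0 j / 2 < x s j \<and> x t0 j / 2 < y s j"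
        unfolding eventually_at by auto
      show ?thesis
      proof (intro exI[of _ e] conjI ballI impI)
        fix s assume s: "s \<in> {t0..<t0+e}" "s <= T"
        show "x t0 j / 2 < x s j" "x t0 j / 2 < y s j"
          using e(2)[of s] s t0 at[of j] \<open>j \<in> ?A\<close> by (cases "s = t0"; auto simp: dist_real_def)+
      qed (rule e)
    qed
    then have "\<forall>j\<in>?A. \<exists>e. 0 < e \<and> (\<forall>s\<in>{t0..<t0+e}. s <= T --> x t0 j / 2 < x s j \<and> x t0 j / 2 < y s j)" by blast
    from bchoice[OF this] obtain e where e': "\<forall>j\<in>?A. 0 < e j \<and> (\<forall>s\<in>{t0..<t0+e j}. s <= T --> x t0 j / 2 < x s j \<and> x t0 j / 2 < y s j)"
      by (rule exE)
    note e = bspec[OF e']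
    define h where "h = Min (insert (T - t0) (e ` ?A)) / 2"
    define c where "c = Min (insert 1 ((%j. x t0 j / 2) ` ?A))"
    have fin: "finite ?A" using S by auto
    have "0 < Min (insert (T - t0) (e ` ?A))" using e fin t0T' by (subst Min_gr_iff) auto
    then have h0: "0 < h" by (simp add: h_def)
    have c0: "0 < c" unfolding c_def using fin by (subst Min_gr_iff) auto
    have "Min (insert (T - t0) (e ` ?A)) <= T - t0" using fin by (intro Min_le) auto
    then have hT: "t0 + h <= T" using t0T' by (simp add: h_def)
    have hc: "c <= x s j \<and> c <= y s j" if "s \<in> {t0..t0+h}" "0 < x t0 j" for s j
    proof -
      have jA: "j \<in> ?A" using offx[OF t0 t0T, of j] that(2) by auto
      have "Min (insert (T - t0) (e ` ?A)) <= e j" using fin jA by (intro Min_le) auto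
      then have "2 * h <= e j" by (simp add: h_def)
      then have "s \<in> {t0..<t0 + e j}" using that \<open>0 < h\<close> by auto
      moreover have "c <= x t0 j / 2" unfolding c_def using fin jA by (intro Min_le) auto
      moreover have "s <= T" using that hT by auto
      ultimately show ?thesis using bspec[OF conjunct2[OF e[OF jA]], of s] by linarith
    qed
    show ?thesis by (rule exI[of _ h], rule exI[of _ c]) (use h0 c0 hT hc in auto)
  qed
  then obtain h c where h: "0 < h" "0 < c" and hT: "t0 + h <= T"
    and c: "!!s j. s \<in> {t0..t0+h} ==> 0 < x t0 j ==> c <= x s j \<and> c <= y s j" by metis
  define A where "A = {j. 0 < x t0 j}"
  have nnx: "0 <= x s j" and nny: "0 <= y s j" if "0 <= s" "s <= T" for s j
    using x y that by (auto simp: flow_on_def)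
  have A: "0 < x s j \<longleftrightarrow> j \<in> A" "0 < y s j \<longleftrightarrow> j \<in> A" if "s \<in> {t0..t0+h}" for s j
  proof -
    have "x s j = 0 \<and> y s j = 0" if "j \<notin> A"
    proof -
      have "x t0 j = 0" using nnx[OF t0 t0T, of j] that by (auto simp: A_def)
      then show ?thesis using x y \<open>s \<in> _\<close> t0 at[of j] hT unfolding flow_on_def by (metis atLeastAtMost_iff order_trans)
    qed
    moreover have "0 < x s j \<and> 0 < y s j" if "j \<in> A"
      using c[OF \<open>s \<in> _\<close>, of j] h that by (auto simp: A_def)
    ultimately show "0 < x s j \<longleftrightarrow> j \<in> A" "0 < y s j \<longleftrightarrow> j \<in> A" by (metis less_irrefl)+
  qed
  have AS: "A \<subseteq> S" using offx[OF t0 t0T] unfolding A_def by fastforce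
  have finA: "finite A" using AS S finite_subset by blast
  obtain F where F: "finite F" "!!t j. 0 < t ==> t < T ==> t \<notin> F ==> ((%t. x t j) has_real_derivative lap_sigma \<beta> (x t) j) (at t)"
    using x by (auto simp: flow_on_def)
  obtain F' where F': "finite F'" "!!t j. 0 < t ==> t < T ==> t \<notin> F' ==> ((%t. y t j) has_real_derivative lap_sigma \<beta> (y t) j) (at t)"
    using y by (auto simp: flow_on_def)
  define L where "L = \<beta> * c powr (-(\<beta> + 1))"
  have L0: "0 <= L" using \<beta> by (simp add: L_def)
  have eqA: "x s j = y s j" if "s \<in> {t0..t0+h}" "j \<in> A" for s j
  proof (rule ode_unique[of A "F \<union> F'" "4 * L" t0 "t0 + h" x y])
    fix \<tau> i assume \<tau>: "\<tau> \<in> {t0<..<t0 + h} - (F \<union> F')" and i: "i \<in> A"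
    have \<tau>': "\<tau> \<in> {t0..t0+h}" using \<tau> by auto
    have "\<bar>lap_sigma \<beta> (x \<tau>) i - lap_sigma \<beta> (y \<tau>) i\<bar> <= 4 * (L * (\<Sum>k\<in>A. \<bar>x \<tau> k - y \<tau> k\<bar>))"
      unfolding lap_sigma_S[OF A(1)[OF \<tau>']] lap_sigma_S[OF A(2)[OF \<tau>']] clap_diff
    proof (rule clap_bound)
      fix k assume k: "k \<in> A"
      have "\<bar>x \<tau> k powr - \<beta> - y \<tau> k powr - \<beta>\<bar> <= L * \<bar>x \<tau> k - y \<tau> k\<bar>"
        unfolding L_def using c[OF \<tau>', of k] k h \<beta> by (intro powr_neg_lipschitz) (auto simp: A_def)
      also have "\<dots> <= L * (\<Sum>k\<in>A. \<bar>x \<tau> k - y \<tau> k\<bar>)"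
        using finA k L0 by (intro mult_left_mono member_le_sum) auto
      finally show "\<bar>x \<tau> k powr - \<beta> - y \<tau> k powr - \<beta>\<bar> <= L * (\<Sum>k\<in>A. \<bar>x \<tau> k - y \<tau> k\<bar>)" .
    qed (use L0 in \<open>auto intro!: mult_nonneg_nonneg sum_nonneg\<close>)
    then show "\<exists>D E. ((%t. x t i) has_real_derivative D) (at \<tau>) \<and> ((%t. y t i) has_real_derivative E) (at \<tau>) \<and>
        \<bar>D - E\<bar> <= 4 * L * (\<Sum>k\<in>A. \<bar>x \<tau> k - y \<tau> k\<bar>)"
      using F(2)[of \<tau> i] F'(2)[of \<tau> i] \<tau> t0 hT
      by (intro exI[of _ "lap_sigma \<beta> (x \<tau>) i"] exI[of _ "lap_sigma \<beta> (y \<tau>) i"]) (auto simp: mult.assoc)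
  qed (use finA F(1) F'(1) L0 at that t0 hT in \<open>auto intro!: continuous_on_subset[OF cx] continuous_on_subset[OF cy]\<close>)
  have eq: "x s = y s" if "s \<in> {t0..t0+h}" for s
  proof
    fix j show "x s j = y s j"
      using eqA[OF that] A[OF that, of j] nnx[of s j] nny[of s j] that t0 hT by (cases "j \<in> A") auto
  qed
  have "t0 + h <= s" if "s \<in> E" for s
    using before[of s] eq[of s] that by (force simp: E_def)
  then have "t0 + h <= Inf E" using ne by (intro cInf_greatest) auto
  then show False using h by (simp add: t0_def)
qed

text \<open>A living particle satisfies \<open>x' >= - 2 * x powr (- \<beta>)\<close>, so the
  derivative of \<open>x powr (\<beta> + 1)\<close> is at least \<open>- 2 * (\<beta> + 1)\<close>.
  A particle that is dead at \<open>t\<close> is followed only up to its first zero.\<close>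

lemma particle_flow_lower:
  assumes \<beta>: "0 < \<beta>" and x: "particle_flow \<beta> S x" and st: "0 <= s" "s <= t"
  shows "x s j powr (\<beta> + 1) - 2 * (\<beta> + 1) * (t - s) <= x t j powr (\<beta> + 1)"
proof -
  have nn: "0 <= x t j" if "0 <= t" for t j using x that by (auto simp: particle_flow_def)
  have dead: "x t j = 0" if "0 <= s" "s <= t" "x s j = 0" for s t j
    using x that unfolding particle_flow_def by blast
  have cont: "continuous_on {0..} (%t. x t j)" using x by (auto simp: particle_flow_def)
  obtain F where F: "finite F" and D: "!!t j. 0 < t ==> t \<notin> F ==> ((%t. x t j) has_real_derivative lap_sigma \<beta> (x t) j) (at t)"
    using x by (auto simp: particle_flow_def)
  have alive: "x s j powr (\<beta> + 1) - 2 * (\<beta> + 1) * (u - s) <= x u j powr (\<beta> + 1)"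
    if u: "s <= u" and pos: "!!\<tau>. s <= \<tau> ==> \<tau> < u ==> 0 < x \<tau> j" for u
  proof -
    have "(- 2 * (\<beta> + 1)) * (u - s) <= x u j powr (\<beta> + 1) - x s j powr (\<beta> + 1)"
    proof (rule fe_ge[OF F u])
      show "continuous_on {s..u} (%t. x t j powr (\<beta> + 1))"
        using \<beta> st nn by (intro continuous_on_powr' continuous_on_subset[OF cont] continuous_intros) auto
      fix \<tau> assume \<tau>: "\<tau> \<in> {s<..<u} - F"
      then have xp: "0 < x \<tau> j" using pos by auto
      have "((%t. x t j powr (\<beta> + 1)) has_real_derivative (\<beta> + 1) * x \<tau> j powr (\<beta> + 1 - 1) * lap_sigma \<beta> (x \<tau>) j) (at \<tau>)"
        using \<tau> st xp by (intro powr_has_derivative_pos D) auto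
      moreover have "(\<beta> + 1) * x \<tau> j powr \<beta> * (- 2 * x \<tau> j powr (- \<beta>)) <= (\<beta> + 1) * x \<tau> j powr \<beta> * lap_sigma \<beta> (x \<tau>) j"
        using \<beta> nn \<tau> st by (intro mult_left_mono lap_sigma_ge) auto
      moreover have "x \<tau> j powr \<beta> * x \<tau> j powr (- \<beta>) = 1" using xp by (simp add: powr_minus)
      then have "(\<beta> + 1) * x \<tau> j powr \<beta> * (- 2 * x \<tau> j powr (- \<beta>)) = - 2 * (\<beta> + 1)" by (simp add: mult.assoc mult.left_commute)
      ultimately show "\<exists>D. ((%t. x t j powr (\<beta> + 1)) has_real_derivative D) (at \<tau>) \<and> - 2 * (\<beta> + 1) <= D"
        by (intro exI conjI) auto
    qed
    then show ?thesis by (simp only: mult_minus_left)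
  qed
  show ?thesis
  proof (cases "x t j = 0")
    case False
    have "0 < x \<tau> j" if "s <= \<tau>" "\<tau> < t" for \<tau>
      using dead[of \<tau> t j] nn[of \<tau> j] that st False by (auto simp: less_le)
    then show ?thesis using alive[of t] st by auto
  next
    case True
    let ?Z = "{\<tau> \<in> {s..t}. x \<tau> j = 0}"
    have cl: "closed ?Z"
    proof -
      have "continuous_on {s..t} (%t. x t j)" by (rule continuous_on_subset[OF cont]) (use st in auto)
      from continuous_closed_preimage[OF this, of "{0}"] show ?thesis by (auto simp: vimage_def Int_def)
    qed
    have bd: "bdd_below ?Z" by (auto intro!: bdd_belowI)
    have iz: "Inf ?Z \<in> ?Z" using True st by (intro closed_contains_Inf cl bd) auto
    have "x s j powr (\<beta> + 1) - 2 * (\<beta> + 1) * (Inf ?Z - s) <= x (Inf ?Z) j powr (\<beta> + 1)"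
    proof (rule alive)
      fix \<tau> assume "s <= \<tau>" "\<tau> < Inf ?Z"
      then show "0 < x \<tau> j" using cInf_lower[OF _ bd, of \<tau>] iz nn[of \<tau> j] st by (force simp: less_le)
    qed (use iz in auto)
    also have "\<dots> = 0" using iz by auto
    finally have "x s j powr (\<beta> + 1) <= 2 * (\<beta> + 1) * (Inf ?Z - s)" by simp
    also have "\<dots> <= 2 * (\<beta> + 1) * (t - s)" using iz \<beta> by (intro mult_left_mono) auto
    finally show ?thesis by (smt (verit) powr_ge_zero)
  qed
qed

lemma powr_cancel: "0 < x ==> x powr p * x powr (- p) = 1" for x p :: real
  by (simp add: powr_minus)

section \<open>Two small particles between large ones\<close>

text \<open>\<open>v0\<close> and \<open>v3\<close> are the powers of the outer neighbours of the
  pair, of which only the bound \<open>V\<close> is known. After one death the survivor has both of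
  them as neighbours.\<close>

locale pair_system =
  fixes \<beta> V T :: real and F :: "real set" and x1 x2 v0 v3 :: "real => real"
  assumes \<beta>: "0 < \<beta>" and V: "0 < V" and fin: "finite F"
    and nn: "!!t. 0 <= t ==> t <= T ==> 0 <= x1 t" "!!t. 0 <= t ==> t <= T ==> 0 <= x2 t"
    and cont: "continuous_on {0..T} x1" "continuous_on {0..T} x2"
    and dead: "!!s t. 0 <= s ==> s <= t ==> t <= T ==> x1 s = 0 ==> x1 t = 0"
      "!!s t. 0 <= s ==> s <= t ==> t <= T ==> x2 s = 0 ==> x2 t = 0"
    and bd: "!!t. 0 < t ==> t < T ==> 0 <= v0 t \<and> v0 t <= V" "!!t. 0 < t ==> t < T ==> 0 <= v3 t \<and> v3 t <= V"
    and D1: "!!t. t \<in> {0<..<T} - F ==> (x1 has_real_derivative (if 0 < x1 t then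
       v0 t - 2 * x1 t powr (- \<beta>) + (if 0 < x2 t then x2 t powr (- \<beta>) else v3 t) else 0)) (at t)"
    and D2: "!!t. t \<in> {0<..<T} - F ==> (x2 has_real_derivative (if 0 < x2 t then
       (if 0 < x1 t then x1 t powr (- \<beta>) else v0 t) - 2 * x2 t powr (- \<beta>) + v3 t else 0)) (at t)"
begin

lemma swap: "pair_system \<beta> V T F x2 x1 v3 v0"
proof
  fix t assume t: "t \<in> {0<..<T} - F"
  show "(x2 has_real_derivative (if 0 < x2 t then
       v3 t - 2 * x2 t powr (- \<beta>) + (if 0 < x1 t then x1 t powr (- \<beta>) else v0 t) else 0)) (at t)"
    by (rule DERIV_cong[OF D2[OF t]]) simp
  show "(x1 has_real_derivative (if 0 < x1 t then
       (if 0 < x2 t then x2 t powr (- \<beta>) else v3 t) - 2 * x1 t powr (- \<beta>) + v0 t else 0)) (at t)"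
    by (rule DERIV_cong[OF D1[OF t]]) simp
qed ((rule \<beta> V fin cont nn bd; assumption?) | (rule dead(1) dead(2); assumption))+

lemma cont_sub: "0 <= a ==> b <= T ==> continuous_on {a..b} x1" "0 <= a ==> b <= T ==> continuous_on {a..b} x2"
  by (rule continuous_on_subset[OF cont(1)], auto) (rule continuous_on_subset[OF cont(2)], auto)

lemma death_time:
  assumes "0 <= a" "a <= b" "b <= T" "x1 b = 0" "0 < x1 a"
  obtains d where "a < d" "d <= b" "x1 d = 0" "!!t. a <= t ==> t < d ==> 0 < x1 t"
proof -
  let ?Z = "{t \<in> {a..b}. x1 t = 0}"
  have "closed ?Z"
    using continuous_closed_preimage[OF cont_sub(1)[OF assms(1,3)], of "{0}"] by (auto simp: vimage_def Int_def)
  moreover have bd: "bdd_below ?Z" by (auto intro!: bdd_belowI)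
  ultimately have iz: "Inf ?Z \<in> ?Z" using assms by (intro closed_contains_Inf) auto
  show ?thesis
  proof (rule that[of "Inf ?Z"])
    show "a < Inf ?Z" using iz assms by (cases "Inf ?Z = a") auto
    fix t assume t: "a <= t" "t < Inf ?Z"
    then have "x1 t \<noteq> 0" using cInf_lower[OF _ bd, of t] iz by force
    then show "0 < x1 t" using nn(1)[of t] t iz assms by (auto simp: less_le)
  qed (use iz in auto)
qed

text \<open>With both particles alive each contributes one power to the loss, a single survivor
  contributes two; each of these powers is at least
  \<open>(x1 + x2) powr (- \<beta>)\<close>.\<close>

lemma sum_deriv:
  assumes t: "t \<in> {0<..<T} - F" and s: "0 < x1 t + x2 t"
  shows "\<exists>D. ((%t. x1 t + x2 t) has_real_derivative D) (at t) \<and> D <= 2 * V - 2 * (x1 t + x2 t) powr (- \<beta>)"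
proof -
  have n: "0 <= x1 t" "0 <= x2 t" "v0 t <= V" "v3 t <= V" using nn[of t] bd[of t] t by auto
  have a: "0 < x1 t ==> (x1 t + x2 t) powr (- \<beta>) <= x1 t powr (- \<beta>)"
    "0 < x2 t ==> (x1 t + x2 t) powr (- \<beta>) <= x2 t powr (- \<beta>)"
    using n \<beta> by (auto intro!: powr_mono2')
  show ?thesis
    by (rule exI, rule conjI, rule DERIV_add[OF D1[OF t] D2[OF t]]) (use n a s in auto)
qed

text \<open>Below the size \<open>\<eta>\<close> the loss outweighs the influx \<open>2 * V\<close>,
  so the sum decreases and cannot climb back to \<open>\<eta>\<close>.\<close>

lemma sum_antimono:
  assumes "0 <= a" "a <= t" "t <= T" and sm: "x1 a + x2 a < \<eta>" "2 * V <= \<eta> powr (- \<beta>)"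
  shows "x1 t + x2 t <= x1 a + x2 a"
proof -
  have \<eta>: "0 < \<eta>" using nn[of a] assms by auto
  have mono: "x1 t + x2 t <= x1 a + x2 a"
    if "a <= t" "t <= T" and le: "!!s. a <= s ==> s < t ==> x1 s + x2 s < \<eta>" for t
  proof -
    have "(x1 t + x2 t) - (x1 a + x2 a) <= 0 * (t - a)"
    proof (rule fe_le[OF fin \<open>a <= t\<close>])
      show "continuous_on {a..t} (%t. x1 t + x2 t)" using that assms by (intro continuous_intros cont_sub) auto
      fix s assume s: "s \<in> {a<..<t} - F"
      then have s': "s \<in> {0<..<T} - F" using assms that by auto
      show "\<exists>D. ((%t. x1 t + x2 t) has_real_derivative D) (at s) \<and> D <= 0"
      proof (cases "0 < x1 s + x2 s")
        case True
        have "\<eta> powr (- \<beta>) <= (x1 s + x2 s) powr (- \<beta>)"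
          using le[of s] s True \<beta> by (intro powr_mono2') auto
        then show ?thesis using sum_deriv[OF s' True] sm(2) V by force
      next
        case False
        then have "\<not> 0 < x1 s" "\<not> 0 < x2 s" using nn[of s] s' by auto
        then show ?thesis using DERIV_add[OF D1[OF s'] D2[OF s']] by (intro exI[of _ 0]) simp
      qed
    qed
    then show ?thesis by simp
  qed
  have "0 < \<eta> - (x1 t + x2 t)" if "a <= t" "t <= T" for t
  proof (rule continuation[of "{()}" a T "%_ t. \<eta> - (x1 t + x2 t)" "()"])
    show "continuous_on {a..T} (%t. \<eta> - (x1 t + x2 t))" using assms by (intro continuous_intros cont_sub) auto
    fix t assume "a < t" "t <= T" and IH: "!!s k. a <= s ==> s < t ==> k \<in> {()} ==> 0 < \<eta> - (x1 s + x2 s)"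
    then have "x1 t + x2 t <= x1 a + x2 a" by (intro mono) auto
    then show "0 < \<eta> - (x1 t + x2 t)" using sm by simp
  qed (use that sm in auto)
  then show ?thesis using mono[OF assms(2,3)] assms by force
qed

text \<open>The influx uses up at most half of the loss, so
  \<open>(x1 + x2) powr (\<beta> + 1)\<close> decreases at least with speed
  \<open>\<beta> + 1\<close>.\<close>

lemma sum_dies:
  assumes a: "0 <= a" and sm: "x1 a + x2 a < \<eta>" "2 * V <= \<eta> powr (- \<beta>)"
    and t: "a + (x1 a + x2 a) powr (\<beta> + 1) / (\<beta> + 1) <= t" "t <= T"
  shows "x1 t = 0" "x2 t = 0"
proof -
  have at: "a <= t" using t(1) \<beta> by (smt (verit) divide_nonneg_nonneg powr_ge_zero)
  have "\<not> 0 < x1 t + x2 t"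
  proof
    assume pos: "0 < x1 t + x2 t"
    have pos': "0 < x1 s + x2 s" if "a <= s" "s <= t" for s
      using dead(1)[of s t] dead(2)[of s t] nn[of s] that a t(2) pos by (smt (verit))
    have "(x1 t + x2 t) powr (\<beta> + 1) - (x1 a + x2 a) powr (\<beta> + 1) <= (- (\<beta> + 1)) * (t - a)"
    proof (rule fe_le[OF fin at])
      show "continuous_on {a..t} (%t. (x1 t + x2 t) powr (\<beta> + 1))"
        using a t pos' by (intro continuous_intros cont_sub) (auto simp: less_le)
      fix s assume s: "s \<in> {a<..<t} - F"
      then have s': "s \<in> {0<..<T} - F" using a t by auto
      have p: "0 < x1 s + x2 s" using pos' s by auto
      obtain D where D: "((%t. x1 t + x2 t) has_real_derivative D) (at s)" "D <= 2 * V - 2 * (x1 s + x2 s) powr (- \<beta>)"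
        using sum_deriv[OF s' p] by blast
      have "x1 s + x2 s <= \<eta>" using sum_antimono[OF a _ _ sm, of s] s t sm by auto
      then have "\<eta> powr (- \<beta>) <= (x1 s + x2 s) powr (- \<beta>)" using p \<beta> by (intro powr_mono2') auto
      then have "D <= - ((x1 s + x2 s) powr (- \<beta>))" using D sm by simp
      then have "(\<beta> + 1) * (x1 s + x2 s) powr \<beta> * D <= (\<beta> + 1) * (x1 s + x2 s) powr \<beta> * (- ((x1 s + x2 s) powr (- \<beta>)))"
        using \<beta> by (intro mult_left_mono) auto
      also have "\<dots> = - (\<beta> + 1)" using powr_cancel[OF p, of \<beta>] by (simp add: mult.assoc)
      finally show "\<exists>D. ((%t. (x1 t + x2 t) powr (\<beta> + 1)) has_real_derivative D) (at s) \<and> D <= - (\<beta> + 1)"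
        using powr_has_derivative_pos[OF D(1) p, of "\<beta> + 1"] by (intro exI conjI) auto
    qed
    also have "\<dots> <= - ((x1 a + x2 a) powr (\<beta> + 1))"
    proof -
      have "(x1 a + x2 a) powr (\<beta> + 1) / (\<beta> + 1) <= t - a" using t(1) by simp
      then have "(x1 a + x2 a) powr (\<beta> + 1) <= (t - a) * (\<beta> + 1)" using \<beta> by (simp add: pos_divide_le_eq)
      then show ?thesis by (simp add: algebra_simps)
    qed
    finally have "(x1 t + x2 t) powr (\<beta> + 1) <= 0" by simp
    moreover have "0 < (x1 t + x2 t) powr (\<beta> + 1)" using pos by simp
    ultimately show False by linarith
  qed
  then show "x1 t = 0" "x2 t = 0" using nn[of t] a at t by auto
qed

text \<open>Instability of the tie: the smaller particle \<open>x1\<close> shrinks faster, and by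
  \<open>sm\<close> the influx from outside cannot compensate the difference of the two powers.
  Hence the gap does not shrink while \<open>x1\<close> lives, and \<open>x2\<close> outlives
  it.\<close>

lemma gap_grows:
  assumes \<kappa>: "0 < \<kappa>" and a: "0 <= a" "a <= t" "t <= T" and x1a: "0 < x1 a" and gap: "(1 + \<kappa>) * x1 a <= x2 a"
    and sm: "V <= (1 - (1 + \<kappa> / 2) powr (- \<beta>)) * (2 * x1 a) powr (- \<beta>)"
    and alive: "!!s. a <= s ==> s < t ==> 0 < x1 s"
  shows "x2 a - x1 a <= x2 t - x1 t" "x1 t <= x1 a" "(1 + \<kappa> / 2) * x1 t < x2 t"
    "s \<in> {a<..<t} - F ==> \<exists>D. (x1 has_real_derivative D) (at s) \<and> D <= V - x1 s powr (- \<beta>)"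
proof -
  define c where "c = 1 - (1 + \<kappa> / 2) powr (- \<beta>)"
  have c1: "c <= 1" by (simp add: c_def)
  \<comment> \<open>The bootstrap hypothesis is weaker than what it yields: a gap of at least
    \<open>\<kappa> * x1 a\<close> together with \<open>x1 <= x1 a\<close> gives back the ratio
    \<open>1 + \<kappa> / 2\<close> strictly.\<close>
  define P where "P s \<longleftrightarrow> (1 + \<kappa> / 2) * x1 s < x2 s \<and> x1 s < 2 * x1 a" for s
  have der: "\<exists>D1 D2. (x1 has_real_derivative D1) (at s) \<and> (x2 has_real_derivative D2) (at s) \<and>
     D1 <= 0 \<and> D1 <= V - x1 s powr (- \<beta>) \<and> D1 <= D2"
    if s: "s \<in> {a<..<t} - F" and Ps: "P s" for s
  proof -
    have s': "s \<in> {0<..<T} - F" using s a by auto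
    have p1: "0 < x1 s" using alive s by auto
    have "0 < (1 + \<kappa> / 2) * x1 s" using p1 \<kappa> by simp
    then have p2: "0 < x2 s" using Ps unfolding P_def by linarith
    have v: "0 <= v0 s" "v0 s <= V" "0 <= v3 s" using bd[of s] s' by auto
    have "x2 s powr (- \<beta>) <= (1 + \<kappa> / 2) powr (- \<beta>) * x1 s powr (- \<beta>)"
    proof -
      have "x2 s powr (- \<beta>) <= ((1 + \<kappa> / 2) * x1 s) powr (- \<beta>)"
        using Ps p1 \<kappa> \<beta> by (intro powr_mono2') (auto simp: P_def)
      then show ?thesis using p1 \<kappa> by (simp add: powr_mult)
    qed
    then have d: "c * x1 s powr (- \<beta>) <= x1 s powr (- \<beta>) - x2 s powr (- \<beta>)" by (simp add: c_def algebra_simps)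
    have "(2 * x1 a) powr (- \<beta>) <= x1 s powr (- \<beta>)" using Ps p1 \<beta> by (intro powr_mono2') (auto simp: P_def)
    moreover have c0: "0 <= c"
    proof (rule ccontr)
      assume "\<not> 0 <= c"
      then have "c * (2 * x1 a) powr (- \<beta>) <= 0" by (intro mult_nonpos_nonneg) auto
      then show False using sm V by (simp add: c_def)
    qed
    ultimately have "c * (2 * x1 a) powr (- \<beta>) <= c * x1 s powr (- \<beta>)" by (rule mult_left_mono)
    then have Vc: "V <= c * x1 s powr (- \<beta>)" using sm by (simp add: c_def)
    also have "\<dots> <= 1 * x1 s powr (- \<beta>)" using c1 by (intro mult_right_mono) auto
    finally have Vu: "V <= x1 s powr (- \<beta>)" by simp
    have u21: "x2 s powr (- \<beta>) <= x1 s powr (- \<beta>)" using d c0 by (smt (verit) mult_nonneg_nonneg powr_ge_zero)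
    show ?thesis
    proof (intro exI conjI)
      show "(x1 has_real_derivative v0 s - 2 * x1 s powr (- \<beta>) + x2 s powr (- \<beta>)) (at s)"
        using D1[OF s'] p1 p2 by simp
      show "(x2 has_real_derivative x1 s powr (- \<beta>) - 2 * x2 s powr (- \<beta>) + v3 s) (at s)"
        using D2[OF s'] p1 p2 by simp
    qed (use v u21 Vu Vc d in auto)
  qed
  have step: "x2 a - x1 a <= x2 u - x1 u \<and> x1 u <= x1 a" if "a <= u" "u <= t" and PP: "!!s. a <= s ==> s < u ==> P s" for u
  proof -
    have "0 * (u - a) <= (x2 u - x1 u) - (x2 a - x1 a)"
    proof (rule fe_ge[OF fin \<open>a <= u\<close>])
      show "continuous_on {a..u} (%t. x2 t - x1 t)" using that a by (intro continuous_intros cont_sub) auto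
      fix s assume s: "s \<in> {a<..<u} - F"
      have "s \<in> {a<..<t} - F" "P s" using s \<open>u <= t\<close> PP[of s] by auto
      from der[OF this] obtain D1 D2 where "(x1 has_real_derivative D1) (at s)" "(x2 has_real_derivative D2) (at s)" "D1 <= D2"
        by blast
      then show "\<exists>D. ((%t. x2 t - x1 t) has_real_derivative D) (at s) \<and> 0 <= D"
        by (intro exI[of _ "D2 - D1"] conjI DERIV_diff) auto
    qed
    moreover have "x1 u - x1 a <= 0 * (u - a)"
    proof (rule fe_le[OF fin \<open>a <= u\<close>])
      show "continuous_on {a..u} x1" using that a by (intro cont_sub) auto
      fix s assume s: "s \<in> {a<..<u} - F"
      have "s \<in> {a<..<t} - F" "P s" using s \<open>u <= t\<close> PP[of s] by auto
      from der[OF this] show "\<exists>D. (x1 has_real_derivative D) (at s) \<and> D <= 0" by blast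
    qed
    ultimately show ?thesis by simp
  qed
  have Pclose: "P u" if "x2 a - x1 a <= x2 u - x1 u" "x1 u <= x1 a" "0 <= x1 u" for u
  proof -
    have "\<kappa> / 2 * x1 u < \<kappa> * x1 a"
    proof -
      have "\<kappa> / 2 * x1 u <= \<kappa> / 2 * x1 a" using \<kappa> that by (intro mult_left_mono) auto
      also have "\<dots> < \<kappa> * x1 a" using \<kappa> x1a by simp
      finally show ?thesis .
    qed
    then have "(1 + \<kappa> / 2) * x1 u < x2 u" using gap that by (simp add: algebra_simps)
    then show ?thesis using that x1a by (simp add: P_def)
  qed
  have P: "P u" if "a <= u" "u <= t" for u
  proof -
    have "0 < (if i then x2 u - (1 + \<kappa> / 2) * x1 u else 2 * x1 a - x1 u)" for i :: bool
    proof (rule continuation[of UNIV a t "%i u. if i then x2 u - (1 + \<kappa> / 2) * x1 u else 2 * x1 a - x1 u"])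
      fix i :: bool
      show "continuous_on {a..t} (%u. if i then x2 u - (1 + \<kappa> / 2) * x1 u else 2 * x1 a - x1 u)"
        using a by (cases i) (auto intro!: continuous_intros cont_sub)
      show "0 < (if i then x2 a - (1 + \<kappa> / 2) * x1 a else 2 * x1 a - x1 a)"
        using Pclose[of a] x1a by (auto simp: P_def)
      fix v assume v: "a < v" "v <= t" and IH: "!!s k. a <= s ==> s < v ==> k \<in> UNIV ==>
          0 < (if k then x2 s - (1 + \<kappa> / 2) * x1 s else 2 * x1 a - x1 s)"
      have "P s" if "a <= s" "s < v" for s using IH[OF that, of True] IH[OF that, of False] by (simp add: P_def)
      then have "P v" using step[of v] v nn(1)[of v] a by (intro Pclose) auto
      then show "0 < (if i then x2 v - (1 + \<kappa> / 2) * x1 v else 2 * x1 a - x1 v)" by (auto simp: P_def)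
    qed (use that in auto)
    from this[of True] this[of False] show ?thesis by (simp add: P_def)
  qed
  show "x2 a - x1 a <= x2 t - x1 t" "x1 t <= x1 a" using step[of t] P a by auto
  show "(1 + \<kappa> / 2) * x1 t < x2 t" using P[of t] a by (simp add: P_def)
  show "\<exists>D. (x1 has_real_derivative D) (at s) \<and> D <= V - x1 s powr (- \<beta>)" if "s \<in> {a<..<t} - F"
  proof -
    have "P s" using that by (intro P) auto
    from der[OF that this] show ?thesis by blast
  qed
qed

text \<open>A small particle dies soon whatever its partner does. Either the partner is of
  comparable size, and both die by \<open>sum_dies\<close>, or it is more than twice as large, and
  \<open>gap_grows\<close> keeps the small one shrinking. This is what makes extinction stable under
  limits.\<close>

lemma small_dies:
  assumes a: "0 <= a" and x1a: "x1 a <= \<eta>" and sm: "2 * V <= (4 * \<eta>) powr (- \<beta>)" and \<eta>: "0 < \<eta>"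
    and sm2: "V <= (1 - (1 + 1 / 2) powr (- \<beta>)) * (2 * \<eta>) powr (- \<beta>)"
    and t: "a + (3 * \<eta>) powr (\<beta> + 1) / (\<beta> + 1) <= t" "t <= T"
  shows "x1 t = 0"
proof (rule ccontr)
  assume nz: "x1 t \<noteq> 0"
  have at: "a <= t" using t(1) \<beta> by (smt (verit) divide_nonneg_nonneg powr_ge_zero)
  have alive: "0 < x1 s" if "a <= s" "s <= t" for s
    using dead(1)[of s t] nn(1)[of s] that a t nz by (auto simp: less_le)
  have x1a0: "0 < x1 a" using alive at by auto
  show False
  proof (cases "x2 a <= 2 * x1 a")
    case True
    have "x1 a + x2 a <= 3 * \<eta>" using True x1a by simp
    then have "(x1 a + x2 a) powr (\<beta> + 1) <= (3 * \<eta>) powr (\<beta> + 1)"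
      using \<beta> nn[of a] a at t by (intro powr_mono2) auto
    then have "(x1 a + x2 a) powr (\<beta> + 1) / (\<beta> + 1) <= (3 * \<eta>) powr (\<beta> + 1) / (\<beta> + 1)"
      using \<beta> by (intro divide_right_mono) auto
    then have "x1 t = 0"
      using sum_dies(1)[OF a _ sm, of t] \<open>x1 a + x2 a <= 3 * \<eta>\<close> \<eta> t by auto
    then show False using nz by simp
  next
    case False
    have mono: "(2 * \<eta>) powr (- \<beta>) <= (2 * x1 a) powr (- \<beta>)" using x1a x1a0 \<beta> by (intro powr_mono2') auto
    have "0 <= 1 - (1 + 1 / 2) powr (- \<beta>)" using \<beta> powr_mono[of "- \<beta>" 0 "1 + 1 / 2"] by simp
    then have sm': "V <= (1 - (1 + 1 / 2) powr (- \<beta>)) * (2 * x1 a) powr (- \<beta>)"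
      using sm2 mult_left_mono[OF mono] by fastforce
    have "x1 t powr (\<beta> + 1) - x1 a powr (\<beta> + 1) <= (- (\<beta> + 1) / 2) * (t - a)"
    proof (rule fe_le[OF fin at])
      show "continuous_on {a..t} (%t. x1 t powr (\<beta> + 1))"
        using a t alive by (intro continuous_intros cont_sub) (auto simp: less_le)
      fix s assume s: "s \<in> {a<..<t} - F"
      have al: "0 < x1 \<tau>" if "a <= \<tau>" "\<tau> < s'" "s' <= t" for \<tau> s' using alive[of \<tau>] that by auto
      obtain D where D: "(x1 has_real_derivative D) (at s)" "D <= V - x1 s powr (- \<beta>)"
        using gap_grows(4)[of 1 a t s] a at t x1a0 False sm' al[of _ t] s by auto
      have "x1 s <= x1 a" using gap_grows(2)[of 1 a s] a s t x1a0 False sm' al[of _ s] by auto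
      then have "(4 * \<eta>) powr (- \<beta>) <= x1 s powr (- \<beta>)" using alive[of s] s x1a \<beta> by (intro powr_mono2') auto
      then have "D <= - (x1 s powr (- \<beta>) / 2)" using D(2) sm by simp
      then have "(\<beta> + 1) * x1 s powr \<beta> * D <= (\<beta> + 1) * x1 s powr \<beta> * (- (x1 s powr (- \<beta>) / 2))"
        using \<beta> by (intro mult_left_mono) auto
      also have "\<dots> = (- (\<beta> + 1) / 2) * (x1 s powr \<beta> * x1 s powr (- \<beta>))" by (simp add: algebra_simps)
      also have "\<dots> = - (\<beta> + 1) / 2" using powr_cancel[of "x1 s" \<beta>] alive[of s] s by simp
      finally show "\<exists>D. ((%t. x1 t powr (\<beta> + 1)) has_real_derivative D) (at s) \<and> D <= - (\<beta> + 1) / 2"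
        using powr_has_derivative_pos[OF D(1), of "\<beta> + 1"] alive[of s] s by (intro exI conjI) auto
    qed
    moreover have "(\<beta> + 1) / 2 * (t - a) \<ge> \<eta> powr (\<beta> + 1)"
    proof -
      have "3 * \<eta> powr (\<beta> + 1) <= 3 powr (\<beta> + 1) * \<eta> powr (\<beta> + 1)"
        using \<beta> powr_mono[of 1 "\<beta> + 1" 3] by (intro mult_right_mono) auto
      also have "\<dots> = (3 * \<eta>) powr (\<beta> + 1)" using \<eta> by (simp add: powr_mult)
      also have "\<dots> <= (t - a) * (\<beta> + 1)"
        using t(1) \<beta> by (subst pos_divide_le_eq[symmetric]) auto
      finally have "3 * \<eta> powr (\<beta> + 1) <= (t - a) * (\<beta> + 1)" .
      moreover have "(\<beta> + 1) / 2 * (t - a) = ((t - a) * (\<beta> + 1)) / 2" by simp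
      ultimately show ?thesis using powr_ge_zero[of \<eta> "\<beta> + 1"] by linarith
    qed
    moreover have "x1 a powr (\<beta> + 1) <= \<eta> powr (\<beta> + 1)" using x1a x1a0 \<beta> by (intro powr_mono2) auto
    moreover have "(- (\<beta> + 1) / 2) * (t - a) = - ((\<beta> + 1) / 2 * (t - a))"
      unfolding minus_divide_left[symmetric] mult_minus_left ..
    ultimately have "x1 t powr (\<beta> + 1) <= 0" by linarith
    moreover have "0 < x1 t powr (\<beta> + 1)" using alive[of t] at by simp
    ultimately show False by linarith
  qed
qed

text \<open>If the partner were larger by the factor \<open>1 + \<kappa>\<close>, the gap would
  persist until \<open>x1\<close> dies, and the tie would fail.\<close>

lemma tie_ratio:
  assumes tie: "!!t. 0 <= t ==> t <= T ==> x1 t = 0 \<longleftrightarrow> x2 t = 0" and end_dead: "x1 T = 0"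
    and \<kappa>: "0 < \<kappa>" and t: "0 <= t" "t <= T" "0 < x1 t" and m: "x1 t <= m"
    and sm: "V <= (1 - (1 + \<kappa> / 2) powr (- \<beta>)) * (2 * m) powr (- \<beta>)"
  shows "x2 t < (1 + \<kappa>) * x1 t"
proof (rule ccontr)
  assume "\<not> x2 t < (1 + \<kappa>) * x1 t"
  then have gap: "(1 + \<kappa>) * x1 t <= x2 t" by simp
  obtain d where d: "t < d" "d <= T" "x1 d = 0" "!!s. t <= s ==> s < d ==> 0 < x1 s"
    using death_time[of t T] t end_dead by auto
  have "(2 * m) powr (- \<beta>) <= (2 * x1 t) powr (- \<beta>)" using m t \<beta> by (intro powr_mono2') auto
  moreover have "0 <= 1 - (1 + \<kappa> / 2) powr (- \<beta>)"
    using \<beta> \<kappa> powr_mono[of "- \<beta>" 0 "1 + \<kappa> / 2"] by simp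
  ultimately have sm': "V <= (1 - (1 + \<kappa> / 2) powr (- \<beta>)) * (2 * x1 t) powr (- \<beta>)"
    using sm by (meson mult_left_mono order_trans)
  have "x2 t - x1 t <= x2 d - x1 d"
    by (rule gap_grows(1)[OF \<kappa> t(1) less_imp_le[OF d(1)] d(2) t(3) gap sm' d(4)])
  moreover have "x1 t * \<kappa> > 0" using t \<kappa> by simp
  ultimately have "0 < x2 d" using gap d(3) by (simp add: algebra_simps)
  moreover have "x2 d = 0" using tie[of d] d t by auto
  ultimately show False by simp
qed

text \<open>For nearly equal sizes \<open>x1 powr \<beta> * x2 powr (- \<beta>)\<close> is close to
  1, so the derivative of \<open>x1 powr (\<beta> + 1)\<close> is close to
  \<open>- (\<beta> + 1)\<close>: the size follows an exact tie without influx. The ratio is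
  controlled by \<open>tie_ratio\<close> up to the common death.\<close>

lemma tie_profile:
  assumes tie: "!!t. 0 <= t ==> t <= T ==> x1 t = 0 \<longleftrightarrow> x2 t = 0" and end_dead: "x1 T = 0" and start: "0 < x1 0" and T: "0 <= T"
    and \<kappa>: "0 < \<kappa>" and m: "!!t. 0 <= t ==> t <= T ==> x1 t <= m \<and> x2 t <= m"
    and sm: "V <= (1 - (1 + \<kappa> / 2) powr (- \<beta>)) * (2 * m) powr (- \<beta>)"
    and \<delta>: "(1 + \<kappa>) powr \<beta> - 1 + V * m powr \<beta> <= \<delta>"
  obtains d where "0 < d" "d <= T" "x1 d = 0" "!!t. 0 <= t ==> t < d ==> 0 < x1 t \<and> 0 < x2 t"
    "!!t. 0 <= t ==> t <= d ==> \<bar>x1 t powr (\<beta> + 1) - (\<beta> + 1) * (d - t)\<bar> <= \<delta> * ((\<beta> + 1) * (d - t))"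
proof -
  interpret sw: pair_system \<beta> V T F x2 x1 v3 v0 by (rule swap)
  obtain d where d: "0 < d" "d <= T" "x1 d = 0" "!!t. 0 <= t ==> t < d ==> 0 < x1 t"
    using death_time[of 0 T] end_dead start T by auto
  have d2: "0 < x2 t" if "0 <= t" "t < d" for t
    using tie[of t] d(4)[OF that] nn(2)[of t] that d by (auto simp: less_le)
  have ratio: "x2 t < (1 + \<kappa>) * x1 t" "x1 t < (1 + \<kappa>) * x2 t" if "0 <= t" "t < d" for t
  proof -
    show "x2 t < (1 + \<kappa>) * x1 t"
      using tie end_dead \<kappa> _ _ d(4)[OF that] _ sm by (rule tie_ratio) (use that d m in auto)
    show "x1 t < (1 + \<kappa>) * x2 t"
      using _ _ \<kappa> _ _ d2[OF that] _ sm by (rule sw.tie_ratio) (use that d m tie end_dead T in auto)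
  qed
  show ?thesis
  proof (rule that[of d])
    fix t assume t: "0 <= t" "t <= d"
    have "\<bar>(x1 d powr (\<beta> + 1) + (\<beta> + 1) * d) - (x1 t powr (\<beta> + 1) + (\<beta> + 1) * t)\<bar> <= (\<delta> * (\<beta> + 1)) * (d - t)"
    proof (rule fe_abs[OF fin t(2)])
      show "continuous_on {t..d} (%t. x1 t powr (\<beta> + 1) + (\<beta> + 1) * t)"
        using \<beta> t d nn by (intro continuous_intros continuous_on_powr' cont_sub) auto
      fix s assume s: "s \<in> {t<..<d} - F"
      then have s': "s \<in> {0<..<T} - F" using t d by auto
      have p: "0 < x1 s" "0 < x2 s" using d(4)[of s] d2[of s] s t by auto
      have r: "x2 s < (1 + \<kappa>) * x1 s" "x1 s < (1 + \<kappa>) * x2 s" using ratio[of s] s t by auto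
      have v: "0 <= v0 s" "v0 s <= V" using bd[of s] s' by auto
      have a: "x1 s powr \<beta> * x2 s powr (- \<beta>) <= (1 + \<kappa>) powr \<beta>"
      proof -
        have "x1 s powr \<beta> <= ((1 + \<kappa>) * x2 s) powr \<beta>" using r p \<beta> by (intro powr_mono2) auto
        then have "x1 s powr \<beta> * x2 s powr (- \<beta>) <= ((1 + \<kappa>) powr \<beta> * x2 s powr \<beta>) * x2 s powr (- \<beta>)"
          using p \<kappa> by (intro mult_right_mono) (auto simp: powr_mult)
        then show ?thesis using powr_cancel[OF p(2), of \<beta>] by (simp add: mult.assoc)
      qed
      \<comment> \<open>With \<open>A = (1 + \<kappa>) powr \<beta>\<close> the inequality
        \<open>2 - A <= 1 / A\<close> bounds the lower deviation by the same \<open>A - 1\<close> as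
        the upper one.\<close>
      have b: "2 - (1 + \<kappa>) powr \<beta> <= x1 s powr \<beta> * x2 s powr (- \<beta>)"
      proof -
        have "x2 s powr \<beta> <= ((1 + \<kappa>) * x1 s) powr \<beta>" using r p \<beta> by (intro powr_mono2) auto
        then have "x2 s powr \<beta> <= (1 + \<kappa>) powr \<beta> * x1 s powr \<beta>" using p \<kappa> by (simp add: powr_mult)
        then have "x2 s powr \<beta> * x2 s powr (- \<beta>) <= ((1 + \<kappa>) powr \<beta> * x1 s powr \<beta>) * x2 s powr (- \<beta>)"
          by (intro mult_right_mono) auto
        then have c: "1 <= (1 + \<kappa>) powr \<beta> * (x1 s powr \<beta> * x2 s powr (- \<beta>))"
          using powr_cancel[OF p(2), of \<beta>] by (simp add: mult.assoc)
        let ?A = "(1 + \<kappa>) powr \<beta>" let ?q = "x1 s powr \<beta> * x2 s powr (- \<beta>)"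
        have "0 < ?A" using \<kappa> by simp
        then have "1 / ?A <= ?q" using c by (simp add: pos_divide_le_eq mult.commute)
        moreover have "2 - ?A <= 1 / ?A"
          unfolding pos_le_divide_eq[OF \<open>0 < ?A\<close>] using zero_le_power2[of "?A - 1"]
          by (simp add: power2_eq_square algebra_simps)
        ultimately show ?thesis by simp
      qed
      have c: "0 <= x1 s powr \<beta> * v0 s" "x1 s powr \<beta> * v0 s <= V * m powr \<beta>"
      proof -
        have "x1 s powr \<beta> <= m powr \<beta>" using p m[of s] s' \<beta> by (intro powr_mono2) auto
        then show "x1 s powr \<beta> * v0 s <= V * m powr \<beta>" using v by (subst mult.commute) (intro mult_mono; simp)
      qed (use v in auto)
      let ?D = "(\<beta> + 1) * x1 s powr (\<beta> + 1 - 1) * (v0 s - 2 * x1 s powr (- \<beta>) + x2 s powr (- \<beta>)) + (\<beta> + 1) * 1"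
      have "?D = (\<beta> + 1) * (x1 s powr \<beta> * v0 s - 1 + x1 s powr \<beta> * x2 s powr (- \<beta>))"
        using powr_cancel[OF p(1), of \<beta>] by (simp add: algebra_simps)
      then have "\<bar>?D\<bar> = (\<beta> + 1) * \<bar>x1 s powr \<beta> * v0 s - 1 + x1 s powr \<beta> * x2 s powr (- \<beta>)\<bar>"
        using \<beta> by (simp add: abs_mult)
      also have "\<dots> <= (\<beta> + 1) * \<delta>"
        using a b c \<delta> \<beta> by (intro mult_left_mono) auto
      finally have "\<bar>?D\<bar> <= \<delta> * (\<beta> + 1)" by (simp add: mult.commute)
      moreover have "((%t. x1 t powr (\<beta> + 1) + (\<beta> + 1) * t) has_real_derivative ?D) (at s)"
        using D1[OF s'] p by (intro DERIV_add powr_has_derivative_pos DERIV_cmult DERIV_ident) auto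
      ultimately show "\<exists>D. ((%t. x1 t powr (\<beta> + 1) + (\<beta> + 1) * t) has_real_derivative D) (at s) \<and> \<bar>D\<bar> <= \<delta> * (\<beta> + 1)"
        by blast
    qed
    then show "\<bar>x1 t powr (\<beta> + 1) - (\<beta> + 1) * (d - t)\<bar> <= \<delta> * ((\<beta> + 1) * (d - t))"
      using d(3) by (simp add: algebra_simps abs_minus_commute)
  qed (use d d2 in auto)
qed

end

text \<open>\<open>xA\<close> is the large particle next to \<open>x1\<close>, and \<open>f\<close>
  is the part of its derivative that does not come from the side of the pair. The large particle on
  the other side is covered by exchanging the roles as in \<open>swap\<close>.\<close>

locale pair_left = pair_system +
  fixes xA f :: "real => real"
  assumes contA: "continuous_on {0..T} xA"
    and DA: "!!t. t \<in> {0<..<T} - F ==> (xA has_real_derivative f t +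
      (if 0 < x1 t then x1 t powr (- \<beta>) else if 0 < x2 t then x2 t powr (- \<beta>) else v3 t)) (at t)"
begin

text \<open>The mass a pair will hand over to its left neighbour is \<open>(2 x\<^sub>1 + x\<^sub>2) / 3\<close> while both particles are
  alive and half of the survivor afterwards: with these weights the singular terms cancel. The jump
  \<open>(x\<^sub>2 - x\<^sub>1) / 6\<close> at the first death is what transmits the perturbation.\<close>

lemma E_both:
  assumes a: "0 <= a" "a <= c" "c <= T" and alive: "!!t. a <= t ==> t < c ==> 0 < x1 t \<and> 0 < x2 t"
    and f: "!!t. a < t ==> t < c ==> \<bar>f t\<bar> <= Df"
  shows "\<bar>(xA c + (2 * x1 c + x2 c) / 3) - (xA a + (2 * x1 a + x2 a) / 3)\<bar> <= (Df + V) * (c - a)"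
proof (rule fe_abs[OF fin a(2)])
  show "continuous_on {a..c} (%t. xA t + (2 * x1 t + x2 t) / 3)"
    using a by (intro continuous_intros cont_sub continuous_on_subset[OF contA]) auto
  fix t assume t: "t \<in> {a<..<c} - F"
  then have t': "t \<in> {0<..<T} - F" using a by auto
  have p: "0 < x1 t" "0 < x2 t" using alive[of t] t by auto
  have v: "0 <= v0 t" "v0 t <= V" "0 <= v3 t" "v3 t <= V" using bd[of t] t' by auto
  let ?D = "(f t + x1 t powr (- \<beta>)) + (2 * (v0 t - 2 * x1 t powr (- \<beta>) + x2 t powr (- \<beta>)) + (x1 t powr (- \<beta>) - 2 * x2 t powr (- \<beta>) + v3 t)) / 3"
  have "((%t. xA t + (2 * x1 t + x2 t) / 3) has_real_derivative ?D) (at t)"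
    using DA[OF t'] D1[OF t'] D2[OF t'] p by (intro DERIV_add DERIV_cdivide DERIV_cmult) auto
  moreover have "?D = f t + (2 * v0 t + v3 t) / 3" by (simp add: field_simps)
  moreover have "\<bar>f t\<bar> <= Df" using f t by auto
  moreover have "\<bar>f t + (2 * v0 t + v3 t) / 3\<bar> <= Df + V" 
    using v \<open>\<bar>f t\<bar> <= Df\<close> unfolding add_divide_distrib by linarith
  ultimately show "\<exists>D. ((%t. xA t + (2 * x1 t + x2 t) / 3) has_real_derivative D) (at t) \<and> \<bar>D\<bar> <= Df + V"
    by metis
qed

lemma E_one:
  assumes a: "0 <= a" "a <= c" "c <= T" and alive: "!!t. a < t ==> t < c ==> x1 t = 0 \<or> x2 t = 0"
    and f: "!!t. a < t ==> t < c ==> \<bar>f t\<bar> <= Df"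
  shows "\<bar>(xA c + (x1 c + x2 c) / 2) - (xA a + (x1 a + x2 a) / 2)\<bar> <= (Df + V) * (c - a)"
proof (rule fe_abs[OF fin a(2)])
  show "continuous_on {a..c} (%t. xA t + (x1 t + x2 t) / 2)"
    using a by (intro continuous_intros cont_sub continuous_on_subset[OF contA]) auto
  fix t assume t: "t \<in> {a<..<c} - F"
  then have t': "t \<in> {0<..<T} - F" using a by auto
  have p: "x1 t = 0 \<or> x2 t = 0" "0 <= x1 t" "0 <= x2 t" using alive[of t] nn[of t] t t' by auto
  have v: "0 <= v0 t" "v0 t <= V" "0 <= v3 t" "v3 t <= V" using bd[of t] t' by auto
  let ?n = "if 0 < x1 t then x1 t powr (- \<beta>) else if 0 < x2 t then x2 t powr (- \<beta>) else v3 t"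
  let ?d1 = "if 0 < x1 t then v0 t - 2 * x1 t powr (- \<beta>) + (if 0 < x2 t then x2 t powr (- \<beta>) else v3 t) else 0"
  let ?d2 = "if 0 < x2 t then (if 0 < x1 t then x1 t powr (- \<beta>) else v0 t) - 2 * x2 t powr (- \<beta>) + v3 t else 0"
  have "((%t. xA t + (x1 t + x2 t) / 2) has_real_derivative (f t + ?n) + (?d1 + ?d2) / 2) (at t)"
    using DA[OF t'] D1[OF t'] D2[OF t'] by (intro DERIV_add DERIV_cdivide)
  moreover have "\<bar>f t\<bar> <= Df" using f t by auto
  then have "\<bar>(f t + ?n) + (?d1 + ?d2) / 2\<bar> <= Df + V"
    using v p by (cases "0 < x1 t"; cases "0 < x2 t") (auto simp: abs_le_iff field_simps)
  ultimately show "\<exists>D. ((%t. xA t + (x1 t + x2 t) / 2) has_real_derivative D) (at t) \<and> \<bar>D\<bar> <= Df + V"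
    by blast
qed

text \<open>\<open>E_both\<close> until \<open>d\<close> and \<open>E_one\<close> afterwards; since
  one size vanishes at \<open>d\<close>, the two weighted sums differ there by exactly
  \<open>(x2 d - x1 d) / 6\<close>.\<close>

lemma handover:
  assumes a: "0 <= a" "a <= d" "d <= c" "c <= T"
    and alive: "!!t. a <= t ==> t < d ==> 0 < x1 t \<and> 0 < x2 t" and d: "x1 d = 0 \<or> x2 d = 0"
    and S: "!!t. a <= t ==> t <= c ==> x1 t + x2 t <= S"
    and f: "!!t. a < t ==> t < c ==> \<bar>f t\<bar> <= Df" and Df: "0 <= Df"
  shows "\<bar>(xA c + (x1 c + x2 c) / 2) - (xA a + (2 * x1 a + x2 a) / 3 + (x2 d - x1 d) / 6)\<bar> <= (Df + V) * (c - a)"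
    "a <= t ==> t <= c ==> \<bar>xA t - xA a\<bar> <= 3 * S + (Df + V) * (c - a)"
proof -
  have one: "x1 t = 0 \<or> x2 t = 0" if "d <= t" "t <= T" for t
    using dead(1)[of d t] dead(2)[of d t] d a that by auto
  have W: "0 <= Df + V" using Df V by simp
  have e1: "\<bar>(xA t + (2 * x1 t + x2 t) / 3) - (xA a + (2 * x1 a + x2 a) / 3)\<bar> <= (Df + V) * (t - a)" if "a <= t" "t <= d" for t
    using a f alive that by (intro E_both) auto
  have e2: "\<bar>(xA t + (x1 t + x2 t) / 2) - (xA d + (x1 d + x2 d) / 2)\<bar> <= (Df + V) * (t - d)" if "d <= t" "t <= c" for t
    using a f one that by (intro E_one) auto
  have split: "(Df + V) * (t - a) = (Df + V) * (d - a) + (Df + V) * (t - d)" for t by (simp add: algebra_simps)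
  show "\<bar>(xA c + (x1 c + x2 c) / 2) - (xA a + (2 * x1 a + x2 a) / 3 + (x2 d - x1 d) / 6)\<bar> <= (Df + V) * (c - a)"
    using e1[of d] e2[of c] a unfolding split[of c] add_divide_distrib diff_divide_distrib by linarith
  show "\<bar>xA t - xA a\<bar> <= 3 * S + (Df + V) * (c - a)" if t: "a <= t" "t <= c"
  proof -
    have n: "0 <= x1 s" "0 <= x2 s" "x1 s + x2 s <= S" if "a <= s" "s <= c" for s using nn[of s] S[of s] that a by auto
    have m: "(Df + V) * (t - a) <= (Df + V) * (c - a)" using W t by (intro mult_left_mono) auto
    have na: "0 <= x1 a" "0 <= x2 a" "x1 a + x2 a <= S" using n[of a] a by auto
    show ?thesis
    proof (cases "t <= d")
      case True
      show ?thesis using e1[OF t(1) True] n[OF t] na m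
        unfolding add_divide_distrib by linarith
    next
      case False
      then have dt: "d <= t" by simp
      note e2' = e2[OF dt t(2)] and e1' = e1[OF a(2) order_refl]
      have nd: "0 <= x1 d" "0 <= x2 d" "x1 d + x2 d <= S" using n[of d] a by auto
      show ?thesis
        using e1' e2' n[OF t] na nd m
        unfolding split[of t] add_divide_distrib by linarith
    qed
  qed
qed

end

section \<open>Configurations of large particles separated by pairs\<close>

text \<open>The power that the large particle at \<open>3 * m\<close> sees on its right. With the
  same index, \<open>nB\<close> is the power that the large particle at \<open>3 * m + 3\<close>
  sees on its left.\<close>

definition nA :: "real => (int => real) => int => real" where
  "nA \<beta> y m = (if 0 < y (3 * m + 1) then y (3 * m + 1) powr (- \<beta>)
     else if 0 < y (3 * m + 2) then y (3 * m + 2) powr (- \<beta>) else y (3 * m + 3) powr (- \<beta>))"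

definition nB :: "real => (int => real) => int => real" where
  "nB \<beta> y m = (if 0 < y (3 * m + 2) then y (3 * m + 2) powr (- \<beta>)
     else if 0 < y (3 * m + 1) then y (3 * m + 1) powr (- \<beta>) else y (3 * m) powr (- \<beta>))"

text \<open>A large site is empty only beyond an end of the row, and then the pair between it and
  the row is empty too. So every living particle finds its neighbours within distance 3 or has
  none.\<close>

definition config :: "(int => real) => bool" where
  "config y \<longleftrightarrow> (\<forall>j. 0 <= y j) \<and>
     (\<forall>m. 0 < y (3 * m) \<or> (\<forall>j\<ge>3 * m - 2. y j = 0) \<or> (\<forall>j\<le>3 * m + 2. y j = 0))"

text \<open>A missing neighbour and an empty site both have power 0, so the end of the row obeys the
  same formula as an occupied site.\<close>

lemma sigma_minus_val:
  assumes "!!i. k < i ==> i < j ==> y i = 0" "k < j" "0 < y k \<or> (\<forall>i\<le>k. y i = 0)"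
  shows "at_ext y (sigma_minus j y) powr (- \<beta>) = y k powr (- \<beta>)"
proof (cases "0 < y k")
  case True
  then have "sigma_minus j y = Some k" using assms by (intro sigma_minus_Some) auto
  then show ?thesis by (simp add: at_ext_def)
next
  case False
  then have z: "!!i. i <= k ==> y i = 0" using assms(3) by auto
  have "sigma_minus j y = None"
  proof (rule sigma_minus_None)
    fix i assume "i < j"
    then show "\<not> 0 < y i" using z[of i] assms(1)[of i] by (cases "i <= k") auto
  qed
  then show ?thesis using z[of k] by (simp add: at_ext_def)
qed

lemma sigma_plus_val:
  assumes "!!i. j < i ==> i < k ==> y i = 0" "j < k" "0 < y k \<or> (\<forall>i\<ge>k. y i = 0)"
  shows "at_ext y (sigma_plus j y) powr (- \<beta>) = y k powr (- \<beta>)"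
proof (cases "0 < y k")
  case True
  then have "sigma_plus j y = Some k" using assms by (intro sigma_plus_Some) auto
  then show ?thesis by (simp add: at_ext_def)
next
  case False
  then have z: "!!i. k <= i ==> y i = 0" using assms(3) by auto
  have "sigma_plus j y = None"
  proof (rule sigma_plus_None)
    fix i assume "j < i"
    then show "\<not> 0 < y i" using z[of i] assms(1)[of i] by (cases "k <= i") auto
  qed
  then show ?thesis using z[of k] by (simp add: at_ext_def)
qed

lemma config_big:
  assumes "config y" "0 < y j"
  shows "j <= 3 * m + 2 ==> \<not> 0 < y (3 * m) ==> j < 3 * m - 2"
    "3 * m - 2 <= j ==> j <= 3 * m + 2 ==> 0 < y (3 * m)"
  using assms unfolding config_def by (metis leI less_irrefl)+

lemma right_val:
  assumes c: "config y" and j: "0 < y (3 * m)"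
  shows "at_ext y (sigma_plus (3 * m) y) powr (- \<beta>) = nA \<beta> y m"
proof -
  have z: "\<not> 0 < y k ==> y k = 0" for k using c by (metis config_def less_eq_real_def)
  have e: "0 < y (3 * m + 3) \<or> (\<forall>i\<ge>3 * m + 1. y i = 0)"
  proof -
    have "0 < y (3 * (m + 1)) \<or> (\<forall>j\<ge>3 * (m + 1) - 2. y j = 0) \<or> (\<forall>j\<le>3 * (m + 1) + 2. y j = 0)"
      using c unfolding config_def by blast
    moreover have "\<not> (\<forall>j\<le>3 * (m + 1) + 2. y j = 0)" using j by (auto intro!: exI[of _ "3 * m"])
    moreover have "3 * (m + 1) = 3 * m + 3" "3 * (m + 1) - 2 = 3 * m + 1" by auto
    ultimately show ?thesis by metis
  qed
  consider "0 < y (3 * m + 1)" | "y (3 * m + 1) = 0" "0 < y (3 * m + 2)" | "y (3 * m + 1) = 0" "y (3 * m + 2) = 0"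
    using z by blast
  then show ?thesis
  proof cases
    case 1
    then show ?thesis using sigma_plus_val[of "3 * m" "3 * m + 1" y] by (simp add: nA_def)
  next
    case 2
    have "i = 3 * m + 1" if "3 * m < i" "i < 3 * m + 2" for i using that by simp
    then have "!!i. 3 * m < i ==> i < 3 * m + 2 ==> y i = 0" using 2 by blast
    then show ?thesis using sigma_plus_val[of "3 * m" "3 * m + 2" y] 2 by (simp add: nA_def)
  next
    case 3
    have "i = 3 * m + 1 \<or> i = 3 * m + 2" if "3 * m < i" "i < 3 * m + 3" for i using that by presburger
    then have "!!i. 3 * m < i ==> i < 3 * m + 3 ==> y i = 0" using 3 by blast
    moreover have "0 < y (3 * m + 3) \<or> (\<forall>i\<ge>3 * m + 3. y i = 0)" using e by force
    ultimately show ?thesis using sigma_plus_val[of "3 * m" "3 * m + 3" y] 3 by (simp add: nA_def)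
  qed
qed

lemma left_val:
  assumes c: "config y" and j: "0 < y (3 * m + 3)"
  shows "at_ext y (sigma_minus (3 * m + 3) y) powr (- \<beta>) = nB \<beta> y m"
proof -
  have z: "\<not> 0 < y k ==> y k = 0" for k using c by (metis config_def less_eq_real_def)
  have e: "0 < y (3 * m) \<or> (\<forall>i\<le>3 * m + 2. y i = 0)"
  proof -
    have "0 < y (3 * m) \<or> (\<forall>j\<ge>3 * m - 2. y j = 0) \<or> (\<forall>j\<le>3 * m + 2. y j = 0)"
      using c unfolding config_def by blast
    moreover have "\<not> (\<forall>j\<ge>3 * m - 2. y j = 0)" using j by (auto intro!: exI[of _ "3 * m + 3"])
    ultimately show ?thesis by simp
  qed
  consider "0 < y (3 * m + 2)" | "y (3 * m + 2) = 0" "0 < y (3 * m + 1)" | "y (3 * m + 1) = 0" "y (3 * m + 2) = 0"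
    using z by blast
  then show ?thesis
  proof cases
    case 1
    then show ?thesis using sigma_minus_val[of "3 * m + 2" "3 * m + 3" y] by (simp add: nB_def)
  next
    case 2
    have "i = 3 * m + 2" if "3 * m + 1 < i" "i < 3 * m + 3" for i using that by simp
    then have "!!i. 3 * m + 1 < i ==> i < 3 * m + 3 ==> y i = 0" using 2 by blast
    then show ?thesis using sigma_minus_val[of "3 * m + 1" "3 * m + 3" y] 2 by (simp add: nB_def)
  next
    case 3
    have "i = 3 * m + 1 \<or> i = 3 * m + 2" if "3 * m < i" "i < 3 * m + 3" for i using that by presburger
    then have "!!i. 3 * m < i ==> i < 3 * m + 3 ==> y i = 0" using 3 by blast
    moreover have "0 < y (3 * m) \<or> (\<forall>i\<le>3 * m. y i = 0)" using e by force
    ultimately show ?thesis using sigma_minus_val[of "3 * m" "3 * m + 3" y] 3 by (simp add: nB_def)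
  qed
qed

lemma lap_big:
  assumes "config y" "0 < y (3 * m)"
  shows "lap_sigma \<beta> y (3 * m) = nB \<beta> y (m - 1) - 2 * y (3 * m) powr (- \<beta>) + nA \<beta> y m"
  using right_val[OF assms, of \<beta>] left_val[OF assms(1), of "m - 1" \<beta>] assms(2)
  by (simp add: lap_sigma_def algebra_simps)

lemma lap_1:
  assumes c: "config y" and p: "0 < y (3 * m + 1)"
  shows "lap_sigma \<beta> y (3 * m + 1) = y (3 * m) powr (- \<beta>) - 2 * y (3 * m + 1) powr (- \<beta>) +
     (if 0 < y (3 * m + 2) then y (3 * m + 2) powr (- \<beta>) else y (3 * m + 3) powr (- \<beta>))"
proof -
  have a: "0 < y (3 * m)" using config_big(2)[OF c p, of m] by simp
  have b: "0 < y (3 * m + 3)" using config_big(2)[OF c p, of "m + 1"] by (simp add: algebra_simps)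
  have l: "at_ext y (sigma_minus (3 * m + 1) y) powr (- \<beta>) = y (3 * m) powr (- \<beta>)"
    using a by (intro sigma_minus_val) auto
  have r: "at_ext y (sigma_plus (3 * m + 1) y) powr (- \<beta>) =
      (if 0 < y (3 * m + 2) then y (3 * m + 2) powr (- \<beta>) else y (3 * m + 3) powr (- \<beta>))"
  proof (cases "0 < y (3 * m + 2)")
    case True
    then show ?thesis using sigma_plus_val[of "3 * m + 1" "3 * m + 2" y \<beta>] by simp
  next
    case False
    then have "y (3 * m + 2) = 0" using c by (metis config_def less_eq_real_def)
    moreover have "i = 3 * m + 2" if "3 * m + 1 < i" "i < 3 * m + 3" for i using that by simp
    ultimately have "!!i. 3 * m + 1 < i ==> i < 3 * m + 3 ==> y i = 0" by blast
    then show ?thesis using sigma_plus_val[of "3 * m + 1" "3 * m + 3" y \<beta>] b False by simp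
  qed
  show ?thesis using p unfolding lap_sigma_def l r by simp
qed

lemma lap_2:
  assumes c: "config y" and p: "0 < y (3 * m + 2)"
  shows "lap_sigma \<beta> y (3 * m + 2) = (if 0 < y (3 * m + 1) then y (3 * m + 1) powr (- \<beta>) else y (3 * m) powr (- \<beta>))
     - 2 * y (3 * m + 2) powr (- \<beta>) + y (3 * m + 3) powr (- \<beta>)"
proof -
  have a: "0 < y (3 * m)" using config_big(2)[OF c p, of m] by simp
  have b: "0 < y (3 * m + 3)" using config_big(2)[OF c p, of "m + 1"] by (simp add: algebra_simps)
  have r: "at_ext y (sigma_plus (3 * m + 2) y) powr (- \<beta>) = y (3 * m + 3) powr (- \<beta>)"
    using b by (intro sigma_plus_val) auto
  have l: "at_ext y (sigma_minus (3 * m + 2) y) powr (- \<beta>) =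
      (if 0 < y (3 * m + 1) then y (3 * m + 1) powr (- \<beta>) else y (3 * m) powr (- \<beta>))"
  proof (cases "0 < y (3 * m + 1)")
    case True
    then show ?thesis using sigma_minus_val[of "3 * m + 1" "3 * m + 2" y \<beta>] by simp
  next
    case False
    then have "y (3 * m + 1) = 0" using c by (metis config_def less_eq_real_def)
    moreover have "i = 3 * m + 1" if "3 * m < i" "i < 3 * m + 2" for i using that by simp
    ultimately have "!!i. 3 * m < i ==> i < 3 * m + 2 ==> y i = 0" by blast
    then show ?thesis using sigma_minus_val[of "3 * m" "3 * m + 2" y \<beta>] a False by simp
  qed
  show ?thesis using p unfolding lap_sigma_def l r by simp
qed

text \<open>The windows for the initial data leave room for the tuning of the pairs and for the
  perturbation of a large particle. The bounds on \<open>T\<close> keep the large particles between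
  1/2 and 2; the particles at negative sites count as large.\<close>

locale triple_flow =
  fixes \<beta> :: real and r :: "nat => real" and N :: nat and T :: real and S :: "int set" and x :: "real => int => real"
  assumes \<beta>: "0 < \<beta>" and flow: "particle_flow \<beta> S x"
    and void: "!!j. 3 * int N < \<bar>j\<bar> ==> x 0 j = 0"
    and big0: "!!j. \<bar>j\<bar> <= 3 * int N ==> j < 0 \<or> j mod 3 = 0 ==> 3 / 4 <= x 0 j \<and> x 0 j <= 5 / 4"
    and small0: "!!m. m < N ==> r m / 2 <= x 0 (3 * int m + 1) \<and> x 0 (3 * int m + 1) <= 3 / 2 * r m"
      "!!m. m < N ==> r m / 2 <= x 0 (3 * int m + 2) \<and> x 0 (3 * int m + 2) <= 3 / 2 * r m"
    and r0: "!!m. 0 < r m" and r_small: "!!m. r m <= 1 / 24" "!!m. 2 * 2 powr \<beta> <= (4 * r m) powr (- \<beta>)"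
    and T0: "0 < T" and T_small: "2 * (\<beta> + 1) * T <= (3 / 4) powr (\<beta> + 1) - (1 / 2) powr (\<beta> + 1)"
      "2 * 2 powr \<beta> * T <= 1 / 4"
begin

abbreviation "V \<equiv> 2 powr \<beta>"

definition F where "F = (SOME F. finite F \<and> (\<forall>t j. 0 < t --> t \<notin> F -->
        ((%t. x t j) has_real_derivative lap_sigma \<beta> (x t) j) (at t)))"

lemma F: "finite F" "!!t j. 0 < t ==> t \<notin> F ==> ((%t. x t j) has_real_derivative lap_sigma \<beta> (x t) j) (at t)"
proof -
  have "\<exists>F. finite F \<and> (\<forall>t j. 0 < t --> t \<notin> F --> ((%t. x t j) has_real_derivative lap_sigma \<beta> (x t) j) (at t))"
    using flow by (simp add: particle_flow_def)
  then have P: "finite F \<and> (\<forall>t j. 0 < t --> t \<notin> F --> ((%t. x t j) has_real_derivative lap_sigma \<beta> (x t) j) (at t))"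
    unfolding F_def by (rule someI_ex)
  show "finite F" by (rule P[THEN conjunct1])
  show "!!t j. 0 < t ==> t \<notin> F ==> ((%t. x t j) has_real_derivative lap_sigma \<beta> (x t) j) (at t)"
    using P[THEN conjunct2] by blast
qed

lemma nn: "0 <= t ==> 0 <= x t j" using flow by (simp add: particle_flow_def)

lemma cont: "0 <= a ==> continuous_on {a..b} (%t. x t j)"
  by (rule continuous_on_subset[of "{0..}"]) (use flow in \<open>auto simp: particle_flow_def\<close>)

lemma dead: "0 <= s ==> s <= t ==> x s j = 0 ==> x t j = 0"
  using flow unfolding particle_flow_def by blast

lemma zero: "0 <= t ==> 3 * int N < \<bar>j\<bar> ==> x t j = 0"
  using dead[of 0 t j] void by simp

lemma lower: "0 <= s ==> s <= t ==> x s j powr (\<beta> + 1) - 2 * (\<beta> + 1) * (t - s) <= x t j powr (\<beta> + 1)"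
  by (rule particle_flow_lower[OF \<beta> flow])

lemma lower_ge:
  assumes "0 <= c" "0 <= a" "a <= x 0 j" "c powr (\<beta> + 1) + 2 * (\<beta> + 1) * t <= a powr (\<beta> + 1)" "0 <= t"
  shows "c <= x t j"
proof (rule ccontr)
  assume "\<not> c <= x t j"
  then have "x t j powr (\<beta> + 1) < c powr (\<beta> + 1)" using nn[of t j] assms \<beta> by (intro powr_less_mono2) auto
  moreover have "a powr (\<beta> + 1) <= x 0 j powr (\<beta> + 1)" using assms \<beta> by (intro powr_mono2) auto
  ultimately show False using lower[of 0 t j] assms by simp
qed

lemma big_ge:
  assumes "0 <= t" "t <= T" "\<bar>j\<bar> <= 3 * int N" "j < 0 \<or> j mod 3 = 0"
  shows "1 / 2 <= x t j"
proof (rule lower_ge)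
  have "2 * (\<beta> + 1) * t <= 2 * (\<beta> + 1) * T" using assms \<beta> by (intro mult_left_mono) auto
  then show "(1 / 2) powr (\<beta> + 1) + 2 * (\<beta> + 1) * t <= (3 / 4) powr (\<beta> + 1)" using T_small by simp
qed (use assms big0[of j] in auto)

lemma big_u:
  assumes "0 <= t" "t <= T" "j < 0 \<or> j mod 3 = 0 \<or> 3 * int N < j"
  shows "0 <= x t j powr (- \<beta>)" "x t j powr (- \<beta>) <= V"
proof -
  show "x t j powr (- \<beta>) <= V"
  proof (cases "\<bar>j\<bar> <= 3 * int N")
    case True
    then have "x t j powr (- \<beta>) <= (1 / 2) powr (- \<beta>)" using big_ge[of t j] assms \<beta> by (intro powr_mono2') auto
    also have "\<dots> = V" by (simp add: powr_minus_divide powr_divide)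
    finally show ?thesis .
  qed (use zero[of t j] assms in auto)
qed auto

lemma config_x: "0 <= t ==> t <= T ==> config (x t)"
  unfolding config_def
proof (intro conjI allI)
  fix m assume t: "0 <= t" "t <= T"
  consider "\<bar>m\<bar> <= int N" | "int N < m" | "m < - int N" by linarith
  then show "0 < x t (3 * m) \<or> (\<forall>j\<ge>3 * m - 2. x t j = 0) \<or> (\<forall>j\<le>3 * m + 2. x t j = 0)"
  proof cases
    case 1
    then have "1 / 2 <= x t (3 * m)" using t by (intro big_ge) auto
    then show ?thesis by simp
  next
    case 2
    then have "\<forall>j\<ge>3 * m - 2. x t j = 0" using t by (auto intro!: zero)
    then show ?thesis by blast
  next
    case 3
    then have "\<forall>j\<le>3 * m + 2. x t j = 0" using t by (auto intro!: zero)
    then show ?thesis by blast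
  qed
qed (rule nn)

lemma V0: "0 < V" by simp

lemma D_big:
  assumes "0 < t" "t < T" "t \<notin> F" "\<bar>m\<bar> <= int N"
  shows "((%t. x t (3 * m)) has_real_derivative nB \<beta> (x t) (m - 1) - 2 * x t (3 * m) powr (- \<beta>) + nA \<beta> (x t) m) (at t)"
proof -
  have "1 / 2 <= x t (3 * m)" using assms by (intro big_ge) auto
  then show ?thesis using F(2)[OF assms(1,3), of "3 * m"] lap_big[OF config_x, of t m \<beta>] assms by simp
qed

lemma D_small:
  assumes "0 < t" "t < T" "t \<notin> F"
  shows "((%t. x t (3 * m + 1)) has_real_derivative (if 0 < x t (3 * m + 1) then
       x t (3 * m) powr (- \<beta>) - 2 * x t (3 * m + 1) powr (- \<beta>) + (if 0 < x t (3 * m + 2) then x t (3 * m + 2) powr (- \<beta>) else x t (3 * m + 3) powr (- \<beta>)) else 0)) (at t)"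
    "((%t. x t (3 * m + 2)) has_real_derivative (if 0 < x t (3 * m + 2) then
       (if 0 < x t (3 * m + 1) then x t (3 * m + 1) powr (- \<beta>) else x t (3 * m) powr (- \<beta>)) - 2 * x t (3 * m + 2) powr (- \<beta>) + x t (3 * m + 3) powr (- \<beta>) else 0)) (at t)"
  using F(2)[OF assms(1,3), of "3 * m + 1"] F(2)[OF assms(1,3), of "3 * m + 2"] config_x[of t] assms
    lap_1[of "x t" m \<beta>] lap_2[of "x t" m \<beta>] lap_sigma_dead[of "x t" "3 * m + 1" \<beta>] lap_sigma_dead[of "x t" "3 * m + 2" \<beta>]
  by auto

lemma pair:
  assumes "m < N"
  shows "pair_system \<beta> V T F (%t. x t (3 * int m + 1)) (%t. x t (3 * int m + 2))
    (%t. x t (3 * int m) powr (- \<beta>)) (%t. x t (3 * int m + 3) powr (- \<beta>))"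
proof
  fix t assume t: "t \<in> {0<..<T} - F"
  show "((%t. x t (3 * int m + 1)) has_real_derivative (if 0 < x t (3 * int m + 1) then
       x t (3 * int m) powr (- \<beta>) - 2 * x t (3 * int m + 1) powr (- \<beta>) + (if 0 < x t (3 * int m + 2) then x t (3 * int m + 2) powr (- \<beta>) else x t (3 * int m + 3) powr (- \<beta>)) else 0)) (at t)"
    "((%t. x t (3 * int m + 2)) has_real_derivative (if 0 < x t (3 * int m + 2) then
       (if 0 < x t (3 * int m + 1) then x t (3 * int m + 1) powr (- \<beta>) else x t (3 * int m) powr (- \<beta>)) - 2 * x t (3 * int m + 2) powr (- \<beta>) + x t (3 * int m + 3) powr (- \<beta>) else 0)) (at t)"
    using D_small[of t "int m"] t by auto
next
  fix t assume t: "0 < t" "t < T"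
  show "0 <= x t (3 * int m) powr (- \<beta>) \<and> x t (3 * int m) powr (- \<beta>) <= V"
    using big_u[of t "3 * int m"] t by auto
  show "0 <= x t (3 * int m + 3) powr (- \<beta>) \<and> x t (3 * int m + 3) powr (- \<beta>) <= V"
    using big_u[of t "3 * int m + 3"] t by auto
next
  fix s t :: real assume "0 <= s" "s <= t"
  then show "x s (3 * int m + 1) = 0 ==> x t (3 * int m + 1) = 0" "x s (3 * int m + 2) = 0 ==> x t (3 * int m + 2) = 0"
    by (auto intro: dead)
qed (use \<beta> V0 F(1) nn cont in auto)

lemma pair_left_A:
  assumes "m < N"
  shows "pair_left \<beta> V T F (%t. x t (3 * int m + 1)) (%t. x t (3 * int m + 2))
    (%t. x t (3 * int m) powr (- \<beta>)) (%t. x t (3 * int m + 3) powr (- \<beta>))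
    (%t. x t (3 * int m)) (%t. nB \<beta> (x t) (int m - 1) - 2 * x t (3 * int m) powr (- \<beta>))"
proof -
  interpret p: pair_system \<beta> V T F "%t. x t (3 * int m + 1)" "%t. x t (3 * int m + 2)"
    "%t. x t (3 * int m) powr (- \<beta>)" "%t. x t (3 * int m + 3) powr (- \<beta>)" by (rule pair[OF assms])
  show ?thesis
    by unfold_locales (use D_big[of _ "int m"] assms cont in \<open>auto simp: nA_def\<close>)
qed

lemma pair_left_B:
  assumes "m < N"
  shows "pair_left \<beta> V T F (%t. x t (3 * int m + 2)) (%t. x t (3 * int m + 1))
    (%t. x t (3 * int m + 3) powr (- \<beta>)) (%t. x t (3 * int m) powr (- \<beta>))
    (%t. x t (3 * int m + 3)) (%t. nA \<beta> (x t) (int m + 1) - 2 * x t (3 * int m + 3) powr (- \<beta>))"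
proof -
  interpret p: pair_system \<beta> V T F "%t. x t (3 * int m + 1)" "%t. x t (3 * int m + 2)"
    "%t. x t (3 * int m) powr (- \<beta>)" "%t. x t (3 * int m + 3) powr (- \<beta>)" by (rule pair[OF assms])
  interpret q: pair_system \<beta> V T F "%t. x t (3 * int m + 2)" "%t. x t (3 * int m + 1)"
    "%t. x t (3 * int m + 3) powr (- \<beta>)" "%t. x t (3 * int m) powr (- \<beta>)" by (rule p.swap)
  show ?thesis
  proof
    fix t assume t: "t \<in> {0<..<T} - F"
    have e: "3 * int m + 3 = 3 * (int m + 1)" by simp
    have "((%t. x t (3 * (int m + 1))) has_real_derivative nB \<beta> (x t) (int m) - 2 * x t (3 * (int m + 1)) powr (- \<beta>) + nA \<beta> (x t) (int m + 1)) (at t)"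
      using D_big[of t "int m + 1"] t assms by auto
    then show "((%t. x t (3 * int m + 3)) has_real_derivative nA \<beta> (x t) (int m + 1) - 2 * x t (3 * int m + 3) powr (- \<beta>) +
      (if 0 < x t (3 * int m + 2) then x t (3 * int m + 2) powr (- \<beta>) else if 0 < x t (3 * int m + 1) then x t (3 * int m + 1) powr (- \<beta>) else x t (3 * int m) powr (- \<beta>))) (at t)"
      unfolding e by (rule DERIV_cong) (simp add: nB_def)
  qed (use cont in auto)
qed

text \<open>The bound of \<open>sum_dies\<close> for the death time of pair \<open>m\<close>, whose
  total size is at most \<open>3 * r m\<close>.\<close>

definition "\<theta> m = (3 * r m) powr (\<beta> + 1) / (\<beta> + 1)"

lemma pair_sum:
  assumes "m < N" "0 <= s" "s <= t" "t <= T"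
  shows "x t (3 * int m + 1) + x t (3 * int m + 2) <= x s (3 * int m + 1) + x s (3 * int m + 2)"
    "x s (3 * int m + 1) + x s (3 * int m + 2) <= 3 * r m"
proof -
  interpret p: pair_system \<beta> V T F "%t. x t (3 * int m + 1)" "%t. x t (3 * int m + 2)"
    "%t. x t (3 * int m) powr (- \<beta>)" "%t. x t (3 * int m + 3) powr (- \<beta>)" by (rule pair[OF assms(1)])
  have i: "x 0 (3 * int m + 1) + x 0 (3 * int m + 2) <= 3 * r m" using small0[OF assms(1)] by simp
  have *: "x s (3 * int m + 1) + x s (3 * int m + 2) <= x 0 (3 * int m + 1) + x 0 (3 * int m + 2)" if "0 <= s" "s <= T" for s
    using p.sum_antimono[of 0 s "4 * r m"] i r0[of m] r_small(2)[of m] that by auto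
  show "x s (3 * int m + 1) + x s (3 * int m + 2) <= 3 * r m" using *[of s] i assms by auto
  then show "x t (3 * int m + 1) + x t (3 * int m + 2) <= x s (3 * int m + 1) + x s (3 * int m + 2)"
    using p.sum_antimono[of s t "4 * r m"] r0[of m] r_small(2)[of m] assms by auto
qed

lemma pair_dead:
  assumes "m < N" "\<theta> m <= t" "t <= T"
  shows "x t (3 * int m + 1) = 0" "x t (3 * int m + 2) = 0"
proof -
  interpret p: pair_system \<beta> V T F "%t. x t (3 * int m + 1)" "%t. x t (3 * int m + 2)"
    "%t. x t (3 * int m) powr (- \<beta>)" "%t. x t (3 * int m + 3) powr (- \<beta>)" by (rule pair[OF assms(1)])
  have i: "x 0 (3 * int m + 1) + x 0 (3 * int m + 2) <= 3 * r m" using small0[OF assms(1)] by simp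
  have "(x 0 (3 * int m + 1) + x 0 (3 * int m + 2)) powr (\<beta> + 1) / (\<beta> + 1) <= \<theta> m"
    unfolding \<theta>_def using i \<beta> nn[of 0] by (intro divide_right_mono powr_mono2) auto
  then have h: "0 + (x 0 (3 * int m + 1) + x 0 (3 * int m + 2)) powr (\<beta> + 1) / (\<beta> + 1) <= t" using assms by simp
  show "x t (3 * int m + 1) = 0" "x t (3 * int m + 2) = 0"
    using p.sum_dies[of 0 "4 * r m" t] h i r0[of m] r_small(2)[of m] assms by auto
qed

lemma nA_nonneg: "0 <= nA \<beta> y m" and nB_nonneg: "0 <= nB \<beta> y m"
  by (auto simp: nA_def nB_def)

lemma sum_pair_D:
  assumes "0 < t" "t < T" "t \<notin> F"
  shows "((%t. x t (3 * m + 1) + x t (3 * m + 2)) has_real_derivative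
     (if 0 < x t (3 * m + 1) \<or> 0 < x t (3 * m + 2) then x t (3 * m) powr (- \<beta>) + x t (3 * m + 3) powr (- \<beta>) - nA \<beta> (x t) m - nB \<beta> (x t) m else 0)) (at t)"
  by (rule DERIV_cong[OF DERIV_add[OF D_small[OF assms]]]) (auto simp: nA_def nB_def)

text \<open>What a large particle gains from an adjacent pair, the pair loses, so the singular
  powers cancel in the sum and the positive terms left are powers of large particles. To the left of
  site 0 all particles are large, and no pairs are added.\<close>

lemma big_block:
  assumes "0 < t" "t < T" "t \<notin> F" "\<bar>m\<bar> <= int N"
  shows "\<exists>D. ((%t. x t (3 * m) + (if 0 <= m then x t (3 * m + 1) + x t (3 * m + 2) else 0) +
      (if 1 <= m then x t (3 * (m - 1) + 1) + x t (3 * (m - 1) + 2) else 0)) has_real_derivative D) (at t) \<and> D <= 2 * V"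
proof -
  have t: "0 <= t" "t <= T" using assms by auto
  let ?u = "%j. x t j powr (- \<beta>)"
  define d where "d k = (if 0 < x t (3 * k + 1) \<or> 0 < x t (3 * k + 2) then ?u (3 * k) + ?u (3 * k + 3) - nA \<beta> (x t) k - nB \<beta> (x t) k else 0)" for k
  have D: "((%t. x t (3 * m) + (if 0 <= m then x t (3 * m + 1) + x t (3 * m + 2) else 0) +
      (if 1 <= m then x t (3 * (m - 1) + 1) + x t (3 * (m - 1) + 2) else 0)) has_real_derivative
      (nB \<beta> (x t) (m - 1) - 2 * ?u (3 * m) + nA \<beta> (x t) m) + (if 0 <= m then d m else 0) + (if 1 <= m then d (m - 1) else 0)) (at t)"
  proof (intro DERIV_add D_big assms)
    show "((%t. if 0 <= m then x t (3 * m + 1) + x t (3 * m + 2) else 0) has_real_derivative (if 0 <= m then d m else 0)) (at t)"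
      using sum_pair_D[OF assms(1-3), of m] by (cases "0 <= m") (simp_all only: d_def if_True if_False DERIV_const)
    show "((%t. if 1 <= m then x t (3 * (m - 1) + 1) + x t (3 * (m - 1) + 2) else 0) has_real_derivative (if 1 <= m then d (m - 1) else 0)) (at t)"
      using sum_pair_D[OF assms(1-3), of "m - 1"] by (cases "1 <= m") (simp_all only: d_def if_True if_False DERIV_const)
  qed
  have u: "0 <= ?u j" for j by simp
  have bu: "?u (3 * k) <= V" "?u (3 * k + 3) <= V" for k using big_u[of t "3 * k"] big_u[of t "3 * k + 3"] t by auto
  have right: "nA \<beta> (x t) m + (if 0 <= m then d m else 0) <= V + ?u (3 * m)"
  proof (cases "0 <= m")
    case True
    show ?thesis using True bu(2)[of m] nB_nonneg[of "x t" m] u[of "3 * m"]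
      by (auto simp: d_def) (auto simp: nA_def intro: add_increasing2)
  next
    case False
    have "nA \<beta> (x t) m <= V" using False big_u(2)[of t "3 * m + 1"] big_u(2)[of t "3 * m + 2"] bu(2)[of m] t by (auto simp: nA_def)
    then show ?thesis using False by (simp add: add_increasing2)
  qed
  have left: "nB \<beta> (x t) (m - 1) + (if 1 <= m then d (m - 1) else 0) <= V + ?u (3 * m)"
  proof (cases "1 <= m")
    case True
    have e: "3 * (m - 1) + 3 = 3 * m" by simp
    show ?thesis using True bu(1)[of "m - 1"] nA_nonneg[of "x t" "m - 1"] u[of "3 * m"]
      unfolding d_def e by (auto) (auto simp: nB_def intro: add_increasing2)
  next
    case False
    have "3 * (m - 1) + 2 < 0" "3 * (m - 1) + 1 < 0" using False by auto
    then have "nB \<beta> (x t) (m - 1) <= V" using big_u(2)[of t "3 * (m - 1) + 1"] big_u(2)[of t "3 * (m - 1) + 2"] bu(1)[of "m - 1"] t by (auto simp: nB_def)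
    then show ?thesis using False by (simp add: add_increasing2)
  qed
  have le: "(nB \<beta> (x t) (m - 1) - 2 * ?u (3 * m) + nA \<beta> (x t) m) + (if 0 <= m then d m else 0) + (if 1 <= m then d (m - 1) else 0) <= 2 * V"
    using left right by linarith
  show ?thesis by (rule exI, rule conjI, rule D, rule le)
qed

lemma neg_block:
  assumes "0 < t" "t < T" "t \<notin> F" "j < 0"
  shows "\<exists>D. ((%t. x t j) has_real_derivative D) (at t) \<and> D <= 2 * V"
proof -
  have t: "0 <= t" "t <= T" using assms by auto
  have *: "x t k powr (- \<beta>) <= V" if "k <= 0" for k using big_u(2)[of t k] t that by (cases "k = 0") auto
  have u: "0 <= x t k powr (- \<beta>)" for k by simp
  define m where "m = j div 3"
  have "j = 3 * m \<or> j = 3 * m + 1 \<or> j = 3 * m + 2" unfolding m_def by presburger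
  then consider "j = 3 * m" | "j = 3 * m + 1" | "j = 3 * m + 2" by blast
  then show ?thesis
  proof cases
    case 1
    show ?thesis
    proof (cases "\<bar>m\<bar> <= int N")
      case True
      have m0: "m <= -1" using 1 assms by auto
      have "nB \<beta> (x t) (m - 1) <= V" "nA \<beta> (x t) m <= V" using * m0 by (auto simp: nA_def nB_def)
      then have le: "nB \<beta> (x t) (m - 1) - 2 * x t (3 * m) powr (- \<beta>) + nA \<beta> (x t) m <= 2 * V"
        using u[of "3 * m"] by linarith
      show ?thesis unfolding 1 by (rule exI, rule conjI, rule D_big[OF assms(1-3) True], rule le)
    next
      case False
      then have "lap_sigma \<beta> (x t) j = 0" using zero[of t j] t 1 by (intro lap_sigma_dead) auto
      then show ?thesis using F(2)[OF assms(1,3), of j] V0 by (intro exI[of _ 0]) auto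
    qed
  next
    case 2
    have "3 * m + 2 <= 0" "3 * m + 3 <= 0" "3 * m <= 0" using 2 assms by presburger+
    then have "x t (3 * m) powr (- \<beta>) <= V" "x t (3 * m + 3) powr (- \<beta>) <= V" "x t (3 * m + 2) powr (- \<beta>) <= V"
      using * by auto
    note c = this
    show ?thesis unfolding 2
      by (intro exI conjI, rule D_small(1)[OF assms(1-3), of m]) (use c u[of "3 * m + 1"] V0 in \<open>auto; linarith\<close>)
  next
    case 3
    have "3 * m + 1 <= 0" "3 * m + 3 <= 0" "3 * m <= 0" using 3 assms by presburger+
    then have "x t (3 * m) powr (- \<beta>) <= V" "x t (3 * m + 3) powr (- \<beta>) <= V" "x t (3 * m + 1) powr (- \<beta>) <= V"
      using * by auto
    note c = this
    show ?thesis unfolding 3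
      by (intro exI conjI, rule D_small(2)[OF assms(1-3), of m]) (use c u[of "3 * m + 2"] V0 in \<open>auto; linarith\<close>)
  qed
qed

end

section \<open>Bounds and a modulus of continuity uniform in the number of pairs\<close>

lemma powr_superadd:
  fixes a b p :: real
  assumes "0 <= a" "0 <= b" "1 <= p"
  shows "a powr p + b powr p <= (a + b) powr p"
proof -
  have *: "u powr p = u * u powr (p - 1)" if "0 <= u" for u :: real
    using that powr_add[of u 1 "p - 1"] by simp
  have "a * a powr (p - 1) + b * b powr (p - 1) <= a * (a + b) powr (p - 1) + b * (a + b) powr (p - 1)"
    using assms by (intro add_mono mult_left_mono powr_mono2) auto
  then show ?thesis using assms by (simp add: * algebra_simps)
qed

context triple_flow
begin

lemma sites:
  obtains (neg) "j < 0" | (big) m where "j = 3 * m" "0 <= m" "m <= int N" | (small) m p where "m < N" "p = 1 \<or> p = 2" "j = 3 * int m + p"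
    | (void) "3 * int N < j"
proof -
  define m where "m = j div 3"
  have j: "j = 3 * m \<or> j = 3 * m + 1 \<or> j = 3 * m + 2" unfolding m_def by presburger
  consider "j < 0" | "0 <= j" "j <= 3 * int N" | "3 * int N < j" by linarith
  then show ?thesis
  proof cases
    case 2
    have m0: "0 <= m" using 2 by (simp add: m_def)
    then have mm: "int (nat m) = m" by simp
    show ?thesis
    proof (cases "j = 3 * m")
      case True
      then show ?thesis using big[of m] 2 m0 by auto
    next
      case False
      then have "m < int N" using j 2 by auto
      then have "nat m < N" using m0 by simp
      then show ?thesis using small[of "nat m" 1] small[of "nat m" 2] j False mm by auto
    qed
  qed (use neg void in auto)
qed

definition "blk m t = x t (3 * m) + (if 0 <= m then x t (3 * m + 1) + x t (3 * m + 2) else 0) +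
      (if 1 <= m then x t (3 * (m - 1) + 1) + x t (3 * (m - 1) + 2) else 0)" for m t

lemma blk_inc:
  assumes "\<bar>m\<bar> <= int N" "0 <= s" "s <= t" "t <= T"
  shows "blk m t - blk m s <= 2 * V * (t - s)"
proof (rule fe_le[OF F(1) assms(3)])
  show "continuous_on {s..t} (blk m)"
    unfolding blk_def using assms by (cases "0 <= m"; cases "1 <= m") (auto intro!: continuous_intros cont)
  show "\<exists>D. (blk m has_real_derivative D) (at \<tau>) \<and> D <= 2 * V" if "\<tau> \<in> {s<..<t} - F" for \<tau>
    unfolding blk_def using big_block[OF _ _ _ assms(1), of \<tau>] that assms by auto
qed

lemma neg_inc:
  assumes "j < 0" "0 <= s" "s <= t" "t <= T"
  shows "x t j - x s j <= 2 * V * (t - s)"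
  using assms by (intro fe_le[OF F(1)] cont neg_block) auto

lemma small_inc:
  assumes "m < N" "0 <= s" "s <= t" "t <= T"
  shows "(x t (3 * int m + 1) + x t (3 * int m + 2)) - (x s (3 * int m + 1) + x s (3 * int m + 2)) <= 2 * V * (t - s)"
proof -
  have "0 <= 2 * V * (t - s)" using assms by simp
  then show ?thesis using pair_sum(1)[OF assms] by linarith
qed

text \<open>A large particle is bounded together with its pairs: \<open>5 / 4\<close> initially, at
  most \<open>1 / 8\<close> for each of two pairs, and an increase of at most
  \<open>1 / 4\<close>.\<close>

lemma upper:
  assumes t: "0 <= t" "t <= T"
  shows "x t j <= 2"
proof -
  have VT: "2 * V * t <= 1 / 4"
  proof -
    have "2 * V * t <= 2 * V * T" using t by (intro mult_left_mono) auto
    then show ?thesis using T_small(2) by linarith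
  qed
  show ?thesis
  proof (cases rule: sites[of j])
    case neg
    have "x 0 j <= 5 / 4" using big0[of j] triple_flow.void[OF triple_flow_axioms, of j] neg by (cases "\<bar>j\<bar> <= 3 * int N") auto
    then show ?thesis using neg_inc[of j 0 t] neg t VT by simp
  next
    case (big m)
    have p: "x s (3 * k + 1) + x s (3 * k + 2) <= 1 / 8" if "0 <= k" "0 <= s" "s <= T" for k s
    proof (cases "k < int N")
      case True
      then have "nat k < N" "int (nat k) = k" using that by auto
      then show ?thesis using pair_sum(2)[of "nat k" s s] r_small(1)[of "nat k"] that by simp
    next
      case False
      then show ?thesis using zero[of s "3 * k + 1"] zero[of s "3 * k + 2"] that by simp
    qed
    have "blk m 0 <= 5 / 4 + 1 / 8 + 1 / 8"
      using p[of m 0] p[of "m - 1" 0] big0[of "3 * m"] big T0 unfolding blk_def by auto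
    moreover have "x t (3 * m) <= blk m t" using nn[OF t(1)] by (simp add: blk_def)
    ultimately show ?thesis using blk_inc[of m 0 t] big t VT by simp
  next
    case (small m p)
    have "x t (3 * int m + 1) + x t (3 * int m + 2) <= 3 * r m" using pair_sum(2)[of m t t] small t by simp
    then show ?thesis using small nn[OF t(1), of "3 * int m + 1"] nn[OF t(1), of "3 * int m + 2"] r_small(1)[of m] by auto
  next
    case void
    then show ?thesis using zero[of t j] void t by simp
  qed
qed

text \<open>For nonnegative \<open>h\<close> the value \<open>c = H h\<close> solves
  \<open>c powr (\<beta> + 1) = 2 * (\<beta> + 1) * h\<close>; by \<open>lower\<close> and
  superadditivity it is the largest possible drop of a size in time \<open>h\<close>.\<close>

definition "H h = (2 * (\<beta> + 1) * h) powr (1 / (\<beta> + 1))" for h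

lemma dec:
  assumes "0 <= s" "s <= t"
  shows "x s j - H (t - s) <= x t j"
proof -
  have b: "1 <= \<beta> + 1" using \<beta> by simp
  define c where "c = H (t - s)"
  have c0: "0 <= c" by (simp add: c_def H_def)
  have cb: "c powr (\<beta> + 1) = 2 * (\<beta> + 1) * (t - s)"
    using assms \<beta> by (simp add: c_def H_def powr_powr)
  have n: "0 <= x t j" "0 <= x s j" using nn assms by auto
  show ?thesis
  proof (rule ccontr)
    assume "\<not> ?thesis"
    then have lt: "x t j + c < x s j" by (simp add: c_def)
    have "x t j powr (\<beta> + 1) + c powr (\<beta> + 1) <= (x t j + c) powr (\<beta> + 1)"
      using n c0 b by (intro powr_superadd)
    also have "\<dots> < x s j powr (\<beta> + 1)" using lt n c0 \<beta> by (intro powr_less_mono2) auto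
    finally show False using lower[OF assms, of j] cb by simp
  qed
qed

text \<open>A large particle can rise quickly by absorbing a pair, but its block rises slowly, so
  the rise is bounded by the decrease of the four adjacent pair particles, each controlled by
  \<open>H\<close>.\<close>

lemma modulus:
  assumes "0 <= s" "s <= t" "t <= T"
  shows "\<bar>x t j - x s j\<bar> <= 2 * V * (t - s) + 4 * H (t - s)"
proof -
  have H0: "0 <= H (t - s)" by (simp add: H_def)
  have V0': "0 <= 2 * V * (t - s)" using assms by simp
  have d: "x s k - x t k <= H (t - s)" for k using dec[OF assms(1,2), of k] by simp
  have "x t j - x s j <= 2 * V * (t - s) + 4 * H (t - s)"
  proof (cases rule: sites[of j])
    case neg
    then show ?thesis using neg_inc[of j s t] neg assms H0 by simp
  next
    case (big m)
    have "x t (3 * m) - x s (3 * m) <= (blk m t - blk m s) + 4 * H (t - s)"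
      using d[of "3 * m + 1"] d[of "3 * m + 2"] d[of "3 * (m - 1) + 1"] d[of "3 * (m - 1) + 2"] H0
      unfolding blk_def by (auto simp del: One_nat_def)
    then show ?thesis using blk_inc[of m s t] big assms by simp
  next
    case (small m p)
    then show ?thesis using small_inc[of m s t] small d[of "3 * int m + 1"] d[of "3 * int m + 2"] assms H0 by auto
  next
    case void
    then show ?thesis using zero[of t j] zero[of s j] void assms H0 V0' by simp
  qed
  moreover have "x s j - x t j <= 2 * V * (t - s) + 4 * H (t - s)" using d[of j] H0 V0' by linarith
  ultimately show ?thesis by (simp add: abs_le_iff)
qed

lemma small_extinct:
  assumes "m < N" "j = 3 * int m + 1 \<or> j = 3 * int m + 2" "0 <= s" "x s j <= \<eta>" "0 < \<eta>"
    "2 * V <= (4 * \<eta>) powr (- \<beta>)" "V <= (1 - (1 + 1 / 2) powr (- \<beta>)) * (2 * \<eta>) powr (- \<beta>)"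
    "s + (3 * \<eta>) powr (\<beta> + 1) / (\<beta> + 1) <= t" "t <= T"
  shows "x t j = 0"
proof -
  interpret p: pair_system \<beta> V T F "%t. x t (3 * int m + 1)" "%t. x t (3 * int m + 2)"
    "%t. x t (3 * int m) powr (- \<beta>)" "%t. x t (3 * int m + 3) powr (- \<beta>)" by (rule pair[OF assms(1)])
  interpret q: pair_system \<beta> V T F "%t. x t (3 * int m + 2)" "%t. x t (3 * int m + 1)"
    "%t. x t (3 * int m + 3) powr (- \<beta>)" "%t. x t (3 * int m) powr (- \<beta>)" by (rule p.swap)
  show ?thesis using assms(2)
  proof
    assume "j = 3 * int m + 1"
    then show ?thesis using p.small_dies[of s \<eta> t] assms by auto
  next
    assume "j = 3 * int m + 2"
    then show ?thesis using q.small_dies[of s \<eta> t] assms by auto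
  qed
qed

end

section \<open>Compactness\<close>

text \<open>On configurations the right-hand side at \<open>j\<close> involves only sites within
  distance 3, so it varies continuously with the powers as long as none of these sites dies.\<close>

lemma lap_local:
  assumes c: "config y" "config y'" and al: "!!i. \<bar>i - j\<bar> <= 3 ==> 0 < y i \<longleftrightarrow> 0 < y' i"
    and C: "!!i. \<bar>i - j\<bar> <= 3 ==> \<bar>y i powr (- \<beta>) - y' i powr (- \<beta>)\<bar> <= C"
  shows "\<bar>lap_sigma \<beta> y j - lap_sigma \<beta> y' j\<bar> <= 4 * C"
proof (cases "0 < y j")
  case False
  then have "\<not> 0 < y' j" using al[of j] by simp
  moreover have "0 <= C" using C[of j] by simp
  ultimately show ?thesis using False by (simp add: lap_sigma_dead)
next
  case True
  then have True': "0 < y' j" using al[of j] by simp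
  define m where "m = j div 3"
  have "j = 3 * m \<or> j = 3 * m + 1 \<or> j = 3 * m + 2" unfolding m_def by presburger
  then consider "j = 3 * m" | "j = 3 * m + 1" | "j = 3 * m + 2" by blast
  then show ?thesis
  proof cases
    case 1
    have a: "\<bar>nA \<beta> y m - nA \<beta> y' m\<bar> <= C"
      using al[of "3 * m + 1"] al[of "3 * m + 2"] C[of "3 * m + 1"] C[of "3 * m + 2"] C[of "3 * m + 3"] 1
      by (simp add: nA_def)
    have b: "\<bar>nB \<beta> y (m - 1) - nB \<beta> y' (m - 1)\<bar> <= C"
      using al[of "3 * (m - 1) + 1"] al[of "3 * (m - 1) + 2"] C[of "3 * (m - 1) + 1"] C[of "3 * (m - 1) + 2"] C[of "3 * (m - 1)"] 1
      by (simp add: nB_def)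
    have e: "\<bar>y (3 * m) powr (- \<beta>) - y' (3 * m) powr (- \<beta>)\<bar> <= C" using C[of j] 1 by simp
    show ?thesis using a b e lap_big[OF c(1), of m \<beta>] lap_big[OF c(2), of m \<beta>] True True' unfolding 1 by linarith
  next
    case 2
    have "\<bar>y (3 * m) powr (- \<beta>) - y' (3 * m) powr (- \<beta>)\<bar> <= C" "\<bar>y (3 * m + 1) powr (- \<beta>) - y' (3 * m + 1) powr (- \<beta>)\<bar> <= C"
      "\<bar>y (3 * m + 2) powr (- \<beta>) - y' (3 * m + 2) powr (- \<beta>)\<bar> <= C" "\<bar>y (3 * m + 3) powr (- \<beta>) - y' (3 * m + 3) powr (- \<beta>)\<bar> <= C"
      using C[of "3 * m"] C[of "3 * m + 1"] C[of "3 * m + 2"] C[of "3 * m + 3"] 2 by simp_all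
    moreover have "0 < y (3 * m + 2) \<longleftrightarrow> 0 < y' (3 * m + 2)" using al[of "3 * m + 2"] 2 by simp
    ultimately show ?thesis
      unfolding 2
      by (cases "0 < y (3 * m + 2)"; simp add: lap_1[OF c(1) True[unfolded 2]] lap_1[OF c(2) True'[unfolded 2]]; linarith)
  next
    case 3
    have "\<bar>y (3 * m) powr (- \<beta>) - y' (3 * m) powr (- \<beta>)\<bar> <= C" "\<bar>y (3 * m + 1) powr (- \<beta>) - y' (3 * m + 1) powr (- \<beta>)\<bar> <= C"
      "\<bar>y (3 * m + 2) powr (- \<beta>) - y' (3 * m + 2) powr (- \<beta>)\<bar> <= C" "\<bar>y (3 * m + 3) powr (- \<beta>) - y' (3 * m + 3) powr (- \<beta>)\<bar> <= C"
      using C[of "3 * m"] C[of "3 * m + 1"] C[of "3 * m + 2"] C[of "3 * m + 3"] 3 by simp_all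
    moreover have "0 < y (3 * m + 1) \<longleftrightarrow> 0 < y' (3 * m + 1)" using al[of "3 * m + 1"] 3 by simp
    ultimately show ?thesis
      unfolding 3
      by (cases "0 < y (3 * m + 1)"; simp add: lap_2[OF c(1) True[unfolded 3]] lap_2[OF c(2) True'[unfolded 3]]; linarith)
  qed
qed

text \<open>Arzela-Ascoli at each site, by the uniform \<open>modulus\<close>, and a diagonal
  sequence over the countably many sites.\<close>

lemma subseq_limit:
  assumes tf: "!!n. triple_flow \<beta> r (N n) T (S n) (x n)"
  obtains k X where "strict_mono (k :: nat => nat)"
    "!!j. uniform_limit {0..T} (%n t. x (k n) t j) (%t. X t j) sequentially"
proof -
  define P where "P i s \<longleftrightarrow> (\<exists>g. uniform_limit {0..T} (%n t. x (s n) t (from_nat i)) g sequentially)" for i and s :: "nat => nat"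
  interpret subseqs P
  proof
    fix i and s :: "nat => nat" assume "strict_mono s"
    define j :: int where "j = from_nat i"
    define V where "V = 2 powr \<beta>"
    define h where "h d = (2 * (\<beta> + 1) * d) powr (1 / (\<beta> + 1))" for d
    have \<beta>: "0 < \<beta>" using tf[of 0] by (simp add: triple_flow_def)
    have mod: "\<bar>x n t j - x n u j\<bar> <= 2 * V * \<bar>t - u\<bar> + 4 * h \<bar>t - u\<bar>" if "t \<in> {0..T}" "u \<in> {0..T}" for n t u
    proof -
      interpret triple_flow \<beta> r "N n" T "S n" "x n" by (rule tf)
      show ?thesis using modulus[of u t j] modulus[of t u j] that
        by (cases "u <= t") (auto simp: H_def h_def V_def abs_minus_commute)
    qed
    have lim: "((%d. 2 * V * d + 4 * h d) \<longlongrightarrow> 0) (at_right 0)"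
    proof -
      have "((%d. h d) \<longlongrightarrow> (2 * (\<beta> + 1) * 0) powr (1 / (\<beta> + 1))) (at_right 0)"
        unfolding h_def using \<beta>
        by (intro tendsto_powr' tendsto_intros) (auto simp: eventually_at_right_field intro!: exI[of _ 1])
      then have "((%d. 2 * V * d + 4 * h d) \<longlongrightarrow> 2 * V * 0 + 4 * 0) (at_right 0)"
        by (intro tendsto_intros) simp_all
      then show ?thesis by simp
    qed
    obtain g k where g: "strict_mono (k :: nat => nat)"
      "!!e. 0 < e ==> \<exists>N. \<forall>n t. n \<ge> N \<and> t \<in> {0..T} --> norm (x (s (k n)) t j - g t) < e"
    proof (rule Arzela_Ascoli[of "{0..T}" "%n t. x (s n) t j" 2])
      fix n t assume "t \<in> {0..T}"
      interpret triple_flow \<beta> r "N (s n)" T "S (s n)" "x (s n)" by (rule tf)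
      show "norm (x (s n) t j) <= 2" using upper[of t j] nn[of t j] \<open>t \<in> {0..T}\<close> by simp
    next
      fix t e :: real assume t: "t \<in> {0..T}" and e: "0 < e"
      obtain b where b: "0 < b" "!!d. 0 < d ==> d < b ==> 2 * V * d + 4 * h d < e"
        using order_tendstoD(2)[OF lim e] by (auto simp: eventually_at_right_field)
      show "\<exists>d>0. \<forall>n u. u \<in> {0..T} \<and> norm (t - u) < d --> norm (x (s n) t j - x (s n) u j) < e"
      proof (intro exI[of _ b] conjI allI impI)
        fix n u assume u: "u \<in> {0..T} \<and> norm (t - u) < b"
        show "norm (x (s n) t j - x (s n) u j) < e"
        proof (cases "t = u")
          case False
          then show ?thesis using mod[OF t, of u "s n"] b(2)[of "\<bar>t - u\<bar>"] u by auto
        qed (use e in simp)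
      qed (rule b(1))
    qed auto
    have "P i (s \<circ> k)"
      unfolding P_def uniform_limit_iff eventually_sequentially
    proof (intro exI[of _ g] allI impI)
      fix e :: real assume "0 < e"
      from g(2)[OF this] obtain M where "!!n t. n \<ge> M ==> t \<in> {0..T} ==> norm (x (s (k n)) t j - g t) < e" by blast
      then show "\<exists>N. \<forall>n\<ge>N. \<forall>t\<in>{0..T}. dist (x ((s \<circ> k) n) t (from_nat i)) (g t) < e"
        by (intro exI[of _ M]) (simp add: dist_norm j_def)
    qed
    then show "\<exists>r'. strict_mono r' \<and> P i (s \<circ> r')" using g(1) by blast
  qed
  have "P i (diagseq \<circ> (+) (Suc i))" for i
  proof (rule diagseq_holds)
    fix r s :: "nat => nat" and i assume r: "strict_mono r" and "P i s"
    then obtain g where g: "uniform_limit {0..T} (%n t. x (s n) t (from_nat i)) g sequentially" by (auto simp: P_def)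
    have "uniform_limit {0..T} (%n t. x (s (r n)) t (from_nat i)) g sequentially"
      using filterlim_compose[OF g filterlim_subseq[OF r]] by (simp add: o_def)
    then show "P i (s \<circ> r)" by (auto simp: P_def o_def)
  qed
  \<comment> \<open>The property is available for the diagonal sequence only from index
    \<open>Suc i\<close> on; an initial segment does not affect the limit.\<close>
  then have "\<exists>g. uniform_limit {0..T} (%n t. x (diagseq n) t (from_nat i)) g sequentially" for i
  proof -
    obtain g where g: "uniform_limit {0..T} (%n t. x (diagseq (Suc i + n)) t (from_nat i)) g sequentially"
      using \<open>!!i. P i (diagseq \<circ> (+) (Suc i))\<close>[of i] by (auto simp: P_def o_def)
    have "uniform_limit {0..T} (%n t. x (diagseq n) t (from_nat i)) g sequentially"
      unfolding uniform_limit_iff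
    proof (intro allI impI)
      fix e :: real assume "0 < e"
      from uniform_limitD[OF g this]
      have "\<forall>\<^sub>F n in sequentially. \<forall>t\<in>{0..T}. dist (x (diagseq (n + Suc i)) t (from_nat i)) (g t) < e" by (simp add: add.commute)
      then show "\<forall>\<^sub>F n in sequentially. \<forall>t\<in>{0..T}. dist (x (diagseq n) t (from_nat i)) (g t) < e"
        by (subst (asm) eventually_sequentially_seg)
    qed
    then show ?thesis by blast
  qed
  then obtain g where g: "!!i. uniform_limit {0..T} (%n t. x (diagseq n) t (from_nat i)) (g i) sequentially" by metis
  show ?thesis
  proof (rule that[of diagseq "%t j. g (to_nat j) t"])
    show "strict_mono diagseq" by (rule subseq_diagseq)
    show "uniform_limit {0..T} (%n t. x (diagseq n) t j) (%t. g (to_nat j) t) sequentially" for j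
      using g[of "to_nat j"] by simp
  qed
qed

section \<open>Limits of flows\<close>

lemma small_size_exists:
  fixes \<beta> :: real
  assumes "0 < \<beta>" "0 < c" "0 < V"
  obtains \<eta> where "0 < \<eta>" "2 * V <= (4 * \<eta>) powr (- \<beta>)" "V <= (1 - (1 + 1 / 2) powr (- \<beta>)) * (2 * \<eta>) powr (- \<beta>)"
    "(3 * \<eta>) powr (\<beta> + 1) / (\<beta> + 1) <= c"
proof -
  define k where "k = 1 - (1 + 1 / 2 :: real) powr (- \<beta>)"
  have "(1 + 1 / 2 :: real) powr (- \<beta>) < (1 + 1 / 2) powr 0" using assms by (intro powr_less_mono) auto
  then have k: "0 < k" by (simp add: k_def)
  have "filterlim (%\<eta>. (4 * \<eta>) powr (- \<beta>)) at_top (at_right 0)" using assms by real_asymp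
  then have a: "\<forall>\<^sub>F \<eta> in at_right 0. 2 * V <= (4 * \<eta>) powr (- \<beta>)" by (simp add: filterlim_at_top)
  have "filterlim (%\<eta>. (2 * \<eta>) powr (- \<beta>)) at_top (at_right 0)" using assms by real_asymp
  then have "\<forall>\<^sub>F \<eta> in at_right 0. V / k <= (2 * \<eta>) powr (- \<beta>)" by (simp add: filterlim_at_top)
  then have b: "\<forall>\<^sub>F \<eta> in at_right 0. V <= k * (2 * \<eta>) powr (- \<beta>)"
    by eventually_elim (use k in \<open>simp add: pos_divide_le_eq mult.commute\<close>)
  have "((%\<eta>. (3 * \<eta>) powr (\<beta> + 1) / (\<beta> + 1)) \<longlongrightarrow> 0) (at_right 0)" using assms by real_asymp
  then have "\<forall>\<^sub>F \<eta> in at_right 0. (3 * \<eta>) powr (\<beta> + 1) / (\<beta> + 1) < c" using assms by (intro order_tendstoD(2))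
  then have "\<forall>\<^sub>F \<eta> in at_right 0. 0 < \<eta> \<and> 2 * V <= (4 * \<eta>) powr (- \<beta>) \<and> V <= k * (2 * \<eta>) powr (- \<beta>) \<and>
      (3 * \<eta>) powr (\<beta> + 1) / (\<beta> + 1) <= c"
    using a b eventually_at_right_less[of 0] by eventually_elim auto
  then obtain \<eta> where "0 < \<eta> \<and> 2 * V <= (4 * \<eta>) powr (- \<beta>) \<and> V <= k * (2 * \<eta>) powr (- \<beta>) \<and>
      (3 * \<eta>) powr (\<beta> + 1) / (\<beta> + 1) <= c"
    by (metis (no_types, lifting) eventually_happens' trivial_limit_at_right_real)
  then show ?thesis using that by (auto simp: k_def)
qed

text \<open>\<open>N_dich\<close> admits both uses: a fixed number of pairs while they are tuned,
  and \<open>N n\<close> tending to infinity for the final limit.\<close>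

locale limit_flow =
  fixes \<beta> :: real and r :: "nat => real" and N :: "nat => nat" and T :: real and S :: "nat => int set"
    and x :: "nat => real => int => real" and X :: "real => int => real"
  assumes tf: "!!n. triple_flow \<beta> r (N n) T (S n) (x n)"
    and ul: "!!j. uniform_limit {0..T} (%n t. x n t j) (%t. X t j) sequentially"
    and N_dich: "!!m. eventually (%n. m < N n) sequentially \<or> eventually (%n. N n <= m) sequentially"
begin

lemma \<beta>: "0 < \<beta>" and T0: "0 < T"
  using triple_flow.\<beta>[OF tf[of 0]] triple_flow.T0[OF tf[of 0]] by auto

lemma conv: "0 <= t ==> t <= T ==> (%n. x n t j) \<longlonglongrightarrow> X t j"
  using tendsto_uniform_limitI[OF ul[of j], of t] by simp

lemma X_bounds:
  assumes "0 <= t" "t <= T"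
  shows "0 <= X t j" "X t j <= 2"
proof -
  show "0 <= X t j" using triple_flow.nn[OF tf] assms by (intro LIMSEQ_le_const[OF conv[OF assms]]) auto
  show "X t j <= 2" using triple_flow.upper[OF tf] assms by (intro LIMSEQ_le_const2[OF conv[OF assms]]) auto
qed

lemma X_cont: "continuous_on {0..T} (%t. X t j)"
  using triple_flow.cont[OF tf, of 0] by (intro uniform_limit_theorem[OF _ ul]) auto

lemma X_dead_lim:
  assumes "0 <= t" "t <= T" "eventually (%n. x n t j = 0) sequentially"
  shows "X t j = 0"
proof -
  have "(%n. x n t j) \<longlonglongrightarrow> 0" by (rule tendsto_eventually[OF assms(3)])
  then show ?thesis using conv[OF assms(1,2)] LIMSEQ_unique by blast
qed

lemma X_sites:
  obtains (big) "!!t. 0 <= t ==> t <= T ==> 1 / 2 <= X t j" "j mod 3 = 0 \<or> j < 0"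
    | (void) "eventually (%n. 3 * int (N n) < \<bar>j\<bar>) sequentially"
    | (small) m where "j = 3 * int m + 1 \<or> j = 3 * int m + 2" "eventually (%n. m < N n) sequentially"
proof (cases "j mod 3 = 0 \<or> j < 0")
  case True
  show ?thesis
  proof (cases "j = 0")
    case True
    show ?thesis
    proof (rule big)
      fix t assume "0 <= t" "t <= T"
      then show "1 / 2 <= X t j"
        using triple_flow.big_ge[OF tf] True by (intro LIMSEQ_le_const[OF conv]) auto
    qed (use True in auto)
  next
    case False
    define m where "m = nat ((\<bar>j\<bar> - 1) div 3)"
    have le: "\<bar>j\<bar> <= 3 * int M \<longleftrightarrow> m < M" for M using False unfolding m_def by auto
    from N_dich[of m] show ?thesis
    proof
      assume ev: "eventually (%n. m < N n) sequentially"
      show ?thesis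
      proof (rule big)
        fix t assume t: "0 <= t" "t <= T"
        have "eventually (%n. 1 / 2 <= x n t j) sequentially"
          using ev by eventually_elim (use triple_flow.big_ge[OF tf] t le \<open>j mod 3 = 0 \<or> j < 0\<close> in auto)
        then show "1 / 2 <= X t j" using conv[OF t] tendsto_lowerbound trivial_limit_sequentially by blast
      qed (rule \<open>j mod 3 = 0 \<or> j < 0\<close>)
    next
      assume ev: "eventually (%n. N n <= m) sequentially"
      show ?thesis
      proof (rule void)
        show "eventually (%n. 3 * int (N n) < \<bar>j\<bar>) sequentially"
          using ev by eventually_elim (metis le not_le)
      qed
    qed
  qed
next
  case False
  define m where "m = nat (j div 3)"
  have j0: "0 <= j" "j mod 3 \<noteq> 0" using False by auto
  then have "int m = j div 3" by (simp add: m_def)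
  moreover have "j = 3 * (j div 3) + 1 \<or> j = 3 * (j div 3) + 2" using j0 by presburger
  ultimately have j: "j = 3 * int m + 1 \<or> j = 3 * int m + 2" by simp
  from N_dich[of m] show ?thesis
  proof
    assume "eventually (%n. m < N n) sequentially"
    then show ?thesis using small j by blast
  next
    assume ev: "eventually (%n. N n <= m) sequentially"
    show ?thesis
    proof (rule void)
      show "eventually (%n. 3 * int (N n) < \<bar>j\<bar>) sequentially"
        using ev by eventually_elim (use j in auto)
    qed
  qed
qed

lemma void_zero: "eventually (%n. 3 * int (N n) < \<bar>j\<bar>) sequentially ==> 0 <= t ==> t <= T ==> X t j = 0"
  by (rule X_dead_lim) (auto elim!: eventually_mono intro: triple_flow.zero[OF tf])

text \<open>If the limit is dead at \<open>s\<close>, the approximating particles are small at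
  \<open>s\<close>, and \<open>small_extinct\<close> kills them before \<open>t\<close>, uniformly
  in \<open>n\<close>.\<close>

lemma extinct_after:
  assumes "0 <= s" "s < t" "t <= T" "X s j = 0"
  shows "eventually (%n. \<forall>\<tau>. t <= \<tau> \<and> \<tau> <= T --> x n \<tau> j = 0) sequentially"
proof (cases rule: X_sites[of j])
  case big
  then show ?thesis using assms by force
next
  case void
  then show ?thesis by eventually_elim (use assms in \<open>auto intro!: triple_flow.zero[OF tf]\<close>)
next
  case (small m)
  obtain \<eta> where \<eta>: "0 < \<eta>" "2 * 2 powr \<beta> <= (4 * \<eta>) powr (- \<beta>)" "2 powr \<beta> <= (1 - (1 + 1 / 2) powr (- \<beta>)) * (2 * \<eta>) powr (- \<beta>)"
    "(3 * \<eta>) powr (\<beta> + 1) / (\<beta> + 1) <= t - s"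
    using small_size_exists[OF \<beta>, of "t - s" "2 powr \<beta>"] assms by auto
  have "eventually (%n. x n s j < \<eta>) sequentially"
    using conv[of s j] assms \<eta>(1) by (intro order_tendstoD(2)) auto
  then show ?thesis using small(2)
  proof eventually_elim
    case (elim n)
    show ?case
    proof (intro allI impI)
      fix \<tau> assume "t <= \<tau> \<and> \<tau> <= T"
      then show "x n \<tau> j = 0"
        using triple_flow.small_extinct[OF tf elim(2) small(1) assms(1) less_imp_le[OF elim(1)] \<eta>(1-3)] \<eta>(4) by auto
    qed
  qed
qed

lemma X_dead:
  assumes "0 <= s" "s <= t" "t <= T" "X s j = 0"
  shows "X t j = 0"
proof (cases "s = t")
  case False
  then have "eventually (%n. \<forall>\<tau>. t <= \<tau> \<and> \<tau> <= T --> x n \<tau> j = 0) sequentially"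
    using assms by (intro extinct_after) auto
  then show ?thesis using assms by (intro X_dead_lim) (auto elim!: eventually_mono)
qed (use assms in auto)

lemma X_config: "0 <= t ==> t <= T ==> config (X t)"
  unfolding config_def
proof (intro conjI allI)
  fix m assume t: "0 <= t" "t <= T"
  show "0 < X t (3 * m) \<or> (\<forall>j\<ge>3 * m - 2. X t j = 0) \<or> (\<forall>j\<le>3 * m + 2. X t j = 0)"
  proof (cases rule: X_sites[of "3 * m"])
    case big
    then show ?thesis using t by force
  next
    case void
    show ?thesis
    proof (cases "0 <= m")
      case True
      have "X t j = 0" if "3 * m - 2 <= j" for j
        by (rule void_zero[OF _ t]) (use void in eventually_elim, use True that in presburger)
      then show ?thesis by blast
    next
      case False
      have "X t j = 0" if "j <= 3 * m + 2" for j
        by (rule void_zero[OF _ t]) (use void in eventually_elim, use False that in presburger)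
      then show ?thesis by blast
    qed
  next
    case (small k)
    from small(1) have False by presburger
    then show ?thesis ..
  qed
qed (rule X_bounds)

text \<open>Serves as an exceptional time. If \<open>j\<close> does not die on
  \<open>{0..T}\<close>, this is the infimum of the empty set, some fixed number whose exclusion
  does no harm.\<close>

definition "death j = Inf {t \<in> {0..T}. X t j = 0}" for j

lemma near:
  assumes t: "0 < t" "t < T" "0 < \<delta>"
  shows "\<exists>e>0. \<exists>n0. \<forall>n\<ge>n0. \<forall>\<tau>. \<bar>\<tau> - t\<bar> <= e --> 0 < \<tau> \<and> \<tau> < T \<and> \<bar>x n \<tau> j - X t j\<bar> <= \<delta>"
proof -
  have d2: "0 < \<delta> / 2" using t by simp
  obtain n0 where n0: "!!n \<tau>. n \<ge> n0 ==> \<tau> \<in> {0..T} ==> \<bar>x n \<tau> j - X \<tau> j\<bar> < \<delta> / 2"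
    using uniform_limitD[OF ul[of j] d2] unfolding eventually_sequentially dist_real_def by blast
  obtain e where e: "e > 0" "!!\<tau>. \<tau> \<in> {0..T} ==> \<bar>\<tau> - t\<bar> < e ==> \<bar>X \<tau> j - X t j\<bar> < \<delta> / 2"
    using X_cont[of j] t d2 unfolding continuous_on_iff by (metis atLeastAtMost_iff dist_real_def less_imp_le)
  show ?thesis
  proof (rule exI[of _ "min (e / 2) (min (t / 2) ((T - t) / 2))"], intro conjI exI[of _ n0] allI impI)
    show "0 < min (e / 2) (min (t / 2) ((T - t) / 2))" using e t by simp
    fix n \<tau> assume n: "n \<ge> n0" and \<tau>: "\<bar>\<tau> - t\<bar> <= min (e / 2) (min (t / 2) ((T - t) / 2))"
    have "\<bar>\<tau> - t\<bar> <= t / 2" "\<bar>\<tau> - t\<bar> <= (T - t) / 2" using \<tau> by simp_all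
    then show a: "0 < \<tau>" "\<tau> < T" using t unfolding diff_divide_distrib abs_le_iff by linarith+
    show "\<bar>x n \<tau> j - X t j\<bar> <= \<delta>"
    proof -
      have "\<tau> \<in> {0..T}" "\<bar>\<tau> - t\<bar> <= e / 2" using a \<tau> by auto
      then show ?thesis using n0[OF n, of \<tau>] e(2)[of \<tau>] e(1) by linarith
    qed
  qed
qed

text \<open>Near a time at which \<open>j\<close> lives the sizes stay away from zero, where the
  power is continuous. If \<open>j\<close> died earlier, it is dead in all late approximations by
  \<open>extinct_after\<close>. Only at the death time itself may the powers fail to
  converge.\<close>

lemma local_stable:
  assumes t: "0 < t" "t < T" "t \<noteq> death j" and \<epsilon>: "0 < \<epsilon>"
  shows "\<exists>e>0. \<exists>n0. \<forall>n\<ge>n0. \<forall>\<tau>. \<bar>\<tau> - t\<bar> <= e --> 0 < \<tau> \<and> \<tau> < T \<and>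
     (0 < x n \<tau> j \<longleftrightarrow> 0 < X t j) \<and> \<bar>x n \<tau> j powr (- \<beta>) - X t j powr (- \<beta>)\<bar> <= \<epsilon>"
proof (cases "0 < X t j")
  case True
  have "isCont (%a. a powr (- \<beta>)) (X t j)" using True by (intro continuous_intros) auto
  then obtain d where d: "d > 0" "!!a. \<bar>a - X t j\<bar> < d ==> \<bar>a powr (- \<beta>) - X t j powr (- \<beta>)\<bar> < \<epsilon>"
    using \<epsilon> unfolding continuous_at_eps_delta dist_real_def by (metis dist_real_def)
  obtain e n0 where e: "e > 0" "!!n \<tau>. n \<ge> n0 ==> \<bar>\<tau> - t\<bar> <= e ==> 0 < \<tau> \<and> \<tau> < T \<and> \<bar>x n \<tau> j - X t j\<bar> <= min (d / 2) (X t j / 2)"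
    using near[OF t(1,2), of "min (d / 2) (X t j / 2)" j] d(1) True by auto
  show ?thesis
  proof (rule exI[of _ e], intro conjI exI[of _ n0] allI impI)
    fix n \<tau> assume a: "n \<ge> n0" "\<bar>\<tau> - t\<bar> <= e"
    note b = e(2)[OF a]
    show "0 < \<tau>" "\<tau> < T" using b by auto
    have "X t j / 2 <= x n \<tau> j" using b by linarith
    then show "0 < x n \<tau> j \<longleftrightarrow> 0 < X t j" using True by simp
    show "\<bar>x n \<tau> j powr (- \<beta>) - X t j powr (- \<beta>)\<bar> <= \<epsilon>" using d(2)[of "x n \<tau> j"] b d(1) by auto
  qed (rule e)
next
  case False
  then have zero: "X t j = 0" using X_bounds(1)[of t j] t by simp
  let ?Z = "{t \<in> {0..T}. X t j = 0}"
  have bd: "bdd_below ?Z" by (auto intro!: bdd_belowI)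
  have "death j <= t" unfolding death_def using zero t by (intro cInf_lower bd) auto
  then have "death j < t" using t by simp
  then obtain s where s: "0 <= s" "s < t" "X s j = 0"
    unfolding death_def using cInf_lessD[of ?Z t] zero t by (metis (mono_tags, lifting) atLeastAtMost_iff empty_iff less_imp_le mem_Collect_eq)
  define e where "e = min ((t - s) / 2) (min (t / 2) ((T - t) / 2))"
  have "eventually (%n. \<forall>\<tau>. t - (t - s) / 2 <= \<tau> \<and> \<tau> <= T --> x n \<tau> j = 0) sequentially"
    using s t by (intro extinct_after[of s]) (auto simp: field_simps)
  then obtain n0 where n0: "!!n \<tau>. n \<ge> n0 ==> t - (t - s) / 2 <= \<tau> ==> \<tau> <= T ==> x n \<tau> j = 0"
    by (auto simp: eventually_sequentially)
  show ?thesis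
  proof (rule exI[of _ e], intro conjI exI[of _ n0] allI impI)
    show "0 < e" using s t by (simp add: e_def)
    fix n \<tau> assume a: "n \<ge> n0" "\<bar>\<tau> - t\<bar> <= e"
    have "\<bar>\<tau> - t\<bar> <= t / 2" "\<bar>\<tau> - t\<bar> <= (T - t) / 2" "\<bar>\<tau> - t\<bar> <= (t - s) / 2" using a(2) by (simp_all add: e_def)
    then have b: "0 < \<tau>" "\<tau> < T" "t - (t - s) / 2 <= \<tau>" using t unfolding diff_divide_distrib abs_le_iff by linarith+
    then show "0 < \<tau>" "\<tau> < T" by auto
    have c: "x n \<tau> j = 0" using n0[OF a(1) b(3)] b by simp
    show "0 < x n \<tau> j \<longleftrightarrow> 0 < X t j" "\<bar>x n \<tau> j powr (- \<beta>) - X t j powr (- \<beta>)\<bar> <= \<epsilon>"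
      using c zero \<epsilon> by auto
  qed
qed

text \<open>Increments of \<open>x n\<close> are estimated over a short interval on which the
  right-hand side is within \<open>\<epsilon>\<close> of the limiting one, and then \<open>n\<close>
  tends to infinity in the increments. This avoids limits of integrals of singular powers.\<close>

lemma X_deriv:
  assumes t: "0 < t" "t < T" and nd: "!!i. \<bar>i - j\<bar> <= 3 ==> t \<noteq> death i"
  shows "((%t. X t j) has_real_derivative lap_sigma \<beta> (X t) j) (at t)"
  unfolding has_field_derivative_def has_derivative_at_alt
proof (intro conjI allI impI)
  show "bounded_linear ((*) (lap_sigma \<beta> (X t) j))" by (rule bounded_linear_mult_right)
  fix \<epsilon> :: real assume \<epsilon>: "0 < \<epsilon>"
  have "\<forall>i\<in>{j-3..j+3}. \<exists>e n0. 0 < e \<and> (\<forall>n\<ge>n0. \<forall>\<tau>. \<bar>\<tau> - t\<bar> <= e --> 0 < \<tau> \<and> \<tau> < T \<and>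
     (0 < x n \<tau> i \<longleftrightarrow> 0 < X t i) \<and> \<bar>x n \<tau> i powr (- \<beta>) - X t i powr (- \<beta>)\<bar> <= \<epsilon> / 4)"
  proof
    fix i assume "i \<in> {j-3..j+3}"
    then have "t \<noteq> death i" by (intro nd) auto
    from local_stable[OF t this, of "\<epsilon> / 4"] \<epsilon> show "\<exists>e n0. 0 < e \<and> (\<forall>n\<ge>n0. \<forall>\<tau>. \<bar>\<tau> - t\<bar> <= e --> 0 < \<tau> \<and> \<tau> < T \<and>
     (0 < x n \<tau> i \<longleftrightarrow> 0 < X t i) \<and> \<bar>x n \<tau> i powr (- \<beta>) - X t i powr (- \<beta>)\<bar> <= \<epsilon> / 4)" by auto
  qed
  from bchoice[OF this] obtain e where "\<forall>i\<in>{j-3..j+3}. \<exists>n0. 0 < e i \<and> (\<forall>n\<ge>n0. \<forall>\<tau>. \<bar>\<tau> - t\<bar> <= e i --> 0 < \<tau> \<and> \<tau> < T \<and>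
     (0 < x n \<tau> i \<longleftrightarrow> 0 < X t i) \<and> \<bar>x n \<tau> i powr (- \<beta>) - X t i powr (- \<beta>)\<bar> <= \<epsilon> / 4)" by (rule exE)
  from bchoice[OF this] obtain n0 where "\<forall>i\<in>{j-3..j+3}. 0 < e i \<and> (\<forall>n\<ge>n0 i. \<forall>\<tau>. \<bar>\<tau> - t\<bar> <= e i --> 0 < \<tau> \<and> \<tau> < T \<and>
     (0 < x n \<tau> i \<longleftrightarrow> 0 < X t i) \<and> \<bar>x n \<tau> i powr (- \<beta>) - X t i powr (- \<beta>)\<bar> <= \<epsilon> / 4)" by (rule exE)
  then have e: "!!i. i \<in> {j-3..j+3} ==> 0 < e i"
    and en: "!!i n \<tau>. i \<in> {j-3..j+3} ==> n \<ge> n0 i ==> \<bar>\<tau> - t\<bar> <= e i ==> 0 < \<tau> \<and> \<tau> < T \<and>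
     (0 < x n \<tau> i \<longleftrightarrow> 0 < X t i) \<and> \<bar>x n \<tau> i powr (- \<beta>) - X t i powr (- \<beta>)\<bar> <= \<epsilon> / 4" by auto
  define E where "E = Min (e ` {j-3..j+3})"
  define M where "M = Max (n0 ` {j-3..j+3})"
  have E0: "0 < E" unfolding E_def using e by (subst Min_gr_iff) auto
  have Ee: "E <= e i" "n0 i <= M" if "i \<in> {j-3..j+3}" for i
    unfolding E_def M_def using that by (auto intro!: Min_le Max_ge)
  have lap: "\<bar>lap_sigma \<beta> (x n \<tau>) j - lap_sigma \<beta> (X t) j\<bar> <= \<epsilon>" "0 < \<tau>" "\<tau> < T" if "n \<ge> M" "\<bar>\<tau> - t\<bar> <= E" for n \<tau>
  proof -
    have all: "0 < \<tau> \<and> \<tau> < T \<and> (0 < x n \<tau> i \<longleftrightarrow> 0 < X t i) \<and> \<bar>x n \<tau> i powr (- \<beta>) - X t i powr (- \<beta>)\<bar> <= \<epsilon> / 4"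
      if "i \<in> {j-3..j+3}" for i
      using en[OF that, of n \<tau>] Ee[OF that] \<open>n \<ge> M\<close> \<open>\<bar>\<tau> - t\<bar> <= E\<close> by linarith
    show \<tau>: "0 < \<tau>" "\<tau> < T" using all[of j] by auto
    have all': "(0 < x n \<tau> i \<longleftrightarrow> 0 < X t i) \<and> \<bar>x n \<tau> i powr (- \<beta>) - X t i powr (- \<beta>)\<bar> <= \<epsilon> / 4" if "\<bar>i - j\<bar> <= 3" for i
    proof -
      have "i \<in> {j-3..j+3}" using that by auto
      from all[OF this] show ?thesis by simp
    qed
    have "\<bar>lap_sigma \<beta> (x n \<tau>) j - lap_sigma \<beta> (X t) j\<bar> <= 4 * (\<epsilon> / 4)"
      using triple_flow.config_x[OF tf, of \<tau> n] \<tau> X_config[of t] t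
      by (intro lap_local conjunct1[OF all'] conjunct2[OF all']) auto
    then show "\<bar>lap_sigma \<beta> (x n \<tau>) j - lap_sigma \<beta> (X t) j\<bar> <= \<epsilon>" by simp
  qed
  define L where "L = lap_sigma \<beta> (X t) j"
  have incr: "\<bar>(x n b j - L * b) - (x n a j - L * a)\<bar> <= \<epsilon> * (b - a)"
    if "n \<ge> M" "a <= b" "\<bar>a - t\<bar> <= E" "\<bar>b - t\<bar> <= E" for n a b
  proof (rule fe_abs)
    show "finite (triple_flow.F \<beta> (x n))" by (rule triple_flow.F(1)[OF tf])
    have "0 < a" using lap(2)[OF that(1,3)] .
    then show "continuous_on {a..b} (%t. x n t j - L * t)"
      by (intro continuous_intros triple_flow.cont[OF tf]) auto
    fix \<tau> assume \<tau>: "\<tau> \<in> {a<..<b} - triple_flow.F \<beta> (x n)"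
    then have "\<bar>\<tau> - t\<bar> <= E" using that by auto
    note l = lap[OF that(1) this]
    have "((%t. x n t j) has_real_derivative lap_sigma \<beta> (x n \<tau>) j) (at \<tau>)"
      using triple_flow.F(2)[OF tf l(2)] \<tau> by auto
    then have "((%t. x n t j - L * t) has_real_derivative lap_sigma \<beta> (x n \<tau>) j - L) (at \<tau>)"
      by (auto intro!: derivative_eq_intros)
    then show "\<exists>D. ((%t. x n t j - L * t) has_real_derivative D) (at \<tau>) \<and> \<bar>D\<bar> <= \<epsilon>"
      using l(1) unfolding L_def by blast
  qed (use that in auto)
  show "\<exists>d>0. \<forall>y. norm (y - t) < d --> norm (X y j - X t j - lap_sigma \<beta> (X t) j * (y - t)) <= \<epsilon> * norm (y - t)"
  proof (intro exI[of _ E] conjI allI impI E0)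
    fix y assume y: "norm (y - t) < E"
    have y0: "0 < y" "y < T" using lap(2,3)[of M y] y by auto
    have "(%n. \<bar>(x n y j - L * y) - (x n t j - L * t)\<bar>) \<longlonglongrightarrow> \<bar>(X y j - L * y) - (X t j - L * t)\<bar>"
      using y0 t by (intro tendsto_intros conv) auto
    moreover have "\<bar>(x n y j - L * y) - (x n t j - L * t)\<bar> <= \<epsilon> * \<bar>y - t\<bar>" if "n \<ge> M" for n
      using incr[OF that, of y t] incr[OF that, of t y] y E0 by (cases "y <= t") (auto simp: abs_minus_commute)
    ultimately have "\<bar>(X y j - L * y) - (X t j - L * t)\<bar> <= \<epsilon> * \<bar>y - t\<bar>"
      by (intro LIMSEQ_le_const2) auto
    then show "norm (X y j - X t j - lap_sigma \<beta> (X t) j * (y - t)) <= \<epsilon> * norm (y - t)"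
      by (simp add: L_def algebra_simps)
  qed
qed

definition "excep j = death ` {j-3..j+3}" for j

lemma X_deriv': "finite (excep j)" "0 < t ==> t < T ==> t \<notin> excep j ==> ((%t. X t j) has_real_derivative lap_sigma \<beta> (X t) j) (at t)"
proof -
  show "finite (excep j)" by (simp add: excep_def)
  assume t: "0 < t" "t < T" "t \<notin> excep j"
  show "((%t. X t j) has_real_derivative lap_sigma \<beta> (X t) j) (at t)"
  proof (rule X_deriv[OF t(1,2)])
    fix i assume "\<bar>i - j\<bar> <= 3"
    then have "i \<in> {j-3..j+3}" by auto
    then show "t \<noteq> death i" using t(3) unfolding excep_def by blast
  qed
qed

lemma X_integrable_big:
  assumes "!!t. 0 <= t ==> t <= T ==> 1 / 2 <= X t j"
  shows "set_integrable lborel {0..T} (%t. X t j powr (- \<beta>))"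
proof (rule borel_integrable_atLeastAtMost')
  show "continuous_on {0..T} (%t. X t j powr (- \<beta>))"
    using assms by (intro continuous_intros X_cont) force
qed

text \<open>For a pair, minus the derivative of the total size plus the powers of the two large
  neighbours dominates each small power. Its integrability follows from the one-sided fundamental
  theorem \<open>lborel_ftc\<close>.\<close>

lemma X_integrable: "set_integrable lborel {0..T} (%t. X t j powr (- \<beta>))"
proof (cases rule: X_sites[of j])
  case big
  then show ?thesis by (intro X_integrable_big)
next
  case void
  then have "set_integrable lborel {0..T} (%t. X t j powr (- \<beta>)) = set_integrable lborel {0..T} (%t::real. 0::real)"
    by (intro set_integrable_cong) (auto simp: void_zero)
  then show ?thesis by (simp add: set_integrable_def)
next
  case (small m)
  let ?m = "int m"
  have bigs: "1 / 2 <= X t (3 * ?m)" "1 / 2 <= X t (3 * ?m + 3)" if t: "0 <= t" "t <= T" for t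
  proof -
    have "eventually (%n. 1 / 2 <= x n t (3 * ?m)) sequentially" "eventually (%n. 1 / 2 <= x n t (3 * ?m + 3)) sequentially"
      using small(2) by (eventually_elim, use triple_flow.big_ge[OF tf] t in auto)+
    then show "1 / 2 <= X t (3 * ?m)" "1 / 2 <= X t (3 * ?m + 3)"
      using conv[OF t] tendsto_lowerbound trivial_limit_sequentially by blast+
  qed
  let ?u = "%k t. X t k powr (- \<beta>)"
  let ?v = "%t. ?u (3 * ?m) t + ?u (3 * ?m + 3) t"
  define g where "g t = - (lap_sigma \<beta> (X t) (3 * ?m + 1) + lap_sigma \<beta> (X t) (3 * ?m + 2))" for t
  have iv: "set_integrable lborel {0..T} ?v"
    by (intro set_integral_add X_integrable_big bigs)
  have g: "?u (3 * ?m + 1) t <= g t + ?v t" "?u (3 * ?m + 2) t <= g t + ?v t" if t: "t \<in> {0..T}" for t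
  proof -
    have c: "config (X t)" using t by (intro X_config) auto
    have z: "\<not> 0 < X t k ==> X t k = 0" for k using X_bounds(1)[of t k] t by auto
    have u: "0 <= ?u k t" for k by simp
    show "?u (3 * ?m + 1) t <= g t + ?v t" "?u (3 * ?m + 2) t <= g t + ?v t"
      using lap_1[OF c, of ?m \<beta>] lap_2[OF c, of ?m \<beta>] z[of "3 * ?m + 1"] z[of "3 * ?m + 2"]
        lap_sigma_dead[of "X t" "3 * ?m + 1" \<beta>] lap_sigma_dead[of "X t" "3 * ?m + 2" \<beta>] u
      unfolding g_def
      by (cases "0 < X t (3 * ?m + 1)"; cases "0 < X t (3 * ?m + 2)"; simp)+
  qed
  have "set_integrable lborel {0..T} g"
  proof (rule lborel_ftc(1)[of "excep (3 * ?m + 1) \<union> excep (3 * ?m + 2)" 0 T "%t. - (X t (3 * ?m + 1) + X t (3 * ?m + 2))" g ?v])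
    show "((%t. - (X t (3 * ?m + 1) + X t (3 * ?m + 2))) has_real_derivative g t) (at t)"
      if "t \<in> {0<..<T} - (excep (3 * ?m + 1) \<union> excep (3 * ?m + 2))" for t
      unfolding g_def using that by (intro DERIV_minus DERIV_add X_deriv') auto
    show "0 <= g t + ?v t" if "t \<in> {0..T}" for t
      using g(1)[OF that] powr_ge_zero order_trans by blast
  qed (use X_deriv' T0 iv X_cont in \<open>auto intro!: continuous_intros\<close>)
  from set_integral_add(1)[OF this iv] have i: "set_integrable lborel {0..T} (%t. g t + ?v t)" .
  have "set_integrable lborel {0..T} (%t. X t k powr (- \<beta>))" if k: "k = 3 * ?m + 1 \<or> k = 3 * ?m + 2" for k
  proof (rule set_integrable_bound[OF i])
    show "set_borel_measurable lborel {0..T} (%t. X t k powr (- \<beta>))"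
      unfolding set_borel_measurable_def using powr_indicator_measurable[OF X_cont] by simp
    show "AE t in lborel. t \<in> {0..T} --> norm (X t k powr (- \<beta>)) <= norm (g t + ?v t)"
    proof (intro AE_I2 impI)
      fix t assume t: "t \<in> {0..T}"
      have "X t k powr (- \<beta>) <= g t + ?v t" using k g[OF t] by auto
      then show "norm (X t k powr (- \<beta>)) <= norm (g t + ?v t)" by simp
    qed
  qed
  then show ?thesis using small(1) by blast
qed

lemma X_solution: "is_solution \<beta> (ereal T) X"
proof (rule is_solutionI)
  fix t assume t: "0 <= t" "ereal t < ereal T"
  then have t': "0 <= t" "t <= T" by auto
  show "0 <= X t j" for j using X_bounds[OF t'] by auto
  show "X t \<in> linf_plus" using X_bounds[OF t'] by (auto simp: linf_plus_def)
  show "set_integrable lborel {0..t} (%s. X s j powr (- \<beta>))" for j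
    by (rule set_integrable_subset[OF X_integrable]) (use t' in auto)
next
  fix j
  show "continuous_on {t. 0 <= t \<and> ereal t < ereal T} (%t. X t j)"
    by (rule continuous_on_subset[OF X_cont]) auto
  show "\<exists>F. finite F \<and> (\<forall>t. 0 < t --> ereal t < ereal T --> t \<notin> F -->
       ((%t. X t j) has_real_derivative lap_sigma \<beta> (X t) j) (at t))"
    using X_deriv' by (intro exI[of _ "excep j"]) auto
qed

lemma X_flow_on:
  assumes "finite S'" "!!j. j \<notin> S' ==> eventually (%n. 3 * int (N n) < \<bar>j\<bar>) sequentially"
  shows "flow_on \<beta> S' T X"
  unfolding flow_on_def
proof (intro conjI)
  have z: "X t j = 0" if "j \<notin> S'" "0 <= t" "t <= T" for t j using void_zero[OF assms(2)] that by simp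
  show "\<exists>F. finite F \<and> (\<forall>t j. 0 < t --> t < T --> t \<notin> F --> ((%t. X t j) has_real_derivative lap_sigma \<beta> (X t) j) (at t))"
  proof (intro exI[of _ "\<Union>j\<in>S'. excep j"] conjI allI impI)
    show "finite (\<Union>j\<in>S'. excep j)" using assms(1) X_deriv' by auto
    fix t j assume t: "0 < t" "t < T" "t \<notin> (\<Union>j\<in>S'. excep j)"
    show "((%t. X t j) has_real_derivative lap_sigma \<beta> (X t) j) (at t)"
    proof (cases "j \<in> S'")
      case True
      then show ?thesis using t X_deriv' by auto
    next
      case False
      have "lap_sigma \<beta> (X t) j = 0" using z[OF False, of t] t by (intro lap_sigma_dead) auto
      moreover have "((%t. X t j) has_real_derivative 0) (at t)"
        by (rule has_field_derivative_transform_within_open[of "%_. 0" _ _ "{0<..<T}"]) (use z[OF False] t in auto)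
      ultimately show ?thesis by simp
    qed
  qed
qed (use assms(1) X_bounds X_cont X_dead void_zero[OF assms(2)] in auto)

end

section \<open>The alternating difference of two flows\<close>

lemma continuation_ge:
  fixes \<phi> :: "'i => real => real"
  assumes "finite I" "finite F" and cont: "!!i. i \<in> I ==> continuous_on {a..b} (\<phi> i)"
    and init: "!!i. i \<in> I ==> 0 < \<phi> i a"
    and D: "!!t i. t \<in> {a<..<b} - F ==> (!!k. k \<in> I ==> 0 < \<phi> k t) ==> i \<in> I ==>
       \<exists>D. (\<phi> i has_real_derivative D) (at t) \<and> 0 <= D"
    and "i \<in> I" "a <= t" "t <= b"
  shows "0 < \<phi> i t"
proof (rule continuation[of I a b \<phi>, OF \<open>finite I\<close> cont init _ \<open>i \<in> I\<close> \<open>a <= t\<close> \<open>t <= b\<close>])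
  fix t i assume t: "a < t" "t <= b" and pos: "!!s k. a <= s ==> s < t ==> k \<in> I ==> 0 < \<phi> k s" and i: "i \<in> I"
  have "0 * (t - a) <= \<phi> i t - \<phi> i a"
  proof (rule fe_ge[OF \<open>finite F\<close>])
    show "continuous_on {a..t} (\<phi> i)" by (rule continuous_on_subset[OF cont[OF i]]) (use t in auto)
    fix s assume s: "s \<in> {a<..<t} - F"
    show "\<exists>D. (\<phi> i has_real_derivative D) (at s) \<and> 0 <= D"
      by (rule D[OF _ _ i]) (use s t pos in auto)
  qed (use t in auto)
  then show "0 < \<phi> i t" using init[OF i] by simp
qed auto

text \<open>Comparison with barriers that move linearly in time: as long as all barriers hold, the
  coupling must not drive any component down faster than its own barrier moves.\<close>

lemma affine_barrier:
  fixes Y :: "'i => real => real"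
  assumes "finite I" "finite F" and cont: "!!i. i \<in> I ==> continuous_on {a..b} (Y i)"
    and init: "!!i. i \<in> I ==> - p0 i < Y i a"
    and D: "!!t i. t \<in> {a<..<b} - F ==> (!!k. k \<in> I ==> - (p0 k + p1 k * (t - a)) < Y k t) ==> i \<in> I ==>
       \<exists>D. (Y i has_real_derivative D) (at t) \<and> - p1 i <= D"
    and i: "i \<in> I" "a <= t" "t <= b"
  shows "- (p0 i + p1 i * (t - a)) < Y i t"
proof -
  have "0 < Y i t + (p0 i + p1 i * (t - a))"
  proof (rule continuation_ge[of I F a b "%i t. Y i t + (p0 i + p1 i * (t - a))", OF assms(1,2) _ _ _ i])
    fix t k assume a: "t \<in> {a<..<b} - F" "!!k. k \<in> I ==> 0 < Y k t + (p0 k + p1 k * (t - a))" "k \<in> I"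
    have "- (p0 k + p1 k * (t - a)) < Y k t" if "k \<in> I" for k using a(2)[OF that] by linarith
    from D[OF a(1) this a(3)] obtain D where "(Y k has_real_derivative D) (at t)" "- p1 k <= D" by blast
    then show "\<exists>D. ((%t. Y k t + (p0 k + p1 k * (t - a))) has_real_derivative D) (at t) \<and> 0 <= D"
      by (intro exI[of _ "D + p1 k"]) (auto intro!: derivative_eq_intros)
  next
    fix k assume "k \<in> I"
    then show "continuous_on {a..b} (%t. Y k t + (p0 k + p1 k * (t - a)))" "0 < Y k a + (p0 k + p1 k * (a - a))"
      using cont[of k] init[of k] by (auto intro!: continuous_intros)
  qed
  then show ?thesis by linarith
qed

definition sg :: "int => real" where "sg i = (if even i then 1 else - 1)"

lemma sg_odd: "odd (i - k) ==> sg k = - sg i" by (auto simp: sg_def)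

lemma sg_sq: "sg i * sg i = 1" and sg_cases: "sg i = 1 \<or> sg i = - 1" by (auto simp: sg_def)

text \<open>The global sign \<open>s\<close> is there to make the perturbation at the last large
  site a positive value of \<open>Y\<close>.\<close>

locale two_flows = fx: triple_flow \<beta> r N T Sx x + fv: triple_flow \<beta> r N T Sv v
  for \<beta> :: real and r :: "nat => real" and N :: nat and T :: real and Sx Sv :: "int set"
    and x v :: "real => int => real" +
  fixes s :: real
  assumes s: "s = 1 \<or> s = - 1"
begin

abbreviation "b \<equiv> \<beta> + 1"

definition "G = fx.F \<union> fv.F"

lemma finite_G: "finite G" using fx.F(1) fv.F(1) by (simp add: G_def)

text \<open>With the sign \<open>(- 1)\<^sup>i\<close> the linearised equation is cooperative: between deaths the derivative of
  \<open>Y i\<close> is \<open>U (i - 1) + 2 * U i + U (i + 1)\<close>, where \<open>U i\<close> has the sign of \<open>Y i\<close>.\<close>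

definition "Y t i = s * sg i * (x t i - v t i)" for t i
definition "U t i = s * sg i * (v t i powr (- \<beta>) - x t i powr (- \<beta>))" for t i

lemma Y_abs: "\<bar>Y t i\<bar> = \<bar>x t i - v t i\<bar>"
  using s sg_cases[of i] unfolding Y_def by (auto simp: abs_mult)

lemma Y_cont: "0 <= a ==> continuous_on {a..c} (%t. Y t i)"
  unfolding Y_def by (intro continuous_intros fx.cont fv.cont)

lemma U_eq:
  assumes "0 < c" "c <= x t i" "c <= v t i" "x t i <= d" "v t i <= d"
  obtains w where "U t i = w * Y t i" "\<beta> * d powr (- b) <= w" "w <= \<beta> * c powr (- b)"
proof -
  obtain w where w: "x t i powr (- \<beta>) - v t i powr (- \<beta>) = - w * (x t i - v t i)"
      "\<beta> * d powr (-(\<beta> + 1)) <= w" "w <= \<beta> * c powr (-(\<beta> + 1))"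
    using powr_neg_mvt[OF assms fx.\<beta>] by auto
  have "U t i = s * sg i * - (x t i powr (- \<beta>) - v t i powr (- \<beta>))" by (simp add: U_def)
  also have "\<dots> = w * Y t i" by (simp add: w(1) Y_def)
  finally show ?thesis using that w by auto
qed

lemma U_low:
  assumes "0 < x t i" "0 < v t i" "x t i <= d" "v t i <= d" "0 <= Y t i"
  shows "\<beta> * d powr (- b) * Y t i <= U t i"
proof -
  obtain w where "U t i = w * Y t i" "\<beta> * d powr (- b) <= w"
    using U_eq[of "min (x t i) (v t i)" t i d] assms by auto
  then show ?thesis using assms by (simp add: mult_right_mono)
qed

lemma U_nonneg:
  assumes "0 < x t i" "0 < v t i" "0 <= Y t i"
  shows "0 <= U t i"
proof -
  have "0 <= \<beta> * max (x t i) (v t i) powr (- b) * Y t i" using assms fx.\<beta> by simp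
  also have "\<dots> <= U t i" by (rule U_low) (use assms in auto)
  finally show ?thesis .
qed

lemma U_abs:
  assumes "0 < c" "c <= x t i" "c <= v t i"
  shows "\<bar>U t i\<bar> <= \<beta> * c powr (- b) * \<bar>Y t i\<bar>"
proof -
  obtain w where w: "U t i = w * Y t i" "\<beta> * max (x t i) (v t i) powr (- b) <= w" "w <= \<beta> * c powr (- b)"
    using U_eq[of c t i "max (x t i) (v t i)"] assms by auto
  have "0 <= w" using w(2) fx.\<beta> by (smt (verit) mult_nonneg_nonneg powr_ge_zero)
  then have "\<bar>U t i\<bar> = w * \<bar>Y t i\<bar>" by (simp add: w(1) abs_mult)
  also have "\<dots> <= \<beta> * c powr (- b) * \<bar>Y t i\<bar>" using w(3) by (intro mult_right_mono) auto
  finally show ?thesis .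
qed

lemma U_ge:
  assumes "0 < c" "c <= x t i" "c <= v t i" "- p <= Y t i" "0 <= p"
  shows "- (\<beta> * c powr (- b) * p) <= U t i"
proof (cases "0 <= Y t i")
  case True
  have "0 <= U t i" by (rule U_nonneg) (use assms True in auto)
  moreover have "0 <= \<beta> * c powr (- b) * p" using assms fx.\<beta> by simp
  ultimately show ?thesis by linarith
next
  case False
  have "\<bar>U t i\<bar> <= \<beta> * c powr (- b) * \<bar>Y t i\<bar>" by (rule U_abs) (use assms in auto)
  also have "\<dots> <= \<beta> * c powr (- b) * p" using assms False fx.\<beta> by (intro mult_left_mono) auto
  finally show ?thesis by linarith
qed

lemma U_void: "0 <= t ==> 3 * int N < \<bar>i\<bar> ==> U t i = 0" "0 <= t ==> 3 * int N < \<bar>i\<bar> ==> Y t i = 0"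
  by (simp_all add: U_def Y_def fx.zero fv.zero)

text \<open>The parity conditions are where deaths in pairs enter: \<open>sg\<close> alternates
  between living neighbours only if an even number of dead sites lies between them. With one
  particle of a pair missing, the coupling would change its sign.\<close>

lemma Y_deriv:
  assumes t: "0 < t" "t \<notin> G" and k: "k < i" "odd (i - k)" and l: "i < l" "odd (l - i)"
    and i: "0 < x t i" "0 < v t i"
    and zero: "!!m. k < m ==> m < l ==> m \<noteq> i ==> x t m = 0 \<and> v t m = 0"
    and lo: "k < - 3 * int N \<or> 0 < x t k \<and> 0 < v t k" and hi: "3 * int N < l \<or> 0 < x t l \<and> 0 < v t l"
  shows "((%t. Y t i) has_real_derivative U t k + 2 * U t i + U t l) (at t)"
proof -
  have lap: "lap_sigma \<beta> y i = y k powr (- \<beta>) - 2 * y i powr (- \<beta>) + y l powr (- \<beta>)"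
    if y: "y = x t \<or> y = v t" for y
  proof -
    have "at_ext y (sigma_minus i y) powr (- \<beta>) = y k powr (- \<beta>)"
      by (rule sigma_minus_val) (use y zero k l lo t fx.zero[of t] fv.zero[of t] in auto)
    moreover have "at_ext y (sigma_plus i y) powr (- \<beta>) = y l powr (- \<beta>)"
      by (rule sigma_plus_val) (use y zero k l hi t fx.zero[of t] fv.zero[of t] in auto)
    moreover have "0 < y i" using y i by auto
    ultimately show ?thesis by (simp add: lap_sigma_def)
  qed
  have "((%t. x t i) has_real_derivative lap_sigma \<beta> (x t) i) (at t)"
    "((%t. v t i) has_real_derivative lap_sigma \<beta> (v t) i) (at t)"
    using t fx.F(2) fv.F(2) by (auto simp: G_def)
  from DERIV_diff[OF this]
  have "((%t. Y t i) has_real_derivative s * sg i * (lap_sigma \<beta> (x t) i - lap_sigma \<beta> (v t) i)) (at t)"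
    unfolding Y_def by (rule DERIV_cmult)
  moreover have "sg k = - sg i" "sg l = - sg i"
    using sg_odd[OF k(2)] sg_odd[OF l(2)] by auto
  ultimately show ?thesis by (simp add: lap U_def algebra_simps)
qed

end

text \<open>Stage \<open>j\<close> runs from \<open>\<sigma>\<close>, when all pairs further right
  are dead in both flows, to the bound \<open>\<theta> j\<close> for the death of pair
  \<open>j\<close>. Up to \<open>jA\<close> all particles, also those of the pairs with smaller
  index, stay above \<open>c\<close>: they are so much larger than pair \<open>j\<close> that they
  hardly change in this time.\<close>

locale stage = two_flows +
  fixes j :: nat and \<sigma> c :: real
  assumes j: "j < N" and \<sigma>: "0 <= \<sigma>" "\<sigma> < fx.\<theta> j" and \<theta>T: "fx.\<theta> j <= T"
    and c: "0 < c" "c <= 1 / 2"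
    and reg: "!!t i. 0 <= t ==> t <= fx.\<theta> j ==> - 3 * int N <= i ==> i <= 3 * int j ==> c <= x t i \<and> c <= v t i"
    and right_dead: "!!m. j < m ==> m < N ==> x \<sigma> (3 * int m + 1) = 0 \<and> x \<sigma> (3 * int m + 2) = 0 \<and>
       v \<sigma> (3 * int m + 1) = 0 \<and> v \<sigma> (3 * int m + 2) = 0"
begin

abbreviation "\<theta> \<equiv> fx.\<theta> j"
abbreviation "jA \<equiv> 3 * int j"
abbreviation "j1 \<equiv> 3 * int j + 1"
abbreviation "j2 \<equiv> 3 * int j + 2"
abbreviation "jB \<equiv> 3 * int j + 3"

text \<open>The Lipschitz constant of the power above the size \<open>c\<close>, hence at all living
  sites outside the pair.\<close>

definition "\<Lambda> = \<beta> * c powr (- b)"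

text \<open>On the left every site is alive, the pairs included. On the right the pairs are dead, so
  \<open>right\<close> consists of large sites only; it starts at \<open>j + 2\<close> because
  \<open>jB\<close> is treated separately.\<close>

definition "left = {- 3 * int N..3 * int j - 1}"
definition "right = (%m. 3 * int m) ` {j + 2..N}"

definition "alive t \<longleftrightarrow> 0 < x t j1 \<and> 0 < x t j2 \<and> 0 < v t j1 \<and> 0 < v t j2"
definition "gone t \<longleftrightarrow> x t j1 = 0 \<and> x t j2 = 0 \<and> v t j1 = 0 \<and> v t j2 = 0"

lemma finite_sites: "finite left" "finite right" by (auto simp: left_def right_def)

lemma \<Lambda>_pos: "0 < \<Lambda>" using c fx.\<beta> by (simp add: \<Lambda>_def)

lemma bigs:
  assumes "0 <= t" "t <= \<theta>" "i = jB \<or> i \<in> right"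
  shows "1 / 2 <= x t i" "1 / 2 <= v t i" "0 < x t i" "0 < v t i" "x t i <= 2" "v t i <= 2"
proof -
  have i: "\<bar>i\<bar> <= 3 * int N" "i mod 3 = 0" using assms(3) j by (auto simp: right_def)
  show "1 / 2 <= x t i" "1 / 2 <= v t i" using fx.big_ge[of t i] fv.big_ge[of t i] i assms \<theta>T by auto
  then show "0 < x t i" "0 < v t i" by linarith+
  show "x t i <= 2" "v t i <= 2" using fx.upper[of t i] fv.upper[of t i] assms \<theta>T by auto
qed

lemma regular:
  assumes t: "0 <= t" "t <= \<theta>" and i: "i \<in> left \<or> i = jA \<or> i = jB \<or> i \<in> right"
  shows "c <= x t i" "c <= v t i" "0 < x t i" "0 < v t i"
proof -
  show "c <= x t i" "c <= v t i"
  proof -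
    consider "- 3 * int N <= i" "i <= jA" | "i = jB \<or> i \<in> right" using i j by (auto simp: left_def)
    then have "c <= x t i \<and> c <= v t i"
    proof cases
      case 1
      then show ?thesis using reg[OF t] by blast
    next
      case 2
      then show ?thesis using bigs(1,2)[OF t 2] c by auto
    qed
    then show "c <= x t i" "c <= v t i" by auto
  qed
  then show "0 < x t i" "0 < v t i" using c by linarith+
qed

lemma reg_U_abs:
  assumes "0 <= t" "t <= \<theta>" "i \<in> left \<or> i = jA \<or> i = jB \<or> i \<in> right \<or> 3 * int N < \<bar>i\<bar>"
  shows "\<bar>U t i\<bar> <= \<Lambda> * \<bar>Y t i\<bar>"
proof (cases "3 * int N < \<bar>i\<bar>")
  case True
  then show ?thesis using U_void assms by simp
next
  case False
  then show ?thesis unfolding \<Lambda>_def using assms by (intro U_abs c regular) auto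
qed

lemma reg_U_ge:
  assumes "0 <= t" "t <= \<theta>" "i \<in> left \<or> i = jA \<or> i = jB \<or> i \<in> right \<or> 3 * int N < \<bar>i\<bar>" "- p <= Y t i" "0 <= p"
  shows "- (\<Lambda> * p) <= U t i"
proof (cases "3 * int N < \<bar>i\<bar>")
  case True
  then show ?thesis using U_void assms \<Lambda>_pos by simp
next
  case False
  then show ?thesis unfolding \<Lambda>_def using assms by (intro U_ge c regular) auto
qed

lemma right_zero:
  assumes "\<sigma> <= t" "jB < i" "i mod 3 \<noteq> 0"
  shows "x t i = 0" "v t i = 0"
proof -
  have "x \<sigma> i = 0 \<and> v \<sigma> i = 0"
  proof (cases "i <= 3 * int N")
    case True
    define m where "m = nat (i div 3)"
    have m: "int m = i div 3" using assms(2) by (simp add: m_def)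
    have "int j < int m" "int m < int N" using assms(2,3) True unfolding m by presburger+
    then have "j < m" "m < N" by auto
    moreover have "i = 3 * int m + 1 \<or> i = 3 * int m + 2" using assms(3) unfolding m by presburger
    ultimately show ?thesis using right_dead[of m] by auto
  next
    case False
    then show ?thesis using fx.zero[OF \<sigma>(1), of i] fv.zero[OF \<sigma>(1), of i] by auto
  qed
  then show "x t i = 0" "v t i = 0" using fx.dead[OF \<sigma>(1) assms(1)] fv.dead[OF \<sigma>(1) assms(1)] by auto
qed

lemma D_left:
  assumes t: "\<sigma> < t" "t < \<theta>" "t \<notin> G" and i: "i \<in> left"
  shows "((%t. Y t i) has_real_derivative U t (i - 1) + 2 * U t i + U t (i + 1)) (at t)"
proof (rule Y_deriv)
  have t': "0 <= t" "t <= \<theta>" using t \<sigma> by auto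
  show "0 < x t i" "0 < v t i" using regular[OF t'] i by auto
  show "i - 1 < - 3 * int N \<or> 0 < x t (i - 1) \<and> 0 < v t (i - 1)"
    using regular[OF t', of "i - 1"] i by (auto simp: left_def)
  have "i + 1 \<in> left \<or> i + 1 = jA" using i by (auto simp: left_def)
  then show "3 * int N < i + 1 \<or> 0 < x t (i + 1) \<and> 0 < v t (i + 1)"
    using regular[OF t', of "i + 1"] by auto
qed (use t \<sigma> in auto)

lemma right_nbr:
  assumes "i \<in> right \<or> i = jB"
  shows "3 * int N < i + 3 \<or> i + 3 \<in> right"
proof -
  obtain m where m: "i = 3 * int m" "j + 1 <= m" "m <= N"
  proof (cases "i = jB")
    case True
    show ?thesis by (rule that[of "Suc j"]) (use True j in auto)
  next
    case False
    then show ?thesis using assms that unfolding right_def by auto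
  qed
  show ?thesis
  proof (cases "m = N")
    case False
    then have "i + 3 = 3 * int (Suc m)" "Suc m \<in> {j + 2..N}" using m by auto
    then show ?thesis unfolding right_def by blast
  qed (use m in auto)
qed

lemma left_nbr: "i \<in> right ==> i - 3 = jB \<or> i - 3 \<in> right"
proof -
  assume "i \<in> right"
  then obtain m where m: "i = 3 * int m" "j + 2 <= m" "m <= N" unfolding right_def by auto
  show ?thesis
  proof (cases "m = j + 2")
    case False
    then have "i - 3 = 3 * int (m - 1)" "m - 1 \<in> {j + 2..N}" using m by auto
    then show ?thesis unfolding right_def by blast
  qed (use m in auto)
qed

lemma D_right:
  assumes t: "\<sigma> < t" "t < \<theta>" "t \<notin> G" and i: "i \<in> right"
  shows "((%t. Y t i) has_real_derivative U t (i - 3) + 2 * U t i + U t (i + 3)) (at t)"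
proof (rule Y_deriv)
  have t': "0 <= t" "t <= \<theta>" using t \<sigma> by auto
  show "0 < x t i" "0 < v t i" using regular[OF t'] i by auto
  show "i - 3 < - 3 * int N \<or> 0 < x t (i - 3) \<and> 0 < v t (i - 3)"
    using regular[OF t', of "i - 3"] left_nbr[OF i] by auto
  show "3 * int N < i + 3 \<or> 0 < x t (i + 3) \<and> 0 < v t (i + 3)"
    using regular[OF t', of "i + 3"] right_nbr[of i] i by auto
  fix m assume m: "i - 3 < m" "m < i + 3" "m \<noteq> i"
  obtain k where k: "i = 3 * int k" "j + 2 <= k" using i by (auto simp: right_def)
  have "jB < m" using m(1) k by auto
  moreover have "m mod 3 \<noteq> 0" using m k(1) by presburger
  ultimately show "x t m = 0 \<and> v t m = 0" using right_zero[of t m] t by auto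
qed (use t \<sigma> in auto)

lemma D_alive:
  assumes t: "\<sigma> < t" "t < \<theta>" "t \<notin> G" and al: "alive t"
  shows "((%t. Y t jA) has_real_derivative U t (jA - 1) + 2 * U t jA + U t j1) (at t)"
    "((%t. Y t j1) has_real_derivative U t jA + 2 * U t j1 + U t j2) (at t)"
    "((%t. Y t j2) has_real_derivative U t j1 + 2 * U t j2 + U t jB) (at t)"
    "((%t. Y t jB) has_real_derivative U t j2 + 2 * U t jB + U t (jB + 3)) (at t)"
proof -
  have t': "0 <= t" "t <= \<theta>" using t \<sigma> by auto
  have pos: "0 < x t i \<and> 0 < v t i" if "- 3 * int N <= i" "i <= jB" for i
  proof -
    consider "i < jA" | "i = jA" | "i = j1" | "i = j2" | "i = jB" using \<open>i <= jB\<close> by linarith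
    then show ?thesis
    proof cases
      case 1
      then have "i \<in> left" using \<open>- 3 * int N <= i\<close> by (simp add: left_def)
      then show ?thesis using regular[OF t', of i] by blast
    qed (use regular[OF t', of i] al in \<open>auto simp: alive_def\<close>)
  qed
  have zero: "x t i = 0 \<and> v t i = 0" if "jB < i" "i < jB + 3" for i
  proof -
    have "i mod 3 \<noteq> 0" using that by presburger
    then show ?thesis using right_zero[of t i] t that by auto
  qed
  show "((%t. Y t jA) has_real_derivative U t (jA - 1) + 2 * U t jA + U t j1) (at t)"
    by (rule Y_deriv) (use t \<sigma> pos j in auto)
  show "((%t. Y t j1) has_real_derivative U t jA + 2 * U t j1 + U t j2) (at t)"
    by (rule Y_deriv) (use t \<sigma> pos j in auto)
  show "((%t. Y t j2) has_real_derivative U t j1 + 2 * U t j2 + U t jB) (at t)"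
    by (rule Y_deriv) (use t \<sigma> pos j in auto)
  have "3 * int N < jB + 3 \<or> 0 < x t (jB + 3) \<and> 0 < v t (jB + 3)"
    using regular[OF t', of "jB + 3"] right_nbr[of jB] by auto
  then show "((%t. Y t jB) has_real_derivative U t j2 + 2 * U t jB + U t (jB + 3)) (at t)"
    by (intro Y_deriv) (use t \<sigma> pos j zero in auto)
qed

lemma D_gone:
  assumes t: "\<sigma> < t" "t < \<theta>" "t \<notin> G" and go: "gone t"
  shows "((%t. Y t jA) has_real_derivative U t (jA - 1) + 2 * U t jA + U t jB) (at t)"
    "((%t. Y t jB) has_real_derivative U t jA + 2 * U t jB + U t (jB + 3)) (at t)"
proof -
  have t': "0 <= t" "t <= \<theta>" using t \<sigma> by auto
  have pos: "0 < x t i \<and> 0 < v t i" if "- 3 * int N <= i" "i <= jA \<or> i = jB" for i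
  proof -
    have "i \<in> left \<or> i = jA \<or> i = jB" using that by (auto simp: left_def)
    then show ?thesis using regular[OF t', of i] by blast
  qed
  have zero: "x t i = 0 \<and> v t i = 0" if "jA < i" "i < jB + 3" "i \<noteq> jB" for i
  proof -
    consider "i = j1" | "i = j2" | "jB < i" using \<open>jA < i\<close> \<open>i \<noteq> jB\<close> by linarith
    then show ?thesis
    proof cases
      case 3
      then have "i mod 3 \<noteq> 0" using \<open>i < jB + 3\<close> by presburger
      then show ?thesis using right_zero[of t i] t 3 by auto
    qed (use go in \<open>auto simp: gone_def\<close>)
  qed
  show "((%t. Y t jA) has_real_derivative U t (jA - 1) + 2 * U t jA + U t jB) (at t)"
    by (rule Y_deriv) (use t \<sigma> pos j zero in auto)
  have "3 * int N < jB + 3 \<or> 0 < x t (jB + 3) \<and> 0 < v t (jB + 3)"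
    using regular[OF t', of "jB + 3"] right_nbr[of jB] by auto
  then show "((%t. Y t jB) has_real_derivative U t jA + 2 * U t jB + U t (jB + 3)) (at t)"
    by (intro Y_deriv) (use t \<sigma> pos j zero in auto)
qed

end

text \<open>At time \<open>\<sigma>\<close> all pairs to the right of the pair \<open>j\<close> are gone. The big particle to its right carries the
  perturbation \<open>g\<close>, all perturbations are at most \<open>K * g\<close>, and those to the left are nonnegative up to an
  error \<open>e\<close>. The pair of \<open>v\<close> dies at time \<open>d\<close>, following the profile of a tie up to a relative error \<open>\<kappa>\<close>. Its
  perturbation exceeds \<open>L0\<close> from time \<open>t0\<close> on.\<close>

locale stage_run = stage +
  fixes g K e t0 d \<kappa> L0 :: real
  assumes \<kappa>: "0 < \<kappa>" "\<kappa> <= 1 / 100" "(1 + 2 * \<kappa>) powr b <= 3 / 2"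
    and g: "0 < g" and K: "1 <= K" and e: "0 < e" and L0: "0 < L0"
    and init_ge: "!!i. i <= 3 * int j + 2 ==> - e <= Y \<sigma> i" and init_B: "Y \<sigma> (3 * int j + 3) = g"
    and init_abs: "!!i. \<bar>Y \<sigma> i\<bar> <= K * g"
    and t0: "2 * \<sigma> <= t0" "0 < t0" "t0 <= d" "d <= \<theta>"
    and early: "!!t i. 0 <= t ==> t <= t0 ==> i = 3 * int j + 1 \<or> i = 3 * int j + 2 ==> r j / 8 <= x t i \<and> r j / 8 <= v t i"
    and r_c: "r j / 8 <= c"
    and v_alive: "!!t i. 0 <= t ==> t < d ==> i = 3 * int j + 1 \<or> i = 3 * int j + 2 ==> 0 < v t i"
    and profile: "!!t i. 0 <= t ==> t <= d ==> i = 3 * int j + 1 \<or> i = 3 * int j + 2 ==>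
       \<bar>v t i powr b - b * (d - t)\<bar> <= \<kappa> * (b * (d - t))"
    \<comment> \<open>\<open>S1\<close>: over the whole stage the coupling to regular sites is a
      small effect, even for values of order \<open>K * g\<close>. \<open>S2\<close>: up to
      \<open>t0\<close> the coupling to the pair is harmless too. \<open>e1\<close> to
      \<open>e3\<close> rank the error \<open>e\<close> far below \<open>g\<close> and
      \<open>L0\<close>.\<close>
    and S1: "10000 * \<Lambda> * K * \<theta> <= 1" and S2: "16 * (\<beta> * (r j / 8) powr (- b)) * t0 <= 1"
    and e1: "48 * (\<beta> * (r j / 8) powr (- b)) * e <= \<beta> * 2 powr (- b) * g"
    and e2: "6 * (\<beta> * (r j / 8) powr (- b)) * e <= \<beta> * (3 * r j) powr (- b) * (\<beta> * 2 powr (- b) * g * t0) / 128"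
    and e3: "2 * e <= L0" "4 * e <= g"
    and L0_le: "L0 <= \<beta> * 2 powr (- b) * g * t0 / 64"
      "L0 <= \<beta> * (3 * r j) powr (- b) * (\<beta> * 2 powr (- b) * g * t0) / 128 * t0 / 8"
begin

text \<open>The Lipschitz constant for all sites up to \<open>t0\<close>, while the pair is above
  the size \<open>r j / 8\<close>. In contrast, \<open>cb\<close> is the smallest slope of the power
  at sizes up to 2.\<close>

definition "\<Lambda>1 = \<beta> * (r j / 8) powr (- b)"
definition "cb = \<beta> * 2 powr (- b)"

lemma pos: "0 < r j" "0 < \<Lambda>1" "0 < cb" "0 < \<theta>" "0 < b"
  using fx.r0[of j] fx.\<beta> \<sigma> by (auto simp: \<Lambda>1_def cb_def)

lemma \<Lambda>_le: "\<Lambda> <= \<Lambda>1"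
  unfolding \<Lambda>_def \<Lambda>1_def using r_c pos fx.\<beta> by (intro mult_left_mono powr_mono2') auto

lemma \<sigma>_t0: "\<sigma> < t0" "t0 <= \<theta>" using t0 \<sigma> by auto

lemma S1': "\<Lambda> * K * (t - a) <= 1 / 1000" "\<Lambda> * (t - a) <= 1 / 1000" "\<Lambda> * (t - a) <= 1 / 10000"
  if "0 <= a" "a <= t" "t <= \<theta>" for a t
proof -
  have "\<Lambda> * K * (t - a) <= \<Lambda> * K * \<theta>" using that \<Lambda>_pos K by (intro mult_left_mono) auto
  then have a: "\<Lambda> * K * (t - a) <= 1 / 10000" using S1 by simp
  then show "\<Lambda> * K * (t - a) <= 1 / 1000" by simp
  have "\<Lambda> * (t - a) * 1 <= \<Lambda> * (t - a) * K" using that \<Lambda>_pos K by (intro mult_left_mono) auto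
  then show "\<Lambda> * (t - a) <= 1 / 10000" using a by (simp add: mult_ac)
  then show "\<Lambda> * (t - a) <= 1 / 1000" by simp
qed

lemma S2': "\<Lambda>1 * (t - \<sigma>) <= 1 / 16" if "\<sigma> <= t" "t <= t0" for t
proof -
  have "\<Lambda>1 * (t - \<sigma>) <= \<Lambda>1 * t0" using that \<sigma> pos by (intro mult_left_mono) auto
  then show ?thesis using S2 by (simp add: \<Lambda>1_def)
qed

lemma Kg: "0 < K * g" "g <= K * g" using g K by auto

definition "sites0 = left \<union> {jA, j1, j2}"
definition "sites1 = sites0 \<union> {jB} \<union> right"

lemma fin: "finite sites0" "finite sites1" using finite_sites by (auto simp: sites0_def sites1_def)

lemma early_alive: "0 <= t ==> t <= t0 ==> alive t"
  using early[of t j1] early[of t j2] pos unfolding alive_def by auto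

lemma D_any:
  assumes t: "\<sigma> < t" "t < \<theta>" "t \<notin> G" and al: "alive t" and i: "i \<in> sites1"
  obtains k l where "((%t. Y t i) has_real_derivative U t k + 2 * U t i + U t l) (at t)"
    "k \<in> sites1 \<or> 3 * int N < \<bar>k\<bar>" "l \<in> sites1 \<or> 3 * int N < \<bar>l\<bar>"
    "i \<in> sites0 ==> k \<in> sites0 \<or> 3 * int N < \<bar>k\<bar>" "i \<in> sites0 ==> l \<in> sites0 \<or> l = jB"
proof -
  have A: "jA - 1 \<in> left" using j by (simp add: left_def)
  from i consider "i \<in> left" | "i = jA" | "i = j1" | "i = j2" | "i = jB" | "i \<in> right"
    unfolding sites1_def sites0_def by auto
  then show thesis
  proof cases
    case 1
    have "i - 1 \<in> left \<or> 3 * int N < \<bar>i - 1\<bar>" "i + 1 \<in> left \<or> i + 1 = jA" using 1 by (auto simp: left_def)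
    then show ?thesis by (intro that[OF D_left[OF t 1]]) (auto simp: sites0_def sites1_def)
  next
    case 2
    show ?thesis by (rule that[of "jA - 1" "j1"]) (use D_alive(1)[OF t al] A 2 in \<open>auto simp: sites0_def sites1_def\<close>)
  next
    case 3
    show ?thesis by (rule that[of "jA" "j2"]) (use D_alive(2)[OF t al] A 3 in \<open>auto simp: sites0_def sites1_def\<close>)
  next
    case 4
    show ?thesis by (rule that[of "j1" "jB"]) (use D_alive(3)[OF t al] A 4 in \<open>auto simp: sites0_def sites1_def\<close>)
  next
    case 5
    have n0: "jB \<notin> sites0" by (auto simp: sites0_def left_def)
    show ?thesis by (rule that[of j2 "jB + 3"]) (use D_alive(4)[OF t al] 5 n0 right_nbr[of jB] in \<open>auto simp: sites0_def sites1_def\<close>)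
  next
    case 6
    have n0: "i \<notin> sites0" using 6 by (auto simp: sites0_def left_def right_def)
    show ?thesis
      by (rule that[OF D_right[OF t 6]]) (use n0 right_nbr[of i] left_nbr[OF 6] 6 in \<open>auto simp: sites1_def\<close>)
  qed
qed

lemma U1_abs:
  assumes "0 <= t" "t <= t0" "i \<in> sites1 \<or> 3 * int N < \<bar>i\<bar>"
  shows "\<bar>U t i\<bar> <= \<Lambda>1 * \<bar>Y t i\<bar>"
proof (cases "i = j1 \<or> i = j2")
  case True
  then show ?thesis unfolding \<Lambda>1_def using early[OF assms(1,2) True] pos by (intro U_abs) auto
next
  case False
  have "\<bar>U t i\<bar> <= \<Lambda> * \<bar>Y t i\<bar>"
    by (rule reg_U_abs) (use assms False \<sigma>_t0 in \<open>auto simp: sites0_def sites1_def\<close>)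
  also have "\<dots> <= \<Lambda>1 * \<bar>Y t i\<bar>" using \<Lambda>_le by (intro mult_right_mono) auto
  finally show ?thesis .
qed

lemma U1_ge:
  assumes "0 <= t" "t <= t0" "i \<in> sites1 \<or> 3 * int N < \<bar>i\<bar>" "- p <= Y t i" "0 <= p"
  shows "- (\<Lambda>1 * p) <= U t i"
proof (cases "i = j1 \<or> i = j2")
  case True
  then show ?thesis unfolding \<Lambda>1_def using early[OF assms(1,2) True] pos assms by (intro U_ge) auto
next
  case False
  have "- (\<Lambda> * p) <= U t i"
    by (rule reg_U_ge) (use assms False \<sigma>_t0 in \<open>auto simp: sites0_def sites1_def\<close>)
  moreover have "\<Lambda> * p <= \<Lambda>1 * p" using \<Lambda>_le assms by (intro mult_right_mono) auto
  ultimately show ?thesis by linarith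
qed

lemma void_sites: "i \<in> sites1 \<or> (\<forall>t\<ge>0. x t i = 0 \<and> v t i = 0) \<or> (jB < i \<and> i mod 3 \<noteq> 0)"
proof (cases "3 * int N < \<bar>i\<bar>")
  case True
  then show ?thesis using fx.zero fv.zero by auto
next
  case False
  show ?thesis
  proof (cases "i <= jB")
    case True
    then have "i \<in> sites1" using False unfolding sites1_def sites0_def left_def by auto
    then show ?thesis ..
  next
    case F2: False
    show ?thesis
    proof (cases "i mod 3 = 0")
      case True
      define m where "m = nat (i div 3)"
      have "int m = i div 3" using F2 by (simp add: m_def)
      then have "i = 3 * int m" "int j + 2 <= int m" "int m <= int N" using True F2 False by presburger+
      then have "i \<in> right" unfolding right_def by auto
      then show ?thesis by (simp add: sites1_def)
    qed (use F2 in auto)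
  qed
qed

text \<open>Up to \<open>t0\<close> no slope exceeds \<open>\<Lambda>1\<close>, and
  \<open>16 * \<Lambda>1 * t0 <= 1\<close> leaves no time for doubling.\<close>

lemma bound1:
  assumes t: "\<sigma> <= t" "t <= t0" and i: "i \<in> sites1"
  shows "\<bar>Y t i\<bar> <= 2 * (K * g)"
proof (rule sup_bound[of sites1 G \<sigma> t0 "%i t. Y t i" "%_. K * g", OF fin(2) finite_G _ _ _ _ i t])
  fix s i assume s: "s \<in> {\<sigma><..<t0} - G" and bd: "!!k. k \<in> sites1 ==> \<bar>Y s k\<bar> <= 2 * (K * g)" and i: "i \<in> sites1"
  have s': "\<sigma> < s" "s < \<theta>" "s \<notin> G" "0 <= s" "s <= t0" using s \<sigma>_t0 \<sigma> by auto
  have Ub: "\<bar>U s k\<bar> <= \<Lambda>1 * (2 * (K * g))" if "k \<in> sites1 \<or> 3 * int N < \<bar>k\<bar>" for k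
  proof -
    have "\<bar>Y s k\<bar> <= 2 * (K * g)" using that bd[of k] U_void(2)[OF s'(4), of k] Kg by auto
    then show ?thesis using U1_abs[OF s'(4,5) that] pos mult_left_mono[of "\<bar>Y s k\<bar>" "2 * (K * g)" \<Lambda>1] by linarith
  qed
  from D_any[OF s'(1-3) early_alive[OF s'(4,5)] i] obtain k l
    where D: "((%t. Y t i) has_real_derivative U s k + 2 * U s i + U s l) (at s)"
      "k \<in> sites1 \<or> 3 * int N < \<bar>k\<bar>" "l \<in> sites1 \<or> 3 * int N < \<bar>l\<bar>" .
  have "\<bar>U s k + 2 * U s i + U s l\<bar> <= 4 * (\<Lambda>1 * (2 * (K * g)))"
    using Ub[OF D(2)] Ub[of i] Ub[OF D(3)] i by linarith
  then have "\<bar>U s k + 2 * U s i + U s l\<bar> * (t0 - \<sigma>) <= 4 * (\<Lambda>1 * (2 * (K * g))) * (t0 - \<sigma>)"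
    using \<sigma>_t0 by (intro mult_right_mono) auto
  also have "\<dots> = 8 * (K * g) * (\<Lambda>1 * (t0 - \<sigma>))" by simp
  also have "\<dots> <= 8 * (K * g) * (1 / 16)" using S2'[of t0] \<sigma>_t0 Kg by (intro mult_left_mono) auto
  finally show "\<exists>D. ((%t. Y t i) has_real_derivative D) (at s) \<and> \<bar>D\<bar> * (t0 - \<sigma>) <= K * g / 2"
    using D(1) by (intro exI[of _ "U s k + 2 * U s i + U s l"]) auto
qed (use Kg init_abs \<sigma> Y_cont in auto)

text \<open>Cooperativity: the positive value at \<open>jB\<close> only helps its neighbours, so
  negative values on the left stem from the error \<open>e\<close> alone. The site \<open>jB\<close>
  itself loses at most through \<open>e\<close> on its left and through \<open>K * g\<close> on its
  right, both with small rates.\<close>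

lemma lower1:
  assumes t: "\<sigma> <= t" "t <= t0"
  shows "i \<in> sites0 ==> - 2 * e <= Y t i" "g / 4 <= Y t jB"
proof -
  \<comment> \<open>The negative \<open>p0\<close> at \<open>jB\<close> turns the barrier there into
    a positive lower bound.\<close>
  define p0 where "p0 i = (if i = jB then - (g / 2) else 3 / 2 * e)" for i
  define p1 where "p1 i = (if i = jB then 2 * \<Lambda>1 * e + 2 * \<Lambda> * K * g else 8 * \<Lambda>1 * e)" for i
  have nB: "i \<noteq> jB" if "i \<in> sites0" for i using that by (auto simp: sites0_def left_def)
  have small: "p1 jB * (u - \<sigma>) <= g / 4" "i \<in> sites0 ==> p1 i * (u - \<sigma>) <= e / 2" if u: "\<sigma> <= u" "u <= t0" for u i
  proof -
    have 1: "\<Lambda>1 * (u - \<sigma>) <= 1 / 16" "\<Lambda> * K * (u - \<sigma>) <= 1 / 1000"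
      using S2'[OF u] S1'(1)[of \<sigma> u] u \<sigma> \<sigma>_t0 by auto
    have "2 * \<Lambda>1 * e * (u - \<sigma>) = 2 * e * (\<Lambda>1 * (u - \<sigma>))" "2 * \<Lambda> * K * g * (u - \<sigma>) = 2 * g * (\<Lambda> * K * (u - \<sigma>))"
      by simp_all
    moreover have "2 * e * (\<Lambda>1 * (u - \<sigma>)) <= 2 * e * (1 / 16)" "2 * g * (\<Lambda> * K * (u - \<sigma>)) <= 2 * g * (1 / 1000)"
      using 1 e g by (auto intro!: mult_left_mono)
    moreover have "p1 jB * (u - \<sigma>) = 2 * \<Lambda>1 * e * (u - \<sigma>) + 2 * \<Lambda> * K * g * (u - \<sigma>)" by (simp add: p1_def distrib_right)
    ultimately show "p1 jB * (u - \<sigma>) <= g / 4" using e3 g by linarith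
    assume "i \<in> sites0"
    have "8 * \<Lambda>1 * e * (u - \<sigma>) = 8 * e * (\<Lambda>1 * (u - \<sigma>))" by simp
    moreover have "8 * e * (\<Lambda>1 * (u - \<sigma>)) <= 8 * e * (1 / 16)" using 1 e by (intro mult_left_mono) auto
    ultimately show "p1 i * (u - \<sigma>) <= e / 2" using nB[OF \<open>i \<in> sites0\<close>] by (simp only: p1_def if_False)
  qed
  have main: "- (p0 i + p1 i * (t - \<sigma>)) < Y t i" if i: "i \<in> sites0 \<union> {jB}" for i
  proof (rule affine_barrier[of "sites0 \<union> {jB}" G \<sigma> t0 "%i t. Y t i", OF _ finite_G _ _ _ i t])
    fix u k assume u: "u \<in> {\<sigma><..<t0} - G" and low: "!!k. k \<in> sites0 \<union> {jB} ==> - (p0 k + p1 k * (u - \<sigma>)) < Y u k"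
      and k: "k \<in> sites0 \<union> {jB}"
    have u': "\<sigma> < u" "u < \<theta>" "u \<notin> G" "0 <= u" "u <= t0" "\<sigma> <= u" "u <= \<theta>" using u \<sigma>_t0 \<sigma> by auto
    have l0: "- (2 * e) <= Y u i" if "i \<in> sites0" for i
      using low[of i] small(2)[OF u'(6,5) that] that nB[OF that] by (auto simp: p0_def)
    have lB: "0 <= Y u jB" using low[of jB] small(1)[OF u'(6,5)] g by (auto simp: p0_def)
    have UB: "0 <= U u jB" by (rule U_nonneg) (use bigs[of u jB] u' lB in auto)
    have U0: "- (\<Lambda>1 * (2 * e)) <= U u i" if "i \<in> sites0 \<or> 3 * int N < \<bar>i\<bar> \<or> i = jB" for i
    proof (cases "i = jB")
      case True
      then show ?thesis using UB pos e by (smt (verit) mult_nonneg_nonneg)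
    next
      case False
      show ?thesis
        by (rule U1_ge) (use False that u' l0[of i] U_void(2)[OF u'(4), of i] e in \<open>auto simp: sites1_def\<close>)
    qed
    show "\<exists>D. ((%t. Y t k) has_real_derivative D) (at u) \<and> - p1 k <= D"
    proof (cases "k = jB")
      case True
      have "jB + 3 \<in> sites1 \<or> 3 * int N < \<bar>jB + 3\<bar>" using right_nbr[of jB] by (auto simp: sites1_def)
      then have R: "\<bar>Y u (jB + 3)\<bar> <= 2 * (K * g)"
        using bound1[of u "jB + 3"] U_void(2)[of u "jB + 3"] u' Kg by auto
      have "- (\<Lambda> * (2 * (K * g))) <= U u (jB + 3)"
        by (rule reg_U_ge) (use R right_nbr[of jB] u' Kg in auto)
      moreover have "- (\<Lambda>1 * (2 * e)) <= U u j2" by (rule U0) (auto simp: sites0_def)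
      ultimately show ?thesis unfolding True
        using D_alive(4)[OF u'(1-3) early_alive[OF u'(4,5)]] UB by (intro exI[of _ "U u j2 + 2 * U u jB + U u (jB + 3)"]) (auto simp: p1_def)
    next
      case False
      then have k0: "k \<in> sites0" "k \<in> sites1" using k by (auto simp: sites1_def)
      from D_any[OF u'(1-3) early_alive[OF u'(4,5)] k0(2)] obtain a b
        where D: "((%t. Y t k) has_real_derivative U u a + 2 * U u k + U u b) (at u)"
          "a \<in> sites0 \<or> 3 * int N < \<bar>a\<bar>" "b \<in> sites0 \<or> b = jB" using k0(1) by metis
      have "- (8 * \<Lambda>1 * e) <= U u a + 2 * U u k + U u b" using U0[of a] U0[of b] U0[of k] k0 D(2,3) by auto
      then show ?thesis using D(1) False by (intro exI[of _ "U u a + 2 * U u k + U u b"]) (auto simp: p1_def)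
    qed
  next
    fix k assume "k \<in> sites0 \<union> {jB}"
    then show "continuous_on {\<sigma>..t0} (%t. Y t k)" "- p0 k < Y \<sigma> k"
      using Y_cont[OF \<sigma>(1)] init_ge[of k] init_B g e by (auto simp: p0_def sites0_def left_def)
  qed (use fin in auto)
  show "g / 4 <= Y t jB" using main[of jB] small(1)[OF t] by (auto simp: p0_def)
  assume i: "i \<in> sites0"
  then show "- 2 * e <= Y t i" using main[of i] small(2)[OF t i] nB[OF i] by (simp add: p0_def)
qed

lemma U1_ge': "\<sigma> <= t ==> t <= t0 ==> i \<in> sites0 ==> - (2 * \<Lambda>1 * e) <= U t i"
  using U1_ge[of t i "2 * e"] lower1(1)[of t i] \<sigma> e by (auto simp: sites1_def)

lemma UB_ge:
  assumes "0 <= t" "t <= \<theta>" "p <= Y t jB" "0 <= p"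
  shows "cb * p <= U t jB"
proof -
  have "cb * p <= cb * Y t jB" using assms pos by (intro mult_left_mono) auto
  also have "\<dots> <= U t jB" unfolding cb_def using bigs[OF assms(1,2), of jB] assms by (intro U_low) auto
  finally show ?thesis .
qed

lemma mid_in: "j1 \<in> sites0" "j2 \<in> sites0" "jA \<in> sites0" by (auto simp: sites0_def)

text \<open>The perturbation at \<open>jB\<close> feeds \<open>j2\<close> at a rate proportional to
  \<open>g\<close>, against losses of order \<open>\<Lambda>1 * e\<close>.\<close>

lemma Y2_ge:
  assumes t: "\<sigma> <= t" "t <= t0"
  shows "cb * g / 8 * (t - \<sigma>) - e <= Y t j2"
proof -
  have "cb * g / 8 * (t - \<sigma>) <= Y t j2 - Y \<sigma> j2"
  proof (rule fe_ge[OF finite_G t(1)])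
    show "continuous_on {\<sigma>..t} (%t. Y t j2)" using Y_cont \<sigma> by auto
    fix u assume "u \<in> {\<sigma><..<t} - G"
    then have u: "\<sigma> < u" "u < \<theta>" "u \<notin> G" "0 <= u" "u <= t0" "\<sigma> <= u" "u <= \<theta>" using t \<sigma>_t0 \<sigma> by auto
    have "cb * (g / 4) <= U u jB" using lower1(2)[OF u(6,5)] u g by (intro UB_ge) auto
    moreover have "48 * (\<Lambda>1 * e) <= cb * g" using e1 by (simp add: \<Lambda>1_def cb_def)
    ultimately have "cb * g / 8 <= U u j1 + 2 * U u j2 + U u jB"
      using U1_ge'[OF u(6,5) mid_in(1)] U1_ge'[OF u(6,5) mid_in(2)] by auto
    then show "\<exists>D. ((%t. Y t j2) has_real_derivative D) (at u) \<and> cb * g / 8 <= D"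
      using D_alive(3)[OF u(1-3) early_alive[OF u(4,5)]] by blast
  qed
  then show ?thesis using init_ge[of j2] by linarith
qed

lemma small_le: "0 <= t ==> t <= T ==> i = j1 \<or> i = j2 ==> x t i <= 3 * r j \<and> v t i <= 3 * r j"
  using fx.pair_sum(2)[OF j, of t t] fv.pair_sum(2)[OF j, of t t] fx.nn[of t j1] fx.nn[of t j2] fv.nn[of t j1] fv.nn[of t j2] by auto

text \<open>The positive value travels from \<open>jB\<close> to \<open>j2\<close> and from there to
  \<open>j1\<close>. The second transfer is counted in the last quarter of \<open>{0..t0}\<close>
  only, when \<open>Y\<close> at \<open>j2\<close> is already of order \<open>g * t0\<close>; hence
  the two factors \<open>t0\<close> in the second bound on \<open>L0\<close>.\<close>

lemma start_pos: "L0 <= Y t0 j1" "L0 <= Y t0 j2" "g / 4 <= Y t0 jB"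
proof -
  have cbg: "0 < cb * g" using pos g by simp
  have Y2: "cb * g * t0 / 64 <= Y t j2" if t: "3 / 4 * t0 <= t" "t <= t0" for t
  proof -
    have "cb * g / 8 * (t0 / 4) <= cb * g / 8 * (t - \<sigma>)" using that t0 cbg by (intro mult_left_mono) auto
    moreover have "cb * g / 8 * (t0 / 4) = cb * g * t0 / 32" by simp
    moreover have "cb * g / 8 * (t - \<sigma>) - e <= Y t j2" using that t0 by (intro Y2_ge) auto
    moreover have "e <= cb * g * t0 / 64" using e3 L0_le(1) e by (simp add: cb_def)
    ultimately show ?thesis by linarith
  qed
  show "L0 <= Y t0 j2" using Y2[of t0] t0 L0_le(1) by (simp add: cb_def)
  define a1 where "a1 = \<beta> * (3 * r j) powr (- b) * (cb * g * t0) / 128"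
  have "a1 * (t0 - 3 / 4 * t0) <= Y t0 j1 - Y (3 / 4 * t0) j1"
  proof (rule fe_ge[OF finite_G])
    show "continuous_on {3 / 4 * t0..t0} (%t. Y t j1)" using Y_cont t0 by auto
    fix u assume "u \<in> {3 / 4 * t0<..<t0} - G"
    then have u: "\<sigma> < u" "u < \<theta>" "u \<notin> G" "0 <= u" "u <= t0" "\<sigma> <= u" "u <= \<theta>" "3 / 4 * t0 <= u" using t0 \<sigma>_t0 \<sigma> by auto
    have Y: "cb * g * t0 / 64 <= Y u j2" using Y2 u by auto
    then have "0 <= Y u j2" using cbg t0 by (smt (verit) divide_nonneg_pos mult_nonneg_nonneg)
    have "\<beta> * (3 * r j) powr (- b) * (cb * g * t0 / 64) <= \<beta> * (3 * r j) powr (- b) * Y u j2"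
      using Y fx.\<beta> by (intro mult_left_mono) auto
    also have "\<dots> <= U u j2"
      using early[OF u(4,5), of j2] small_le[of u j2] u \<theta>T pos \<open>0 <= Y u j2\<close> by (intro U_low) auto
    finally have "2 * a1 <= U u j2" by (simp add: a1_def mult_ac)
    moreover have "6 * (\<Lambda>1 * e) <= a1" using e2 by (simp add: \<Lambda>1_def cb_def a1_def)
    ultimately have "a1 <= U u jA + 2 * U u j1 + U u j2"
      using U1_ge'[OF u(6,5) mid_in(1)] U1_ge'[OF u(6,5) mid_in(3)] by auto
    then show "\<exists>D. ((%t. Y t j1) has_real_derivative D) (at u) \<and> a1 <= D"
      using D_alive(2)[OF u(1-3) early_alive[OF u(4,5)]] by blast
  qed (use t0 in auto)
  moreover have "- 2 * e <= Y (3 / 4 * t0) j1" by (rule lower1(1)) (use t0 mid_in in auto)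
  moreover have "L0 <= a1 * t0 / 8" using L0_le(2) by (simp add: a1_def cb_def)
  ultimately show "L0 <= Y t0 j1" using e3 by simp
  show "g / 4 <= Y t0 jB" by (rule lower1(2)) (use \<sigma>_t0 in auto)
qed

end

section \<open>From \<open>t0\<close> to the first death in the perturbed pair\<close>

context stage_run
begin

text \<open>The size at time \<open>t\<close> of an exact tie without influx that dies at
  \<open>d\<close>.\<close>

definition "X t = (b * (d - t)) powr (1 / b)" for t

lemma X_powr: "t <= d ==> X t powr b = b * (d - t)"
  using pos by (simp add: X_def powr_powr)

lemma X_pos: "t < d ==> 0 < X t" using pos by (simp add: X_def)

lemma X_mono: "a <= t ==> t <= d ==> X t <= X a"
  unfolding X_def using pos by (intro powr_mono2) auto

text \<open>Since \<open>b >= 1\<close>, a relative error \<open>\<kappa>\<close> in the power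
  \<open>b\<close> is at most a relative error \<open>\<kappa>\<close> in the size.\<close>

lemma v_X:
  assumes "0 <= t" "t <= d" "i = j1 \<or> i = j2"
  shows "v t i <= (1 + \<kappa>) * X t" "(1 - \<kappa>) * X t <= v t i"
proof -
  have b1: "1 <= b" using fx.\<beta> by simp
  have X0: "0 <= X t" by (simp add: X_def)
  have "\<bar>v t i powr b - X t powr b\<bar> <= \<kappa> * X t powr b"
    using profile[OF assms] by (simp only: X_powr[OF assms(2)])
  then have P: "v t i powr b <= (1 + \<kappa>) * X t powr b" "(1 - \<kappa>) * X t powr b <= v t i powr b"
    by (simp_all add: abs_le_iff distrib_right left_diff_distrib)
  have "(1 + \<kappa>) powr 1 <= (1 + \<kappa>) powr b" using \<kappa> b1 by (intro powr_mono) auto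
  then have "(1 + \<kappa>) * X t powr b <= ((1 + \<kappa>) * X t) powr b" using \<kappa> X0 by (auto simp: powr_mult intro!: mult_right_mono)
  then have "v t i powr b <= ((1 + \<kappa>) * X t) powr b" using P by linarith
  then show "v t i <= (1 + \<kappa>) * X t" using powr_less_mono2[of b "(1 + \<kappa>) * X t" "v t i"] pos \<kappa> X0 by force
  have "(1 - \<kappa>) powr b <= (1 - \<kappa>) powr 1" using \<kappa> b1 by (intro powr_mono') auto
  then have "((1 - \<kappa>) * X t) powr b <= (1 - \<kappa>) * X t powr b" using \<kappa> X0 by (auto simp: powr_mult intro!: mult_right_mono)
  then have "((1 - \<kappa>) * X t) powr b <= v t i powr b" using P by linarith
  then show "(1 - \<kappa>) * X t <= v t i" using powr_less_mono2[of b "v t i" "(1 - \<kappa>) * X t"] pos fv.nn[OF assms(1), of i] by force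
qed

lemma v_d: "i = j1 \<or> i = j2 ==> v d i = 0"
  using v_X[of d i] t0 fv.nn[of d i] by (auto simp: X_def)

lemma eKg: "e <= K * g" using e3 Kg g by linarith

text \<open>After \<open>t0\<close> the slopes at the pair are unbounded, but only the sign of
  \<open>U\<close> there is used: positive \<open>Y\<close> at \<open>j1\<close>, \<open>j2\<close>
  and \<open>jB\<close> pushes all neighbours up. Negative influences come from regular sites alone,
  with the small rate \<open>\<Lambda>\<close>.\<close>

lemma barrier:
  assumes \<tau>: "t0 <= \<tau>" "\<tau> <= \<theta>" and al: "!!t. t0 <= t ==> t < \<tau> ==> alive t" and t: "t0 <= t" "t <= \<tau>"
  shows "i \<in> left \<or> i = jA ==> - 4 * e <= Y t i" "L0 / 2 <= Y t j1" "L0 / 2 <= Y t j2" "g / 8 <= Y t jB"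
    "i \<in> right ==> - 3 * (K * g) <= Y t i"
proof -
  define p0 where "p0 i = (if i = jB then - (g / 5) else if i = j1 then - (3 / 4 * L0) else if i = j2 then - (L0 / 2 + L0 / 4)
      else if i \<in> right then 9 / 4 * (K * g) else 3 * e)" for i
  define p1 where "p1 i = (if i = jB then 3 * \<Lambda> * K * g else if i = j1 then 4 * \<Lambda> * e else if i = j2 then 0
      else if i \<in> right then 12 * \<Lambda> * (K * g) else 16 * \<Lambda> * e)" for i
  have R: "i \<noteq> jB" "i \<noteq> j1" "i \<noteq> j2" "i \<notin> left" "i \<noteq> jA" if "i \<in> right" for i using that by (auto simp: right_def left_def)
  have Lf: "i \<noteq> jB" "i \<noteq> j1" "i \<noteq> j2" "i \<notin> right" if "i \<in> left \<or> i = jA" for i using that by (auto simp: right_def left_def)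
  have bnd: "p0 jB + p1 jB * (u - t0) <= - (g / 8)" "p0 j1 + p1 j1 * (u - t0) <= - (L0 / 2)" "p0 j2 + p1 j2 * (u - t0) <= - (L0 / 2)"
    "!!i. i \<in> right ==> p0 i + p1 i * (u - t0) <= 3 * (K * g)" "!!i. i \<in> left \<or> i = jA ==> p0 i + p1 i * (u - t0) <= 4 * e"
    if u: "t0 <= u" "u <= \<tau>" for u
  proof -
    have 1: "\<Lambda> * (u - t0) <= 1 / 1000" "\<Lambda> * K * (u - t0) <= 1 / 1000" using S1'[of t0 u] u \<tau> t0 by auto
    have 2: "\<Lambda> * e * (u - t0) <= e / 1000" "\<Lambda> * (K * g) * (u - t0) <= g / 1000"
      using mult_left_mono[OF 1(1), of e] mult_left_mono[OF 1(2), of g] e g by (simp_all add: mult_ac)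
    have "p1 jB * (u - t0) = 3 * (\<Lambda> * (K * g) * (u - t0))" by (simp add: p1_def)
    moreover have "p0 jB = - (g / 5)" by (simp add: p0_def)
    ultimately show "p0 jB + p1 jB * (u - t0) <= - (g / 8)" using 2 g by linarith
    have "p1 j1 * (u - t0) = 4 * (\<Lambda> * e * (u - t0))" by (simp add: p1_def)
    moreover have "p0 j1 = - (3 / 4 * L0)" by (simp add: p0_def)
    ultimately show "p0 j1 + p1 j1 * (u - t0) <= - (L0 / 2)" using 2 e3 L0 by linarith
    show "p0 j2 + p1 j2 * (u - t0) <= - (L0 / 2)" using L0 by (simp add: p0_def p1_def)
    fix i
    show "p0 i + p1 i * (u - t0) <= 3 * (K * g)" if i: "i \<in> right"
    proof -
      have "p1 i * (u - t0) = 12 * (\<Lambda> * (K * g) * (u - t0))" using R[OF i] i by (simp add: p1_def)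
      moreover have "p0 i = 9 / 4 * (K * g)" using R[OF i] i by (simp add: p0_def)
      ultimately show ?thesis using 2 g Kg by linarith
    qed
    show "p0 i + p1 i * (u - t0) <= 4 * e" if i: "i \<in> left \<or> i = jA"
    proof -
      have "p1 i * (u - t0) = 16 * (\<Lambda> * e * (u - t0))" using Lf[OF i] by (simp add: p1_def)
      moreover have "p0 i = 3 * e" using Lf[OF i] by (simp add: p0_def)
      ultimately show ?thesis using 2 e by linarith
    qed
  qed
  have main: "- (p0 i + p1 i * (t - t0)) < Y t i" if i: "i \<in> sites1" for i
  proof (rule affine_barrier[of sites1 G t0 \<tau> "%i t. Y t i", OF _ finite_G _ _ _ i t])
    fix u k assume u: "u \<in> {t0<..<\<tau>} - G" and low: "!!k. k \<in> sites1 ==> - (p0 k + p1 k * (u - t0)) < Y u k" and k: "k \<in> sites1"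
    have u': "\<sigma> < u" "u < \<theta>" "u \<notin> G" "0 <= u" "t0 <= u" "u <= \<theta>" "u <= \<tau>" "u < \<tau>" using u \<sigma>_t0 \<sigma> \<tau> by auto
    have alu: "alive u" by (rule al) (use u' in auto)
    note bu = bnd[OF u'(5,7)]
    have YL: "- (4 * e) <= Y u i" if "i \<in> left \<or> i = jA" for i
      using low[of i] bu(5)[OF that] that by (auto simp: sites1_def sites0_def)
    have YR: "- (3 * (K * g)) <= Y u i" if "i \<in> right" for i
      using low[of i] bu(4)[OF that] that by (auto simp: sites1_def)
    have Y12: "0 <= Y u j1" "0 <= Y u j2" "0 <= Y u jB"
      using low[of j1] low[of j2] low[of jB] bu(1-3) L0 g by (auto simp: sites1_def sites0_def)
    have UL: "- (4 * \<Lambda> * e) <= U u i" if "i \<in> left \<or> i = jA \<or> 3 * int N < \<bar>i\<bar>" for i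
      using reg_U_ge[of u i "4 * e"] YL[of i] U_void(2)[of u i] that u' e by auto
    have UR: "- (3 * \<Lambda> * (K * g)) <= U u i" if "i \<in> right \<or> 3 * int N < \<bar>i\<bar>" for i
      using reg_U_ge[of u i "3 * (K * g)"] YR[of i] U_void(2)[of u i] that u' Kg by auto
    have U12: "0 <= U u j1" "0 <= U u j2" "0 <= U u jB"
      using Y12 alu bigs[of u jB] u' by (auto simp: alive_def intro!: U_nonneg)
    from k consider "k \<in> left" | "k = jA" | "k = j1" | "k = j2" | "k = jB" | "k \<in> right"
      unfolding sites1_def sites0_def by auto
    then show "\<exists>D. ((%t. Y t k) has_real_derivative D) (at u) \<and> - p1 k <= D"
    proof cases
      case 1
      have "k - 1 \<in> left \<or> 3 * int N < \<bar>k - 1\<bar>" "k + 1 \<in> left \<or> k + 1 = jA" using 1 by (auto simp: left_def)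
      then have "- p1 k <= U u (k - 1) + 2 * U u k + U u (k + 1)"
        using UL[of "k - 1"] UL[of "k + 1"] UL[of k] 1 Lf[of k] by (auto simp: p1_def)
      then show ?thesis using D_left[OF u'(1-3) 1] by blast
    next
      case 2
      have "jA - 1 \<in> left" using j by (simp add: left_def)
      then have "- p1 k <= U u (jA - 1) + 2 * U u jA + U u j1"
        using UL[of "jA - 1"] UL[of jA] U12 2 Lf[of jA] mult_pos_pos[OF \<Lambda>_pos e] by (auto simp: p1_def mult.assoc)
      then show ?thesis unfolding 2 using D_alive(1)[OF u'(1-3) alu] by blast
    next
      case 3
      have "- p1 k <= U u jA + 2 * U u j1 + U u j2" using UL[of jA] U12 3 by (auto simp: p1_def)
      then show ?thesis unfolding 3 using D_alive(2)[OF u'(1-3) alu] by blast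
    next
      case 4
      have "- p1 k <= U u j1 + 2 * U u j2 + U u jB" using U12 4 by (auto simp: p1_def)
      then show ?thesis unfolding 4 using D_alive(3)[OF u'(1-3) alu] by blast
    next
      case 5
      have "- p1 k <= U u j2 + 2 * U u jB + U u (jB + 3)" using U12 5 UR[of "jB + 3"] right_nbr[of jB] by (auto simp: p1_def)
      then show ?thesis unfolding 5 using D_alive(4)[OF u'(1-3) alu] by blast
    next
      case 6
      have "0 <= 3 * \<Lambda> * (K * g)" using \<Lambda>_pos Kg by simp
      have "- (3 * \<Lambda> * (K * g)) <= U u (k - 3)"
      proof (cases "k - 3 = jB")
        case True
        show ?thesis unfolding True using U12(3) \<open>0 <= 3 * \<Lambda> * (K * g)\<close> by linarith
      next
        case False
        then show ?thesis using UR[of "k - 3"] left_nbr[OF 6] by blast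
      qed
      then have "- p1 k <= U u (k - 3) + 2 * U u k + U u (k + 3)"
        using UR[of k] UR[of "k + 3"] right_nbr[of k] 6 R[OF 6] by (auto simp: p1_def)
      then show ?thesis using D_right[OF u'(1-3) 6] by blast
    qed
  next
    fix k assume k: "k \<in> sites1"
    then show "continuous_on {t0..\<tau>} (%t. Y t k)" using Y_cont t0 by auto
    from k consider "k \<in> left \<or> k = jA" | "k = j1" | "k = j2" | "k = jB" | "k \<in> right"
      unfolding sites1_def sites0_def by auto
    then show "- p0 k < Y t0 k"
    proof cases
      case 1
      then have "k \<in> sites0" by (auto simp: sites0_def)
      then show ?thesis using lower1(1)[of t0 k] Lf[OF 1] \<sigma>_t0 e by (auto simp: p0_def)
    next
      case 5
      have "\<bar>Y t0 k\<bar> <= 2 * (K * g)" by (rule bound1) (use \<sigma>_t0 k in auto)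
      then show ?thesis using R[OF 5] 5 Kg by (auto simp: p0_def)
    qed (use start_pos L0 g in \<open>auto simp: p0_def\<close>)
  qed (use fin in auto)
  show "i \<in> left \<or> i = jA ==> - 4 * e <= Y t i" using main[of i] bnd(5)[OF t, of i] by (auto simp: sites1_def sites0_def)
  show "L0 / 2 <= Y t j1" "L0 / 2 <= Y t j2" "g / 8 <= Y t jB"
    using main[of j1] main[of j2] main[of jB] bnd(1-3)[OF t] by (auto simp: sites1_def sites0_def)
  show "i \<in> right ==> - 3 * (K * g) <= Y t i" using main[of i] bnd(4)[OF t, of i] by (auto simp: sites1_def)
qed

text \<open>\<open>i\<close> survives and \<open>l\<close> dies. For \<open>s * sg j1 = 1\<close>,
  positive \<open>Y\<close> means that \<open>x\<close> is above \<open>v\<close> at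
  \<open>j1\<close> and below \<open>v\<close> at \<open>j2\<close>, so the right particle goes
  first; otherwise the left one.\<close>

definition "loser i l \<longleftrightarrow> (i = j1 \<and> l = j2 \<and> s * sg j1 = 1) \<or> (i = j2 \<and> l = j1 \<and> s * sg j1 = - 1)"

text \<open>At the common death of the pair of \<open>v\<close> both \<open>Y\<close> values would
  still be positive, which forces a negative size of \<open>x\<close> at one of the two sites. So
  \<open>x\<close> loses that particle strictly before \<open>d\<close>, and the other one, being
  above \<open>v\<close>, is alive.\<close>

lemma first_death:
  obtains \<tau> i l where "t0 < \<tau>" "\<tau> < d" "!!t. 0 <= t ==> t < \<tau> ==> alive t" "loser i l" "x \<tau> l = 0" "0 < x \<tau> i"
proof -
  interpret P: pair_system \<beta> "2 powr \<beta>" T fx.F "%t. x t j1" "%t. x t j2" "%t. x t jA powr (- \<beta>)" "%t. x t jB powr (- \<beta>)"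
    by (rule fx.pair[OF j])
  interpret P': pair_system \<beta> "2 powr \<beta>" T fx.F "%t. x t j2" "%t. x t j1" "%t. x t jB powr (- \<beta>)" "%t. x t jA powr (- \<beta>)"
    by (rule P.swap)
  have dead: "x \<theta> j1 = 0" "x \<theta> j2 = 0" using fx.pair_dead[OF j order_refl \<theta>T] by auto
  have a0: "0 < x t0 j1" "0 < x t0 j2" using early_alive[of t0] t0 by (auto simp: alive_def)
  obtain d1 where d1: "t0 < d1" "d1 <= \<theta>" "x d1 j1 = 0" "!!t. t0 <= t ==> t < d1 ==> 0 < x t j1"
    by (rule P.death_time[of t0 \<theta>]) (use \<sigma>_t0 t0 \<theta>T dead a0 in auto)
  obtain d2 where d2: "t0 < d2" "d2 <= \<theta>" "x d2 j2 = 0" "!!t. t0 <= t ==> t < d2 ==> 0 < x t j2"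
    by (rule P'.death_time[of t0 \<theta>]) (use \<sigma>_t0 t0 \<theta>T dead a0 in auto)
  define \<tau> where "\<tau> = min d1 (min d2 d)"
  have al0: "alive t" if "t0 <= t" "t < \<tau>" for t
    using d1(4)[OF that(1)] d2(4)[OF that(1)] v_alive[of t] that t0 unfolding alive_def \<tau>_def by auto
  have al: "alive t" if "0 <= t" "t < \<tau>" for t
    using early_alive[of t] al0[of t] that by (cases "t <= t0") auto
  have le: "t0 <= \<tau>" "\<tau> <= \<theta>" "\<tau> <= d" unfolding \<tau>_def using d1 d2 t0 by auto
  note B = barrier[OF le(1,2) al0 le(1) order_refl]
  have Yp: "0 < s * sg j1 * (x \<tau> j1 - v \<tau> j1)" "0 < - (s * sg j1) * (x \<tau> j2 - v \<tau> j2)"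
  proof -
    have "0 < Y \<tau> j1" "0 < Y \<tau> j2" using B(2,3) L0 by linarith+
    moreover have "sg j2 = - sg j1" by (rule sg_odd) auto
    ultimately show "0 < s * sg j1 * (x \<tau> j1 - v \<tau> j1)" "0 < - (s * sg j1) * (x \<tau> j2 - v \<tau> j2)"
      unfolding Y_def by auto
  qed
  have x0: "0 <= x \<tau> j1" "0 <= x \<tau> j2" "0 <= v \<tau> j1" "0 <= v \<tau> j2" using le t0 by (auto intro: fx.nn fv.nn)
  have "\<tau> \<noteq> d" and "(s * sg j1 = 1 \<and> x \<tau> j2 = 0 \<and> 0 < x \<tau> j1) \<or> (s * sg j1 = - 1 \<and> x \<tau> j1 = 0 \<and> 0 < x \<tau> j2)"
  proof -
    have ss: "s * sg j1 = 1 \<or> s * sg j1 = - 1" using s sg_cases[of j1] by auto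
    show ne: "\<tau> \<noteq> d"
    proof
      assume "\<tau> = d"
      then have "v \<tau> j1 = 0" "v \<tau> j2 = 0" using v_d by auto
      then show False using Yp ss x0 by auto
    qed
    then have "\<tau> = d1 \<or> \<tau> = d2" unfolding \<tau>_def min_def by (auto split: if_splits)
    then have "x \<tau> j1 = 0 \<or> x \<tau> j2 = 0" using d1 d2 by auto
    then show "(s * sg j1 = 1 \<and> x \<tau> j2 = 0 \<and> 0 < x \<tau> j1) \<or> (s * sg j1 = - 1 \<and> x \<tau> j1 = 0 \<and> 0 < x \<tau> j2)"
      using ss Yp x0 by auto
  qed
  moreover have "t0 < \<tau> \<or> \<tau> = d" using d1 d2 le t0 unfolding \<tau>_def by (auto simp: min_def)
  ultimately show ?thesis
    using that[of \<tau> j1 j2] that[of \<tau> j2 j1] al le unfolding loser_def by auto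
qed

end

section \<open>Growth of the perturbation up to the first death\<close>

locale stage_tau = stage_run +
  fixes \<tau> :: real and iw il :: int
  assumes \<tau>: "t0 < \<tau>" "\<tau> < d" and al: "!!t. 0 <= t ==> t < \<tau> ==> alive t"
    and lo: "loser iw il" and dies: "x \<tau> il = 0" "0 < x \<tau> iw"
begin

text \<open>Up to the sign, the gap between the two particles of \<open>x\<close> minus the gap
  between those of \<open>v\<close>.\<close>

definition "q t = Y t j1 + Y t j2" for t
definition "Q = q \<tau>"
definition "PA t = Y t jA - (2 * Y t j1 - Y t j2) / 3" for t
definition "PB t = Y t jB + (Y t j1 - 2 * Y t j2) / 3" for t
definition "B = 4 * (K * g) + Q"

lemma \<tau>_le: "t0 <= \<tau>" "\<tau> <= \<theta>" "\<tau> <= d" "0 <= \<tau>" using \<tau> t0 by auto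

lemma bar:
  assumes t: "t0 <= t" "t <= \<tau>"
  shows "i \<in> left \<or> i = jA ==> - 4 * e <= Y t i" "L0 / 2 <= Y t j1" "L0 / 2 <= Y t j2" "g / 8 <= Y t jB"
    "i \<in> right ==> - 3 * (K * g) <= Y t i"
  using barrier[OF \<tau>_le(1,2) al t] t0 by auto

lemma U_signs:
  assumes t: "t0 <= t" "t < \<tau>"
  shows "0 <= U t j1" "0 <= U t j2" "cb * (g / 8) <= U t jB" "i \<in> left \<or> i = jA ==> - (4 * \<Lambda> * e) <= U t i"
proof -
  have b: "- 4 * e <= Y t i" if "i \<in> left \<or> i = jA" for i using bar(1)[of t i] that t by auto
  have al': "alive t" using al[of t] t t0 by auto
  show "0 <= U t j1" "0 <= U t j2"
    using bar(2,3)[of t] t L0 al' unfolding alive_def by (auto intro!: U_nonneg)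
  show "cb * (g / 8) <= U t jB" using bar(4)[of t] t t0 \<tau>_le g by (intro UB_ge) auto
  assume i: "i \<in> left \<or> i = jA"
  show "- (4 * \<Lambda> * e) <= U t i" using reg_U_ge[of t i "4 * e"] b[OF i] i t t0 \<tau>_le e by auto
qed

lemma \<Lambda>e: "16 * (\<Lambda> * e) <= cb * g / 3"
proof -
  have "\<Lambda> * e <= \<Lambda>1 * e" using \<Lambda>_le e by (intro mult_right_mono) auto
  moreover have "48 * (\<Lambda>1 * e) <= cb * g" using e1 by (simp add: \<Lambda>1_def cb_def)
  ultimately show ?thesis by linarith
qed

text \<open>\<open>U\<close> at \<open>jB\<close> is at least \<open>cb * g / 8\<close> and
  outweighs the possibly negative \<open>U\<close> at \<open>jA\<close>, so \<open>q\<close> grows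
  at least as fast as the pair alone would make it.\<close>

lemma q_deriv:
  assumes "t \<in> {t0<..<\<tau>} - G"
  shows "\<exists>D. (q has_real_derivative D) (at t) \<and> 3 * (U t j1 + U t j2) <= D"
proof -
  have t: "\<sigma> < t" "t < \<theta>" "t \<notin> G" "alive t" "t0 <= t" "t < \<tau>" using assms \<sigma>_t0 \<sigma> \<tau>_le t0 al[of t] by auto
  have "(q has_real_derivative (U t jA + 2 * U t j1 + U t j2) + (U t j1 + 2 * U t j2 + U t jB)) (at t)"
    unfolding q_def by (intro DERIV_add D_alive[OF t(1-4)])
  moreover have "0 <= U t jA + U t jB" using U_signs(3)[OF t(5,6)] U_signs(4)[OF t(5,6) disjI2[OF refl]] \<Lambda>e mult_pos_pos[OF \<Lambda>_pos e] by linarith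
  ultimately show ?thesis by (intro exI[of _ "(U t jA + 2 * U t j1 + U t j2) + (U t j1 + 2 * U t j2 + U t jB)"]) auto
qed

lemma q_cont: "0 <= a ==> continuous_on {a..u} q"
  unfolding q_def by (intro continuous_intros Y_cont)

lemma q_mono:
  assumes "t0 <= a" "a <= t" "t <= \<tau>"
  shows "q a <= q t"
proof -
  have "0 * (t - a) <= q t - q a"
  proof (rule fe_ge[OF finite_G assms(2)])
    show "continuous_on {a..t} q" using q_cont assms t0 by auto
    fix u assume u: "u \<in> {a<..<t} - G"
    then have u': "u \<in> {t0<..<\<tau>} - G" using assms by auto
    have "0 <= U u j1" "0 <= U u j2" using U_signs(1,2)[of u] u' by auto
    then show "\<exists>D. (q has_real_derivative D) (at u) \<and> 0 <= D" using q_deriv[OF u'] by (meson add_nonneg_nonneg mult_nonneg_nonneg order_trans zero_le_numeral)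
  qed
  then show ?thesis by simp
qed

lemma Y12: "t0 <= t ==> t <= \<tau> ==> 0 <= Y t j1 \<and> Y t j1 <= q t \<and> 0 <= Y t j2 \<and> Y t j2 <= q t \<and> q t <= Q"
  using bar(2,3)[of t] L0 q_mono[of t \<tau>] by (auto simp: q_def Q_def)

lemma Q_pos: "0 < Q" "L0 <= Q" using bar(2,3)[of \<tau>] \<tau>_le L0 by (auto simp: q_def Q_def)

text \<open>In \<open>PA\<close> and \<open>PB\<close> the singular terms \<open>U j1\<close> and \<open>U j2\<close> cancel.\<close>

lemma PA_deriv:
  assumes u: "\<sigma> < u" "u < \<theta>" "u \<notin> G" "alive u"
  shows "(PA has_real_derivative U u (jA - 1) + 4 / 3 * U u jA + U u jB / 3) (at u)"
proof -
  have "(PA has_real_derivative (U u (jA - 1) + 2 * U u jA + U u j1) -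
      (2 * (U u jA + 2 * U u j1 + U u j2) - (U u j1 + 2 * U u j2 + U u jB)) / 3) (at u)"
    unfolding PA_def by (intro DERIV_diff DERIV_cdivide DERIV_cmult D_alive[OF u])
  then show ?thesis by (simp add: field_simps)
qed

text \<open>The slopes at the pair are unbounded near \<open>\<tau>\<close>, so the bootstrap runs
  with \<open>PA\<close> and \<open>PB\<close> in place of the values at \<open>jA\<close> and
  \<open>jB\<close>; the difference is at most a multiple of \<open>Q\<close>.\<close>

lemma bound2:
  assumes t: "t0 <= t" "t <= \<tau>" and i: "i \<in> left \<or> i = jA \<or> i = jB \<or> i \<in> right"
  shows "\<bar>Y t i\<bar> <= 3 * B"
proof -
  define f where "f i t = (if i = jA then PA t else if i = jB then PB t else Y t i)" for i t
  let ?I = "left \<union> {jA, jB} \<union> right"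
  have B0: "0 < B" using Kg Q_pos by (simp add: B_def)
  have QB: "Q <= B" using Kg by (simp add: B_def)
  have Yf: "\<bar>Y u k\<bar> <= 3 * B" if u: "t0 <= u" "u <= \<tau>" and fk: "\<bar>f k u\<bar> <= 2 * B" for u k
    using fk Y12[OF u] QB B0 unfolding f_def PA_def PB_def by (auto split: if_splits simp: abs_le_iff add_divide_distrib diff_divide_distrib)
  have nAB: "k \<noteq> jA" "k \<noteq> jB" if "k \<in> left \<or> k \<in> right" for k using that by (auto simp: left_def right_def)
  have "\<bar>f i t\<bar> <= 2 * B"
  proof (rule sup_bound[of ?I G t0 \<tau> f "%_. B", OF _ finite_G _ _ B0 _ _ t])
    fix u k assume u: "u \<in> {t0<..<\<tau>} - G" and bd: "!!k. k \<in> ?I ==> \<bar>f k u\<bar> <= 2 * B" and k: "k \<in> ?I"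
    have u': "\<sigma> < u" "u < \<theta>" "u \<notin> G" "alive u" "t0 <= u" "u <= \<tau>" "0 <= u" "u <= \<theta>" using u \<sigma>_t0 \<sigma> \<tau>_le t0 al[of u] by auto
    have Ub: "\<bar>U u k\<bar> <= \<Lambda> * (3 * B)" if "k \<in> ?I \<or> 3 * int N < \<bar>k\<bar>" for k
    proof -
      have "\<bar>Y u k\<bar> <= 3 * B" using that Yf[OF u'(5,6) bd, of k] U_void(2)[OF u'(7), of k] B0 by auto
      then have "\<Lambda> * \<bar>Y u k\<bar> <= \<Lambda> * (3 * B)" using \<Lambda>_pos by (intro mult_left_mono) auto
      moreover have "\<bar>U u k\<bar> <= \<Lambda> * \<bar>Y u k\<bar>" by (rule reg_U_abs) (use that u' in auto)
      ultimately show ?thesis by linarith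
    qed
    have small: "\<bar>D\<bar> * (\<tau> - t0) <= B / 2" if "\<bar>D\<bar> <= 4 * (\<Lambda> * (3 * B))" for D
    proof -
      have "\<bar>D\<bar> * (\<tau> - t0) <= 4 * (\<Lambda> * (3 * B)) * (\<tau> - t0)" using that \<tau> by (intro mult_right_mono) auto
      also have "\<dots> = 12 * B * (\<Lambda> * (\<tau> - t0))" by simp
      also have "\<dots> <= 12 * B * (1 / 1000)" using S1'(2)[of t0 \<tau>] \<tau>_le t0 B0 by (intro mult_left_mono) auto
      finally show ?thesis using B0 by simp
    qed
    have jA1: "jA - 1 \<in> left" using j by (simp add: left_def)
    have jB3: "jB + 3 \<in> ?I \<or> 3 * int N < \<bar>jB + 3\<bar>" using right_nbr[of jB] by auto
    from k consider "k \<in> left" | "k = jA" | "k = jB" | "k \<in> right" by auto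
    then show "\<exists>D. (f k has_real_derivative D) (at u) \<and> \<bar>D\<bar> * (\<tau> - t0) <= B / 2"
    proof cases
      case 1
      have "k - 1 \<in> ?I \<or> 3 * int N < \<bar>k - 1\<bar>" "k + 1 \<in> ?I" using 1 by (auto simp: left_def)
      then have "\<bar>U u (k - 1) + 2 * U u k + U u (k + 1)\<bar> <= 4 * (\<Lambda> * (3 * B))"
        using Ub[of "k - 1"] Ub[of k] Ub[of "k + 1"] k by linarith
      moreover have "f k = (%t. Y t k)" using nAB[of k] 1 by (auto simp: f_def)
      ultimately show ?thesis using D_left[OF u'(1-3) 1] small by auto
    next
      case 2
      note PA_deriv[OF u'(1-4)]
      moreover have "\<bar>U u (jA - 1) + 4 / 3 * U u jA + U u jB / 3\<bar> <= 4 * (\<Lambda> * (3 * B))"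
        using Ub[of "jA - 1"] Ub[of jA] Ub[of jB] jA1 by (auto simp: abs_le_iff)
      moreover have "f k = PA" using 2 by (auto simp: f_def)
      ultimately show ?thesis using small by auto
    next
      case 3
      have "(PB has_real_derivative (U u j2 + 2 * U u jB + U u (jB + 3)) +
          ((U u jA + 2 * U u j1 + U u j2) - 2 * (U u j1 + 2 * U u j2 + U u jB)) / 3) (at u)"
        unfolding PB_def by (intro DERIV_add DERIV_diff DERIV_cdivide DERIV_cmult D_alive[OF u'(1-4)])
      then have "(PB has_real_derivative U u (jB + 3) + 4 / 3 * U u jB + U u jA / 3) (at u)"
        by (simp add: field_simps)
      moreover have "\<bar>U u (jB + 3) + 4 / 3 * U u jB + U u jA / 3\<bar> <= 4 * (\<Lambda> * (3 * B))"
        using Ub[OF jB3] Ub[of jA] Ub[of jB] by (auto simp: abs_le_iff)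
      moreover have "f k = PB" using 3 by (auto simp: f_def)
      ultimately show ?thesis using small by auto
    next
      case 4
      have "k - 3 \<in> ?I" "k + 3 \<in> ?I \<or> 3 * int N < \<bar>k + 3\<bar>" using right_nbr[of k] left_nbr[OF 4] 4 by auto
      then have "\<bar>U u (k - 3) + 2 * U u k + U u (k + 3)\<bar> <= 4 * (\<Lambda> * (3 * B))"
        using Ub[of "k - 3"] Ub[of k] Ub[of "k + 3"] k by linarith
      moreover have "f k = (%t. Y t k)" using nAB[of k] 4 by (auto simp: f_def)
      ultimately show ?thesis using D_right[OF u'(1-3) 4] small by auto
    qed
  next
    fix k assume k: "k \<in> ?I"
    show "continuous_on {t0..\<tau>} (f k)"
      unfolding f_def PA_def PB_def using Y_cont t0 by (cases "k = jA"; cases "k = jB") (auto intro!: continuous_intros)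
    have bd: "\<bar>Y t0 k\<bar> <= 2 * (K * g)" if "k \<in> sites1" for k by (rule bound1) (use \<sigma>_t0 that in auto)
    have "k \<in> sites1" using k by (auto simp: sites1_def sites0_def)
    then show "\<bar>f k t0\<bar> <= B"
      using bd[of k] bd[of j1] bd[of j2] Q_pos Kg unfolding f_def PA_def PB_def B_def
      by (auto simp: sites1_def sites0_def abs_le_iff add_divide_distrib diff_divide_distrib)
  qed (use i finite_sites in auto)
  then show ?thesis by (rule Yf[OF t])
qed

text \<open>\<open>U\<close> at \<open>jB\<close> enters the derivative of \<open>PA\<close> with a
  positive sign, so only the errors on the left can pull \<open>PA\<close> down.\<close>

lemma PA_ge: "- 5 * (K * g) <= PA \<tau>"
proof -
  have "- (10 * (\<Lambda> * e)) * (\<tau> - t0) <= PA \<tau> - PA t0"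
  proof (rule fe_ge[OF finite_G \<tau>_le(1)])
    show "continuous_on {t0..\<tau>} PA" unfolding PA_def using Y_cont t0 by (intro continuous_intros) auto
    fix u assume u: "u \<in> {t0<..<\<tau>} - G"
    have u': "\<sigma> < u" "u < \<theta>" "u \<notin> G" "alive u" "t0 <= u" "u < \<tau>" using u \<sigma>_t0 \<sigma> \<tau>_le t0 al[of u] by auto
    have "0 < cb * (g / 8)" using g pos by simp
    moreover have "jA - 1 \<in> left" using j by (simp add: left_def)
    ultimately have "- (10 * (\<Lambda> * e)) <= U u (jA - 1) + 4 / 3 * U u jA + U u jB / 3"
      using U_signs(3)[OF u'(5,6)] U_signs(4)[OF u'(5,6), of jA] U_signs(4)[OF u'(5,6), of "jA - 1"] mult_pos_pos[OF \<Lambda>_pos e] by auto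
    then show "\<exists>D. (PA has_real_derivative D) (at u) \<and> - (10 * (\<Lambda> * e)) <= D" using PA_deriv[OF u'(1-4)] by blast
  qed
  moreover have "- (10 * (\<Lambda> * e)) * (\<tau> - t0) = - (10 * (\<Lambda> * e) * (\<tau> - t0))" by simp
  moreover have "10 * (\<Lambda> * e) * (\<tau> - t0) <= e"
  proof -
    have "10 * (\<Lambda> * e) * (\<tau> - t0) = 10 * e * (\<Lambda> * (\<tau> - t0))" by simp
    also have "\<dots> <= 10 * e * (1 / 1000)" using S1'(2)[of t0 \<tau>] \<tau>_le t0 e by (intro mult_left_mono) auto
    finally show ?thesis using e by simp
  qed
  moreover have bd: "\<bar>Y t0 k\<bar> <= 2 * (K * g)" if "k \<in> sites1" for k by (rule bound1) (use \<sigma>_t0 that in auto)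
  have "- 4 * (K * g) <= PA t0"
    using bd[of jA] bd[of j1] bd[of j2] unfolding PA_def by (auto simp: sites1_def sites0_def abs_le_iff add_divide_distrib diff_divide_distrib)
  ultimately show ?thesis using eKg by linarith
qed

text \<open>At \<open>\<tau>\<close> the size of \<open>x\<close> at the dying site is 0, so the
  absolute value of \<open>Y\<close> there is the size of \<open>v\<close>, which is close to
  \<open>X \<tau>\<close>.\<close>

lemma X_Q: "(1 - \<kappa>) * X \<tau> <= Q"
proof -
  have l: "il = j1 \<or> il = j2" using lo by (auto simp: loser_def)
  have "(1 - \<kappa>) * X \<tau> <= v \<tau> il" by (rule v_X) (use \<tau>_le l in auto)
  also have "\<dots> = \<bar>Y \<tau> il\<bar>" using fv.nn[of \<tau> il] \<tau>_le by (simp add: Y_abs dies)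
  also have "\<dots> <= Q" using Y12[OF \<tau>_le(1) order_refl] l by auto
  finally show ?thesis .
qed

text \<open>As long as \<open>q <= \<kappa> * X\<close> the pair of \<open>x\<close> is close to the tie, hence \<open>q * X powr (2 * \<beta>)\<close> does not decrease.
  The tie itself gives \<open>3 * \<beta>\<close> in place of \<open>2 * \<beta>\<close>; the difference absorbs the errors.\<close>

lemma Q_grow: "\<kappa> * X t0 <= Q \<or> q t0 * X t0 powr (2 * \<beta>) <= Q * (Q / \<kappa>) powr (2 * \<beta>)"
proof (rule disjCI)
  assume "\<not> q t0 * X t0 powr (2 * \<beta>) <= Q * (Q / \<kappa>) powr (2 * \<beta>)"
  show "\<kappa> * X t0 <= Q"
  proof (rule ccontr)
    assume "\<not> \<kappa> * X t0 <= Q"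
    then have lt: "Q / \<kappa> < X t0" using \<kappa> by (simp add: field_simps)
    \<comment> \<open>At \<open>t1\<close> the profile equals \<open>Q / \<kappa>\<close>. Before
      that \<open>q <= Q <= \<kappa> * X\<close>, so the particles of both flows are at most
      \<open>1 + 2 * \<kappa>\<close> times the profile.\<close>
    define t1 where "t1 = d - (Q / \<kappa>) powr b / b"
    have Xt1: "X t1 = Q / \<kappa>" using pos Q_pos \<kappa> by (simp add: X_def t1_def powr_powr)
    have "(Q / \<kappa>) powr b < X t0 powr b" using lt Q_pos \<kappa> pos by (intro powr_less_mono2) auto
    then have "t0 < t1" using X_powr[of t0] t0 pos by (simp add: t1_def field_simps)
    have "\<kappa> * X \<tau> <= (1 - \<kappa>) * X \<tau>" using \<kappa> X_pos[OF \<tau>(2)] by (intro mult_right_mono) auto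
    then have "X \<tau> <= Q / \<kappa>" using X_Q \<kappa> by (simp add: field_simps)
    then have "X \<tau> powr b <= (Q / \<kappa>) powr b" using pos by (intro powr_mono2) (auto simp: X_def)
    then have "t1 <= \<tau>" using X_powr[of \<tau>] \<tau> pos by (simp add: t1_def field_simps)
    have "0 * (t1 - t0) <= q t1 * X t1 powr (2 * \<beta>) - q t0 * X t0 powr (2 * \<beta>)"
    proof (rule fe_ge[OF finite_G less_imp_le[OF \<open>t0 < t1\<close>]])
      show "continuous_on {t0..t1} (%t. q t * X t powr (2 * \<beta>))"
        unfolding X_def using t0 \<open>t1 <= \<tau>\<close> \<tau> pos fx.\<beta> by (intro continuous_intros q_cont) auto
      fix u assume u: "u \<in> {t0<..<t1} - G"
      then have u': "u \<in> {t0<..<\<tau>} - G" "u < d" "0 <= u" "u <= d" "t0 <= u" "u < \<tau>" using \<open>t1 <= \<tau>\<close> \<tau> t0 by auto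
      define \<xi> where "\<xi> = X u"
      have \<xi>: "0 < \<xi>" "Q / \<kappa> <= \<xi>" using X_pos[OF u'(2)] X_mono[of u t1] Xt1 u \<open>t1 <= \<tau>\<close> \<tau> by (auto simp: \<xi>_def)
      have Qx: "Q <= \<kappa> * \<xi>" using \<xi> \<kappa> by (simp add: field_simps)
      have Yu: "0 <= Y u j1" "Y u j1 <= Q" "0 <= Y u j2" "Y u j2 <= Q" using Y12[of u] u' by auto
      have alu: "alive u" using al u' by auto
      have Ui: "2 / 3 * (\<beta> * \<xi> powr (- b)) * Y u i <= U u i" if i: "i = j1 \<or> i = j2" for i
      proof -
        have Yi: "0 <= Y u i" "Y u i <= \<kappa> * \<xi>" using Yu Qx i by auto
        have vu: "v u i <= (1 + \<kappa>) * \<xi>" unfolding \<xi>_def by (rule v_X) (use u' i in auto)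
        have xu: "x u i <= (1 + 2 * \<kappa>) * \<xi>" using Y_abs[of u i] Yi vu by (simp add: algebra_simps)
        have vu': "v u i <= (1 + 2 * \<kappa>) * \<xi>" using vu Yi by (simp add: algebra_simps)
        define P where "P = (1 + 2 * \<kappa>) powr b"
        have "0 < P" "P <= 3 / 2" using \<kappa> by (simp_all add: P_def)
        moreover have "(1 + 2 * \<kappa>) powr (- b) = 1 / P" unfolding P_def by (rule powr_minus_divide)
        ultimately have "1 <= 3 / 2 * (1 + 2 * \<kappa>) powr (- b)" by simp
        then have "1 * (2 / 3 * (\<beta> * \<xi> powr (- b)) * Y u i) <= 3 / 2 * (1 + 2 * \<kappa>) powr (- b) * (2 / 3 * (\<beta> * \<xi> powr (- b)) * Y u i)"
          using Yi fx.\<beta> by (intro mult_right_mono) auto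
        also have "\<dots> = \<beta> * ((1 + 2 * \<kappa>) * \<xi>) powr (- b) * Y u i" using \<kappa> \<xi> by (simp add: powr_mult)
        also have "\<dots> <= U u i" using alu i xu vu' Yi by (intro U_low) (auto simp: alive_def)
        finally show ?thesis by simp
      qed
      obtain D where D: "(q has_real_derivative D) (at u)" "3 * (U u j1 + U u j2) <= D" using q_deriv[OF u'(1)] by blast
      \<comment> \<open>Three times the factor \<open>2 / 3\<close> from \<open>Ui\<close>: the
        growth rate of \<open>q\<close> just compensates the decay of
        \<open>X powr (2 * \<beta>)\<close>.\<close>
      have "2 * \<beta> * \<xi> powr (- b) * q u <= D" using Ui[of j1] Ui[of j2] D(2) by (simp add: q_def algebra_simps)
      have X': "((%t. X t powr (2 * \<beta>)) has_real_derivative - (2 * \<beta>) * (\<xi> powr (2 * \<beta>) * \<xi> powr (- b))) (at u)"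
      proof -
        define w where "w = b * (d - u)"
        have w: "0 < w" using u' pos by (simp add: w_def)
        have eq: "X t powr (2 * \<beta>) = (b * (d - t)) powr (2 * \<beta> / b)" for t by (simp add: X_def powr_powr)
        have powr_step: "0 < w ==> w powr k * (0 * ln w + (- b) * k / w) = k * w powr (k - 1) * (- b)" for w k :: real
        proof -
          assume w: "0 < w"
          define n where "n = w powr k"
          have "w powr (k - 1) = n / w" using w by (simp add: powr_diff n_def)
          then show ?thesis unfolding n_def[symmetric] by simp
        qed
        have h: "((%t. b * (d - t)) has_real_derivative - b) (at u)" by (auto intro!: derivative_eq_intros)
        have d1: "((%t. (b * (d - t)) powr (2 * \<beta> / b)) has_real_derivative 2 * \<beta> / b * w powr (2 * \<beta> / b - 1) * (- b)) (at u)"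
        proof (rule DERIV_cong[OF DERIV_powr[OF h _ DERIV_const]])
          show "0 < b * (d - u)" using w by (simp add: w_def)
          show "(b * (d - u)) powr (2 * \<beta> / b) * (0 * ln (b * (d - u)) + (- b) * (2 * \<beta> / b) / (b * (d - u))) =
              2 * \<beta> / b * w powr (2 * \<beta> / b - 1) * (- b)"
            unfolding w_def[symmetric] by (rule powr_step[OF w])
        qed
        have d2: "\<xi> powr (2 * \<beta>) * \<xi> powr (- b) = w powr (2 * \<beta> / b - 1)"
        proof -
          have "\<xi> = w powr (1 / b)" by (simp add: \<xi>_def X_def w_def)
          then have "\<xi> powr (2 * \<beta>) * \<xi> powr (- b) = w powr (1 / b * (2 * \<beta> + (- b)))"
            by (simp only: powr_add[symmetric] powr_powr distrib_left)
          also have "1 / b * (2 * \<beta> + (- b)) = 1 / b * (2 * \<beta> - b)" by simp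
          also have "1 / b * (2 * \<beta> - b) = 2 * \<beta> / b - 1" using pos(5) by (simp only: right_diff_distrib) simp
          finally show ?thesis .
        qed
        have canc: "n \<noteq> 0 ==> a / n * W * (- n) = - (a * W)" for a n W :: real by simp
        have "b \<noteq> 0" using pos(5) by linarith
        from canc[OF this, of "2 * \<beta>"] have d3: "2 * \<beta> / b * w powr (2 * \<beta> / b - 1) * (- b) = - (2 * \<beta> * w powr (2 * \<beta> / b - 1))" .
        show ?thesis using d1 unfolding eq d2 d3 mult_minus_left .
      qed
      have "((%t. q t * X t powr (2 * \<beta>)) has_real_derivative
          q u * (- (2 * \<beta>) * (\<xi> powr (2 * \<beta>) * \<xi> powr (- b))) + D * \<xi> powr (2 * \<beta>)) (at u)"
        using DERIV_mult'[OF D(1) X'] by (simp add: \<xi>_def)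
      moreover have "0 <= (D - 2 * \<beta> * \<xi> powr (- b) * q u) * \<xi> powr (2 * \<beta>)"
        using \<open>2 * \<beta> * \<xi> powr (- b) * q u <= D\<close> by (intro mult_nonneg_nonneg) auto
      ultimately show "\<exists>D. ((%t. q t * X t powr (2 * \<beta>)) has_real_derivative D) (at u) \<and> 0 <= D"
        by (intro exI conjI) (assumption, simp add: algebra_simps)
    qed
    moreover have "q t1 * X t1 powr (2 * \<beta>) <= Q * (Q / \<kappa>) powr (2 * \<beta>)"
      unfolding Xt1 using Y12[of t1] \<open>t0 < t1\<close> \<open>t1 <= \<tau>\<close> by (intro mult_right_mono) auto
    ultimately show False using \<open>\<not> q t0 * X t0 powr (2 * \<beta>) <= Q * (Q / \<kappa>) powr (2 * \<beta>)\<close> by linarith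
  qed
qed

text \<open>With \<open>L0\<close> of order \<open>g * r j powr (\<beta> + 1)\<close> the second
  alternative is the gain \<open>Q powr (1 + 2 * \<beta>) >= c * g * r j powr (1 + 3 *
  \<beta>)\<close>. In the first one \<open>Q\<close> is already comparable to the pair
  itself.\<close>

lemma Q_ge: "\<kappa> * r j / 16 <= Q \<or> 2 * L0 * (\<kappa> * r j / 16) powr (2 * \<beta>) <= Q powr (1 + 2 * \<beta>)"
proof -
  have "r j / 8 <= v t0 j1" using early[of t0 j1] t0 by auto
  also have "\<dots> <= (1 + \<kappa>) * X t0" by (rule v_X) (use t0 in auto)
  also have "\<dots> <= 2 * X t0" using \<kappa> by (intro mult_right_mono) (auto simp: X_def)
  finally have X0: "r j / 16 <= X t0" by simp
  from Q_grow show ?thesis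
  proof
    assume "\<kappa> * X t0 <= Q"
    moreover have "\<kappa> * (r j / 16) <= \<kappa> * X t0" using X0 \<kappa> by (intro mult_left_mono) auto
    ultimately show ?thesis by simp
  next
    assume h: "q t0 * X t0 powr (2 * \<beta>) <= Q * (Q / \<kappa>) powr (2 * \<beta>)"
    have "2 * L0 * (r j / 16) powr (2 * \<beta>) <= q t0 * X t0 powr (2 * \<beta>)"
      using start_pos X0 pos fx.\<beta> L0 by (intro mult_mono powr_mono2) (auto simp: q_def)
    then have "2 * L0 * (r j / 16) powr (2 * \<beta>) <= Q * (Q powr (2 * \<beta>) / \<kappa> powr (2 * \<beta>))"
      using h Q_pos \<kappa> by (simp add: powr_divide)
    then have "2 * L0 * (\<kappa> powr (2 * \<beta>) * (r j / 16) powr (2 * \<beta>)) <= Q * Q powr (2 * \<beta>)"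
      using \<kappa> by (simp add: field_simps)
    moreover have "\<kappa> powr (2 * \<beta>) * (r j / 16) powr (2 * \<beta>) = (\<kappa> * r j / 16) powr (2 * \<beta>)"
      using \<kappa> pos by (simp add: powr_mult[symmetric])
    moreover have "Q * Q powr (2 * \<beta>) = Q powr (1 + 2 * \<beta>)" using Q_pos by (simp add: powr_add)
    ultimately show ?thesis by metis
  qed
qed

end

section \<open>Transfer from the survivor to the large neighbours\<close>

locale stage_end = stage_tau +
  assumes KgQ: "2000 * (K * g) <= Q" and err: "c powr (- \<beta>) * (12 * r j) powr \<beta> <= 1 / 10000"
begin

definition "sv = x \<tau> iw"
text \<open>By \<open>sum_dies\<close> a survivor of size about \<open>Q\<close> is dead after time
  \<open>(2 * Q) powr b\<close>; the minimum keeps \<open>t1\<close> within the stage.\<close>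

definition "t1 = min \<theta> (\<tau> + (2 * Q) powr b)"

lemma lo': "(iw = j1 \<and> il = j2) \<or> (iw = j2 \<and> il = j1)" using lo by (auto simp: loser_def)

lemma Y_wl: "Y \<tau> iw = sv - v \<tau> iw" "Y \<tau> il = v \<tau> il" "Q = sv - v \<tau> iw + v \<tau> il"
proof -
  have "sg j2 = - sg j1" by (rule sg_odd) auto
  then show a: "Y \<tau> iw = sv - v \<tau> iw" "Y \<tau> il = v \<tau> il"
    using lo dies unfolding Y_def sv_def loser_def by auto
  show "Q = sv - v \<tau> iw + v \<tau> il" using a lo' unfolding Q_def q_def by auto
qed

lemma X\<tau>: "X \<tau> <= 102 / 100 * Q" "0 < X \<tau>"
proof -
  show "0 < X \<tau>" by (rule X_pos[OF \<tau>(2)])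
  then have "99 / 100 * X \<tau> <= (1 - \<kappa>) * X \<tau>" using \<kappa> by (intro mult_right_mono) auto
  then show "X \<tau> <= 102 / 100 * Q" using X_Q Q_pos by linarith
qed

lemma v\<tau>: "i = j1 \<or> i = j2 ==> v \<tau> i <= 104 / 100 * Q \<and> \<bar>v \<tau> i - X \<tau>\<bar> <= 2 / 100 * Q"
proof -
  assume i: "i = j1 \<or> i = j2"
  have k: "\<kappa> * X \<tau> <= 1 / 100 * X \<tau>" using \<kappa> X\<tau> by (intro mult_right_mono) auto
  have "v \<tau> i <= X \<tau> + \<kappa> * X \<tau>" "X \<tau> - \<kappa> * X \<tau> <= v \<tau> i"
    using v_X[OF \<tau>_le(4,3) i] by (simp_all add: algebra_simps)
  then have "v \<tau> i - X \<tau> <= 1 / 100 * X \<tau>" "- (v \<tau> i - X \<tau>) <= 1 / 100 * X \<tau>" using k by linarith+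
  then show ?thesis using X\<tau> Q_pos(1) unfolding abs_le_iff by linarith
qed

text \<open>At \<open>\<tau>\<close> both particles of \<open>v\<close> are close to
  \<open>X \<tau>\<close>, so their contributions to \<open>Q\<close> nearly cancel, and
  \<open>Q\<close> is the size of the survivor up to four percent.\<close>

lemma sv_Q: "96 / 100 * Q <= sv" "sv <= 104 / 100 * Q"
proof -
  have "iw = j1 \<or> iw = j2" "il = j1 \<or> il = j2" using lo' by auto
  then show "96 / 100 * Q <= sv" "sv <= 104 / 100 * Q"
    using Y_wl(3) v\<tau>[of iw] v\<tau>[of il] unfolding abs_le_iff by linarith+
qed

lemma Q_r: "Q <= 6 * r j"
proof -
  have "0 <= v \<tau> iw" using fv.nn \<tau>_le by auto
  then show ?thesis using Y_wl(3) small_le[of \<tau> iw] small_le[of \<tau> il] lo' \<tau>_le \<theta>T pos by (auto simp: sv_def)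
qed

lemma t1: "\<tau> <= t1" "t1 <= \<theta>" "d <= t1" "0 <= t1" "t1 <= T" "t1 - \<tau> <= (2 * Q) powr b"
proof -
  have b1: "1 <= b" using fx.\<beta> by simp
  have "b * (d - \<tau>) <= (2 * Q) powr b"
    using X_powr[OF \<tau>_le(3)] powr_mono2[of b "X \<tau>" "2 * Q"] X\<tau> Q_pos pos by simp
  moreover have "1 * (d - \<tau>) <= b * (d - \<tau>)" using b1 \<tau> by (intro mult_right_mono) auto
  ultimately show "d <= t1" using t0 by (simp add: t1_def)
qed (use \<tau>_le \<theta>T in \<open>auto simp: t1_def\<close>)

lemma gone_after: "t1 <= t ==> t <= \<theta> ==> gone t"
proof -
  assume t: "t1 <= t" "t <= \<theta>"
  interpret P: pair_system \<beta> "2 powr \<beta>" T fx.F "%t. x t j1" "%t. x t j2" "%t. x t jA powr (- \<beta>)" "%t. x t jB powr (- \<beta>)"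
    by (rule fx.pair[OF j])
  have v: "v t j1 = 0" "v t j2 = 0"
    using fv.dead[of d t] v_d t t1(3) t0 by auto
  have "x t1 j1 = 0 \<and> x t1 j2 = 0"
  proof (cases "t1 = \<theta>")
    case True
    then show ?thesis using fx.pair_dead[OF j order_refl \<theta>T] by auto
  next
    case False
    then have t1': "t1 = \<tau> + (2 * Q) powr b" by (auto simp: t1_def min_def split: if_splits)
    have sum: "x \<tau> j1 + x \<tau> j2 = sv" using lo' dies by (auto simp: sv_def)
    have "sv powr b <= (2 * Q) powr b" using sv_Q Q_pos pos by (intro powr_mono2) auto
    moreover have "sv powr b / b <= sv powr b / 1" using fx.\<beta> by (intro divide_left_mono) auto
    ultimately have "\<tau> + (x \<tau> j1 + x \<tau> j2) powr b / b <= t1" unfolding sum t1' by simp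
    moreover have "x \<tau> j1 + x \<tau> j2 < 4 * r j" using fx.pair_sum(2)[OF j, of \<tau> \<tau>] \<tau>_le \<theta>T pos by auto
    ultimately show ?thesis using P.sum_dies[OF \<tau>_le(4) _ fx.r_small(2)[of j], where t = t1] t1 by auto
  qed
  then have "x t j1 = 0" "x t j2 = 0" using fx.dead[OF t1(4) t(1)] by auto
  then show "gone t" using v by (simp add: gone_def)
qed

definition "E = 3 * c powr (- \<beta>)"
definition "H = E * (t1 - \<tau>)"

text \<open>In time \<open>(2 * Q) powr b\<close> the regular neighbours contribute about
  \<open>c powr (- \<beta>) * Q powr b\<close>, which is negligible against \<open>Q\<close> because
  the pair is much smaller than \<open>c\<close>.\<close>

lemma H_le: "H <= Q / 1000"
proof -
  have "H <= E * (2 * Q) powr b" unfolding H_def E_def using t1 by (intro mult_left_mono) auto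
  also have "(2 * Q) powr b = 2 * Q * (2 * Q) powr \<beta>" using Q_pos by (simp add: powr_add)
  also have "E * (2 * Q * (2 * Q) powr \<beta>) = 6 * Q * (c powr (- \<beta>) * (2 * Q) powr \<beta>)" by (simp add: E_def)
  also have "\<dots> <= 6 * Q * (c powr (- \<beta>) * (12 * r j) powr \<beta>)"
    using Q_pos Q_r fx.\<beta> by (intro mult_left_mono powr_mono2) auto
  also have "\<dots> <= 6 * Q * (1 / 10000)" using Q_pos err by (intro mult_left_mono) auto
  finally show ?thesis using Q_pos by simp
qed

lemma u_le: "c powr (- \<beta>) \<ge> 2 powr \<beta>"
proof -
  have "(1 / 2) powr (- \<beta>) <= c powr (- \<beta>)" using c fx.\<beta> by (intro powr_mono2') auto
  then show ?thesis by (simp add: powr_minus powr_divide field_simps)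
qed

lemma left_f:
  assumes "0 <= t" "t <= \<theta>" and y: "y = x \<or> y = v"
  shows "\<bar>nB \<beta> (y t) (int j - 1) - 2 * y t jA powr (- \<beta>)\<bar> <= 2 * c powr (- \<beta>)"
proof -
  have A: "jA - 1 \<in> left" using j by (simp add: left_def)
  have c': "c <= y t (jA - 1)" "c <= y t jA" using regular[OF assms(1,2), of "jA - 1"] regular[OF assms(1,2), of jA] A y by auto
  have eq: "3 * (int j - 1) + 2 = jA - 1" by simp
  have "nB \<beta> (y t) (int j - 1) = y t (jA - 1) powr (- \<beta>)" unfolding nB_def eq using c' c by auto
  moreover have "y t (jA - 1) powr (- \<beta>) <= c powr (- \<beta>)" "y t jA powr (- \<beta>) <= c powr (- \<beta>)"
    using c' c fx.\<beta> by (auto intro!: powr_mono2')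
  moreover have "0 <= y t (jA - 1) powr (- \<beta>)" "0 <= y t jA powr (- \<beta>)" by simp_all
  ultimately show ?thesis by linarith
qed

lemma right_f:
  assumes "\<sigma> <= t" "t <= \<theta>" and y: "y = x \<or> y = v"
  shows "\<bar>nA \<beta> (y t) (int j + 1) - 2 * y t jB powr (- \<beta>)\<bar> <= 2 * c powr (- \<beta>)"
proof -
  have t: "0 <= t" using assms \<sigma> by simp
  have z: "y t (jB + 1) = 0" "y t (jB + 2) = 0"
    using right_zero[OF assms(1), of "jB + 1"] right_zero[OF assms(1), of "jB + 2"] y by (auto simp: mod_add_eq)
  have eq: "3 * (int j + 1) + 1 = jB + 1" "3 * (int j + 1) + 2 = jB + 2" "3 * (int j + 1) + 3 = jB + 3" by simp_all
  have "nA \<beta> (y t) (int j + 1) = y t (jB + 3) powr (- \<beta>)" unfolding nA_def eq using z by simp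
  moreover have "y t (jB + 3) powr (- \<beta>) <= 2 powr \<beta>" "y t jB powr (- \<beta>) <= 2 powr \<beta>"
    using fx.big_u(2)[of t "jB + 3"] fv.big_u(2)[of t "jB + 3"] fx.big_u(2)[of t jB] fv.big_u(2)[of t jB] t assms \<theta>T y by auto
  moreover have "0 <= y t (jB + 3) powr (- \<beta>)" "0 <= y t jB powr (- \<beta>)" by simp_all
  ultimately show ?thesis using u_le by linarith
qed

text \<open>For \<open>x\<close> one particle is dead already at \<open>\<tau>\<close>, so the
  survivor is split evenly. For \<open>v\<close> both particles die at \<open>d\<close>, so the jump
  term vanishes and the weights \<open>2 / 3\<close> and \<open>1 / 3\<close> remain.\<close>

lemma handover_A:
  assumes t: "\<tau> <= t" "t <= t1"
  shows "\<bar>x t1 jA - (x \<tau> jA + sv / 2)\<bar> <= H" "\<bar>x t jA - x \<tau> jA\<bar> <= 3 * sv + H"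
    "\<bar>x t1 jB - (x \<tau> jB + sv / 2)\<bar> <= H" "\<bar>x t jB - x \<tau> jB\<bar> <= 3 * sv + H"
    "\<bar>v t1 jA - (v \<tau> jA + (2 * v \<tau> j1 + v \<tau> j2) / 3)\<bar> <= H" "\<bar>v t jA - v \<tau> jA\<bar> <= 3 * (208 / 100 * Q) + H"
    "\<bar>v t1 jB - (v \<tau> jB + (v \<tau> j1 + 2 * v \<tau> j2) / 3)\<bar> <= H" "\<bar>v t jB - v \<tau> jB\<bar> <= 3 * (208 / 100 * Q) + H"
proof -
  have E: "2 * c powr (- \<beta>) + 2 powr \<beta> <= E" unfolding E_def using u_le by simp
  have EH: "(2 * c powr (- \<beta>) + 2 powr \<beta>) * (t1 - \<tau>) <= H" unfolding H_def using E t1 by (intro mult_right_mono) auto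
  have sumx: "x \<tau> j1 + x \<tau> j2 = sv" using lo' dies by (auto simp: sv_def)
  have S: "x u j1 + x u j2 <= sv" "v u j1 + v u j2 <= 208 / 100 * Q" if "\<tau> <= u" "u <= t1" for u
    using fx.pair_sum(1)[OF j \<tau>_le(4) that(1)] fv.pair_sum(1)[OF j \<tau>_le(4) that(1)] that t1 sumx v\<tau>[of j1] v\<tau>[of j2] by auto
  have gx: "x t1 j1 = 0" "x t1 j2 = 0" "v t1 j1 = 0" "v t1 j2 = 0" "v d j1 = 0" "v d j2 = 0"
    using gone_after[OF order_refl t1(2)] v_d by (auto simp: gone_def)
  have dx: "x \<tau> j1 = 0 \<or> x \<tau> j2 = 0" using lo' dies by auto
  have al: "0 < v u j1 \<and> 0 < v u j2" if "\<tau> <= u" "u < d" for u using v_alive[of u] that \<tau>_le by auto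
  have L: "\<bar>nB \<beta> (y u) (int j - 1) - 2 * y u jA powr (- \<beta>)\<bar> <= 2 * c powr (- \<beta>)"
    "\<bar>nA \<beta> (y u) (int j + 1) - 2 * y u jB powr (- \<beta>)\<bar> <= 2 * c powr (- \<beta>)" if "\<tau> < u" "u < t1" "y = x \<or> y = v" for u y
    using left_f[OF _ _ that(3)] right_f[OF _ _ that(3)] that \<tau>_le t1 \<sigma>_t0 by auto
  interpret xA: pair_left \<beta> "2 powr \<beta>" T fx.F "%t. x t j1" "%t. x t j2" "%t. x t jA powr (- \<beta>)" "%t. x t jB powr (- \<beta>)"
    "%t. x t jA" "%t. nB \<beta> (x t) (int j - 1) - 2 * x t jA powr (- \<beta>)" by (rule fx.pair_left_A[OF j])
  interpret xB: pair_left \<beta> "2 powr \<beta>" T fx.F "%t. x t j2" "%t. x t j1" "%t. x t jB powr (- \<beta>)" "%t. x t jA powr (- \<beta>)"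
    "%t. x t jB" "%t. nA \<beta> (x t) (int j + 1) - 2 * x t jB powr (- \<beta>)" by (rule fx.pair_left_B[OF j])
  interpret vA: pair_left \<beta> "2 powr \<beta>" T fv.F "%t. v t j1" "%t. v t j2" "%t. v t jA powr (- \<beta>)" "%t. v t jB powr (- \<beta>)"
    "%t. v t jA" "%t. nB \<beta> (v t) (int j - 1) - 2 * v t jA powr (- \<beta>)" by (rule fv.pair_left_A[OF j])
  interpret vB: pair_left \<beta> "2 powr \<beta>" T fv.F "%t. v t j2" "%t. v t j1" "%t. v t jB powr (- \<beta>)" "%t. v t jA powr (- \<beta>)"
    "%t. v t jB" "%t. nA \<beta> (v t) (int j + 1) - 2 * v t jB powr (- \<beta>)" by (rule fv.pair_left_B[OF j])
  have xAh: "\<bar>(x t1 jA + (x t1 j1 + x t1 j2) / 2) - (x \<tau> jA + (2 * x \<tau> j1 + x \<tau> j2) / 3 + (x \<tau> j2 - x \<tau> j1) / 6)\<bar>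
      <= (2 * c powr (- \<beta>) + 2 powr \<beta>) * (t1 - \<tau>)" "\<bar>x t jA - x \<tau> jA\<bar> <= 3 * sv + (2 * c powr (- \<beta>) + 2 powr \<beta>) * (t1 - \<tau>)"
    by (rule xA.handover[of \<tau> \<tau> t1 sv]; use \<tau>_le t1 dx S L t in auto)+
  have xBh: "\<bar>(x t1 jB + (x t1 j2 + x t1 j1) / 2) - (x \<tau> jB + (2 * x \<tau> j2 + x \<tau> j1) / 3 + (x \<tau> j1 - x \<tau> j2) / 6)\<bar>
      <= (2 * c powr (- \<beta>) + 2 powr \<beta>) * (t1 - \<tau>)" "\<bar>x t jB - x \<tau> jB\<bar> <= 3 * sv + (2 * c powr (- \<beta>) + 2 powr \<beta>) * (t1 - \<tau>)"
    by (rule xB.handover[of \<tau> \<tau> t1 sv]; use \<tau>_le t1 dx S L t in \<open>auto simp: add.commute\<close>)+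
  have vAh: "\<bar>(v t1 jA + (v t1 j1 + v t1 j2) / 2) - (v \<tau> jA + (2 * v \<tau> j1 + v \<tau> j2) / 3 + (v d j2 - v d j1) / 6)\<bar>
      <= (2 * c powr (- \<beta>) + 2 powr \<beta>) * (t1 - \<tau>)" "\<bar>v t jA - v \<tau> jA\<bar> <= 3 * (208 / 100 * Q) + (2 * c powr (- \<beta>) + 2 powr \<beta>) * (t1 - \<tau>)"
    by (rule vA.handover[of \<tau> d t1 "208 / 100 * Q"]; use \<tau>_le t1 gx al S L t in auto)+
  have vBh: "\<bar>(v t1 jB + (v t1 j2 + v t1 j1) / 2) - (v \<tau> jB + (2 * v \<tau> j2 + v \<tau> j1) / 3 + (v d j1 - v d j2) / 6)\<bar>
      <= (2 * c powr (- \<beta>) + 2 powr \<beta>) * (t1 - \<tau>)" "\<bar>v t jB - v \<tau> jB\<bar> <= 3 * (208 / 100 * Q) + (2 * c powr (- \<beta>) + 2 powr \<beta>) * (t1 - \<tau>)"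
    by (rule vB.handover[of \<tau> d t1 "208 / 100 * Q"]; use \<tau>_le t1 gx al S L t in \<open>auto simp: add.commute\<close>)+
  have ex: "(2 * x \<tau> j1 + x \<tau> j2) / 3 + (x \<tau> j2 - x \<tau> j1) / 6 = sv / 2" "(2 * x \<tau> j2 + x \<tau> j1) / 3 + (x \<tau> j1 - x \<tau> j2) / 6 = sv / 2"
    using sumx by (simp_all add: field_simps)
  show "\<bar>x t1 jA - (x \<tau> jA + sv / 2)\<bar> <= H" using xAh(1) EH ex(1) gx(1,2) by (simp add: add.assoc)
  show "\<bar>x t1 jB - (x \<tau> jB + sv / 2)\<bar> <= H" using xBh(1) EH ex(2) gx(1,2) by (simp add: add.assoc)
  show "\<bar>v t1 jA - (v \<tau> jA + (2 * v \<tau> j1 + v \<tau> j2) / 3)\<bar> <= H" using vAh(1) EH gx(3-6) by simp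
  show "\<bar>v t1 jB - (v \<tau> jB + (v \<tau> j1 + 2 * v \<tau> j2) / 3)\<bar> <= H" using vBh(1) EH gx(3-6) by (simp add: add.commute)
  show "\<bar>x t jA - x \<tau> jA\<bar> <= 3 * sv + H" "\<bar>x t jB - x \<tau> jB\<bar> <= 3 * sv + H"
    "\<bar>v t jA - v \<tau> jA\<bar> <= 3 * (208 / 100 * Q) + H" "\<bar>v t jB - v \<tau> jB\<bar> <= 3 * (208 / 100 * Q) + H"
    using xAh(2) xBh(2) vAh(2) vBh(2) EH by linarith+
qed

lemma B_le: "3 * B <= 4 * Q" using KgQ Q_pos Kg by (simp add: B_def)

lemma Y_AB:
  assumes t: "\<tau> <= t" "t <= t1" and i: "i = jA \<or> i = jB"
  shows "\<bar>Y t i\<bar> <= 14 * Q"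
proof -
  have "\<bar>Y \<tau> i\<bar> <= 4 * Q" using bound2[OF \<tau>_le(1) order_refl, of i] B_le i by auto
  moreover have "\<bar>x t i - x \<tau> i\<bar> <= 3 * sv + H" "\<bar>v t i - v \<tau> i\<bar> <= 3 * (208 / 100 * Q) + H"
    using handover_A(2,4,6,8)[OF t] i by auto
  ultimately show ?thesis using H_le sv_Q Q_pos unfolding Y_abs by linarith
qed

text \<open>The survivor \<open>sv\<close> leaves \<open>sv / 6\<close> more (or less) at \<open>jA\<close> than a pair dying in a tie would.\<close>

lemma YA_t1: "155 / 1000 * Q <= Y t1 jA"
proof -
  have S: "s * sg j1 = 1 \<and> iw = j1 \<and> il = j2 \<or> s * sg j1 = - 1 \<and> iw = j2 \<and> il = j1"
    using lo by (auto simp: loser_def)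
  have sA: "sg jA = - sg j1" by (rule sg_odd) auto
  note h = handover_A(1,5)[OF order_refl t1(1)]
  have P: "Y \<tau> jA - (2 * Y \<tau> j1 - Y \<tau> j2) / 3 \<ge> - 5 * (K * g)" using PA_ge by (simp add: PA_def)
  have Y: "Y t jA = - (s * sg j1) * (x t jA - v t jA)" for t by (simp add: Y_def sA)
  \<comment> \<open>The terms with \<open>v\<close> cancel; the survivor contributes
    \<open>2 / 3 - 1 / 2\<close> in one case and \<open>1 / 2 - 1 / 3\<close> in the other.\<close>
  have "sv / 6 - 2 * H - 5 * (K * g) <= Y t1 jA"
    using S
  proof
    assume a: "s * sg j1 = 1 \<and> iw = j1 \<and> il = j2"
    have y: "Y \<tau> j1 = sv - v \<tau> j1" "Y \<tau> j2 = v \<tau> j2" using a Y_wl by auto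
    show ?thesis using P h unfolding y unfolding Y using a by (simp add: abs_le_iff add_divide_distrib diff_divide_distrib)
  next
    assume a: "s * sg j1 = - 1 \<and> iw = j2 \<and> il = j1"
    have y: "Y \<tau> j2 = sv - v \<tau> j2" "Y \<tau> j1 = v \<tau> j1" using a Y_wl by auto
    show ?thesis using P h unfolding y unfolding Y using a by (simp add: abs_le_iff add_divide_distrib diff_divide_distrib)
  qed
  then show ?thesis using H_le sv_Q KgQ Q_pos by linarith
qed

text \<open>Common to the two remaining phases. Between \<open>\<tau>\<close> and \<open>t1\<close>
  the sites \<open>jA\<close> and \<open>jB\<close> feel singular powers and are controlled through
  \<open>out\<close>; after \<open>t1\<close> they belong to \<open>I\<close> like all
  others.\<close>

lemma sup_reg:
  assumes a: "\<tau> <= a" "a <= c'" "c' <= \<theta>" and M: "0 < M" and I: "I \<subseteq> left \<union> {jA, jB} \<union> right"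
    and init: "!!i. i \<in> I ==> \<bar>Y a i\<bar> <= M" and out: "!!i t. i \<notin> I ==> i \<in> left \<union> {jA, jB} \<union> right ==> a <= t ==> t <= c' ==> \<bar>Y t i\<bar> <= 2 * M"
    and D: "!!t i. a < t ==> t < c' ==> t \<notin> G ==> i \<in> I ==> \<exists>k l. ((%t. Y t i) has_real_derivative U t k + 2 * U t i + U t l) (at t) \<and>
      {k, l} \<subseteq> left \<union> {jA, jB} \<union> right \<union> {i. 3 * int N < \<bar>i\<bar>}"
    and t: "a <= t" "t <= c'"
  shows "i \<in> left \<union> {jA, jB} \<union> right ==> \<bar>Y t i\<bar> <= 2 * M"
    "i \<in> I ==> \<bar>Y t i - Y a i\<bar> <= 8 * \<Lambda> * M * (t - a)"
proof -
  have a0: "0 <= a" using a \<tau>_le by simp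
  have Ub: "\<bar>U u k + 2 * U u i + U u l\<bar> <= 8 * \<Lambda> * M"
    if u: "a <= u" "u <= c'" and bd: "!!k. k \<in> I ==> \<bar>Y u k\<bar> <= 2 * M" and i: "i \<in> I"
      and kl: "{k, l} \<subseteq> left \<union> {jA, jB} \<union> right \<union> {i. 3 * int N < \<bar>i\<bar>}" for u k i l
  proof -
    have "\<bar>U u m\<bar> <= \<Lambda> * (2 * M)" if m: "m \<in> left \<union> {jA, jB} \<union> right \<union> {i. 3 * int N < \<bar>i\<bar>}" for m
    proof -
      have u0: "0 <= u" "u <= \<theta>" using u a a0 by auto
      have "\<bar>Y u m\<bar> <= 2 * M"
        using bd[of m] out[OF _ _ u, of m] U_void(2)[OF u0(1), of m] m M by (cases "m \<in> I") auto
      then have "\<Lambda> * \<bar>Y u m\<bar> <= \<Lambda> * (2 * M)" using \<Lambda>_pos by (intro mult_left_mono) auto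
      moreover have "\<bar>U u m\<bar> <= \<Lambda> * \<bar>Y u m\<bar>" by (rule reg_U_abs) (use m u0 in auto)
      ultimately show ?thesis by linarith
    qed
    moreover have "k \<in> left \<union> {jA, jB} \<union> right \<union> {i. 3 * int N < \<bar>i\<bar>}" "l \<in> left \<union> {jA, jB} \<union> right \<union> {i. 3 * int N < \<bar>i\<bar>}"
      "i \<in> left \<union> {jA, jB} \<union> right \<union> {i. 3 * int N < \<bar>i\<bar>}" using kl i I by blast+
    ultimately have "\<bar>U u k\<bar> <= \<Lambda> * (2 * M)" "\<bar>U u l\<bar> <= \<Lambda> * (2 * M)" "\<bar>U u i\<bar> <= \<Lambda> * (2 * M)" by blast+
    then show ?thesis by linarith
  qed
  have main: "\<bar>Y t i\<bar> <= 2 * M" if i: "i \<in> I" and t: "a <= t" "t <= c'" for t i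
  proof (rule sup_bound[of I G a c' "%i t. Y t i" "%_. M", OF _ finite_G _ init M _ i t])
    show "finite I" using I finite_sites by (auto intro: finite_subset)
    fix u i assume u: "u \<in> {a<..<c'} - G" and bd: "!!k. k \<in> I ==> \<bar>Y u k\<bar> <= 2 * M" and i: "i \<in> I"
    obtain k l where kl: "((%t. Y t i) has_real_derivative U u k + 2 * U u i + U u l) (at u)"
      "{k, l} \<subseteq> left \<union> {jA, jB} \<union> right \<union> {i. 3 * int N < \<bar>i\<bar>}" using D[OF _ _ _ i, of u] u by auto
    have "\<bar>U u k + 2 * U u i + U u l\<bar> <= 8 * \<Lambda> * M" by (rule Ub[OF _ _ bd i kl(2)]) (use u in auto)
    then have "\<bar>U u k + 2 * U u i + U u l\<bar> * (c' - a) <= 8 * \<Lambda> * M * (c' - a)" using a by (intro mult_right_mono) auto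
    also have "\<dots> = 8 * M * (\<Lambda> * (c' - a))" by simp
    also have "\<dots> <= 8 * M * (1 / 1000)" using S1'(2)[OF a0 a(2,3)] M by (intro mult_left_mono) auto
    finally show "\<exists>D. ((%t. Y t i) has_real_derivative D) (at u) \<and> \<bar>D\<bar> * (c' - a) <= M / 2"
      using kl(1) M by (intro exI[of _ "U u k + 2 * U u i + U u l"]) auto
  qed (use Y_cont a0 in auto)
  show "i \<in> left \<union> {jA, jB} \<union> right ==> \<bar>Y t i\<bar> <= 2 * M" using main[OF _ t, of i] out[OF _ _ t, of i] by blast
  show "\<bar>Y t i - Y a i\<bar> <= 8 * \<Lambda> * M * (t - a)" if i: "i \<in> I"
  proof (rule fe_abs[OF finite_G t(1)])
    show "continuous_on {a..t} (%t. Y t i)" using Y_cont a0 by auto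
    fix u assume u: "u \<in> {a<..<t} - G"
    obtain k l where kl: "((%t. Y t i) has_real_derivative U u k + 2 * U u i + U u l) (at u)"
      "{k, l} \<subseteq> left \<union> {jA, jB} \<union> right \<union> {i. 3 * int N < \<bar>i\<bar>}" using D[OF _ _ _ i, of u] u t by auto
    have "\<bar>U u k + 2 * U u i + U u l\<bar> <= 8 * \<Lambda> * M" by (rule Ub[OF _ _ main i kl(2)]) (use u t in auto)
    then show "\<exists>D. ((%t. Y t i) has_real_derivative D) (at u) \<and> \<bar>D\<bar> <= 8 * \<Lambda> * M" using kl(1) by blast
  qed
qed

lemma D_lr:
  assumes t: "\<sigma> < t" "t < \<theta>" "t \<notin> G" and i: "i \<in> left \<union> right"
  shows "\<exists>k l. ((%t. Y t i) has_real_derivative U t k + 2 * U t i + U t l) (at t) \<and>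
      {k, l} \<subseteq> left \<union> {jA, jB} \<union> right \<union> {i. 3 * int N < \<bar>i\<bar>}"
  using i
proof
  assume i: "i \<in> left"
  then have "{i - 1, i + 1} \<subseteq> left \<union> {jA, jB} \<union> right \<union> {i. 3 * int N < \<bar>i\<bar>}" by (auto simp: left_def)
  then show ?thesis using D_left[OF t i] by blast
next
  assume i: "i \<in> right"
  then have "{i - 3, i + 3} \<subseteq> left \<union> {jA, jB} \<union> right \<union> {i. 3 * int N < \<bar>i\<bar>}"
    using left_nbr[OF i] right_nbr[of i] by auto
  then show ?thesis using D_right[OF t i] by blast
qed

lemma D_all:
  assumes t: "\<sigma> < t" "t < \<theta>" "t \<notin> G" "t1 <= t" and i: "i \<in> left \<union> {jA, jB} \<union> right"
  shows "\<exists>k l. ((%t. Y t i) has_real_derivative U t k + 2 * U t i + U t l) (at t) \<and>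
      {k, l} \<subseteq> left \<union> {jA, jB} \<union> right \<union> {i. 3 * int N < \<bar>i\<bar>}"
proof -
  note g = D_gone[OF t(1-3) gone_after[OF t(4)]]
  consider "i \<in> left \<union> right" | "i = jA" | "i = jB" using i by auto
  then show ?thesis
  proof cases
    case 1
    then show ?thesis using D_lr[OF t(1-3)] by blast
  next
    case 2
    have "{jA - 1, jB} \<subseteq> left \<union> {jA, jB} \<union> right \<union> {i. 3 * int N < \<bar>i\<bar>}" using j by (auto simp: left_def)
    then show ?thesis using g(1) t 2 by (metis less_imp_le)
  next
    case 3
    have "{jA, jB + 3} \<subseteq> left \<union> {jA, jB} \<union> right \<union> {i. 3 * int N < \<bar>i\<bar>}" using right_nbr[of jB] by auto
    then show ?thesis using g(2) t 3 by (metis less_imp_le)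
  qed
qed

text \<open>The error on the left at \<open>t1\<close>: the old one plus what values of order
  \<open>Q\<close> can transfer with rate \<open>\<Lambda>\<close> in the short time
  \<open>t1 - \<tau>\<close>.\<close>

definition "e' = 4 * e + 112 * \<Lambda> * Q * (2 * Q) powr b"

lemma \<sigma>\<tau>: "\<sigma> < \<tau>" using \<sigma>_t0 \<tau> by linarith

lemma phase3:
  shows "i \<in> left ==> \<bar>Y t1 i\<bar> <= 28 * Q" "i \<in> right ==> \<bar>Y t1 i\<bar> <= 28 * Q" "i \<in> left ==> - e' <= Y t1 i"
proof -
  note sr = sup_reg[of \<tau> t1 "14 * Q" "left \<union> right" t1 i, OF order_refl t1(1,2)]
  have init: "\<bar>Y \<tau> k\<bar> <= 14 * Q" if "k \<in> left \<union> right" for k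
    using bound2[OF \<tau>_le(1) order_refl, of k] that B_le Q_pos by auto
  have out: "\<bar>Y t k\<bar> <= 2 * (14 * Q)" if "k \<notin> left \<union> right" "k \<in> left \<union> {jA, jB} \<union> right" "\<tau> <= t" "t <= t1" for t k
    using Y_AB[of t k] that Q_pos by auto
  have 1: "i \<in> left \<union> {jA, jB} \<union> right ==> \<bar>Y t1 i\<bar> <= 2 * (14 * Q)"
    by (rule sr(1)) (use init out D_lr \<sigma>\<tau> t1 Q_pos in auto)
  then show "i \<in> left ==> \<bar>Y t1 i\<bar> <= 28 * Q" "i \<in> right ==> \<bar>Y t1 i\<bar> <= 28 * Q" by auto
  assume i: "i \<in> left"
  have "\<bar>Y t1 i - Y \<tau> i\<bar> <= 8 * \<Lambda> * (14 * Q) * (t1 - \<tau>)"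
    by (rule sr(2)) (use init out D_lr \<sigma>\<tau> t1 Q_pos i in auto)
  also have "\<dots> <= 8 * \<Lambda> * (14 * Q) * (2 * Q) powr b" using t1 \<Lambda>_pos Q_pos by (intro mult_left_mono) auto
  finally show "- e' <= Y t1 i" using bar(1)[OF \<tau>_le(1) order_refl, of i] i by (simp add: e'_def)
qed

lemma final_bound:
  assumes t: "t1 <= t" "t <= \<theta>" and i: "i \<in> left \<union> {jA, jB} \<union> right"
  shows "\<bar>Y t i\<bar> <= 56 * Q" "\<bar>Y t i - Y t1 i\<bar> <= 224 / 10000 * Q"
proof -
  note sr = sup_reg[of t1 \<theta> "28 * Q" "left \<union> {jA, jB} \<union> right" t i, OF t1(1,2) order_refl]
  have init: "\<bar>Y t1 k\<bar> <= 28 * Q" if "k \<in> left \<union> {jA, jB} \<union> right" for k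
    using phase3(1,2)[of k] Y_AB[OF t1(1) order_refl, of k] that Q_pos by auto
  have "\<bar>Y t i\<bar> <= 2 * (28 * Q)"
    by (rule sr(1)[OF _ _ init _ _ t i]) (use D_all \<sigma>\<tau> t1 Q_pos in auto)
  then show "\<bar>Y t i\<bar> <= 56 * Q" by simp
  have "\<bar>Y t i - Y t1 i\<bar> <= 8 * \<Lambda> * (28 * Q) * (t - t1)"
    by (rule sr(2)[OF _ _ init _ _ t i]) (use D_all \<sigma>\<tau> t1 Q_pos in auto)
  also have "\<dots> = 224 * Q * (\<Lambda> * (t - t1))" by simp
  also have "\<dots> <= 224 * Q * (1 / 10000)" using S1'(3)[OF t1(4) t] Q_pos by (intro mult_left_mono) auto
  finally show "\<bar>Y t i - Y t1 i\<bar> <= 224 / 10000 * Q" by simp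
qed

lemma YA_after: "t1 <= t ==> t <= \<theta> ==> Q / 8 <= Y t jA"
  using final_bound(2)[of t jA] YA_t1 Q_pos unfolding abs_le_iff by simp

text \<open>After \<open>t1\<close> the pair is gone and \<open>Y\<close> is positive at
  \<open>jA\<close>, so only the error on the left itself can pull the left sites down.\<close>

lemma left_ge:
  assumes i: "i \<in> left"
  shows "- 2 * e' <= Y \<theta> i"
proof -
  have e'0: "0 < e'" using e \<Lambda>_pos Q_pos by (simp add: e'_def add_pos_nonneg)
  have sm: "8 * \<Lambda> * e' * (u - t1) <= e' / 2" if "t1 <= u" "u <= \<theta>" for u
  proof -
    have "8 * \<Lambda> * e' * (u - t1) = 8 * e' * (\<Lambda> * (u - t1))" by simp
    also have "\<dots> <= 8 * e' * (1 / 1000)" using S1'(2)[OF t1(4) that] e'0 by (intro mult_left_mono) auto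
    finally show ?thesis using e'0 by simp
  qed
  have "- (3 / 2 * e' + 8 * \<Lambda> * e' * (\<theta> - t1)) < Y \<theta> i"
  proof (rule affine_barrier[of left G t1 \<theta> "%i t. Y t i" "%_. 3 / 2 * e'" "%_. 8 * \<Lambda> * e'", OF finite_sites(1) finite_G _ _ _ i t1(2) order_refl])
    fix u k assume u: "u \<in> {t1<..<\<theta>} - G" and low: "!!k. k \<in> left ==> - (3 / 2 * e' + 8 * \<Lambda> * e' * (u - t1)) < Y u k" and k: "k \<in> left"
    have u': "\<sigma> < u" "u < \<theta>" "u \<notin> G" "t1 <= u" "u <= \<theta>" "0 <= u" using u \<sigma>\<tau> t1 by auto
    have Yg: "- (2 * e') <= Y u m" if "m \<in> left \<or> m = jA \<or> 3 * int N < \<bar>m\<bar>" for m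
    proof (cases "m \<in> left")
      case True
      then show ?thesis using low[OF True] sm[OF u'(4,5)] by linarith
    next
      case False
      then show ?thesis using that YA_after[OF u'(4,5)] U_void(2)[OF u'(6), of m] Q_pos e'0 by auto
    qed
    have Ug: "- (\<Lambda> * (2 * e')) <= U u m" if "m \<in> left \<or> m = jA \<or> 3 * int N < \<bar>m\<bar>" for m
      using reg_U_ge[OF u'(6,5) _ Yg[OF that]] that e'0 by auto
    have "k - 1 \<in> left \<or> 3 * int N < \<bar>k - 1\<bar>" "k + 1 \<in> left \<or> k + 1 = jA" using k by (auto simp: left_def)
    then have "- (8 * \<Lambda> * e') <= U u (k - 1) + 2 * U u k + U u (k + 1)"
      using Ug[of "k - 1"] Ug[of k] Ug[of "k + 1"] k by auto
    then show "\<exists>D. ((%t. Y t k) has_real_derivative D) (at u) \<and> - (8 * \<Lambda> * e') <= D"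
      using D_left[OF u'(1-3) k] by blast
  next
    fix k assume "k \<in> left"
    then show "continuous_on {t1..\<theta>} (%t. Y t k)" "- (3 / 2 * e') < Y t1 k"
      using Y_cont t1 phase3(3)[of k] e'0 by auto
  qed
  then show ?thesis using sm[OF t1(2) order_refl] by linarith
qed

lemma final_all: "\<bar>Y \<theta> i\<bar> <= 56 * Q"
proof -
  consider "i \<in> left \<union> {jA, jB} \<union> right" | "i = j1 \<or> i = j2" | "\<forall>t\<ge>0. x t i = 0 \<and> v t i = 0" | "jB < i \<and> i mod 3 \<noteq> 0"
    using void_sites[of i] by (auto simp: sites1_def sites0_def)
  then show ?thesis
  proof cases
    case 1
    then show ?thesis using final_bound(1)[OF t1(2) order_refl] by simp
  next
    case 2
    then show ?thesis using gone_after[OF t1(2) order_refl] Q_pos by (auto simp: gone_def Y_def)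
  next
    case 3
    then show ?thesis using pos Q_pos by (simp add: Y_def)
  next
    case 4
    then show ?thesis using right_zero[of \<theta> i] \<sigma> Q_pos by (simp add: Y_def)
  qed
qed

end

context stage_run
begin

text \<open>\<open>Q\<close> becomes known only inside the proof, so the dominance over
  \<open>K * g\<close> is assumed for every \<open>Q\<close> that satisfies the gain estimate
  \<open>Q_ge\<close>.\<close>

lemma stage_result:
  assumes KgQ: "!!Q. \<kappa> * r j / 16 <= Q \<or> 2 * L0 * (\<kappa> * r j / 16) powr (2 * \<beta>) <= Q powr (1 + 2 * \<beta>) ==> 0 < Q ==> 2000 * (K * g) <= Q"
    and err: "c powr (- \<beta>) * (12 * r j) powr \<beta> <= 1 / 10000"
  obtains Q where "0 < Q" "Q <= 6 * r j" "\<kappa> * r j / 16 <= Q \<or> 2 * L0 * (\<kappa> * r j / 16) powr (2 * \<beta>) <= Q powr (1 + 2 * \<beta>)"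
    "Q / 8 <= Y \<theta> (3 * int j)" "!!i. \<bar>Y \<theta> i\<bar> <= 56 * Q"
    "!!i. i <= 3 * int j - 1 ==> - (8 * e + 224 * \<Lambda> * Q * (2 * Q) powr b) <= Y \<theta> i"
proof -
  obtain \<tau> iw il where t: "t0 < \<tau>" "\<tau> < d" "!!t. 0 <= t ==> t < \<tau> ==> alive t" "loser iw il" "x \<tau> il = 0" "0 < x \<tau> iw"
    using first_death by metis
  interpret st: stage_tau \<beta> r N T Sx Sv x v s j \<sigma> c g K e t0 d \<kappa> L0 \<tau> iw il
    by unfold_locales (use t in auto)
  interpret se: stage_end \<beta> r N T Sx Sv x v s j \<sigma> c g K e t0 d \<kappa> L0 \<tau> iw il
    by unfold_locales (use KgQ[OF st.Q_ge st.Q_pos(1)] err in auto)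
  show ?thesis
  proof (rule that[of st.Q])
    show "st.Q / 8 <= Y \<theta> (3 * int j)" by (rule se.YA_after[OF se.t1(2) order_refl])
    fix i assume i: "i <= 3 * int j - 1"
    have e'0: "0 < se.e'" using e \<Lambda>_pos st.Q_pos by (simp add: se.e'_def add_pos_nonneg)
    show "- (8 * e + 224 * \<Lambda> * st.Q * (2 * st.Q) powr b) <= Y \<theta> i"
    proof (cases "i \<in> left")
      case True
      have "2 * se.e' = 8 * e + 224 * \<Lambda> * st.Q * (2 * st.Q) powr b" by (simp add: se.e'_def algebra_simps)
      then show ?thesis using se.left_ge[OF True] by linarith
    next
      case False
      then have "Y \<theta> i = 0" using i j pos by (intro U_void(2)) (auto simp: left_def)
      then show ?thesis using e'0 by (simp add: se.e'_def)
    qed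
  qed (use st.Q_pos st.Q_ge se.Q_r se.final_all in auto)
qed

end

section \<open>Tuning of the pairs\<close>

text \<open>The implication "if \<open>i\<close> is dead, so is \<open>k\<close>" passes to limits:
  right after \<open>t\<close> the approximations of \<open>i\<close> are dead, hence those of
  \<open>k\<close>, and continuity of the limit reaches back to \<open>t\<close>.\<close>

lemma (in limit_flow) dies_with:
  assumes i: "!!n t. 0 <= t ==> t <= T ==> x n t i = 0 ==> x n t k = 0" and kT: "!!n. x n T k = 0"
    and t: "0 <= t" "t <= T" "X t i = 0"
  shows "X t k = 0"
proof (cases "t = T")
  case True
  then show ?thesis using kT t by (intro X_dead_lim) auto
next
  case False
  have later: "X u k = 0" if u: "t < u" "u <= T" for u
  proof (rule X_dead_lim)
    have "eventually (%n. \<forall>\<tau>. u <= \<tau> \<and> \<tau> <= T --> x n \<tau> i = 0) sequentially"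
      by (rule extinct_after) (use t u in auto)
    then show "eventually (%n. x n u k = 0) sequentially"
      by eventually_elim (use i u t in auto)
  qed (use u t in auto)
  define w where "w n = t + (T - t) / real (Suc n)" for n
  have w: "t < w n" "w n <= T" for n
  proof -
    show "t < w n" using False t by (simp add: w_def)
    have "(T - t) / real (Suc n) <= (T - t) / 1" using t by (intro divide_left_mono) auto
    then show "w n <= T" by (simp add: w_def)
  qed
  have w0: "0 <= w n" for n using w(1)[of n] t by linarith
  have "(%n. t + (T - t) * inverse (real (Suc n))) \<longlonglongrightarrow> t + (T - t) * 0"
    by (intro tendsto_intros LIMSEQ_inverse_real_of_nat)
  then have "w \<longlonglongrightarrow> t" by (simp add: w_def[abs_def] divide_inverse)
  then have "(%n. X (w n) k) \<longlonglongrightarrow> X t k"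
    by (rule continuous_on_tendsto_compose[OF X_cont]) (use t w w0 in auto)
  then show ?thesis using later w by (simp add: LIMSEQ_const_iff)
qed

text \<open>\<open>\<kappa>\<close> is the relative range in which the sizes are varied; by
  \<open>gap\<close> a relative difference of this order decides which particle of a pair dies
  first.\<close>

locale tuning =
  fixes \<beta> :: real and r :: "nat => real" and T \<kappa> :: real
  assumes \<beta>: "0 < \<beta>" and r0: "!!m. 0 < r m" and r_small: "!!m. r m <= 1 / 24" "!!m. 2 * 2 powr \<beta> <= (4 * r m) powr (- \<beta>)"
    and T0: "0 < T" and T_small: "2 * (\<beta> + 1) * T <= (3 / 4) powr (\<beta> + 1) - (1 / 2) powr (\<beta> + 1)" "2 * 2 powr \<beta> * T <= 1 / 4"
    and \<kappa>: "0 < \<kappa>" "\<kappa> <= 1 / 2"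
    and gap: "!!m. 2 powr \<beta> <= (1 - (1 + \<kappa> / 2) powr (- \<beta>)) * (2 * (3 * r m)) powr (- \<beta>)"
    and T_long: "!!m. (3 * r m) powr (\<beta> + 1) / (\<beta> + 1) <= T"
begin

text \<open>One parameter per pair is enough for one tie per pair, so the first particle keeps the
  size \<open>r j\<close>.\<close>

definition "sz a j p = (if p = 1 then r j else r j * (1 - \<kappa> + 2 * \<kappa> * a j))" for a :: "nat => real" and j p :: nat
definition "unit_box = {a :: nat => real. \<forall>i. 0 <= a i \<and> a i <= 1}"
definition "supp N = {- 3 * int N..3 * int N}"
definition "sel N a = (SOME x. particle_flow \<beta> (supp N) x \<and> x 0 = alpha_N N (sz a))"

lemma sz_bounds:
  assumes "a \<in> unit_box"
  shows "r j * (1 - \<kappa>) <= sz a j p" "sz a j p <= r j * (1 + \<kappa>)" "0 < sz a j p"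
proof -
  have "\<kappa> * 0 <= \<kappa> * a j" "\<kappa> * a j <= \<kappa> * 1" using assms \<kappa> by (auto simp: unit_box_def intro!: mult_left_mono)
  then have "r j * (1 - \<kappa>) <= r j * (1 - \<kappa> + 2 * \<kappa> * a j)" "r j * (1 - \<kappa> + 2 * \<kappa> * a j) <= r j * (1 + \<kappa>)"
    using r0[of j] by (auto intro!: mult_left_mono)
  moreover have "r j * (1 - \<kappa>) <= r j * 1" "r j * 1 <= r j * (1 + \<kappa>)" using \<kappa> r0[of j] by (auto intro!: mult_left_mono)
  ultimately show *: "r j * (1 - \<kappa>) <= sz a j p" "sz a j p <= r j * (1 + \<kappa>)" unfolding sz_def by auto
  have "0 < r j * (1 - \<kappa>)" using r0 \<kappa> by simp
  then show "0 < sz a j p" using * by linarith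
qed

lemma alpha_vals:
  "3 * int N < \<bar>i\<bar> ==> alpha_N N R i = 0" "\<bar>i\<bar> <= 3 * int N ==> i < 0 \<or> i mod 3 = 0 ==> alpha_N N R i = 1"
  "m < N ==> alpha_N N R (3 * int m + 1) = R m 1" "m < N ==> alpha_N N R (3 * int m + 2) = R m 2"
  by (auto simp: alpha_N_def alpha_def)

lemma alpha_pos:
  assumes "a \<in> unit_box" "\<bar>i\<bar> <= 3 * int N"
  shows "0 < alpha_N N (sz a) i"
  using assms(2) sz_bounds(3)[OF assms(1)] by (simp add: alpha_N_def alpha_def)

lemma triple:
  assumes a: "a \<in> unit_box" and x: "particle_flow \<beta> S x" and \<epsilon>: "0 <= \<epsilon>" "\<epsilon> <= 1 / 4"
    and x0: "x 0 = (%i. alpha_N N (sz a) i + \<epsilon> * unit_seq (3 * int N) i)"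
  shows "triple_flow \<beta> r N T S x"
proof
  fix j
  show "3 * int N < \<bar>j\<bar> ==> x 0 j = 0" by (auto simp: x0 alpha_vals unit_seq_def)
  show "\<bar>j\<bar> <= 3 * int N ==> j < 0 \<or> j mod 3 = 0 ==> 3 / 4 <= x 0 j \<and> x 0 j <= 5 / 4"
    using \<epsilon> by (auto simp: x0 alpha_vals unit_seq_def)
next
  fix m assume m: "m < N"
  have "r m * (1 / 2) <= r m * (1 - \<kappa>)" "r m * (1 + \<kappa>) <= r m * (3 / 2)" using \<kappa> r0[of m] by (auto intro!: mult_left_mono)
  then show "r m / 2 <= x 0 (3 * int m + 1) \<and> x 0 (3 * int m + 1) <= 3 / 2 * r m"
    "r m / 2 <= x 0 (3 * int m + 2) \<and> x 0 (3 * int m + 2) <= 3 / 2 * r m"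
    using sz_bounds(1,2)[OF a, of m 1] sz_bounds(1,2)[OF a, of m 2] m by (auto simp: x0 alpha_vals unit_seq_def)
qed (use \<beta> r0 r_small T0 T_small x in auto)

lemma flow_exists:
  fixes N :: nat and \<epsilon> :: real and a :: "nat => real"
  assumes a: "a \<in> unit_box" and \<epsilon>: "0 <= \<epsilon>"
  defines "y \<equiv> (%i. alpha_N N (sz a) i + \<epsilon> * unit_seq (3 * int N) i)"
  shows "{i. y i \<noteq> 0} = supp N" "\<exists>x. particle_flow \<beta> (supp N) x \<and> x 0 = y"
proof -
  have p: "0 < y i" if "\<bar>i\<bar> <= 3 * int N" for i
    using alpha_pos[OF a that] \<epsilon> by (auto simp: y_def unit_seq_def add_pos_nonneg)
  have z: "y i = 0" if "3 * int N < \<bar>i\<bar>" for i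
    using that by (auto simp: y_def unit_seq_def alpha_vals)
  show s: "{i. y i \<noteq> 0} = supp N"
  proof (rule set_eqI)
    fix i show "i \<in> {i. y i \<noteq> 0} \<longleftrightarrow> i \<in> supp N"
      using p[of i] z[of i] by (cases "\<bar>i\<bar> <= 3 * int N") (auto simp: supp_def)
  qed
  have "0 <= y i" for i using p[of i] z[of i] by (cases "\<bar>i\<bar> <= 3 * int N") auto
  then have "\<exists>x. particle_flow \<beta> {i. y i \<noteq> 0} x \<and> x 0 = y"
    by (intro particle_flow_exists \<beta>) (simp_all add: s, simp add: supp_def)
  then show "\<exists>x. particle_flow \<beta> (supp N) x \<and> x 0 = y" by (simp add: s)
qed

lemma sel:
  assumes "a \<in> unit_box"
  shows "particle_flow \<beta> (supp N) (sel N a)" "sel N a 0 = alpha_N N (sz a)" "triple_flow \<beta> r N T (supp N) (sel N a)"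
proof -
  have "\<exists>x. particle_flow \<beta> (supp N) x \<and> x 0 = alpha_N N (sz a)" using flow_exists(2)[OF assms, of 0 N] by simp
  then have *: "particle_flow \<beta> (supp N) (sel N a) \<and> sel N a 0 = alpha_N N (sz a)" unfolding sel_def by (rule someI_ex)
  then show "particle_flow \<beta> (supp N) (sel N a)" "sel N a 0 = alpha_N N (sz a)" by auto
  then show "triple_flow \<beta> r N T (supp N) (sel N a)" by (intro triple[OF assms, where \<epsilon> = 0]) auto
qed

lemma dead_T: "a \<in> unit_box ==> m < N ==> sel N a T (3 * int m + 1) = 0 \<and> sel N a T (3 * int m + 2) = 0"
proof -
  assume a: "a \<in> unit_box" and m: "m < N"
  interpret triple_flow \<beta> r N T "supp N" "sel N a" by (rule sel(3)[OF a])
  have "\<theta> m <= T" using T_long by (simp add: \<theta>_def)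
  then show ?thesis using pair_dead[OF m] by auto
qed

text \<open>Label 0 says that the second particle does not outlive the first. Kuhn's lemma asks for
  label 0 on the face \<open>a m = 0\<close> and label 1 on the face \<open>a m = 1\<close>.\<close>

definition "label N a m = (if \<forall>t. 0 <= t --> t <= T --> sel N a t (3 * int m + 1) = 0 --> sel N a t (3 * int m + 2) = 0 then 0 else 1 :: nat)"

lemma gap_le:
  assumes "0 < y" "y <= 3 * r m"
  shows "2 powr \<beta> <= (1 - (1 + \<kappa> / 2) powr (- \<beta>)) * (2 * y) powr (- \<beta>)"
proof -
  have "(1 + \<kappa> / 2) powr (- \<beta>) <= 1" using \<kappa> \<beta> by (simp add: powr_minus ge_one_powr_ge_zero inverse_le_1_iff)
  then have "(1 - (1 + \<kappa> / 2) powr (- \<beta>)) * (2 * (3 * r m)) powr (- \<beta>) <= (1 - (1 + \<kappa> / 2) powr (- \<beta>)) * (2 * y) powr (- \<beta>)"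
    using assms \<beta> by (intro mult_left_mono powr_mono2') auto
  then show ?thesis using gap[of m] by linarith
qed

text \<open>On this face the second particle is smaller by a factor of at least
  \<open>1 + \<kappa>\<close>, since \<open>(1 + \<kappa>) * (1 - \<kappa>) <= 1\<close>, and by
  \<open>gap_grows\<close> it dies first.\<close>

lemma label_0:
  assumes a: "a \<in> unit_box" and m: "m < N" and am: "a m = 0"
  shows "label N a m = 0"
proof -
  interpret triple_flow \<beta> r N T "supp N" "sel N a" by (rule sel(3)[OF a])
  interpret P: pair_system \<beta> V T F "%t. sel N a t (3 * int m + 2)" "%t. sel N a t (3 * int m + 1)"
    "%t. sel N a t (3 * int m + 3) powr (- \<beta>)" "%t. sel N a t (3 * int m) powr (- \<beta>)"
    by (rule pair_system.swap[OF pair[OF m]])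
  have i: "sel N a 0 (3 * int m + 1) = r m" "sel N a 0 (3 * int m + 2) = r m * (1 - \<kappa>)"
    using m am by (simp_all add: sel(2)[OF a] alpha_vals sz_def)
  have "sel N a t (3 * int m + 2) = 0" if t: "0 <= t" "t <= T" "sel N a t (3 * int m + 1) = 0" for t
  proof (rule ccontr)
    assume n: "sel N a t (3 * int m + 2) \<noteq> 0"
    have al: "0 < sel N a s (3 * int m + 2)" if "0 <= s" "s <= t" for s
      using dead[OF that, of "3 * int m + 2"] n nn[OF that(1), of "3 * int m + 2"] by fastforce
    have "(1 + \<kappa> / 2) * sel N a t (3 * int m + 2) < sel N a t (3 * int m + 1)"
    proof (rule P.gap_grows(3)[OF \<kappa>(1) order_refl t(1,2)])
      have "r m * (1 - \<kappa> * \<kappa>) <= r m * 1" using r0[of m] \<kappa> by (intro mult_left_mono) auto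
      then show "(1 + \<kappa>) * sel N a 0 (3 * int m + 2) <= sel N a 0 (3 * int m + 1)" unfolding i by (simp add: algebra_simps)
      show "V <= (1 - (1 + \<kappa> / 2) powr (- \<beta>)) * (2 * sel N a 0 (3 * int m + 2)) powr (- \<beta>)"
        unfolding i by (rule gap_le[of _ m]) (use r0[of m] \<kappa> in \<open>auto simp: algebra_simps\<close>)
    qed (use al t in auto)
    moreover have "0 < (1 + \<kappa> / 2) * sel N a t (3 * int m + 2)" using al[of t] t \<kappa> by (intro mult_pos_pos) auto
    ultimately show False using t by simp
  qed
  then show ?thesis by (simp add: label_def)
qed

lemma label_1:
  assumes a: "a \<in> unit_box" and m: "m < N" and am: "a m = 1"
  shows "label N a m = 1"
proof -
  interpret triple_flow \<beta> r N T "supp N" "sel N a" by (rule sel(3)[OF a])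
  interpret P: pair_system \<beta> V T F "%t. sel N a t (3 * int m + 1)" "%t. sel N a t (3 * int m + 2)"
    "%t. sel N a t (3 * int m) powr (- \<beta>)" "%t. sel N a t (3 * int m + 3) powr (- \<beta>)"
    by (rule pair[OF m])
  have i: "sel N a 0 (3 * int m + 1) = r m" "sel N a 0 (3 * int m + 2) = r m * (1 + \<kappa>)"
    using m am by (simp_all add: sel(2)[OF a] alpha_vals sz_def)
  obtain d where d: "0 < d" "d <= T" "sel N a d (3 * int m + 1) = 0" "!!t. 0 <= t ==> t < d ==> 0 < sel N a t (3 * int m + 1)"
    by (rule P.death_time[of 0 T]) (use dead_T[OF a m] T0 i r0[of m] in auto)
  have "sel N a 0 (3 * int m + 2) - sel N a 0 (3 * int m + 1) <= sel N a d (3 * int m + 2) - sel N a d (3 * int m + 1)"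
  proof (rule P.gap_grows(1)[OF \<kappa>(1)])
    show "V <= (1 - (1 + \<kappa> / 2) powr (- \<beta>)) * (2 * sel N a 0 (3 * int m + 1)) powr (- \<beta>)"
      unfolding i by (rule gap_le[of _ m]) (use r0[of m] in auto)
  qed (use d i r0[of m] in \<open>auto simp: algebra_simps\<close>)
  moreover have "0 < r m * \<kappa>" using r0 \<kappa> by simp
  ultimately have "sel N a d (3 * int m + 2) \<noteq> 0" using d(3) unfolding i by (simp add: algebra_simps)
  then show ?thesis using d unfolding label_def by (auto intro!: exI[of _ d])
qed

lemma label_cases: "label N a m = 0 \<or> label N a m = 1" by (simp add: label_def)

lemma label_0D: "label N a m = 0 ==> 0 <= t ==> t <= T ==> sel N a t (3 * int m + 1) = 0 ==> sel N a t (3 * int m + 2) = 0"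
  by (auto simp: label_def split: if_splits)

lemma label_1D:
  assumes a: "a \<in> unit_box" and l: "label N a m = 1" and t: "0 <= t" "t <= T" "sel N a t (3 * int m + 2) = 0"
  shows "sel N a t (3 * int m + 1) = 0"
proof -
  interpret triple_flow \<beta> r N T "supp N" "sel N a" by (rule sel(3)[OF a])
  obtain u where u: "0 <= u" "sel N a u (3 * int m + 1) = 0" "sel N a u (3 * int m + 2) \<noteq> 0"
    using l by (auto simp: label_def split: if_splits)
  show ?thesis
  proof (cases "u <= t")
    case True
    then show ?thesis using dead[OF u(1) _ u(2)] by simp
  next
    case False
    then show ?thesis using dead[OF t(1) _ t(3), of u] u(3) by simp
  qed
qed

text \<open>Continuous dependence on the parameters, along a subsequence: a limit exists by
  compactness, is a flow with the limiting initial data, and is the selected flow by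
  uniqueness.\<close>

lemma limit_of_data:
  assumes A: "!!n. A n \<in> unit_box" and a: "a \<in> unit_box" and lim: "!!i. i < N ==> (%n. A n i) \<longlonglongrightarrow> a i"
  obtains k where "strict_mono k" "limit_flow \<beta> r (%_. N) T (%_. supp N) (%n. sel N (A (k n))) (sel N a)"
proof -
  obtain k X where k: "strict_mono k" "!!j. uniform_limit {0..T} (%n t. sel N (A (k n)) t j) (%t. X t j) sequentially"
    by (rule subseq_limit[of \<beta> r "%_. N" T "%_. supp N" "%n. sel N (A n)"]) (use sel(3)[OF A] in auto)
  interpret L: limit_flow \<beta> r "%_. N" T "%_. supp N" "%n. sel N (A (k n))" X
  proof (rule limit_flow.intro)
    show "eventually (%n::nat. m < N) sequentially \<or> eventually (%n::nat. N <= m) sequentially" for m by (cases "m < N") auto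
  qed (use sel(3)[OF A] k(2) in auto)
  have X0: "X 0 j = sel N a 0 j" for j
  proof (rule LIMSEQ_unique)
    show "(%n. sel N (A (k n)) 0 j) \<longlonglongrightarrow> X 0 j" by (rule L.conv) (use T0 in auto)
    have "(%n. alpha_N N (sz (A (k n))) j) \<longlonglongrightarrow> alpha_N N (sz a) j"
    proof (cases "3 * int N < \<bar>j\<bar> \<or> j < 0 \<or> j mod 3 = 0")
      case True
      then have "alpha_N N R j = alpha_N N R' j" for R R' by (auto simp: alpha_N_def alpha_def)
      then have "(%n. alpha_N N (sz (A (k n))) j) = (%n. alpha_N N (sz a) j)" by blast
      then show ?thesis by simp
    next
      case False
      define m where "m = nat (j div 3)"
      have m: "int m = j div 3" using False by (simp add: m_def)
      have "int m < int N" using False unfolding m by presburger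
      then have mN: "m < N" by simp
      have l: "(%n. A (k n) m) \<longlonglongrightarrow> a m" using LIMSEQ_subseq_LIMSEQ[OF lim[OF mN] k(1)] by (simp add: o_def)
      have "j = 3 * int m + 1 \<or> j = 3 * int m + 2" using False unfolding m by presburger
      then show ?thesis
      proof
        assume "j = 3 * int m + 1"
        then show ?thesis using mN by (simp add: alpha_vals sz_def)
      next
        assume j: "j = 3 * int m + 2"
        show ?thesis unfolding j alpha_vals(4)[OF mN] by (simp add: sz_def) (intro tendsto_intros l)
      qed
    qed
    then show "(%n. sel N (A (k n)) 0 j) \<longlonglongrightarrow> sel N a 0 j" by (simp add: sel(2)[OF A] sel(2)[OF a])
  qed
  have fX: "flow_on \<beta> (supp N) T X"
    by (rule L.X_flow_on) (auto simp: supp_def)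
  have eq: "X t = sel N a t" if "0 <= t" "t <= T" for t
    by (rule flow_on_unique[OF \<beta> fX particle_flow_on[OF sel(1)[OF a]] _ that]) (use X0 in auto)
  have "limit_flow \<beta> r (%_. N) T (%_. supp N) (%n. sel N (A (k n))) (sel N a)"
  proof (rule limit_flow.intro)
    fix j
    have "uniform_limit {0..T} (%n t. sel N (A (k n)) t j) (%t. sel N a t j) sequentially \<longleftrightarrow>
        uniform_limit {0..T} (%n t. sel N (A (k n)) t j) (%t. X t j) sequentially"
      by (rule uniform_limit_cong') (use eq in auto)
    then show "uniform_limit {0..T} (%n t. sel N (A (k n)) t j) (%t. sel N a t j) sequentially" using L.ul by simp
  qed (use L.tf L.N_dich in auto)
  then show ?thesis using that k(1) by blast
qed

text \<open>Read as implications between deaths, both labels are closed conditions. Each cell has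
  vertices with both labels in every coordinate, and all vertices converge to the same parameter, so
  both implications hold for the limit.\<close>

lemma tie_exists:
  obtains a where "a \<in> unit_box"
    "!!m t. m < N ==> 0 <= t ==> t <= T ==> sel N a t (3 * int m + 1) = 0 \<longleftrightarrow> sel N a t (3 * int m + 2) = 0"
proof -
  define pt where "pt n q i = (if i < N then real (q i) / real (Suc n) else 0)" for n and q :: "nat => nat" and i
  have pt_box: "pt n q \<in> unit_box" if "!!i. i < N ==> q i <= Suc n" for n q
  proof -
    have "real (q i) <= real (Suc n)" if "i < N" for i using \<open>!!i. i < N ==> q i <= Suc n\<close>[OF that] by (simp only: of_nat_le_iff)
    then show ?thesis by (auto simp: unit_box_def pt_def divide_le_eq_1)
  qed
  define cell where "cell n q \<longleftrightarrow> (\<forall>i<N. q i < Suc n) \<and> (\<forall>i<N. \<exists>r s. (\<forall>j<N. q j <= r j \<and> r j <= q j + 1) \<and>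
      (\<forall>j<N. q j <= s j \<and> s j <= q j + 1) \<and> label N (pt n r) i \<noteq> label N (pt n s) i)" for n q
  have "\<forall>n. \<exists>q. cell n q"
  proof
    fix n
    show "\<exists>q. cell n q"
    proof (rule kuhn_lemma[of "Suc n" N "%q i. label N (pt n q) i"])
      show "\<forall>x. (\<forall>i<N. x i <= Suc n) --> (\<forall>i<N. label N (pt n x) i = 0 \<or> label N (pt n x) i = 1)"
        by (intro allI impI label_cases)
      show "\<forall>x. (\<forall>i<N. x i <= Suc n) --> (\<forall>i<N. x i = 0 --> label N (pt n x) i = 0)"
        by (intro allI impI label_0 pt_box) (auto simp: pt_def)
      show "\<forall>x. (\<forall>i<N. x i <= Suc n) --> (\<forall>i<N. x i = Suc n --> label N (pt n x) i = 1)"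
        by (intro allI impI label_1 pt_box) (auto simp: pt_def)
      fix q assume "\<forall>i<N. q i < Suc n" "\<forall>i<N. \<exists>r s. (\<forall>j<N. q j <= r j \<and> r j <= q j + 1) \<and>
        (\<forall>j<N. q j <= s j \<and> s j <= q j + 1) \<and> label N (pt n r) i \<noteq> label N (pt n s) i"
      then have "cell n q" unfolding cell_def by (rule conjI)
      then show "\<exists>q. cell n q" by auto
    qed simp
  qed
  from choice[OF this] obtain q where cq: "\<forall>n. cell n (q n)" by (rule exE)
  have q: "q n i < Suc n" if "i < N" for n i using cq that unfolding cell_def by blast
  define A where "A n = pt n (q n)" for n
  have A: "A n \<in> unit_box" for n unfolding A_def by (rule pt_box) (use q in \<open>auto intro: less_imp_le\<close>)
  obtain k X where k: "strict_mono k" "!!j. uniform_limit {0..T} (%n t. sel N (A (k n)) t j) (%t. X t j) sequentially"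
    by (rule subseq_limit[of \<beta> r "%_. N" T "%_. supp N" "%n. sel N (A n)"]) (use sel(3)[OF A] in auto)
  \<comment> \<open>The limiting parameters are read off from the limiting initial sizes, so
    compactness of the flows serves for them as well.\<close>
  define a where "a i = (if i < N then (X 0 (3 * int i + 2) / r i - (1 - \<kappa>)) / (2 * \<kappa>) else 0)" for i
  have lim: "(%n. A (k n) i) \<longlonglongrightarrow> a i" if i: "i < N" for i
  proof -
    have "(%n. sel N (A (k n)) 0 (3 * int i + 2)) \<longlonglongrightarrow> X 0 (3 * int i + 2)"
      using tendsto_uniform_limitI[OF k(2), of 0 "3 * int i + 2"] T0 by simp
    then have "(%n. (sel N (A (k n)) 0 (3 * int i + 2) / r i - (1 - \<kappa>)) / (2 * \<kappa>)) \<longlonglongrightarrow> (X 0 (3 * int i + 2) / r i - (1 - \<kappa>)) / (2 * \<kappa>)"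
      using r0[of i] \<kappa> by (intro tendsto_intros) auto
    moreover have "(sel N (A (k n)) 0 (3 * int i + 2) / r i - (1 - \<kappa>)) / (2 * \<kappa>) = A (k n) i" for n
      using r0[of i] \<kappa> i by (simp add: sel(2)[OF A] alpha_vals sz_def)
    ultimately show ?thesis using i by (simp add: a_def)
  qed
  have a: "a \<in> unit_box"
  proof -
    have "0 <= a i \<and> a i <= 1" for i
    proof (cases "i < N")
      case True
      have "\<exists>M. \<forall>n\<ge>M. 0 <= A (k n) i" "\<exists>M. \<forall>n\<ge>M. A (k n) i <= 1" using A by (auto simp: unit_box_def)
      then show ?thesis using LIMSEQ_le_const[OF lim[OF True]] LIMSEQ_le_const2[OF lim[OF True]] by blast
    qed (simp add: a_def)
    then show ?thesis by (simp add: unit_box_def)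
  qed
  \<comment> \<open>For each pair and each of the two labels, flows with that label at this pair
    converge to the flow of \<open>a\<close>.\<close>
  have lab: "\<exists>k'. limit_flow \<beta> r (%_. N) T (%_. supp N) k' (sel N a) \<and> (\<forall>n. \<exists>c. k' n = sel N c \<and> c \<in> unit_box \<and> label N c i = l)"
    if i: "i < N" and l: "l = 0 \<or> l = 1" for i l
  proof -
    have "\<forall>n. \<exists>c. (\<forall>j<N. q n j <= c j \<and> c j <= q n j + 1) \<and> label N (pt n c) i = l"
    proof
      fix n
      obtain u w where u: "\<forall>j<N. q n j <= u j \<and> u j <= q n j + 1" and w: "\<forall>j<N. q n j <= w j \<and> w j <= q n j + 1"
        and ne: "label N (pt n u) i \<noteq> label N (pt n w) i"
        using cq i unfolding cell_def by blast
      have "label N (pt n u) i = l \<or> label N (pt n w) i = l"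
        using ne label_cases[of N "pt n u" i] label_cases[of N "pt n w" i] l by auto
      then show "\<exists>c. (\<forall>j<N. q n j <= c j \<and> c j <= q n j + 1) \<and> label N (pt n c) i = l"
        using u w by blast
    qed
    from choice[OF this] obtain c where c0: "\<forall>n. (\<forall>j<N. q n j <= c n j \<and> c n j <= q n j + 1) \<and> label N (pt n (c n)) i = l" by (rule exE)
    have c: "q n j <= c n j \<and> c n j <= q n j + 1" "label N (pt n (c n)) i = l" if "j < N" for n j using c0 that by blast+
    have cl: "label N (pt n (c n)) i = l" for n using c0 by blast
    define C where "C n = pt (k n) (c (k n))" for n
    have C: "C n \<in> unit_box" for n
    proof -
      have "c (k n) j <= Suc (k n)" if "j < N" for j using c(1)[OF that, of "k n"] q[OF that, of "k n"] by simp
      then show ?thesis unfolding C_def by (intro pt_box) auto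
    qed
    have limC: "(%n. C n j) \<longlonglongrightarrow> a j" if j: "j < N" for j
    proof -
      have "(%n. C n j - A (k n) j) \<longlonglongrightarrow> 0"
      proof (rule Lim_null_comparison)
        show "\<forall>\<^sub>F n in sequentially. norm (C n j - A (k n) j) <= inverse (real (Suc (k n)))"
        proof (rule always_eventually, rule allI)
          fix n
          have "\<bar>real (c (k n) j) - real (q (k n) j)\<bar> <= 1" using c(1)[OF j, of "k n"] by auto
          then have "\<bar>real (c (k n) j) - real (q (k n) j)\<bar> / real (Suc (k n)) <= 1 / real (Suc (k n))" by (intro divide_right_mono) auto
          then show "norm (C n j - A (k n) j) <= inverse (real (Suc (k n)))"
            using j by (simp add: C_def A_def pt_def diff_divide_distrib[symmetric] inverse_eq_divide)
        qed
        show "(%n. inverse (real (Suc (k n)))) \<longlonglongrightarrow> 0"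
          using LIMSEQ_subseq_LIMSEQ[OF LIMSEQ_inverse_real_of_nat k(1)] by (simp add: o_def)
      qed
      from tendsto_add[OF this lim[OF j]] show ?thesis by simp
    qed
    obtain k' where k': "strict_mono k'" "limit_flow \<beta> r (%_. N) T (%_. supp N) (%n. sel N (C (k' n))) (sel N a)"
      by (rule limit_of_data[OF C a limC])
    have "label N (C n) i = l" for n using cl by (simp add: C_def)
    then show ?thesis using C k'(2) by (intro exI[of _ "%n. sel N (C (k' n))"]) auto
  qed
  show ?thesis
  proof (rule that[OF a])
    fix m t assume m: "m < N" and t: "0 <= t" "t <= T"
    show "sel N a t (3 * int m + 1) = 0 \<longleftrightarrow> sel N a t (3 * int m + 2) = 0"
    proof
      assume z: "sel N a t (3 * int m + 1) = 0"
      obtain y where y: "limit_flow \<beta> r (%_. N) T (%_. supp N) y (sel N a)" "!!n. \<exists>c. y n = sel N c \<and> c \<in> unit_box \<and> label N c m = 0"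
        using lab[OF m, of 0] by auto
      show "sel N a t (3 * int m + 2) = 0"
      proof (rule limit_flow.dies_with[OF y(1) _ _ t z])
        show "y n u (3 * int m + 1) = 0 ==> y n u (3 * int m + 2) = 0" if "0 <= u" "u <= T" for n u
          using y(2)[of n] label_0D that by metis
        show "y n T (3 * int m + 2) = 0" for n using y(2)[of n] dead_T[OF _ m] by metis
      qed
    next
      assume z: "sel N a t (3 * int m + 2) = 0"
      obtain y where y: "limit_flow \<beta> r (%_. N) T (%_. supp N) y (sel N a)" "!!n. \<exists>c. y n = sel N c \<and> c \<in> unit_box \<and> label N c m = 1"
        using lab[OF m, of 1] by auto
      show "sel N a t (3 * int m + 1) = 0"
      proof (rule limit_flow.dies_with[OF y(1) _ _ t z])
        show "y n u (3 * int m + 2) = 0 ==> y n u (3 * int m + 1) = 0" if "0 <= u" "u <= T" for n u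
          using y(2)[of n] label_1D that by metis
        show "y n T (3 * int m + 1) = 0" for n using y(2)[of n] dead_T[OF _ m] by metis
      qed
    qed
  qed
qed

end

section \<open>Propagation of the perturbation\<close>

text \<open>The sizes of the pairs are \<open>r\<^sub>j\<^sub>+\<^sub>1 = r\<^sub>j powr A\<close> with \<open>r\<^sub>0 = \<rho>\<close>, they are tuned within a relative distance
  \<open>\<kappa>'\<close>, and the perturbation that reaches site \<open>3 * j\<close> is at least \<open>r\<^sub>j powr P\<close>. The parameters \<open>t0\<close>, \<open>L0\<close> and \<open>e\<close> of
  a stage are \<open>h\<close>, \<open>lam * g\<close> and \<open>\<eta> * g\<close> times \<open>r\<^sub>j powr (\<beta> + 1)\<close>, and \<open>\<nu>\<close> bounds the quotients of consecutive sizes.\<close>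

locale constants =
  fixes \<beta> A P \<kappa> \<kappa>' h lam \<eta> \<nu> \<rho> :: real
  assumes \<beta>: "0 < \<beta>" and A: "2 < A" and P: "1 < P"
    and \<kappa>: "0 < \<kappa>" "\<kappa> <= 1 / 100" "(1 + 2 * \<kappa>) powr (\<beta> + 1) <= 3 / 2"
    and \<kappa>': "0 < \<kappa>'" "\<kappa>' <= 1 / 100"
    and h: "0 < h" "16 * \<beta> * 8 powr (\<beta> + 1) * h <= 1" "2 * (\<beta> + 1) * h <= 4 powr (- (\<beta> + 1))"
    and lam: "0 < lam" "lam <= \<beta> * 2 powr (- (\<beta> + 1)) * h / 64"
      "lam <= \<beta> * 3 powr (- (\<beta> + 1)) * (\<beta> * 2 powr (- (\<beta> + 1))) * h * h / 1024"
    and \<eta>: "0 < \<eta>" "48 * \<beta> * 8 powr (\<beta> + 1) * \<eta> <= \<beta> * 2 powr (- (\<beta> + 1))"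
      "6 * \<beta> * 8 powr (\<beta> + 1) * \<eta> <= \<beta> * 3 powr (- (\<beta> + 1)) * (\<beta> * 2 powr (- (\<beta> + 1))) * h / 128" "2 * \<eta> <= lam" "4 * \<eta> <= 1"
    and \<nu>: "0 < \<nu>" "\<nu> <= 1 / 2" "4 powr (- (\<beta> + 1)) + 2 * 3 powr (\<beta> + 1) * \<nu> powr (\<beta> + 1) <= 2 powr (- (\<beta> + 1))"
      "4480000 * 4 powr (\<beta> + 1) * 3 powr (\<beta> + 1) * \<nu> powr (\<beta> + 1) <= 1" "(48 * \<nu>) powr \<beta> <= 1 / 10000"
      "2 * 3 powr (\<beta> + 1) * \<nu> powr (\<beta> + 1) <= h" "896000 * 336 * \<nu> <= \<kappa> / 16"
    and \<rho>: "0 < \<rho>" "\<rho> < 1"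
    and small: "!!r. 0 < r ==> r <= \<rho> ==> r powr (A - 1) <= \<nu>" "!!r. 0 < r ==> r <= \<rho> ==> r <= \<nu>"
      "!!r. 0 < r ==> r <= \<rho> ==> r <= 1 / 24" "!!r. 0 < r ==> r <= \<rho> ==> 2 * 2 powr \<beta> <= (4 * r) powr (- \<beta>)"
      "!!r. 0 < r ==> r <= \<rho> ==> 2 powr \<beta> <= (1 - (1 + \<kappa>' / 2) powr (- \<beta>)) * (2 * (3 * r)) powr (- \<beta>)"
      "!!r. 0 < r ==> r <= \<rho> ==> (1 + \<kappa>') powr \<beta> - 1 + 2 powr \<beta> * (3 * r) powr \<beta> <= \<kappa>"
      "!!r. 0 < r ==> r <= \<rho> ==> 2 * (3 * r) powr (\<beta> + 1) <= (3 / 4) powr (\<beta> + 1) - (1 / 2) powr (\<beta> + 1)"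
      "!!r. 0 < r ==> r <= \<rho> ==> 2 * 2 powr \<beta> * (3 * r) powr (\<beta> + 1) <= 1 / 4"
      "!!r. 0 < r ==> r <= \<rho> ==> 896000 powr (1 + 2 * \<beta>) * (336 * r powr A) powr (2 * \<beta>) <= 2 * lam * r powr (\<beta> + 1) * (\<kappa> * r / 16) powr (2 * \<beta>)"
      "!!r. 0 < r ==> r <= \<rho> ==> 3584 * \<beta> * 48 powr (\<beta> + 1) * (r powr A) powr (\<beta> + 1) <= \<eta> * r powr (\<beta> + 1) * r powr (\<beta> + 1)"
      "!!r. 0 < r ==> r <= \<rho> ==> 8 * r powr P <= \<kappa> * r / 16"
      "!!r. 0 < r ==> r <= \<rho> ==> (8 * r powr P) powr (1 + 2 * \<beta>) <= 2 * (lam * (r powr A) powr P * r powr (\<beta> + 1)) * (\<kappa> * r / 16) powr (2 * \<beta>)"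
begin

definition "rr j = \<rho> powr (A ^ j)" for j :: nat
text \<open>The death bound for pair 0, the largest pair; at this time all pairs are dead.\<close>

definition "TT = (3 * \<rho>) powr (\<beta> + 1) / (\<beta> + 1)"

lemma rr_pos: "0 < rr j" using \<rho> by (simp add: rr_def)

lemma rr_0: "rr 0 = \<rho>" using \<rho> by (simp add: rr_def)

lemma rr_Suc: "rr (Suc j) = rr j powr A"
  by (simp add: rr_def powr_powr mult.commute)

lemma rr_le: "rr j <= \<rho>"
proof -
  have "1 <= A ^ j" using A by (intro one_le_power) auto
  then have "\<rho> powr (A ^ j) <= \<rho> powr 1" using \<rho> by (intro powr_mono') auto
  then show ?thesis using \<rho> by (simp add: rr_def)
qed

lemma rr_ratio: "rr (Suc j) <= \<nu> * rr j"
proof -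
  have "rr (Suc j) = rr j powr (A - 1) * rr j" using rr_pos[of j] by (simp add: rr_Suc powr_diff)
  also have "\<dots> <= \<nu> * rr j" using small(1)[OF rr_pos rr_le] rr_pos[of j] by (intro mult_right_mono) auto
  finally show ?thesis .
qed

lemma rr_antimono: "i <= j ==> rr j <= rr i"
proof (induction j rule: dec_induct)
  case (step n)
  have "\<nu> * rr n <= 1 * rr n" using \<nu> rr_pos[of n] by (intro mult_right_mono) auto
  then show ?case using rr_ratio[of n] step by linarith
qed simp

lemma b1: "1 <= \<beta> + 1" "0 < \<beta> + 1" using \<beta> by auto

lemma TT_bounds: "0 < TT" "TT <= (3 * \<rho>) powr (\<beta> + 1)" "(\<beta> + 1) * TT = (3 * \<rho>) powr (\<beta> + 1)"
proof -
  show "0 < TT" "(\<beta> + 1) * TT = (3 * \<rho>) powr (\<beta> + 1)" using \<rho> b1 by (simp_all add: TT_def)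
  have "(3 * \<rho>) powr (\<beta> + 1) / (\<beta> + 1) <= (3 * \<rho>) powr (\<beta> + 1) / 1" using b1 by (intro divide_left_mono) auto
  then show "TT <= (3 * \<rho>) powr (\<beta> + 1)" by (simp add: TT_def)
qed

sublocale tuning \<beta> rr TT \<kappa>'
proof
  fix m
  show "2 * (\<beta> + 1) * TT <= (3 / 4) powr (\<beta> + 1) - (1 / 2) powr (\<beta> + 1)"
    using small(7)[OF \<rho>(1) order_refl] by (simp only: mult.assoc TT_bounds(3))
  have "2 * 2 powr \<beta> * TT <= 2 * 2 powr \<beta> * (3 * \<rho>) powr (\<beta> + 1)" using TT_bounds by (intro mult_left_mono) auto
  then show "2 * 2 powr \<beta> * TT <= 1 / 4" using small(8)[OF \<rho>(1) order_refl] by linarith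
  show "(3 * rr m) powr (\<beta> + 1) / (\<beta> + 1) <= TT"
    unfolding TT_def using rr_le[of m] rr_pos[of m] b1 by (intro divide_right_mono powr_mono2) auto
qed (use \<beta> \<kappa>' rr_pos small(3-5)[OF rr_pos rr_le] TT_bounds in auto)

end

section \<open>Passing the perturbation from pair to pair\<close>

locale cascade = constants + two_flows \<beta> rr N TT Sx Sv x v s for N Sx Sv x v s +
  assumes tie: "!!m t. m < N ==> 0 <= t ==> t <= TT ==> v t (3 * int m + 1) = 0 \<longleftrightarrow> v t (3 * int m + 2) = 0"
begin

abbreviation "\<Theta> \<equiv> fx.\<theta>"

lemma \<Theta>_def': "\<Theta> m = (3 * rr m) powr b / b" by (simp add: fx.\<theta>_def)

lemma \<Theta>_mono: "i <= j ==> \<Theta> j <= \<Theta> i"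
  unfolding \<Theta>_def' using rr_antimono[of i j] rr_pos[of j] b1 by (intro divide_right_mono powr_mono2) auto

lemma \<Theta>_0: "\<Theta> 0 = TT" by (simp add: \<Theta>_def' TT_def rr_0)

lemma \<Theta>_T: "\<Theta> j <= TT" using \<Theta>_mono[of 0 j] \<Theta>_0 by simp

lemma \<Theta>_pos: "0 < \<Theta> j" using rr_pos[of j] b1 by (simp add: \<Theta>_def')

lemma \<Theta>_b: "b * \<Theta> j = 3 powr b * rr j powr b"
  using b1 rr_pos[of j] by (simp add: \<Theta>_def' powr_mult)

lemma \<Theta>_le: "\<Theta> j <= 3 powr b * rr j powr b"
proof -
  have "1 * \<Theta> j <= b * \<Theta> j" using \<Theta>_pos[of j] b1 by (intro mult_right_mono) auto
  then show ?thesis by (simp add: \<Theta>_b)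
qed

text \<open>\<open>tie_profile\<close> applies to each particle of the pair, and the tie makes the
  two death times equal.\<close>

lemma profile_exists:
  assumes j: "j < N"
  shows "\<exists>d>0. d <= \<Theta> j \<and>
    (\<forall>t i. 0 <= t --> t < d --> i = 3 * int j + 1 \<or> i = 3 * int j + 2 --> 0 < v t i) \<and>
    (\<forall>t i. 0 <= t --> t <= d --> i = 3 * int j + 1 \<or> i = 3 * int j + 2 --> \<bar>v t i powr b - b * (d - t)\<bar> <= \<kappa> * (b * (d - t)))"
proof -
  interpret P: pair_system \<beta> "2 powr \<beta>" TT fv.F "%t. v t (3 * int j + 1)" "%t. v t (3 * int j + 2)"
    "%t. v t (3 * int j) powr (- \<beta>)" "%t. v t (3 * int j + 3) powr (- \<beta>)" by (rule fv.pair[OF j])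
  interpret P': pair_system \<beta> "2 powr \<beta>" TT fv.F "%t. v t (3 * int j + 2)" "%t. v t (3 * int j + 1)"
    "%t. v t (3 * int j + 3) powr (- \<beta>)" "%t. v t (3 * int j) powr (- \<beta>)" by (rule P.swap)
  have dead: "v TT (3 * int j + 1) = 0" "v TT (3 * int j + 2) = 0" using fv.pair_dead[OF j \<Theta>_T order_refl] by auto
  have start: "0 < v 0 (3 * int j + 1)" "0 < v 0 (3 * int j + 2)" using fv.small0[OF j] rr_pos[of j] by auto
  have m: "v t (3 * int j + 1) <= 3 * rr j" "v t (3 * int j + 2) <= 3 * rr j" if "0 <= t" "t <= TT" for t
    using fv.pair_sum(2)[OF j, of t t] fv.nn[of t "3 * int j + 1"] fv.nn[of t "3 * int j + 2"] that by auto
  note sm = small(5,6)[OF rr_pos rr_le, of j]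
  have T0: "0 <= TT" using TT_bounds by simp
  obtain d where d: "0 < d" "d <= TT" "v d (3 * int j + 1) = 0" "!!t. 0 <= t ==> t < d ==> 0 < v t (3 * int j + 1) \<and> 0 < v t (3 * int j + 2)"
    "!!t. 0 <= t ==> t <= d ==> \<bar>v t (3 * int j + 1) powr (\<beta> + 1) - (\<beta> + 1) * (d - t)\<bar> <= \<kappa> * ((\<beta> + 1) * (d - t))"
    using P.tie_profile[OF tie[OF j] dead(1) start(1) T0 \<kappa>'(1) conjI[OF m] sm] by metis
  obtain d' where d': "0 < d'" "d' <= TT" "v d' (3 * int j + 2) = 0" "!!t. 0 <= t ==> t < d' ==> 0 < v t (3 * int j + 2) \<and> 0 < v t (3 * int j + 1)"
    "!!t. 0 <= t ==> t <= d' ==> \<bar>v t (3 * int j + 2) powr (\<beta> + 1) - (\<beta> + 1) * (d' - t)\<bar> <= \<kappa> * ((\<beta> + 1) * (d' - t))"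
    using P'.tie_profile[OF tie[OF j, symmetric] dead(2) start(2) T0 \<kappa>'(1) conjI[OF m(2,1)] sm] by metis
  have "v d (3 * int j + 2) = 0" "v d' (3 * int j + 1) = 0" using tie[OF j] d d' by auto
  then have eq: "d' = d" using d(1,3,4) d'(1,3,4) by (metis less_eq_real_def less_irrefl linorder_neqE_linordered_idom)
  have "v (\<Theta> j) (3 * int j + 1) = 0" using fv.pair_dead[OF j order_refl \<Theta>_T] by auto
  then have "d <= \<Theta> j" using d(4)[of "\<Theta> j"] \<Theta>_pos[of j] by force
  then show ?thesis using d d' eq by (intro exI[of _ d]) auto
qed

text \<open>The size of the next larger pair. For \<open>j = 0\<close> there is none, and the value
  2 makes \<open>rp j / 4\<close> the lower bound \<open>1 / 2\<close> of the large
  particles.\<close>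

definition "rp j = (if j = 0 then 2 else rr (j - 1))" for j :: nat

lemma rp_pos: "0 < rp j" and rp_ratio: "rr j <= \<nu> * rp j" and rp_le: "rp j <= 2"
proof -
  show "0 < rp j" using rr_pos by (simp add: rp_def)
  show "rr j <= \<nu> * rp j"
    using rr_ratio[of "j - 1"] small(2)[OF \<rho>(1) order_refl] \<nu> by (cases j) (auto simp: rp_def rr_0)
  show "rp j <= 2" using rr_le[of "j - 1"] \<rho> by (auto simp: rp_def)
qed

text \<open>A stage ends with all values at most \<open>56 * Q\<close> and with the new
  \<open>g\<close> at least \<open>Q / 8\<close>, whence \<open>448 = 8 * 56\<close>; with
  \<open>Q <= 6 * r\<close> this gives \<open>336 = 6 * 56\<close>.\<close>

definition "stage_inv a j g \<longleftrightarrow> rr (Suc j) powr P <= g \<and> g <= 336 * rr (Suc j) \<and> g <= 1 \<and> Y a (3 * int j + 3) = g \<and>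
   (\<forall>i\<le>3 * int j + 2. - (\<eta> * g * rr j powr b) <= Y a i) \<and> (\<forall>i. \<bar>Y a i\<bar> <= 448 * g)"

lemma powr_b_ratio: "rr j powr b <= \<nu> powr b * rp j powr b" "rr (Suc j) powr b <= \<nu> powr b * rr j powr b"
proof -
  have "rr j powr b <= (\<nu> * rp j) powr b" using rp_ratio[of j] rr_pos[of j] b1 by (intro powr_mono2) auto
  then show "rr j powr b <= \<nu> powr b * rp j powr b" using \<nu> rp_pos[of j] by (simp add: powr_mult)
  have "rr (Suc j) powr b <= (\<nu> * rr j) powr b" using rr_ratio[of j] rr_pos[of "Suc j"] b1 by (intro powr_mono2) auto
  then show "rr (Suc j) powr b <= \<nu> powr b * rr j powr b" using \<nu> rr_pos[of j] by (simp add: powr_mult)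
qed

lemma lower_both:
  assumes "y = x \<or> y = v" "m < N" "i = 3 * int m + 1 \<or> i = 3 * int m + 2" "0 <= t" "0 <= c" "c powr b + 2 * b * t <= (rr m / 2) powr b"
  shows "c <= y t i"
proof -
  have a: "rr m / 2 <= x 0 i" "rr m / 2 <= v 0 i" using fx.small0[OF assms(2)] fv.small0[OF assms(2)] assms(3) by auto
  have "0 <= rr m / 2" using rr_pos[of m] by simp
  then show ?thesis using fx.lower_ge[OF assms(5) _ a(1) assms(6,4)] fv.lower_ge[OF assms(5) _ a(2) assms(6,4)] assms(1) by auto
qed

end

locale cascade_step = cascade +
  fixes j :: nat and a0 g d :: real
  assumes j: "j < N" and a0: "a0 = (if Suc j = N then 0 else \<Theta> (Suc j))" and si: "stage_inv a0 j g"
    and d: "0 < d" "d <= \<Theta> j"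
    "!!t i. 0 <= t ==> t < d ==> i = 3 * int j + 1 \<or> i = 3 * int j + 2 ==> 0 < v t i"
    "!!t i. 0 <= t ==> t <= d ==> i = 3 * int j + 1 \<or> i = 3 * int j + 2 ==> \<bar>v t i powr b - b * (d - t)\<bar> <= \<kappa> * (b * (d - t))"
begin

definition "R = rr j"
text \<open>Life times scale like the power \<open>b\<close> of the size: \<open>\<mu>\<close> is
  the time scale of pair \<open>j\<close>, and \<open>\<mu>q\<close> that of the next larger
  pair.\<close>

definition "\<mu> = R powr b"
definition "q = rp j"
definition "\<mu>q = q powr b"

lemma R: "0 < R" "R <= 1 / 24" "R < 1" "R <= \<rho>"
  using rr_pos[of j] rr_le[of j] small(3)[OF rr_pos rr_le, of j] by (auto simp: R_def)

lemma q: "0 < q" "R <= \<nu> * q" "q <= 2" "R <= q / 2"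
proof -
  show *: "0 < q" "R <= \<nu> * q" "q <= 2" using rp_pos[of j] rp_ratio[of j] rp_le[of j] by (auto simp: q_def R_def)
  have "\<nu> * q <= 1 / 2 * q" using \<nu> * by (intro mult_right_mono) auto
  then show "R <= q / 2" using * by linarith
qed

lemma \<mu>: "0 < \<mu>" "\<mu> <= 1" "0 < \<mu>q" "\<mu> <= \<nu> powr b * \<mu>q"
  using R q powr_b_ratio(1)[of j] powr_mono2[of b R 1] b1 by (auto simp: \<mu>_def \<mu>q_def R_def q_def)

lemma g: "0 < g" "(R powr A) powr P <= g" "g <= 336 * R powr A" "g <= 1" "g <= 336 * (\<nu> * R)"
proof -
  show *: "(R powr A) powr P <= g" "g <= 336 * R powr A" "g <= 1"
    using si unfolding stage_inv_def rr_Suc R_def[symmetric] by auto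
  have "0 < (R powr A) powr P" using R by simp
  then show "0 < g" using * by linarith
  show "g <= 336 * (\<nu> * R)" using si rr_ratio[of j] unfolding stage_inv_def R_def by auto
qed

lemma scale: "(R / 8) powr (- b) = 8 powr b / \<mu>" "(3 * R) powr (- b) = 3 powr (- b) / \<mu>" "(q / 4) powr (- b) = 4 powr b / \<mu>q"
  "(R / 8) powr b = 8 powr (- b) * \<mu>" "(R / 2) powr b = 2 powr (- b) * \<mu>" "(q / 4) powr b = 4 powr (- b) * \<mu>q" "(q / 2) powr b = 2 powr (- b) * \<mu>q"
proof -
  have *: "(y / c) powr (- n) = c powr n / y powr n" "(y / c) powr n = c powr (- n) * y powr n" "(c * y) powr (- n) = c powr (- n) / y powr n"
    if "0 < y" "0 < c" for y c n :: real
    using that by (simp_all add: powr_divide powr_mult powr_minus divide_simps)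
  show "(R / 8) powr (- b) = 8 powr b / \<mu>" "(3 * R) powr (- b) = 3 powr (- b) / \<mu>" "(q / 4) powr (- b) = 4 powr b / \<mu>q"
    "(R / 8) powr b = 8 powr (- b) * \<mu>" "(R / 2) powr b = 2 powr (- b) * \<mu>" "(q / 4) powr b = 4 powr (- b) * \<mu>q" "(q / 2) powr b = 2 powr (- b) * \<mu>q"
    unfolding \<mu>_def \<mu>q_def using R q by (intro *; simp)+
qed

lemma \<Theta>j: "b * \<Theta> j = 3 powr b * \<mu>" "\<Theta> j <= 3 powr b * \<mu>"
  using \<Theta>_b[of j] \<Theta>_le[of j] by (simp_all only: R_def \<mu>_def)

lemma a0_le: "0 <= a0" "2 * a0 <= h * \<mu>"
proof -
  show "0 <= a0" using \<Theta>_pos[of "Suc j"] by (simp add: a0)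
  have "2 * \<Theta> (Suc j) <= 2 * (3 powr b * rr (Suc j) powr b)" using \<Theta>_le[of "Suc j"] by simp
  also have "\<dots> <= 2 * (3 powr b * (\<nu> powr b * \<mu>))" unfolding \<mu>_def R_def using powr_b_ratio(2)[of j] by (intro mult_left_mono) auto
  also have "\<dots> = (2 * 3 powr b * \<nu> powr b) * \<mu>" by simp
  also have "\<dots> <= h * \<mu>" using \<nu>(6) \<mu> by (intro mult_right_mono) auto
  finally show "2 * a0 <= h * \<mu>" using h \<mu> by (simp add: a0)
qed

lemma hd: "2 * b * (h * \<mu>) <= 4 powr (- b) * \<mu>"
proof -
  have "2 * b * h * \<mu> <= 4 powr (- b) * \<mu>" using h(3) \<mu> by (intro mult_right_mono) auto
  then show ?thesis by (simp only: mult.assoc)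
qed

lemma p24: "8 powr (- b) * \<mu> + 4 powr (- b) * \<mu> <= 2 powr (- b) * \<mu>"
proof -
  define w where "w = (2::real) powr (- b)"
  have w3: "4 powr (- b) = w * w" "8 powr (- b) = w * (w * w)"
    unfolding w_def by (simp_all only: powr_mult[symmetric]) simp_all
  have w: "0 < w" "w <= 1 / 2"
  proof -
    have "2 powr (- b) <= 2 powr (- 1 :: real)" using b1 by (intro powr_mono) auto
    then show "0 < w" "w <= 1 / 2" by (simp_all add: w_def powr_minus)
  qed
  have 1: "w * w <= w * (1 / 2)" using w by (intro mult_left_mono) auto
  have "w * (w * w) <= w * (1 / 4)" using w mult_mono[of w "1/2" w "1/2"] by (intro mult_left_mono) auto
  then have "8 powr (- b) + 4 powr (- b) <= 2 powr (- b)" using 1 w unfolding w3 w_def[symmetric] by linarith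
  then have "(8 powr (- b) + 4 powr (- b)) * \<mu> <= 2 powr (- b) * \<mu>" using \<mu> by (intro mult_right_mono) auto
  then show ?thesis by (simp only: distrib_right)
qed

lemma t0d: "h * \<mu> <= d"
proof -
  have "(R / 2) powr b <= v 0 (3 * int j + 1) powr b" using fv.small0[OF j] R b1 by (intro powr_mono2) (auto simp: R_def)
  moreover have "\<bar>v 0 (3 * int j + 1) powr b - b * d\<bar> <= \<kappa> * (b * d)" using d(4)[of 0 "3 * int j + 1"] d(1) by simp
  moreover have "\<kappa> * (b * d) <= 1 * (b * d)" using \<kappa> b1 d(1) by (intro mult_right_mono) auto
  ultimately have "2 powr (- b) * \<mu> <= 2 * (b * d)" unfolding scale by linarith
  moreover have "0 <= 8 powr (- b) * \<mu>" using \<mu> by simp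
  ultimately have "2 * b * (h * \<mu>) <= 2 * b * d" using hd p24 by linarith
  moreover have "0 < 2 * b" using b1 by simp
  ultimately show ?thesis by (simp only: mult_le_cancel_left_pos)
qed

text \<open>The time \<open>\<Theta> j\<close> is so short on the scale \<open>\<mu>q\<close> that
  all larger pairs keep at least a quarter of \<open>q\<close>.\<close>

lemma reg: 
  assumes y: "y = x \<or> y = v" and t: "0 <= t" "t <= \<Theta> j" and i: "- 3 * int N <= i" "i <= 3 * int j"
  shows "q / 4 <= y t i"
proof (cases "i < 0 \<or> i mod 3 = 0")
  case True
  have "\<bar>i\<bar> <= 3 * int N" using i j by auto
  then have "1 / 2 <= y t i" using fx.big_ge[of t i] fv.big_ge[of t i] True t \<Theta>_T[of j] y by auto
  then show ?thesis using q by linarith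
next
  case False
  define m where "m = nat (i div 3)"
  have m: "int m = i div 3" using False by (simp add: m_def)
  have "int m < int j" using i False unfolding m by presburger
  then have mj: "m < j" by simp
  have im: "i = 3 * int m + 1 \<or> i = 3 * int m + 2" using False unfolding m by presburger
  have "q <= rr m" using mj rr_antimono[of m "j - 1"] by (simp add: q_def rp_def)
  then have 1: "(q / 2) powr b <= (rr m / 2) powr b" using q b1 by (intro powr_mono2) auto
  have "b * t <= b * \<Theta> j" using t b1 by (intro mult_left_mono) auto
  then have "2 * b * t <= 2 * (3 powr b * \<mu>)" using \<Theta>j(1) by linarith
  also have "\<dots> <= 2 * (3 powr b * (\<nu> powr b * \<mu>q))" using \<mu> by (intro mult_left_mono) auto
  finally have "(q / 4) powr b + 2 * b * t <= (4 powr (- b) + 2 * 3 powr b * \<nu> powr b) * \<mu>q" unfolding scale by (simp add: algebra_simps)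
  also have "\<dots> <= 2 powr (- b) * \<mu>q" using \<nu>(3) \<mu> by (intro mult_right_mono) auto
  finally have "(q / 4) powr b + 2 * b * t <= (q / 2) powr b" unfolding scale .
  then have "(q / 4) powr b + 2 * b * t <= (rr m / 2) powr b" using 1 by linarith
  then show ?thesis using mj j q by (intro lower_both[OF y _ im t(1)]) auto
qed

lemma early: "0 <= t ==> t <= h * \<mu> ==> i = 3 * int j + 1 \<or> i = 3 * int j + 2 ==> y = x \<or> y = v ==> R / 8 <= y t i"
proof -
  assume t: "0 <= t" "t <= h * \<mu>" and i: "i = 3 * int j + 1 \<or> i = 3 * int j + 2" and y: "y = x \<or> y = v"
  have "2 * b * t <= 2 * b * (h * \<mu>)" using t b1 by (intro mult_left_mono) auto
  then have "(R / 8) powr b + 2 * b * t <= (R / 2) powr b" using hd p24 unfolding scale by linarith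
  then show "R / 8 <= y t i" using lower_both[OF y j i t(1), of "R / 8"] R by (simp add: R_def)
qed

sublocale st: stage \<beta> rr N TT Sx Sv x v s j a0 "q / 4"
proof
  show "a0 < \<Theta> j" using a0_le t0d d(1,2) by linarith
  show "\<Theta> j <= TT" by (rule \<Theta>_T)
  show "q / 4 <= x t i \<and> q / 4 <= v t i" if "0 <= t" "t <= \<Theta> j" "- 3 * int N <= i" "i <= 3 * int j" for t i
    using reg[OF _ that] by blast
  show "x a0 (3 * int m + 1) = 0 \<and> x a0 (3 * int m + 2) = 0 \<and> v a0 (3 * int m + 1) = 0 \<and> v a0 (3 * int m + 2) = 0" if m: "j < m" "m < N" for m
  proof -
    have s: "a0 = \<Theta> (Suc j)" using m by (simp add: a0)
    then have "\<Theta> m <= a0" "a0 <= TT" using \<Theta>_mono[of "Suc j" m] \<Theta>_T m by auto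
    then show ?thesis using fx.pair_dead[OF m(2)] fv.pair_dead[OF m(2)] by auto
  qed
qed (use j a0_le q in auto)

lemma \<Lambda>_eq: "st.\<Lambda> = \<beta> * (4 powr b / \<mu>q)" unfolding st.\<Lambda>_def scale ..

lemma S1: "10000 * st.\<Lambda> * 448 * \<Theta> j <= 1"
proof -
  have bt: "\<beta> * \<Theta> j <= 3 powr b * \<mu>"
  proof -
    have "\<beta> * \<Theta> j <= b * \<Theta> j" using \<Theta>_pos[of j] by (intro mult_right_mono) auto
    then show ?thesis using \<Theta>j(1) by linarith
  qed
  have "10000 * st.\<Lambda> * 448 * \<Theta> j = 4480000 * 4 powr b / \<mu>q * (\<beta> * \<Theta> j)" by (simp add: \<Lambda>_eq)
  also have "\<dots> <= 4480000 * 4 powr b / \<mu>q * (3 powr b * (\<nu> powr b * \<mu>q))"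
    using bt \<mu> by (intro mult_left_mono order_trans[OF bt]) auto
  also have "\<dots> = 4480000 * 4 powr b * 3 powr b * \<nu> powr b" using \<mu> by simp
  finally show ?thesis using \<nu>(4) by linarith
qed

sublocale run: stage_run \<beta> rr N TT Sx Sv x v s j a0 "q / 4" g 448 "\<eta> * g * \<mu>" "h * \<mu>" d \<kappa> "lam * g * \<mu>"
proof
  show "0 < \<kappa>" "\<kappa> <= 1 / 100" "(1 + 2 * \<kappa>) powr b <= 3 / 2" by (rule \<kappa>)+
  show "0 < g" "(1::real) <= 448" "0 < \<eta> * g * \<mu>" "0 < lam * g * \<mu>" using g \<eta> \<mu> lam by auto
  show "- (\<eta> * g * \<mu>) <= Y a0 i" if "i <= 3 * int j + 2" for i using si that by (auto simp: stage_inv_def \<mu>_def R_def)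
  show "Y a0 (3 * int j + 3) = g" "\<bar>Y a0 i\<bar> <= 448 * g" for i using si by (auto simp: stage_inv_def)
  show "2 * a0 <= h * \<mu>" "0 < h * \<mu>" "h * \<mu> <= d" "d <= \<Theta> j" using a0_le h \<mu> t0d d by auto
  show "rr j / 8 <= x t i \<and> rr j / 8 <= v t i" if "0 <= t" "t <= h * \<mu>" "i = 3 * int j + 1 \<or> i = 3 * int j + 2" for t i
    using early[OF that, of x] early[OF that, of v] by (auto simp: R_def)
  show "rr j / 8 <= q / 4" using q R by (simp add: R_def)
  show "0 < v t i" if "0 <= t" "t < d" "i = 3 * int j + 1 \<or> i = 3 * int j + 2" for t i by (rule d(3)[OF that])
  show "\<bar>v t i powr b - b * (d - t)\<bar> <= \<kappa> * (b * (d - t))" if "0 <= t" "t <= d" "i = 3 * int j + 1 \<or> i = 3 * int j + 2" for t i by (rule d(4)[OF that])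
  show "10000 * st.\<Lambda> * 448 * \<Theta> j <= 1" by (rule S1)
  show "16 * (\<beta> * (rr j / 8) powr - b) * (h * \<mu>) <= 1"
  proof -
    have "16 * (\<beta> * (rr j / 8) powr - b) * (h * \<mu>) = 16 * \<beta> * 8 powr b * h" unfolding R_def[symmetric] scale using \<mu> by simp
    then show ?thesis using h(2) by linarith
  qed
  show "48 * (\<beta> * (rr j / 8) powr - b) * (\<eta> * g * \<mu>) <= \<beta> * 2 powr - b * g"
  proof -
    have "48 * (\<beta> * (rr j / 8) powr - b) * (\<eta> * g * \<mu>) = 48 * \<beta> * 8 powr b * \<eta> * g" unfolding R_def[symmetric] scale using \<mu> by simp
    also have "\<dots> <= \<beta> * 2 powr - b * g" using \<eta>(2) g by (intro mult_right_mono) auto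
    finally show ?thesis .
  qed
  show "6 * (\<beta> * (rr j / 8) powr - b) * (\<eta> * g * \<mu>) <= \<beta> * (3 * rr j) powr - b * (\<beta> * 2 powr - b * g * (h * \<mu>)) / 128"
  proof -
    have "6 * (\<beta> * (rr j / 8) powr - b) * (\<eta> * g * \<mu>) = 6 * \<beta> * 8 powr b * \<eta> * g" unfolding R_def[symmetric] scale using \<mu> by simp
    also have "\<dots> <= \<beta> * 3 powr - b * (\<beta> * 2 powr - b) * h / 128 * g" using \<eta>(3) g by (intro mult_right_mono) auto
    also have "\<dots> = \<beta> * (3 * rr j) powr - b * (\<beta> * 2 powr - b * g * (h * \<mu>)) / 128" unfolding R_def[symmetric] scale using \<mu> by simp
    finally show ?thesis .
  qed
  show "2 * (\<eta> * g * \<mu>) <= lam * g * \<mu>"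
  proof -
    have "2 * \<eta> * (g * \<mu>) <= lam * (g * \<mu>)" using \<eta>(4) g \<mu> by (intro mult_right_mono) auto
    then show ?thesis by simp
  qed
  show "4 * (\<eta> * g * \<mu>) <= g"
  proof -
    have "4 * \<eta> * \<mu> <= 1 * 1" using \<eta> \<mu> by (intro mult_mono) auto
    then have "4 * \<eta> * \<mu> * g <= 1 * g" using g by (intro mult_right_mono) auto
    then show ?thesis by (simp add: mult_ac)
  qed
  show "lam * g * \<mu> <= \<beta> * 2 powr - b * g * (h * \<mu>) / 64"
  proof -
    have "lam * (g * \<mu>) <= \<beta> * 2 powr - b * h / 64 * (g * \<mu>)" using lam(2) g \<mu> by (intro mult_right_mono) auto
    then show ?thesis by (simp add: mult_ac)
  qed
  show "lam * g * \<mu> <= \<beta> * (3 * rr j) powr - b * (\<beta> * 2 powr - b * g * (h * \<mu>)) / 128 * (h * \<mu>) / 8"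
  proof -
    have "lam * (g * \<mu>) <= \<beta> * 3 powr - b * (\<beta> * 2 powr - b) * h * h / 1024 * (g * \<mu>)" using lam(3) g \<mu> by (intro mult_right_mono) auto
    also have "\<dots> = \<beta> * (3 * rr j) powr - b * (\<beta> * 2 powr - b * g * (h * \<mu>)) / 128 * (h * \<mu>) / 8" unfolding R_def[symmetric] scale using \<mu> by simp
    finally show ?thesis by (simp add: mult.assoc)
  qed
qed

abbreviation "grown Q \<equiv> \<kappa> * rr j / 16 <= Q \<or> 2 * (lam * g * \<mu>) * (\<kappa> * rr j / 16) powr (2 * \<beta>) <= Q powr (1 + 2 * \<beta>)"

text \<open>This uses the upper bound \<open>g <= 336 * R powr A\<close>: by \<open>small(9)\<close>
  the gain beats \<open>g\<close> with the factor \<open>896000 = 2000 * 448\<close>.\<close>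

lemma grown_big:
  assumes Q: "grown Q" "0 < Q"
  shows "2000 * (448 * g) <= Q"
  using Q(1)
proof
  assume "\<kappa> * rr j / 16 <= Q"
  moreover have "896000 * 336 * \<nu> * R <= \<kappa> / 16 * R" using \<nu>(7) R by (intro mult_right_mono) auto
  ultimately show ?thesis using g(5) by (simp add: R_def)
next
  assume h: "2 * (lam * g * \<mu>) * (\<kappa> * rr j / 16) powr (2 * \<beta>) <= Q powr (1 + 2 * \<beta>)"
  have "(896000 * g) powr (1 + 2 * \<beta>) = g * (896000 powr (1 + 2 * \<beta>) * g powr (2 * \<beta>))"
    using g by (simp add: powr_mult powr_add)
  also have "\<dots> <= g * (896000 powr (1 + 2 * \<beta>) * (336 * R powr A) powr (2 * \<beta>))"
    using g \<beta> by (intro mult_left_mono powr_mono2) auto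
  also have "\<dots> <= g * (2 * lam * R powr b * (\<kappa> * R / 16) powr (2 * \<beta>))"
    using small(9)[OF R(1,4)] g by (intro mult_left_mono) auto
  also have "\<dots> = 2 * (lam * g * \<mu>) * (\<kappa> * rr j / 16) powr (2 * \<beta>)" by (simp add: \<mu>_def R_def)
  finally have "(896000 * g) powr (1 + 2 * \<beta>) <= Q powr (1 + 2 * \<beta>)" using h by linarith
  then have "\<not> Q < 896000 * g" using powr_less_mono2[of "1 + 2 * \<beta>" Q "896000 * g"] Q(2) \<beta> by auto
  then show ?thesis by simp
qed

text \<open>Here the exponent \<open>P\<close> reproduces itself: from
  \<open>g >= (R powr A) powr P\<close> follows \<open>Q >= 8 * R powr P\<close>, and the next
  \<open>g\<close> is at least \<open>Q / 8\<close>.\<close>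

lemma grown_low:
  assumes Q: "grown Q" "0 < Q"
  shows "8 * R powr P <= Q"
  using Q(1)
proof
  assume "\<kappa> * rr j / 16 <= Q"
  then show ?thesis using small(11)[OF R(1,4)] by (simp add: R_def)
next
  assume h: "2 * (lam * g * \<mu>) * (\<kappa> * rr j / 16) powr (2 * \<beta>) <= Q powr (1 + 2 * \<beta>)"
  have "(8 * R powr P) powr (1 + 2 * \<beta>) <= 2 * (lam * (R powr A) powr P * R powr b) * (\<kappa> * R / 16) powr (2 * \<beta>)"
    by (rule small(12)[OF R(1,4)])
  also have "\<dots> <= 2 * (lam * g * \<mu>) * (\<kappa> * R / 16) powr (2 * \<beta>)"
    unfolding \<mu>_def using g lam by (intro mult_right_mono mult_left_mono) auto
  finally have "(8 * R powr P) powr (1 + 2 * \<beta>) <= Q powr (1 + 2 * \<beta>)" using h unfolding R_def by linarith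
  then have "\<not> Q < 8 * R powr P" using powr_less_mono2[of "1 + 2 * \<beta>" Q "8 * R powr P"] Q(2) \<beta> by auto
  then show ?thesis by simp
qed

lemma err: "(q / 4) powr (- \<beta>) * (12 * rr j) powr \<beta> <= 1 / 10000"
proof -
  have "(q / 4) powr (- \<beta>) * (12 * R) powr \<beta> = (12 * R / (q / 4)) powr \<beta>"
  proof -
    have "(12 * R / (q / 4)) powr \<beta> = (12 * R) powr \<beta> / (q / 4) powr \<beta>" by (rule powr_divide)
    moreover have "(q / 4) powr (- \<beta>) = 1 / (q / 4) powr \<beta>" by (rule powr_minus_divide)
    ultimately show ?thesis by simp
  qed
  also have "12 * R / (q / 4) = 48 * (R / q)" by simp
  also have "(48 * (R / q)) powr \<beta> <= (48 * \<nu>) powr \<beta>" using q R \<beta> by (intro powr_mono2) (auto simp: field_simps)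
  also have "\<dots> <= 1 / 10000" by (rule \<nu>(5))
  finally show ?thesis by (simp add: R_def)
qed

lemma step:
  "\<exists>g'. Y (\<Theta> j) (3 * int j) = g' \<and> rr j powr P <= g' \<and> g' <= 336 * rr j \<and> (\<forall>i. \<bar>Y (\<Theta> j) i\<bar> <= 448 * g') \<and>
    (0 < j --> (\<forall>i\<le>3 * int j - 1. - (\<eta> * g' * rr (j - 1) powr b) <= Y (\<Theta> j) i))"
proof -
  obtain Q where Q: "0 < Q" "Q <= 6 * rr j" "grown Q" "Q / 8 <= Y (\<Theta> j) (3 * int j)" "!!i. \<bar>Y (\<Theta> j) i\<bar> <= 56 * Q"
    "!!i. i <= 3 * int j - 1 ==> - (8 * (\<eta> * g * \<mu>) + 224 * st.\<Lambda> * Q * (2 * Q) powr b) <= Y (\<Theta> j) i"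
    by (rule run.stage_result[OF grown_big err]) auto
  define g' where "g' = Y (\<Theta> j) (3 * int j)"
  have g': "Q / 8 <= g'" "g' <= 56 * Q" using Q(4) Q(5)[of "3 * int j"] by (auto simp: g'_def)
  \<comment> \<open>The new part of the error is of order \<open>Q * R powr b / q powr b\<close>.
    With \<open>R = q powr A\<close> and \<open>A > 2\<close> it stays below the tolerance
    \<open>\<eta> * g' * q powr b\<close> of the next stage.\<close>
  have "- (\<eta> * g' * rr (j - 1) powr b) <= Y (\<Theta> j) i" if j0: "0 < j" and i: "i <= 3 * int j - 1" for i
  proof -
    have qr: "q = rr (j - 1)" "R = q powr A" using j0 rr_Suc[of "j - 1"] by (auto simp: q_def rp_def R_def)
    have q\<rho>: "q <= \<rho>" using rr_le qr by simp
    have "(2 * Q) powr b <= (12 * R) powr b" using Q b1 by (intro powr_mono2) (auto simp: R_def)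
    also have "\<dots> = 12 powr b * \<mu>" using R by (simp add: powr_mult \<mu>_def)
    finally have "224 * st.\<Lambda> * Q * (2 * Q) powr b <= 224 * st.\<Lambda> * Q * (12 powr b * \<mu>)" using st.\<Lambda>_pos Q by (intro mult_left_mono) auto
    also have "\<dots> = 224 * \<beta> * (4 powr b * 12 powr b) * \<mu> / \<mu>q * Q" by (simp add: \<Lambda>_eq)
    also have "4 powr b * 12 powr b = (48 :: real) powr b" by (simp add: powr_mult[symmetric])
    also have "224 * \<beta> * 48 powr b * \<mu> / \<mu>q * Q = 3584 * \<beta> * 48 powr b * \<mu> / \<mu>q * (Q / 16)" by simp
    also have "\<dots> <= (\<eta> * \<mu>q * \<mu>q) / \<mu>q * (Q / 16)"
      using small(10)[OF q(1) q\<rho>] \<mu> Q unfolding qr(2)[symmetric] \<mu>_def[symmetric] \<mu>q_def[symmetric]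
      by (intro mult_right_mono divide_right_mono) auto
    also have "\<dots> = \<eta> * (Q / 16) * \<mu>q" using \<mu> by simp
    finally have 1: "224 * st.\<Lambda> * Q * (2 * Q) powr b <= \<eta> * (Q / 16) * \<mu>q" .
    have "\<mu> <= \<mu>q" unfolding \<mu>_def \<mu>q_def using R q b1 by (intro powr_mono2) auto
    then have "\<eta> * (8 * g) * \<mu> <= \<eta> * (Q / 16) * \<mu>q"
      using grown_big[OF Q(3,1)] g \<eta> \<mu> by (intro mult_mono) auto
    then have "8 * (\<eta> * g * \<mu>) + 224 * st.\<Lambda> * Q * (2 * Q) powr b <= \<eta> * (Q / 8) * \<mu>q" using 1 by simp
    also have "\<dots> <= \<eta> * g' * \<mu>q" using g' \<eta> \<mu> by (intro mult_right_mono mult_left_mono) auto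
    finally show ?thesis using Q(6)[OF i] unfolding \<mu>q_def qr(1) by linarith
  qed
  moreover have "rr j powr P <= g'" using grown_low[OF Q(3,1)] g' by (simp add: R_def)
  moreover have "g' <= 336 * rr j" using g' Q(2) by linarith
  moreover have "\<bar>Y (\<Theta> j) i\<bar> <= 448 * g'" for i using Q(5)[of i] g' by linarith
  ultimately show ?thesis unfolding g'_def by blast
qed

end

context cascade
begin

lemma stage_step:
  assumes j: "j < N" and si: "stage_inv (if Suc j = N then 0 else \<Theta> (Suc j)) j g"
  shows "\<exists>g'. Y (\<Theta> j) (3 * int j) = g' \<and> rr j powr P <= g' \<and> g' <= 336 * rr j \<and> (\<forall>i. \<bar>Y (\<Theta> j) i\<bar> <= 448 * g') \<and>
    (0 < j --> (\<forall>i\<le>3 * int j - 1. - (\<eta> * g' * rr (j - 1) powr b) <= Y (\<Theta> j) i))"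
proof -
  obtain d where d0: "0 < d" "d <= \<Theta> j"
    and dd: "\<forall>t i. 0 <= t --> t < d --> i = 3 * int j + 1 \<or> i = 3 * int j + 2 --> 0 < v t i"
      "\<forall>t i. 0 <= t --> t <= d --> i = 3 * int j + 1 \<or> i = 3 * int j + 2 --> \<bar>v t i powr b - b * (d - t)\<bar> <= \<kappa> * (b * (d - t))"
    using profile_exists[OF j] by blast
  interpret cascade_step \<beta> A P \<kappa> \<kappa>' h lam \<eta> \<nu> \<rho> N Sx Sv x v s j "if Suc j = N then 0 else \<Theta> (Suc j)" g d
    by unfold_locales (use j si d0 dd in blast)+
  show ?thesis by (rule step)
qed

text \<open>The induction goes down from the rightmost pair; the conclusion for pair
  \<open>j\<close> at time \<open>\<Theta> j\<close> is the invariant with which stage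
  \<open>j - 1\<close> starts.\<close>

lemma chain:
  assumes N: "0 < N" and start: "stage_inv 0 (N - 1) g" and j: "j < N"
  shows "\<exists>g'. Y (\<Theta> j) (3 * int j) = g' \<and> rr j powr P <= g' \<and> g' <= 336 * rr j \<and> (\<forall>i. \<bar>Y (\<Theta> j) i\<bar> <= 448 * g') \<and>
    (0 < j --> (\<forall>i\<le>3 * int j - 1. - (\<eta> * g' * rr (j - 1) powr b) <= Y (\<Theta> j) i))"
  using j
proof (induction "N - 1 - j" arbitrary: j)
  case 0
  then have "j = N - 1" by simp
  then show ?case using start N by (intro stage_step[of j g]) auto
next
  case (Suc n)
  then have Sj: "Suc j < N" "n = N - 1 - Suc j" by auto
  obtain g' where g': "Y (\<Theta> (Suc j)) (3 * int (Suc j)) = g'" "rr (Suc j) powr P <= g'" "g' <= 336 * rr (Suc j)"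
    "\<forall>i. \<bar>Y (\<Theta> (Suc j)) i\<bar> <= 448 * g'" "\<forall>i\<le>3 * int (Suc j) - 1. - (\<eta> * g' * rr j powr b) <= Y (\<Theta> (Suc j)) i"
    using Suc.hyps(1)[OF Sj(2,1)] by auto
  have "336 * rr (Suc j) <= 336 * (\<nu> * rr j)" using rr_ratio[of j] by simp
  also have "\<dots> <= 336 * (\<nu> * 1)" using \<nu> rr_le[of j] \<rho> by (intro mult_left_mono) auto
  also have "\<dots> <= 1" using \<nu>(7) \<kappa> by simp
  finally have "g' <= 1" using g'(3) by linarith
  then have "stage_inv (\<Theta> (Suc j)) j g'" using g' by (auto simp: stage_inv_def algebra_simps)
  then show ?case using Sj by (intro stage_step[of j g']) auto
qed

end

locale perturbed = constants + two_flows \<beta> rr N TT Sx Sv x v "sg (3 * int N)" for N Sx Sv x v +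
  assumes tie: "!!m t. m < N ==> 0 <= t ==> t <= TT ==> v t (3 * int m + 1) = 0 \<longleftrightarrow> v t (3 * int m + 2) = 0"
    and start: "!!i. x 0 i = v 0 i + rr N powr P * unit_seq (3 * int N) i" and N: "0 < N"
begin

text \<open>The initial perturbation \<open>rr N powr P\<close> is exactly the lower bound that the
  invariant demands at the first stage, and what arrives at site 0 is at least
  \<open>rr 0 powr P\<close>, whatever \<open>N\<close>.\<close>

lemma separated: "\<rho> powr P <= \<bar>x TT 0 - v TT 0\<bar>"
proof -
  interpret cascade \<beta> A P \<kappa> \<kappa>' h lam \<eta> \<nu> \<rho> N Sx Sv x v "sg (3 * int N)"
    by unfold_locales (rule tie)
  define g where "g = rr N powr P"
  have g: "0 < g" "g <= rr N" "g <= 1"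
  proof -
    show "0 < g" using rr_pos[of N] by (simp add: g_def)
    have "rr N powr P <= rr N powr 1" using P rr_le[of N] \<rho> rr_pos[of N] by (intro powr_mono') auto
    then show "g <= rr N" using rr_pos[of N] by (simp add: g_def)
    then show "g <= 1" using rr_le[of N] \<rho> by linarith
  qed
  have Y0: "Y 0 i = (if i = 3 * int N then g else 0)" for i
    using sg_sq[of "3 * int N"] by (simp add: Y_def start unit_seq_def g_def)
  have N1: "Suc (N - 1) = N" "3 * int (N - 1) + 3 = 3 * int N" using N by auto
  have "0 <= \<eta> * g * rr (N - 1) powr b" using \<eta> g by simp
  then have "stage_inv 0 (N - 1) g"
    unfolding stage_inv_def N1 Y0 using g N by (auto simp: g_def[symmetric])
  from chain[OF N this N] have "rr 0 powr P <= Y (\<Theta> 0) 0" by auto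
  then have "rr 0 powr P <= \<bar>Y (\<Theta> 0) 0\<bar>" by linarith
  then show ?thesis unfolding Y_abs \<Theta>_0 rr_0 .
qed

end

section \<open>Choice of the exponents and constants\<close>

lemma eventually_powr_le:
  fixes p q c1 c2 :: real
  assumes "0 < c1" "0 < c2" "q < p"
  shows "\<forall>\<^sub>F r in at_right (0::real). c1 * r powr p <= c2 * r powr q"
  unfolding eventually_at_right_field
proof (intro exI[of _ "(c2 / c1) powr (1 / (p - q))"] conjI allI impI)
  show "0 < (c2 / c1) powr (1 / (p - q))" using assms by simp
  fix r :: real assume r: "0 < r" "r < (c2 / c1) powr (1 / (p - q))"
  have "r powr (p - q) <= ((c2 / c1) powr (1 / (p - q))) powr (p - q)" using r assms by (intro powr_mono2) auto
  also have "\<dots> = c2 / c1" using assms by (simp add: powr_powr)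
  finally have "c1 * r powr (p - q) <= c2" using assms by (simp add: field_simps)
  then have "c1 * r powr (p - q) * r powr q <= c2 * r powr q" by (intro mult_right_mono) auto
  then show "c1 * r powr p <= c2 * r powr q" by (simp add: mult.assoc powr_add[symmetric])
qed

lemma eventually_powr_le1:
  fixes p c1 c2 :: real
  assumes "0 < c1" "0 < c2" "0 < p"
  shows "\<forall>\<^sub>F r in at_right (0::real). c1 * r powr p <= c2"
  using eventually_powr_le[OF assms(1,2,3)] eventually_at_right_less[of 0] by eventually_elim simp

lemma at_right_witness:
  assumes "\<forall>\<^sub>F r in at_right (0::real). P r"
  obtains r where "0 < r" "P r"
proof -
  obtain u where "0 < u" "!!y. 0 < y ==> y < u ==> P y" using assms by (auto simp: eventually_at_right_field)
  then show ?thesis using that[of "u / 2"] by simp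
qed

lemma eventually_powr_neg_ge:
  fixes \<beta> c k C :: real
  assumes "0 < \<beta>" "0 < c" "0 < k"
  shows "\<forall>\<^sub>F r in at_right (0::real). C <= k * (c * r) powr (- \<beta>)"
proof -
  have "filterlim (%r. (c * r) powr (- \<beta>)) at_top (at_right 0)" using assms by real_asymp
  then have "\<forall>\<^sub>F r in at_right 0. C / k <= (c * r) powr (- \<beta>)" by (simp add: filterlim_at_top)
  then show ?thesis by eventually_elim (use assms in \<open>simp add: pos_divide_le_eq mult.commute\<close>)
qed

text \<open>The interval from \<open>(1 + 3 * \<beta>) / (2 * \<beta>)\<close> to
  \<open>1 + 2 * \<beta>\<close> is nonempty. \<open>A\<close> is the midpoint of its part above 2,
  and \<open>P\<close> is then so large that \<open>P * (1 + 2 * \<beta> - A)\<close> exceeds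
  \<open>1 + 3 * \<beta>\<close>.\<close>

lemma exponents_exist:
  fixes \<beta> :: real
  assumes "2 / 3 <= \<beta>"
  obtains A P where "2 < A" "1 < P" "1 + 3 * \<beta> < 2 * \<beta> * A" "A * P + 1 + 3 * \<beta> < P * (1 + 2 * \<beta>)"
proof -
  define M where "M = max 2 ((1 + 3 * \<beta>) / (2 * \<beta>))"
  have "1 + 3 * \<beta> < 2 * \<beta> * (1 + 2 * \<beta>)"
  proof -
    \<comment> \<open>The product equals \<open>4 * \<beta> * \<beta> - \<beta> - 10 / 9\<close>, so
      \<open>4 * \<beta> * \<beta> - \<beta> - 1\<close> is positive.\<close>
    have "0 <= (\<beta> - 2 / 3) * (4 * \<beta> + 5 / 3)" using assms by (intro mult_nonneg_nonneg) auto
    then show ?thesis using assms by (simp add: algebra_simps)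
  qed
  then have M: "M < 1 + 2 * \<beta>" using assms by (auto simp: M_def divide_less_eq mult_ac)
  define A where "A = (M + (1 + 2 * \<beta>)) / 2"
  have A: "M < A" "A < 1 + 2 * \<beta>" using M by (auto simp: A_def)
  have "(1 + 3 * \<beta>) / (2 * \<beta>) < A" using A(1) by (simp add: M_def)
  then have 1: "1 + 3 * \<beta> < 2 * \<beta> * A" using assms by (simp add: divide_less_eq mult_ac)
  define P where "P = 1 + (1 + 3 * \<beta>) / (1 + 2 * \<beta> - A)"
  have d: "0 < 1 + 2 * \<beta> - A" using A by simp
  then have P1: "1 < P" using assms by (simp add: P_def)
  have "(1 + n / D) * D = D + n" if "0 < D" for n D :: real using that by (simp add: distrib_right)
  from this[OF d, of "1 + 3 * \<beta>"] have "P * (1 + 2 * \<beta> - A) = (1 + 2 * \<beta> - A) + (1 + 3 * \<beta>)" unfolding P_def .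
  then have 2: "A * P + 1 + 3 * \<beta> < P * (1 + 2 * \<beta>)" using d by (simp add: algebra_simps)
  show ?thesis by (rule that[OF _ P1 1 2]) (use A M_def in auto)
qed

text \<open>The constants are fixed in the order \<open>\<kappa>\<close>, \<open>\<kappa>'\<close>,
  \<open>h\<close>, \<open>lam\<close>, \<open>\<eta>\<close>, \<open>\<nu>\<close>,
  \<open>\<rho>\<close>, each depending on earlier ones only, so that smallness can be demanded of
  one after the other.\<close>

lemma constants_exist:
  fixes \<beta> :: real
  assumes \<beta>23: "2 / 3 <= \<beta>"
  shows "\<exists>A P \<kappa> \<kappa>' h lam \<eta> \<nu> \<rho>. constants \<beta> A P \<kappa> \<kappa>' h lam \<eta> \<nu> \<rho>"
proof -
  let ?b = "\<beta> + 1"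
  have \<beta>: "0 < \<beta>" using \<beta>23 by simp
  obtain A P where A: "2 < A" and P: "1 < P" and AP: "1 + 3 * \<beta> < 2 * \<beta> * A" "A * P + 1 + 3 * \<beta> < P * (1 + 2 * \<beta>)"
    by (rule exponents_exist[OF \<beta>23])
  have "((%k. (1 + 2 * k) powr ?b) \<longlongrightarrow> (1 + 2 * 0) powr ?b) (at_right 0)" by (intro tendsto_intros) auto
  then have "\<forall>\<^sub>F k in at_right 0. (1 + 2 * k) powr ?b < 3 / 2" by (intro order_tendstoD(2)) auto
  moreover have "\<forall>\<^sub>F k in at_right 0. k <= 1 / (100::real)" using eventually_powr_le1[of 1 "1 / 100" 1] eventually_at_right_less[of 0] by (auto elim: eventually_elim2)
  ultimately have "\<forall>\<^sub>F k in at_right 0. (1 + 2 * k) powr ?b < 3 / 2 \<and> k <= 1 / 100" by (rule eventually_conj)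
  then obtain \<kappa> where \<kappa>: "0 < \<kappa>" "(1 + 2 * \<kappa>) powr ?b < 3 / 2" "\<kappa> <= 1 / 100" using at_right_witness by blast
  have "((%k. (1 + k) powr \<beta> - 1) \<longlongrightarrow> (1 + 0) powr \<beta> - 1) (at_right 0)" by (intro tendsto_intros) auto
  then have "\<forall>\<^sub>F k in at_right 0. (1 + k) powr \<beta> - 1 < \<kappa>" using \<kappa> by (intro order_tendstoD(2)) auto
  moreover have "\<forall>\<^sub>F k in at_right 0. k <= 1 / (100::real)" using eventually_powr_le1[of 1 "1 / 100" 1] eventually_at_right_less[of 0] by (auto elim: eventually_elim2)
  ultimately have "\<forall>\<^sub>F k in at_right 0. (1 + k) powr \<beta> - 1 < \<kappa> \<and> k <= 1 / 100" by (rule eventually_conj)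
  then obtain \<kappa>' where \<kappa>': "0 < \<kappa>'" "(1 + \<kappa>') powr \<beta> - 1 < \<kappa>" "\<kappa>' <= 1 / 100" using at_right_witness by blast
  define h where "h = min (1 / (16 * \<beta> * 8 powr ?b)) (4 powr (- ?b) / (2 * ?b))"
  have h: "0 < h" "16 * \<beta> * 8 powr ?b * h <= 1" "2 * ?b * h <= 4 powr (- ?b)"
  proof -
    have *: "c * h <= D" if "0 < c" "h <= D / c" for c D using that by (simp add: pos_le_divide_eq mult.commute)
    show "0 < h" using \<beta> by (simp add: h_def)
    show "16 * \<beta> * 8 powr ?b * h <= 1" by (rule *) (use \<beta> in \<open>auto simp: h_def\<close>)
    show "2 * ?b * h <= 4 powr (- ?b)" by (rule *) (use \<beta> in \<open>auto simp: h_def\<close>)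
  qed
  define lam where "lam = min (\<beta> * 2 powr (- ?b) * h / 64) (\<beta> * 3 powr (- ?b) * (\<beta> * 2 powr (- ?b)) * h * h / 1024)"
  have lam: "0 < lam" using \<beta> h by (simp add: lam_def)
  define \<eta> where "\<eta> = min (min (\<beta> * 2 powr (- ?b) / (48 * \<beta> * 8 powr ?b))
      (\<beta> * 3 powr (- ?b) * (\<beta> * 2 powr (- ?b)) * h / 128 / (6 * \<beta> * 8 powr ?b))) (min (lam / 2) (1 / 4))"
  have \<eta>: "0 < \<eta>" "48 * \<beta> * 8 powr ?b * \<eta> <= \<beta> * 2 powr (- ?b)"
      "6 * \<beta> * 8 powr ?b * \<eta> <= \<beta> * 3 powr (- ?b) * (\<beta> * 2 powr (- ?b)) * h / 128" "2 * \<eta> <= lam" "4 * \<eta> <= 1"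
  proof -
    have *: "c * \<eta> <= D" if "0 < c" "\<eta> <= D / c" for c D using that by (simp add: pos_le_divide_eq mult.commute)
    show "0 < \<eta>" using \<beta> h lam by (simp add: \<eta>_def)
    show "48 * \<beta> * 8 powr ?b * \<eta> <= \<beta> * 2 powr (- ?b)" by (rule *) (use \<beta> in \<open>auto simp: \<eta>_def\<close>)
    show "6 * \<beta> * 8 powr ?b * \<eta> <= \<beta> * 3 powr (- ?b) * (\<beta> * 2 powr (- ?b)) * h / 128"
      by (rule *) (use \<beta> in \<open>auto simp: \<eta>_def\<close>)
    show "2 * \<eta> <= lam" "4 * \<eta> <= 1" by (auto simp: \<eta>_def)
  qed
  have gap4: "0 < (2 powr (- ?b) - 4 powr (- ?b) :: real)"
    using powr_less_mono2_neg[of "- ?b" 2 4] \<beta> by simp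
  have "\<forall>\<^sub>F \<nu> in at_right (0::real). 0 < \<nu> \<and> 1 * \<nu> powr 1 <= 1 / 2 \<and> 2 * 3 powr ?b * \<nu> powr ?b <= 2 powr (- ?b) - 4 powr (- ?b) \<and>
      4480000 * 4 powr ?b * 3 powr ?b * \<nu> powr ?b <= 1 \<and> 48 powr \<beta> * \<nu> powr \<beta> <= 1 / 10000 \<and>
      2 * 3 powr ?b * \<nu> powr ?b <= h \<and> 896000 * 336 * \<nu> powr 1 <= \<kappa> / 16"
    by (intro eventually_conj eventually_powr_le1 eventually_at_right_less) (use \<beta> \<kappa> h gap4 in auto)
  then obtain \<nu> where \<nu>0: "0 < \<nu> \<and> 1 * \<nu> powr 1 <= 1 / 2 \<and> 2 * 3 powr ?b * \<nu> powr ?b <= 2 powr (- ?b) - 4 powr (- ?b) \<and>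
      4480000 * 4 powr ?b * 3 powr ?b * \<nu> powr ?b <= 1 \<and> 48 powr \<beta> * \<nu> powr \<beta> <= 1 / 10000 \<and>
      2 * 3 powr ?b * \<nu> powr ?b <= h \<and> 896000 * 336 * \<nu> powr 1 <= \<kappa> / 16"
    by (rule at_right_witness)
  then have \<nu>: "0 < \<nu>" "\<nu> <= 1 / 2" "4 powr (- ?b) + 2 * 3 powr ?b * \<nu> powr ?b <= 2 powr (- ?b)"
      "4480000 * 4 powr ?b * 3 powr ?b * \<nu> powr ?b <= 1" "(48 * \<nu>) powr \<beta> <= 1 / 10000"
      "2 * 3 powr ?b * \<nu> powr ?b <= h" "896000 * 336 * \<nu> <= \<kappa> / 16"
    by (auto simp: powr_mult)
  define Pr where "Pr r \<longleftrightarrow> r powr (A - 1) <= \<nu> \<and> r <= \<nu> \<and> r <= 1 / 24 \<and> 2 * 2 powr \<beta> <= (4 * r) powr (- \<beta>) \<and>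
      2 powr \<beta> <= (1 - (1 + \<kappa>' / 2) powr (- \<beta>)) * (2 * (3 * r)) powr (- \<beta>) \<and>
      (1 + \<kappa>') powr \<beta> - 1 + 2 powr \<beta> * (3 * r) powr \<beta> <= \<kappa> \<and>
      2 * (3 * r) powr ?b <= (3 / 4) powr ?b - (1 / 2) powr ?b \<and> 2 * 2 powr \<beta> * (3 * r) powr ?b <= 1 / 4 \<and>
      896000 powr (1 + 2 * \<beta>) * (336 * r powr A) powr (2 * \<beta>) <= 2 * lam * r powr ?b * (\<kappa> * r / 16) powr (2 * \<beta>) \<and>
      3584 * \<beta> * 48 powr ?b * (r powr A) powr ?b <= \<eta> * r powr ?b * r powr ?b \<and>
      8 * r powr P <= \<kappa> * r / 16 \<and>
      (8 * r powr P) powr (1 + 2 * \<beta>) <= 2 * (lam * (r powr A) powr P * r powr ?b) * (\<kappa> * r / 16) powr (2 * \<beta>)" for r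
  have k5: "0 < 1 - (1 + \<kappa>' / 2) powr (- \<beta>)"
    using powr_less_mono2_neg[of "- \<beta>" 1 "1 + \<kappa>' / 2"] \<beta> \<kappa>' by simp
  have k7: "0 < (3 / 4) powr ?b - (1 / 2 :: real) powr ?b" using powr_less_mono2[of ?b "1 / 2" "3 / 4"] \<beta> by simp
  \<comment> \<open>The conditions are rewritten as \<open>c1 * r powr p <= c2 * r powr q\<close>
    with \<open>q < p\<close>, or as a constant below a negative power of \<open>r\<close>; so they
    hold for all small \<open>r\<close>. The two exponent inequalities for \<open>A\<close> and
    \<open>P\<close> order the exponents in the gain conditions.\<close>
  have ev: "\<forall>\<^sub>F r in at_right (0::real). 0 < r \<and> 1 * r powr (A - 1) <= \<nu> \<and> 1 * r powr 1 <= \<nu> \<and> 1 * r powr 1 <= 1 / 24 \<and>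
      2 * 2 powr \<beta> <= 1 * (4 * r) powr (- \<beta>) \<and> 2 powr \<beta> <= (1 - (1 + \<kappa>' / 2) powr (- \<beta>)) * (6 * r) powr (- \<beta>) \<and>
      2 powr \<beta> * 3 powr \<beta> * r powr \<beta> <= \<kappa> - ((1 + \<kappa>') powr \<beta> - 1) \<and>
      2 * 3 powr ?b * r powr ?b <= (3 / 4) powr ?b - (1 / 2) powr ?b \<and> 2 * 2 powr \<beta> * 3 powr ?b * r powr ?b <= 1 / 4 \<and>
      896000 powr (1 + 2 * \<beta>) * 336 powr (2 * \<beta>) * r powr (A * (2 * \<beta>)) <= 2 * lam * (\<kappa> / 16) powr (2 * \<beta>) * r powr (?b + 2 * \<beta>) \<and>
      3584 * \<beta> * 48 powr ?b * r powr (A * ?b) <= \<eta> * r powr (?b + ?b) \<and>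
      8 * r powr P <= \<kappa> / 16 * r powr 1 \<and>
      8 powr (1 + 2 * \<beta>) * r powr (P * (1 + 2 * \<beta>)) <= 2 * lam * (\<kappa> / 16) powr (2 * \<beta>) * r powr (A * P + ?b + 2 * \<beta>)"
  proof (intro eventually_conj eventually_powr_le1 eventually_powr_le eventually_powr_neg_ge eventually_at_right_less)
    have "2 * ?b < A * ?b" using A \<beta> by (intro mult_strict_right_mono) auto
    then show "?b + ?b < A * ?b" by simp
    show "?b + 2 * \<beta> < A * (2 * \<beta>)" using AP(1) by (simp add: mult_ac)
    show "A * P + ?b + 2 * \<beta> < P * (1 + 2 * \<beta>)" using AP(2) by simp
  qed (use A P \<beta> \<kappa> \<kappa>' h lam \<eta> \<nu> k5 k7 in auto)
  have "\<forall>\<^sub>F r in at_right 0. 0 < r \<and> r < 1 \<and> Pr r"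
    using ev eventually_at_right_real[OF zero_less_one]
  proof eventually_elim
    case (elim r)
    have r: "0 < r" "r < 1" using elim(2) by auto
    have e9: "(336 * r powr A) powr (2 * \<beta>) = 336 powr (2 * \<beta>) * r powr (A * (2 * \<beta>))" "(r powr A) powr ?b = r powr (A * ?b)"
      "(\<kappa> * r / 16) powr (2 * \<beta>) = (\<kappa> / 16) powr (2 * \<beta>) * r powr (2 * \<beta>)"
      "(8 * r powr P) powr (1 + 2 * \<beta>) = 8 powr (1 + 2 * \<beta>) * r powr (P * (1 + 2 * \<beta>))" "(r powr A) powr P = r powr (A * P)"
      "(3 * r) powr \<beta> = 3 powr \<beta> * r powr \<beta>" "(3 * r) powr ?b = 3 powr ?b * r powr ?b" "2 * (3 * r) = 6 * r"
      using powr_mult[of "\<kappa> / 16" r "2 * \<beta>"] by (simp_all add: powr_mult powr_powr)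
    have e10: "r powr (?b + 2 * \<beta>) = r powr ?b * r powr (2 * \<beta>)" "r powr (?b + ?b) = r powr ?b * r powr ?b"
      "r powr (A * P + ?b + 2 * \<beta>) = r powr (A * P) * r powr ?b * r powr (2 * \<beta>)" "r powr 1 = r"
      using r by (simp_all only: powr_add) simp
    have "Pr r" unfolding Pr_def e9 using elim(1) unfolding e10 by (simp add: mult_ac)
    then show ?case using r by simp
  qed
  then obtain u where u: "0 < u" "!!y. 0 < y ==> y < u ==> 0 < y \<and> y < 1 \<and> Pr y" by (auto simp: eventually_at_right_field)
  define \<rho> where "\<rho> = u / 2"
  have \<rho>: "0 < \<rho>" "\<rho> < 1" "!!r. 0 < r ==> r <= \<rho> ==> Pr r" using u(1) u(2)[of "u / 2"] u(2) by (auto simp: \<rho>_def)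
  have "constants \<beta> A P \<kappa> \<kappa>' h lam \<eta> \<nu> \<rho>"
    by unfold_locales
      (use \<beta> A P \<kappa> \<kappa>' h lam lam_def \<eta> \<nu> \<rho>(1,2) \<rho>(3)[unfolded Pr_def] in \<open>auto simp only: less_imp_le min.cobounded1 min.cobounded2\<close>)
  then show ?thesis by blast
qed

context constants
begin

text \<open>Consecutive pairs differ by a factor of at most \<open>1 / 2\<close>, whereas tuning
  changes a size by at most one percent.\<close>

lemma sz_decreasing:
  assumes a: "a \<in> unit_box" and ij: "i < j"
  shows "sz a j p < sz a i p"
proof -
  have "rr j <= rr (Suc i)" using ij by (intro rr_antimono) auto
  then have "rr j <= \<nu> * rr i" using rr_ratio[of i] by linarith
  also have "\<dots> <= 1 / 2 * rr i" using \<nu> rr_pos[of i] by (intro mult_right_mono) auto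
  finally have 1: "rr j <= 1 / 2 * rr i" .
  have "sz a j p <= rr j * (1 + \<kappa>')" by (rule sz_bounds(2)[OF a])
  also have "\<dots> <= 1 / 2 * rr i * (1 + \<kappa>')" using 1 \<kappa>' by (intro mult_right_mono) auto
  also have "\<dots> = rr i * ((1 + \<kappa>') / 2)" by simp
  also have "\<dots> < rr i * (1 - \<kappa>')" using \<kappa>' rr_pos[of i] by (intro mult_strict_left_mono) auto
  also have "\<dots> <= sz a i p" by (rule sz_bounds(1)[OF a])
  finally show ?thesis .
qed

lemma alpha_conv:
  assumes R: "!!j p. p \<in> {1, 2} ==> (%N. R N j p) \<longlonglongrightarrow> Rlim j p"
  shows "(%N. alpha_N N (R N) i) \<longlonglongrightarrow> alpha Rlim i"
proof -
  have "(%N. alpha (R N) i) \<longlonglongrightarrow> alpha Rlim i"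
  proof (cases "i < 0 \<or> i mod 3 = 0")
    case False
    then have "i mod 3 = 1 \<or> i mod 3 = 2" by presburger
    then have "nat (i mod 3) \<in> {1, 2}" by auto
    from R[OF this] show ?thesis using False by (simp add: alpha_def)
  qed (simp add: alpha_def)
  moreover have "eventually (%N. alpha (R N) i = alpha_N N (R N) i) sequentially"
    using eventually_ge_at_top[of "nat \<bar>i\<bar>"] by eventually_elim (auto simp: alpha_N_def)
  ultimately show ?thesis by (rule Lim_transform_eventually)
qed

end

text \<open>The threshold is at least \<open>2 / 3\<close> because \<open>3 ^ 5 = 243\<close> is
  below \<open>2 ^ 8 = 256\<close>.\<close>

lemma exponent_bound:
  fixes \<beta> :: real
  assumes "\<beta> \<ge> (ln 4 - ln 3) / (ln 3 - ln 2)"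
  shows "2 / 3 <= \<beta>"
proof -
  have "2 * (ln 3 - ln 2) <= 3 * (ln 4 - ln (3::real))"
  proof -
    have "ln (243 :: real) <= ln 256" by simp
    moreover have "ln (243::real) = 5 * ln 3" using ln_realpow[of 3 5] by simp
    moreover have "ln (256::real) = 8 * ln 2" using ln_realpow[of 2 8] by simp
    moreover have "ln (4::real) = 2 * ln 2" using ln_realpow[of 2 2] by simp
    ultimately show ?thesis by simp
  qed
  moreover have "0 < ln 3 - ln (2::real)" by simp
  ultimately have "2 / 3 <= (ln 4 - ln 3) / (ln 3 - ln (2::real))" by (simp add: field_simps)
  then show ?thesis using assms by linarith
qed

theorem theorem4p1:
  fixes \<beta> :: real
  assumes "\<beta> \<ge> (ln 4 - ln 3) / (ln 3 - ln 2)"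
  shows "\<exists>(R :: nat \<Rightarrow> nat \<Rightarrow> nat \<Rightarrow> real) (\<epsilon> :: nat \<Rightarrow> real)
          (xbarN :: nat \<Rightarrow> real \<Rightarrow> int \<Rightarrow> real) (xN :: nat \<Rightarrow> real \<Rightarrow> int \<Rightarrow> real).
      (\<forall>N. \<forall>p\<in>{1,2}. (\<forall>j<N. R N j p > 0) \<and> strict_antimono_on {..<N} (\<lambda>j. R N j p)) \<and>
      (\<forall>N. finite_particle_solution \<beta> (alpha_N N (R N)) (xbarN N)) \<and>
      (\<forall>N. finite_particle_solution \<beta>
             (\<lambda>i. alpha_N N (R N) i + \<epsilon> N * unit_seq (3 * int N) i) (xN N)) \<and>
      (\<exists>Rlim :: nat \<Rightarrow> nat \<Rightarrow> real.
         (\<forall>j. \<forall>p\<in>{1,2}. Rlim j p > 0 \<and> (\<lambda>N. R N j p) \<longlonglongrightarrow> Rlim j p) \<and>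
         (\<exists>(T :: real) (xbar :: real \<Rightarrow> int \<Rightarrow> real) (x :: real \<Rightarrow> int \<Rightarrow> real) (\<phi> :: nat \<Rightarrow> nat).
            T > 0 \<and>
            (\<forall>t\<in>{0..T}. xbar t \<in> linf_plus \<and> x t \<in> linf_plus) \<and>
            strict_mono \<phi> \<and>
            (\<forall>j. uniform_limit {0..T} (\<lambda>n t. xbarN (\<phi> n) t j) (\<lambda>t. xbar t j) sequentially \<and>
                 uniform_limit {0..T} (\<lambda>n t. xN (\<phi> n) t j) (\<lambda>t. x t j) sequentially) \<and>
            is_solution \<beta> (ereal T) xbar \<and> is_solution \<beta> (ereal T) x \<and>
            xbar 0 = alpha Rlim \<and> x 0 = alpha Rlim \<and>
            (\<exists>t\<in>{0..T}. xbar t \<noteq> x t)))"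
proof -
  obtain A P \<kappa> \<kappa>' h lam \<eta> \<nu> \<rho> where "constants \<beta> A P \<kappa> \<kappa>' h lam \<eta> \<nu> \<rho>"
    using constants_exist[OF exponent_bound[OF assms]] by blast
  then interpret constants \<beta> A P \<kappa> \<kappa>' h lam \<eta> \<nu> \<rho> .
  define good where "good N a \<longleftrightarrow> a \<in> unit_box \<and> (\<forall>m t. m < N --> 0 <= t --> t <= TT -->
      (sel N a t (3 * int m + 1) = 0 \<longleftrightarrow> sel N a t (3 * int m + 2) = 0))" for N a
  have "\<forall>N. \<exists>a. good N a"
  proof
    fix N
    show "\<exists>a. good N a" by (rule tie_exists[of N]) (auto simp: good_def)
  qed
  from choice[OF this] obtain af where af: "\<forall>N. good N (af N)" by (rule exE)
  have box: "af N \<in> unit_box" for N using af by (simp add: good_def)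
  obtain k X0 where k: "strict_mono k" "!!j. uniform_limit {0..TT} (%n t. sel (k n) (af (k n)) t j) (%t. X0 t j) sequentially"
    by (rule subseq_limit[of \<beta> rr "%n. n" TT supp "%n. sel n (af n)"]) (use sel(3)[OF box] in auto)
  \<comment> \<open>The tuned parameters converge only along \<open>k\<close>, whereas all \<open>N\<close> are required; so every \<open>N\<close> takes over
    the parameters of the next member of the subsequence.\<close>
  have kge: "n <= k n" for n by (rule seq_suble[OF k(1)])
  define ix where "ix N = (LEAST n. N <= k n)" for N
  define aF where "aF N = af (k (ix N))" for N
  have ix_k: "ix (k n) = n" for n
    unfolding ix_def using k(1) by (intro Least_equality) (auto simp: strict_mono_less_eq)
  have ix_ge: "N <= k (ix N)" for N unfolding ix_def by (rule LeastI[of _ N]) (rule kge)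
  have ix_top: "filterlim ix at_top sequentially"
  proof (unfold filterlim_at_top eventually_sequentially, intro allI exI impI)
    fix M N assume "k M <= N"
    then have "k M <= k (ix N)" using ix_ge[of N] by linarith
    then show "M <= ix N" using k(1) by (simp add: strict_mono_less_eq)
  qed
  have aF: "aF N \<in> unit_box" for N by (simp add: aF_def box)
  have aFk: "aF (k n) = af (k n)" for n by (simp add: aF_def ix_k)
  \<comment> \<open>The first particle of a pair has the same size for all \<open>N\<close>; the
    limit of the second is the initial size in the limiting flow.\<close>
  define Rl where "Rl j p = (if p = 1 then rr j else X0 0 (3 * int j + 2))" for j p :: nat
  have X0lim: "(%n. sz (af (k n)) j 2) \<longlonglongrightarrow> X0 0 (3 * int j + 2)" for j
  proof -
    have "(%n. sel (k n) (af (k n)) 0 (3 * int j + 2)) \<longlonglongrightarrow> X0 0 (3 * int j + 2)"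
      using tendsto_uniform_limitI[OF k(2), of 0] T0 by simp
    moreover have "eventually (%n. sel (k n) (af (k n)) 0 (3 * int j + 2) = sz (af (k n)) j 2) sequentially"
      using eventually_gt_at_top[of j]
    proof eventually_elim
      case (elim n)
      then have "j < k n" using kge[of n] by linarith
      then show ?case by (simp add: sel(2)[OF box] alpha_vals)
    qed
    ultimately show ?thesis by (rule Lim_transform_eventually)
  qed
  have Rlim: "0 < Rl j p" "(%N. sz (aF N) j p) \<longlonglongrightarrow> Rl j p" if p: "p \<in> {1, 2}" for j p
  proof -
    have pos: "0 < rr j * (1 - \<kappa>')" using rr_pos[of j] \<kappa>' by simp
    have "rr j * (1 - \<kappa>') <= X0 0 (3 * int j + 2)"
      by (rule LIMSEQ_le_const[OF X0lim]) (use sz_bounds(1)[OF box] in auto)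
    then show "0 < Rl j p" using pos rr_pos[of j] by (auto simp: Rl_def)
    have "(%N. sz (af (k (ix N))) j 2) \<longlonglongrightarrow> X0 0 (3 * int j + 2)"
      by (rule filterlim_compose[OF X0lim ix_top])
    then show "(%N. sz (aF N) j p) \<longlonglongrightarrow> Rl j p" using p by (auto simp: Rl_def aF_def sz_def)
  qed
  define \<epsilon> where "\<epsilon> N = rr N powr P" for N
  have \<epsilon>: "0 <= \<epsilon> N" "\<epsilon> N <= 1 / 4" for N
  proof -
    have "rr N powr P <= rr N powr 1" using P rr_le[of N] \<rho> rr_pos[of N] by (intro powr_mono') auto
    then show "0 <= \<epsilon> N" "\<epsilon> N <= 1 / 4" using small(3)[OF rr_pos rr_le, of N] rr_pos[of N] by (auto simp: \<epsilon>_def)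
  qed
  define y where "y N i = alpha_N N (sz (aF N)) i + \<epsilon> N * unit_seq (3 * int N) i" for N i
  have "\<forall>N. \<exists>x. particle_flow \<beta> (supp N) x \<and> x 0 = y N"
    unfolding y_def using flow_exists(2)[OF aF \<epsilon>(1)] by blast
  from choice[OF this] obtain xN where xN0: "\<forall>N. particle_flow \<beta> (supp N) (xN N) \<and> xN N 0 = y N" by (rule exE)
  have xN: "particle_flow \<beta> (supp N) (xN N)" "xN N 0 = y N" "triple_flow \<beta> rr N TT (supp N) (xN N)" for N
  proof -
    show *: "particle_flow \<beta> (supp N) (xN N)" "xN N 0 = y N" using xN0 by auto
    show "triple_flow \<beta> rr N TT (supp N) (xN N)" by (rule triple[OF aF * (1) \<epsilon>]) (use * in \<open>auto simp: y_def\<close>)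
  qed
  define vN where "vN N = sel N (aF N)" for N
  have vN: "particle_flow \<beta> (supp N) (vN N)" "vN N 0 = alpha_N N (sz (aF N))" "triple_flow \<beta> rr N TT (supp N) (vN N)" for N
    using sel[OF aF] by (auto simp: vN_def)
  have sol: "finite_particle_solution \<beta> (alpha_N N (sz (aF N))) (vN N)" "finite_particle_solution \<beta> (y N) (xN N)" for N
  proof -
    have "{i. alpha_N N (sz (aF N)) i \<noteq> 0} = supp N" "{i. y N i \<noteq> 0} = supp N"
      using flow_exists(1)[OF aF, of 0 N N] flow_exists(1)[OF aF \<epsilon>(1), of N N N] by (auto simp: y_def)
    then show "finite_particle_solution \<beta> (alpha_N N (sz (aF N))) (vN N)" "finite_particle_solution \<beta> (y N) (xN N)"
      using particle_flow_solution vN(1,2)[of N] xN(1,2)[of N] by metis+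
  qed
  \<comment> \<open>The perturbed flows need a further subsequence, along which the tuned flows
    still converge.\<close>
  obtain k2 X1 where k2: "strict_mono k2" "!!j. uniform_limit {0..TT} (%n t. xN (k (k2 n)) t j) (%t. X1 t j) sequentially"
    by (rule subseq_limit[of \<beta> rr k TT "%n. supp (k n)" "%n. xN (k n)"]) (use xN(3) in auto)
  define \<phi> where "\<phi> n = k (k2 n)" for n
  have \<phi>: "strict_mono \<phi>" using strict_mono_compose[OF k(1) k2(1)] by (simp add: \<phi>_def[abs_def] o_def)
  have \<phi>top: "filterlim \<phi> at_top sequentially" by (rule filterlim_subseq[OF \<phi>])
  have ul0: "uniform_limit {0..TT} (%n t. vN (\<phi> n) t j) (%t. X0 t j) sequentially" for j
  proof -
    have "uniform_limit {0..TT} (%n t. sel (k (k2 n)) (af (k (k2 n))) t j) (%t. X0 t j) sequentially"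
      by (rule filterlim_compose[OF k(2) filterlim_subseq[OF k2(1)]])
    then show ?thesis by (simp add: vN_def \<phi>_def aFk)
  qed
  have ul1: "uniform_limit {0..TT} (%n t. xN (\<phi> n) t j) (%t. X1 t j) sequentially" for j
    unfolding \<phi>_def by (rule k2(2))
  have dich: "eventually (%n. m < \<phi> n) sequentially" for m
    by (rule eventually_compose_filterlim[OF eventually_gt_at_top \<phi>top])
  interpret L0: limit_flow \<beta> rr \<phi> TT "%n. supp (\<phi> n)" "%n. vN (\<phi> n)" X0
    by (rule limit_flow.intro) (use vN(3) ul0 dich in auto)
  interpret L1: limit_flow \<beta> rr \<phi> TT "%n. supp (\<phi> n)" "%n. xN (\<phi> n)" X1
    by (rule limit_flow.intro) (use xN(3) ul1 dich in auto)
  have init: "X0 0 i = alpha Rl i" "X1 0 i = alpha Rl i" for i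
  proof -
    have a: "(%n. alpha_N (\<phi> n) (sz (aF (\<phi> n))) i) \<longlonglongrightarrow> alpha Rl i"
      by (rule filterlim_compose[OF alpha_conv[OF Rlim(2)] \<phi>top])
    have "(%n. vN (\<phi> n) 0 i) \<longlonglongrightarrow> X0 0 i" using T0 by (intro L0.conv) auto
    then show "X0 0 i = alpha Rl i" using a LIMSEQ_unique unfolding vN(2) by blast
    \<comment> \<open>The perturbed site \<open>3 * N\<close> leaves every bounded range, so at each
      fixed site the two initial data agree eventually.\<close>
    have "eventually (%n. alpha_N (\<phi> n) (sz (aF (\<phi> n))) i = y (\<phi> n) i) sequentially"
      using dich[of "nat \<bar>i\<bar>"] by eventually_elim (auto simp: y_def unit_seq_def)
    from Lim_transform_eventually[OF a this] have "(%n. y (\<phi> n) i) \<longlonglongrightarrow> alpha Rl i" .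
    moreover have "(%n. xN (\<phi> n) 0 i) \<longlonglongrightarrow> X1 0 i" using T0 by (intro L1.conv) auto
    ultimately show "X1 0 i = alpha Rl i" using LIMSEQ_unique unfolding xN(2) by blast
  qed
  \<comment> \<open>The separation is measured at the fixed site 0 and the fixed time
    \<open>TT\<close> with a bound independent of \<open>N\<close>, so it survives the
    limit.\<close>
  have sep: "\<rho> powr P <= \<bar>X1 TT 0 - X0 TT 0\<bar>"
  proof (rule tendsto_lowerbound)
    show "(%n. \<bar>xN (\<phi> n) TT 0 - vN (\<phi> n) TT 0\<bar>) \<longlonglongrightarrow> \<bar>X1 TT 0 - X0 TT 0\<bar>"
      using T0 by (intro tendsto_intros L0.conv L1.conv) auto
    show "eventually (%n. \<rho> powr P <= \<bar>xN (\<phi> n) TT 0 - vN (\<phi> n) TT 0\<bar>) sequentially"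
      using dich[of 0]
    proof eventually_elim
      case (elim n)
      have "aF (\<phi> n) = af (\<phi> n)" by (simp add: \<phi>_def aFk)
      then have g: "good (\<phi> n) (aF (\<phi> n))" using af by simp
      have ts: "two_flows \<beta> rr (\<phi> n) TT (supp (\<phi> n)) (supp (\<phi> n)) (xN (\<phi> n)) (vN (\<phi> n)) (sg (3 * int (\<phi> n)))"
        by (rule two_flows.intro[OF xN(3) vN(3)]) (unfold_locales, rule sg_cases)
      have "perturbed \<beta> A P \<kappa> \<kappa>' h lam \<eta> \<nu> \<rho> (\<phi> n) (supp (\<phi> n)) (supp (\<phi> n)) (xN (\<phi> n)) (vN (\<phi> n))"
        by (rule perturbed.intro[OF constants_axioms ts], unfold_locales)
          (use g elim in \<open>auto simp: good_def vN_def xN(2) sel(2)[OF aF] y_def \<epsilon>_def\<close>)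
      from perturbed.separated[OF this] show ?case .
    qed
  qed simp
  have neq: "X0 TT \<noteq> X1 TT" using sep \<rho> by auto
  have linf: "X0 t \<in> linf_plus \<and> X1 t \<in> linf_plus" if "t \<in> {0..TT}" for t
    using L0.X_bounds[of t] L1.X_bounds[of t] that unfolding linf_plus_def by auto
  have "\<forall>N. \<forall>p\<in>{1,2}. (\<forall>j<N. sz (aF N) j p > 0) \<and> strict_antimono_on {..<N} (%j. sz (aF N) j p)"
    using sz_bounds(3)[OF aF] sz_decreasing[OF aF] by (auto intro!: monotone_onI)
  moreover have "\<forall>N. finite_particle_solution \<beta> (alpha_N N (sz (aF N))) (vN N)" using sol(1) by blast
  moreover have "\<forall>N. finite_particle_solution \<beta> (%i. alpha_N N (sz (aF N)) i + \<epsilon> N * unit_seq (3 * int N) i) (xN N)"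
    using sol(2) unfolding y_def[abs_def] by blast
  moreover have "\<forall>j. \<forall>p\<in>{1,2}. Rl j p > 0 \<and> (%N. sz (aF N) j p) \<longlonglongrightarrow> Rl j p" using Rlim by blast
  moreover have "\<exists>t\<in>{0..TT}. X0 t \<noteq> X1 t" using neq T0 by (intro bexI[of _ TT]) auto
  moreover have "X0 0 = alpha Rl" "X1 0 = alpha Rl" using init by auto
  ultimately show ?thesis
    using T0 linf \<phi> ul0 ul1 L0.X_solution L1.X_solution
    by - (rule exI[of _ "%N. sz (aF N)"], rule exI[of _ \<epsilon>], rule exI[of _ vN], rule exI[of _ xN], intro conjI,
        assumption, assumption, assumption, rule exI[of _ Rl], rule conjI, assumption,
        rule exI[of _ TT], rule exI[of _ X0], rule exI[of _ X1], rule exI[of _ \<phi>], blast)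
qed

end
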